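(* The following problem (\textsc{Recency-bounded-MSO/DMS-MC}) is decidable: given a DMS $\mathcal{S}$, an MSO-FO sentence $\phi$ over the schema of $\mathcal{S}$, and a natural number $\mathbf{b}$, decide whether $\rho\models\phi$ for every $\mathbf{b}$-bounded run $\rho\in\textsf{Runs}_{\mathbf{b}}(\mathcal{S})$.
   Context: Fix a countably infinite data domain $\Delta$. A relational schema $\mathcal{R}$ is a finite set of relation names $R/a$ with arities $a\ge 0$. A database instance over $\mathcal{R}$ and a set $D$ is a finite set of facts $R(e_1,\dots,e_a)$ with $R/a\in\mathcal{R}$, $e_i\in D$; a nullary $p/0$ is true in $I$ iff $p\in I$. $\mathrm{adom}(I)$ is the set of elements of $\Delta$ occurring in $I$. A $\mathrm{FOL}(\mathcal{R})$ query is a first-order formula with equality over $\mathcal{R}$, evaluated with active-domain semantics ($\exists u$ ranges over $\mathrm{adom}(I)$); $I,\sigma\models Q$ denotes satisfaction under a substitution $\sigma$ of its free variables. For an instance $I$ with variable arguments and a substitution $\sigma$, $\sigma(I)$ replaces each variable $u$ by $\sigma(u)$. A DMS is $\mathcal{S}=\langle I_0,\textsc{acts}\rangle$ with $I_0$ an instance with $\mathrm{adom}(I_0)=\emptyset$ and $\textsc{acts}$ a finite set of actions $\alpha=\langle\vec u,\vec v,Q,\mathit{Del},\mathit{Add}\rangle$: $\vec u$ a finite set of variables, $\vec v=\langle v_1,\dots,v_n\rangle$ a finite tuple of distinct variables disjoint from $\vec u$, $Q$ a $\mathrm{FOL}(\mathcal{R})$ query with free variables exactly $\vec u$, $\mathit{Del}$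 an instance with arguments in $\vec u$, $\mathit{Add}$ an instance with arguments in $\vec u\cup\vec v$ in which every $v_i$ occurs. There is a transition $\langle I,H\rangle\xrightarrow{\alpha:\sigma}\langle I',H'\rangle$ (with $H\subseteq\Delta$) iff $\sigma:\vec u\cup\vec v\to\Delta$ satisfies $\sigma(u)\in\mathrm{adom}(I)$ for $u\in\vec u$, $\sigma(v)\notin H$ for $v\in\vec v$, $\sigma$ injective on $\vec v$, $I,\sigma|_{\vec u}\models Q$, $I'=(I\setminus\sigma(\mathit{Del}))\cup\sigma(\mathit{Add})$, and $H'=H\cup\{\sigma(v)\mid v\in\vec v\}$. Recency: a $\mathbf{b}$-configuration is $\langle I,H,s\rangle$ with $s:H\to\mathbb{N}$ injective (sequence numbering). $\mathrm{Recent}_{\mathbf{b}}(I,s)$ is the maximal set $D\subseteq\mathrm{adom}(I)$ with $|D|\le\mathbf{b}$ such that $s(e)<s(e')$ for all $e'\in D$, $e\in\mathrm{adom}(I)\setminus D$ (the $\mathbf{b}$ elements of $\mathrm{adom}(I)$ with largest sequence numbers). We write $\langle I,H,s\rangle\xrightarrow{\alpha:\sigma}_{\mathbf{b}}\langle I',H',s'\rangle$ iff (1) $\langle I,H\rangle\xrightarrow{\alpha:\sigma}\langle I',H'\rangle$; (2) $\sigma(u)\in\mathrm{Recent}_{\mathbf{b}}(I,s)$ for every $u\in\vec u$; (3) $s':H'\to\mathbb{N}$ is injective, agrees with $s$ on $H$, and $s'(\sigma(v))>s(e)$ for all $v\in\vec v$, $e\in H$; (4) $s'(\sigma(v_i))<s'(\sigma(v_j))$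 for $i<j$. A $\mathbf{b}$-bounded extended run is an infinite sequence $\langle I_0,H_0,s_0\rangle\xrightarrow{\alpha_0:\sigma_0}_{\mathbf{b}}\langle I_1,H_1,s_1\rangle\xrightarrow{\alpha_1:\sigma_1}_{\mathbf{b}}\cdots$ with $I_0$ the initial instance of $\mathcal{S}$, $H_0=\emptyset$, $s_0$ empty; the $\mathbf{b}$-bounded run it generates is $I_0,I_1,\dots$; $\textsf{Runs}_{\mathbf{b}}(\mathcal{S})$ is the set of these. MSO-FO formulae over $\mathcal{R}$: $\phi ::= Q@x \mid x<y \mid x\in X \mid \neg\phi \mid \phi\wedge\phi \mid \exists x.\phi \mid \exists X.\phi \mid \exists^g u.\phi$, with $x,y$ position variables over $\mathbb{N}$, $X$ set variables over subsets of $\mathbb{N}$, $u$ a data variable, $Q$ a $\mathrm{FOL}(\mathcal{R})$ query. On a run $\rho=I_0,I_1,\dots$ with $\mathrm{gadom}(\rho)=\bigcup_i\mathrm{adom}(I_i)$: $Q@x$ holds iff, with $i=\sigma(x)$, the values assigned to the free variables of $Q$ lie in $\mathrm{adom}(I_i)$ and $I_i,\sigma|_{\mathrm{free}(Q)}\models Q$; $\exists^g u.\phi$ holds iff some $e\in\mathrm{gadom}(\rho)$ assigned to $u$ makes $\phi$ hold; other cases standard. *)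

theory Defs
  imports Main "HOL-Library.Nat_Bijection"
begin

text \<open>The countably infinite data domain Delta is modelled by nat.  Relation names are
  natural numbers; a fact R(e1,...,ea) is the pair (R, [e1,...,ea]).  The same type is used
  for facts whose arguments are variables (variables are also natural numbers).\<close>

type_synonym fact = "nat \<times> nat list"
type_synonym schema = "(nat \<times> nat) list"   \<comment> \<open>list of R/a, i.e. (name, arity)\<close>

definition adom :: "fact set \<Rightarrow> nat set" where
  "adom I = (\<Union>f\<in>I. set (snd f))"

definition subst_inst :: "(nat \<Rightarrow> nat) \<Rightarrow> fact set \<Rightarrow> fact set" where
  "subst_inst \<sigma> I = (\<lambda>(r, args). (r, map \<sigma> args)) ` I"

definition wf_schema :: "schema \<Rightarrow> bool" where
  "wf_schema R \<longleftrightarrow> distinct (map fst R)"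

definition fact_over :: "schema \<Rightarrow> fact \<Rightarrow> bool" where
  "fact_over R f \<longleftrightarrow> (fst f, length (snd f)) \<in> set R"

datatype fol =
    FAtom nat "nat list"
  | FEq nat nat
  | FNot fol
  | FAnd fol fol
  | FEx nat fol

fun fv_fol :: "fol \<Rightarrow> nat set" where
  "fv_fol (FAtom r xs) = set xs"
| "fv_fol (FEq x y) = {x, y}"
| "fv_fol (FNot q) = fv_fol q"
| "fv_fol (FAnd q1 q2) = fv_fol q1 \<union> fv_fol q2"
| "fv_fol (FEx x q) = fv_fol q - {x}"

fun fol_over :: "schema \<Rightarrow> fol \<Rightarrow> bool" where
  "fol_over R (FAtom r xs) = ((r, length xs) \<in> set R)"
| "fol_over R (FEq x y) = True"
| "fol_over R (FNot q) = fol_over R q"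
| "fol_over R (FAnd q1 q2) = (fol_over R q1 \<and> fol_over R q2)"
| "fol_over R (FEx x q) = fol_over R q"

fun fol_sat :: "fact set \<Rightarrow> (nat \<Rightarrow> nat) \<Rightarrow> fol \<Rightarrow> bool" where
  "fol_sat I \<sigma> (FAtom r xs) = ((r, map \<sigma> xs) \<in> I)"
| "fol_sat I \<sigma> (FEq x y) = (\<sigma> x = \<sigma> y)"
| "fol_sat I \<sigma> (FNot q) = (\<not> fol_sat I \<sigma> q)"
| "fol_sat I \<sigma> (FAnd q1 q2) = (fol_sat I \<sigma> q1 \<and> fol_sat I \<sigma> q2)"
| "fol_sat I \<sigma> (FEx x q) = (\<exists>e\<in>adom I. fol_sat I (\<sigma>(x := e)) q)"

datatype action = Action
  (act_u: "nat list")      \<comment> \<open>the finite set u (as a list; only its set matters)\<close>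
  (act_v: "nat list")
  (act_Q: fol)
  (act_Del: "fact list")
  (act_Add: "fact list")

datatype dms = DMS
  (dms_schema: schema)
  (dms_init: "fact list")
  (dms_acts: "action list")

definition wf_action :: "schema \<Rightarrow> action \<Rightarrow> bool" where
  "wf_action R \<alpha> \<longleftrightarrow>
     distinct (act_v \<alpha>) \<and> set (act_u \<alpha>) \<inter> set (act_v \<alpha>) = {} \<and>
     fol_over R (act_Q \<alpha>) \<and> fv_fol (act_Q \<alpha>) = set (act_u \<alpha>) \<and>
     (\<forall>f\<in>set (act_Del \<alpha>). fact_over R f \<and> set (snd f) \<subseteq> set (act_u \<alpha>)) \<and>
     (\<forall>f\<in>set (act_Add \<alpha>). fact_over R f \<and> set (snd f) \<subseteq> set (act_u \<alpha>) \<union> set (act_v \<alpha>)) \<and>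
     set (act_v \<alpha>) \<subseteq> adom (set (act_Add \<alpha>))"

definition wf_dms :: "dms \<Rightarrow> bool" where
  "wf_dms S \<longleftrightarrow> wf_schema (dms_schema S) \<and>
     (\<forall>f\<in>set (dms_init S). fact_over (dms_schema S) f) \<and>
     adom (set (dms_init S)) = {} \<and>
     (\<forall>\<alpha>\<in>set (dms_acts S). wf_action (dms_schema S) \<alpha>)"

text \<open>A b-configuration (I, H, s); the sequence numbering s is a total function of which
  only the restriction to H is relevant (it is required to be injective on H).\<close>

type_synonym config = "fact set \<times> nat set \<times> (nat \<Rightarrow> nat)"

text \<open>Recent_b(I,s): the (at most) b elements of adom(I) with the largest sequence numbers,
  i.e. those elements of adom(I) exceeded (w.r.t. s) by fewer than b elements of adom(I).\<close>

definition Recent :: "nat \<Rightarrow> fact set \<Rightarrow> (nat \<Rightarrow> nat) \<Rightarrow> nat set" where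
  "Recent b I s = {e \<in> adom I. card {e' \<in> adom I. s e < s e'} < b}"

definition dms_step :: "nat \<Rightarrow> config \<Rightarrow> action \<Rightarrow> (nat \<Rightarrow> nat) \<Rightarrow> config \<Rightarrow> bool" where
  "dms_step b c \<alpha> \<sigma> c' \<longleftrightarrow>
     (case c of (I, H, s) \<Rightarrow> case c' of (I', H', s') \<Rightarrow>
       \<comment> \<open>(1) plain DMS transition\<close>
       (\<forall>u\<in>set (act_u \<alpha>). \<sigma> u \<in> adom I) \<and>
       (\<forall>v\<in>set (act_v \<alpha>). \<sigma> v \<notin> H) \<and>
       inj_on \<sigma> (set (act_v \<alpha>)) \<and>
       fol_sat I \<sigma> (act_Q \<alpha>) \<and>
       I' = (I - subst_inst \<sigma> (set (act_Del \<alpha>))) \<union> subst_inst \<sigma> (set (act_Add \<alpha>)) \<and>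
       H' = H \<union> \<sigma> ` set (act_v \<alpha>) \<and>
       \<comment> \<open>(2) recency bound\<close>
       (\<forall>u\<in>set (act_u \<alpha>). \<sigma> u \<in> Recent b I s) \<and>
       \<comment> \<open>(3) new sequence numbering\<close>
       inj_on s' H' \<and> (\<forall>e\<in>H. s' e = s e) \<and>
       (\<forall>v\<in>set (act_v \<alpha>). \<forall>e\<in>H. s e < s' (\<sigma> v)) \<and>
       \<comment> \<open>(4) fresh values numbered in the order of the tuple v\<close>
       (\<forall>i j. i < j \<and> j < length (act_v \<alpha>) \<longrightarrow>
          s' (\<sigma> (act_v \<alpha> ! i)) < s' (\<sigma> (act_v \<alpha> ! j))))"

definition ext_run :: "nat \<Rightarrow> dms \<Rightarrow> (nat \<Rightarrow> config) \<Rightarrow> bool" where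
  "ext_run b S cs \<longleftrightarrow>
     fst (cs 0) = set (dms_init S) \<and> fst (snd (cs 0)) = {} \<and>
     (\<forall>i. \<exists>\<alpha>\<in>set (dms_acts S). \<exists>\<sigma>. dms_step b (cs i) \<alpha> \<sigma> (cs (Suc i)))"

definition Runs :: "nat \<Rightarrow> dms \<Rightarrow> (nat \<Rightarrow> fact set) set" where
  "Runs b S = {\<rho>. \<exists>cs. ext_run b S cs \<and> \<rho> = (\<lambda>i. fst (cs i))}"

text \<open>Position variables, set variables and data variables are three separate
  namespaces (each indexed by nat).\<close>

datatype mso =
    MQAt fol nat
  | MLess nat nat
  | MIn nat nat
  | MNot mso
  | MAnd mso mso
  | MExPos nat mso
  | MExSet nat mso
  | MExData nat mso

fun fvp :: "mso \<Rightarrow> nat set" where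
  "fvp (MQAt q x) = {x}"
| "fvp (MLess x y) = {x, y}"
| "fvp (MIn x X) = {x}"
| "fvp (MNot \<phi>) = fvp \<phi>"
| "fvp (MAnd \<phi> \<psi>) = fvp \<phi> \<union> fvp \<psi>"
| "fvp (MExPos x \<phi>) = fvp \<phi> - {x}"
| "fvp (MExSet X \<phi>) = fvp \<phi>"
| "fvp (MExData u \<phi>) = fvp \<phi>"

fun fvs :: "mso \<Rightarrow> nat set" where
  "fvs (MQAt q x) = {}"
| "fvs (MLess x y) = {}"
| "fvs (MIn x X) = {X}"
| "fvs (MNot \<phi>) = fvs \<phi>"
| "fvs (MAnd \<phi> \<psi>) = fvs \<phi> \<union> fvs \<psi>"
| "fvs (MExPos x \<phi>) = fvs \<phi>"
| "fvs (MExSet X \<phi>) = fvs \<phi> - {X}"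
| "fvs (MExData u \<phi>) = fvs \<phi>"

fun fvd :: "mso \<Rightarrow> nat set" where
  "fvd (MQAt q x) = fv_fol q"
| "fvd (MLess x y) = {}"
| "fvd (MIn x X) = {}"
| "fvd (MNot \<phi>) = fvd \<phi>"
| "fvd (MAnd \<phi> \<psi>) = fvd \<phi> \<union> fvd \<psi>"
| "fvd (MExPos x \<phi>) = fvd \<phi>"
| "fvd (MExSet X \<phi>) = fvd \<phi>"
| "fvd (MExData u \<phi>) = fvd \<phi> - {u}"

definition sentence :: "mso \<Rightarrow> bool" where
  "sentence \<phi> \<longleftrightarrow> fvp \<phi> = {} \<and> fvs \<phi> = {} \<and> fvd \<phi> = {}"

fun mso_over :: "schema \<Rightarrow> mso \<Rightarrow> bool" where
  "mso_over R (MQAt q x) = fol_over R q"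
| "mso_over R (MLess x y) = True"
| "mso_over R (MIn x X) = True"
| "mso_over R (MNot \<phi>) = mso_over R \<phi>"
| "mso_over R (MAnd \<phi> \<psi>) = (mso_over R \<phi> \<and> mso_over R \<psi>)"
| "mso_over R (MExPos x \<phi>) = mso_over R \<phi>"
| "mso_over R (MExSet X \<phi>) = mso_over R \<phi>"
| "mso_over R (MExData u \<phi>) = mso_over R \<phi>"

definition gadom :: "(nat \<Rightarrow> fact set) \<Rightarrow> nat set" where
  "gadom \<rho> = (\<Union>i. adom (\<rho> i))"

fun mso_sat :: "(nat \<Rightarrow> fact set) \<Rightarrow> (nat \<Rightarrow> nat) \<Rightarrow> (nat \<Rightarrow> nat set) \<Rightarrow> (nat \<Rightarrow> nat)
                 \<Rightarrow> mso \<Rightarrow> bool" where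
  "mso_sat \<rho> p X d (MQAt q x) =
     ((\<forall>u\<in>fv_fol q. d u \<in> adom (\<rho> (p x))) \<and> fol_sat (\<rho> (p x)) d q)"
| "mso_sat \<rho> p X d (MLess x y) = (p x < p y)"
| "mso_sat \<rho> p X d (MIn x Y) = (p x \<in> X Y)"
| "mso_sat \<rho> p X d (MNot \<phi>) = (\<not> mso_sat \<rho> p X d \<phi>)"
| "mso_sat \<rho> p X d (MAnd \<phi> \<psi>) = (mso_sat \<rho> p X d \<phi> \<and> mso_sat \<rho> p X d \<psi>)"
| "mso_sat \<rho> p X d (MExPos x \<phi>) = (\<exists>i. mso_sat \<rho> (p(x := i)) X d \<phi>)"
| "mso_sat \<rho> p X d (MExSet Y \<phi>) = (\<exists>A. mso_sat \<rho> p (X(Y := A)) d \<phi>)"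
| "mso_sat \<rho> p X d (MExData u \<phi>) = (\<exists>e\<in>gadom \<rho>. mso_sat \<rho> p X (d(u := e)) \<phi>)"

text \<open>Satisfaction of a sentence (the assignments are irrelevant for sentences).\<close>
definition models :: "(nat \<Rightarrow> fact set) \<Rightarrow> mso \<Rightarrow> bool" where
  "models \<rho> \<phi> \<longleftrightarrow> mso_sat \<rho> (\<lambda>_. 0) (\<lambda>_. {}) (\<lambda>_. 0) \<phi>"

datatype recf =
    Zf
  | Sf
  | Pj nat
  | Cn recf "recf list"
  | Pr recf recf
  | Mn recf

inductive rf_eval :: "recf \<Rightarrow> nat list \<Rightarrow> nat \<Rightarrow> bool" where
  zero: "rf_eval Zf xs 0"
| succ: "rf_eval Sf (x # xs) (Suc x)"
| proj: "i < length xs \<Longrightarrow> rf_eval (Pj i) xs (xs ! i)"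
| comp: "length ys = length gs \<Longrightarrow> (\<forall>i<length gs. rf_eval (gs ! i) xs (ys ! i)) \<Longrightarrow>
         rf_eval f ys r \<Longrightarrow> rf_eval (Cn f gs) xs r"
| prim0: "rf_eval f xs r \<Longrightarrow> rf_eval (Pr f g) (0 # xs) r"
| primS: "rf_eval (Pr f g) (n # xs) r \<Longrightarrow> rf_eval g (r # n # xs) r' \<Longrightarrow>
          rf_eval (Pr f g) (Suc n # xs) r'"
| mini: "rf_eval f (n # xs) 0 \<Longrightarrow> (\<forall>m<n. \<exists>k. k \<noteq> 0 \<and> rf_eval f (m # xs) k) \<Longrightarrow>
         rf_eval (Mn f) xs n"

text \<open>A predicate on (encodings as) natural numbers is decidable iff some partial recursive
  function computes its characteristic function on the relevant inputs.\<close>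

definition enc_pair :: "nat \<Rightarrow> nat \<Rightarrow> nat" where
  "enc_pair a b = prod_encode (a, b)"

definition enc_fact :: "fact \<Rightarrow> nat" where
  "enc_fact f = enc_pair (fst f) (list_encode (snd f))"

definition enc_facts :: "fact list \<Rightarrow> nat" where
  "enc_facts fs = list_encode (map enc_fact fs)"

fun enc_fol :: "fol \<Rightarrow> nat" where
  "enc_fol (FAtom r xs) = enc_pair 0 (enc_pair r (list_encode xs))"
| "enc_fol (FEq x y) = enc_pair 1 (enc_pair x y)"
| "enc_fol (FNot q) = enc_pair 2 (enc_fol q)"
| "enc_fol (FAnd q1 q2) = enc_pair 3 (enc_pair (enc_fol q1) (enc_fol q2))"
| "enc_fol (FEx x q) = enc_pair 4 (enc_pair x (enc_fol q))"

fun enc_action :: "action \<Rightarrow> nat" where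
  "enc_action (Action u v q d a) =
     list_encode [list_encode u, list_encode v, enc_fol q, enc_facts d, enc_facts a]"

fun enc_dms :: "dms \<Rightarrow> nat" where
  "enc_dms (DMS R I0 acts) =
     list_encode [list_encode (map (\<lambda>(r, a). enc_pair r a) R), enc_facts I0,
                  list_encode (map enc_action acts)]"

fun enc_mso :: "mso \<Rightarrow> nat" where
  "enc_mso (MQAt q x) = enc_pair 0 (enc_pair (enc_fol q) x)"
| "enc_mso (MLess x y) = enc_pair 1 (enc_pair x y)"
| "enc_mso (MIn x X) = enc_pair 2 (enc_pair x X)"
| "enc_mso (MNot \<phi>) = enc_pair 3 (enc_mso \<phi>)"
| "enc_mso (MAnd \<phi> \<psi>) = enc_pair 4 (enc_pair (enc_mso \<phi>) (enc_mso \<psi>))"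
| "enc_mso (MExPos x \<phi>) = enc_pair 5 (enc_pair x (enc_mso \<phi>))"
| "enc_mso (MExSet X \<phi>) = enc_pair 6 (enc_pair X (enc_mso \<phi>))"
| "enc_mso (MExData u \<phi>) = enc_pair 7 (enc_pair u (enc_mso \<phi>))"

definition enc_instance :: "dms \<Rightarrow> mso \<Rightarrow> nat \<Rightarrow> nat" where
  "enc_instance S \<phi> b = list_encode [enc_dms S, enc_mso \<phi>, b]"

definition recency_mc :: "dms \<Rightarrow> mso \<Rightarrow> nat \<Rightarrow> bool" where
  "recency_mc S \<phi> b \<longleftrightarrow> (\<forall>\<rho>\<in>Runs b S. models \<rho> \<phi>)"

definition valid_input :: "dms \<Rightarrow> mso \<Rightarrow> bool" where
  "valid_input S \<phi> \<longleftrightarrow> wf_dms S \<and> sentence \<phi> \<and> mso_over (dms_schema S) \<phi>"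

end

theory Submission
  imports Defs "HOL-Library.Ramsey"
begin

text \<open>A run that violates the sentence is described by a nested word. Its letters create elements and perform
  actions; finitely many registers hold the elements that the next actions may use, and a nesting brings the value
  that a register had at its beginning back at its end. Recency-boundedness makes finitely many registers
  sufficient: the recent elements are kept in registers, and as long as more than \<open>b\<close> elements are alive, the
  oldest one can be put aside by a nesting, since it cannot be used before the number of newer elements has fallen
  to \<open>b - 1\<close>. Conversely, an MSO sentence over such words with atoms comparing a register with a
  second-order variable expresses that a word describes a run of the system which violates the given sentence.

  Satisfiability of such sentences is decided by the composition method. The behaviour of a finite word with
  respect to a formula lies in a finite algebra: Boolean matrices that trace the contents of registers for atoms, pairs for
  connectives, sets for quantifiers. By Ramsey's theorem every infinite word factorises into types \<open>a e e e \<dots>\<close>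
  with \<open>a e = a\<close> and \<open>e e = e\<close>, so that satisfiability is a property of the finite set of generated types.
  Both answers have finite certificates, which a recursive function finds by unbounded search.\<close>

subsection \<open>Computable functions and decidable predicates\<close>

text \<open>An element is identified with the letter that creates it. The order of the letters then
  is the sequence numbering, and since sentences do not see names, a run may be replaced by a
  renamed one. The obstacle is that unboundedly many elements can be alive at once. A nesting
  restores a single register, so its effect on a matrix is the replacement of one column, and types
  stay finite at any nesting depth. Instances are not stored at all: a fact holds if an earlier
  action added it and no action in between deleted it, which MSO expresses by comparing register
  contents. The second obstacle is that the decision procedure has to be a term of
  \<open>recf\<close> acting on codes. Programming recursion on formulas and on nested sets of types
  is avoided: formula codes unfold lazily by one computable step, and the operations of the algebra
  are checked by rules with bounded quantifiers only. Variables of actions serve as names of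
  registers and codes of actions as letters, so the numbers of registers and letters grow with the
  input; one computable bound \<open>K\<close> limits both.\<close>

definition pfst :: "nat \<Rightarrow> nat" where "pfst x = fst (prod_decode x)"
definition psnd :: "nat \<Rightarrow> nat" where "psnd x = snd (prod_decode x)"

lemma pfst_pair [simp]: "pfst (enc_pair a b) = a"
  by (simp add: pfst_def enc_pair_def)

lemma psnd_pair [simp]: "psnd (enc_pair a b) = b"
  by (simp add: psnd_def enc_pair_def)

lemma pair_proj [simp]: "enc_pair (pfst x) (psnd x) = x"
  by (simp add: pfst_def psnd_def enc_pair_def)

lemma enc_pair_inject [simp]: "enc_pair a b = enc_pair c d \<longleftrightarrow> a = c \<and> b = d"
  by (simp add: enc_pair_def)

lemma le_enc_pair: "a \<le> enc_pair a b" "b \<le> enc_pair a b"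
  by (simp_all add: enc_pair_def le_prod_encode_1 le_prod_encode_2)

text \<open>Monotonicity in both arguments is what bounds the codes of all letters of an instance by
  a single number.\<close>

lemma enc_pair_mono: "a \<le> c \<Longrightarrow> b \<le> d \<Longrightarrow> enc_pair a b \<le> enc_pair c d"
proof -
  have tri: "m \<le> n \<Longrightarrow> triangle m \<le> triangle n" for m n
    unfolding triangle_def by (intro div_le_mono mult_le_mono) auto
  show "a \<le> c \<Longrightarrow> b \<le> d \<Longrightarrow> enc_pair a b \<le> enc_pair c d"
    unfolding enc_pair_def prod_encode_def using tri[of "a + b" "c + d"] by simp
qed

text \<open>Almost everything is phrased for unary functions with tuples packed by
  \<open>enc_pair\<close>, so that closure rules chain by mere introduction; argument lists appear
  only where the constructors of \<open>recf\<close> are applied.\<close>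

definition comput :: "nat \<Rightarrow> (nat list \<Rightarrow> nat) \<Rightarrow> bool" where
  "comput n g \<longleftrightarrow> (\<exists>f. \<forall>xs. length xs = n \<longrightarrow> rf_eval f xs (g xs))"

definition bin :: "(nat \<Rightarrow> nat \<Rightarrow> nat) \<Rightarrow> bool" where
  "bin h \<longleftrightarrow> (\<exists>f. \<forall>x y. rf_eval f [x, y] (h x y))"

definition cmp :: "(nat \<Rightarrow> nat) \<Rightarrow> bool" where
  "cmp g \<longleftrightarrow> (\<exists>f. \<forall>x. rf_eval f [x] (g x))"

definition dec :: "(nat \<Rightarrow> bool) \<Rightarrow> bool" where
  "dec P \<longleftrightarrow> cmp (\<lambda>x. of_bool (P x))"

lemma comput_proj: "i < n \<Longrightarrow> comput n (\<lambda>xs. xs ! i)"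
  unfolding comput_def by (intro exI[of _ "Pj i"]) (auto intro: rf_eval.proj)

lemma comput_cmp:
  assumes "cmp h" "comput n a"
  shows "comput n (\<lambda>xs. h (a xs))"
proof -
  obtain F A where F: "\<And>x. rf_eval F [x] (h x)" and A: "\<And>xs. length xs = n \<Longrightarrow> rf_eval A xs (a xs)"
    using assms by (auto simp: cmp_def comput_def)
  have "rf_eval (Cn F [A]) xs (h (a xs))" if "length xs = n" for xs
    by (rule rf_eval.comp[where ys="[a xs]"]) (use F A[OF that] in auto)
  then show ?thesis unfolding comput_def by blast
qed

lemma comput_bin:
  assumes "bin h" "comput n a" "comput n b"
  shows "comput n (\<lambda>xs. h (a xs) (b xs))"
proof -
  obtain F A B where F: "\<And>x y. rf_eval F [x, y] (h x y)"
    and A: "\<And>xs. length xs = n \<Longrightarrow> rf_eval A xs (a xs)"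
    and B: "\<And>xs. length xs = n \<Longrightarrow> rf_eval B xs (b xs)"
    using assms by (auto simp: bin_def comput_def)
  have "rf_eval (Cn F [A, B]) xs (h (a xs) (b xs))" if "length xs = n" for xs
    by (rule rf_eval.comp[where ys="[a xs, b xs]"]) (use F A[OF that] B[OF that] in \<open>auto simp: less_Suc_eq\<close>)
  then show ?thesis unfolding comput_def by blast
qed

lemma cmp_iff: "cmp g \<longleftrightarrow> comput 1 (\<lambda>xs. g (xs ! 0))"
proof
  assume "cmp g" from comput_cmp[OF this] show "comput 1 (\<lambda>xs. g (xs ! 0))"
    by (simp add: comput_proj)
next
  assume "comput 1 (\<lambda>xs. g (xs ! 0))"
  then obtain f where f: "\<And>xs. length xs = 1 \<Longrightarrow> rf_eval f xs (g (xs ! 0))"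
    by (auto simp: comput_def)
  have "rf_eval f [x] (g x)" for x using f[of "[x]"] by simp
  then show "cmp g" unfolding cmp_def by blast
qed

lemma bin_iff: "bin g \<longleftrightarrow> comput 2 (\<lambda>xs. g (xs ! 0) (xs ! 1))"
proof
  assume "bin g" from comput_bin[OF this] show "comput 2 (\<lambda>xs. g (xs ! 0) (xs ! 1))"
    by (simp add: comput_proj)
next
  assume "comput 2 (\<lambda>xs. g (xs ! 0) (xs ! 1))"
  then obtain f where f: "\<And>xs. length xs = 2 \<Longrightarrow> rf_eval f xs (g (xs ! 0) (xs ! 1))"
    by (auto simp: comput_def)
  have "rf_eval f [x, y] (g x y)" for x y using f[of "[x, y]"] by simp
  then show "bin g" unfolding bin_def by blast
qed

lemma cmp_id: "cmp (\<lambda>x. x)"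
  unfolding cmp_iff by (rule comput_proj) simp

lemma cmp_Suc0: "cmp Suc"
  unfolding cmp_def by (intro exI[of _ Sf]) (auto intro: rf_eval.succ)

lemma cmp_comp: "cmp h \<Longrightarrow> cmp a \<Longrightarrow> cmp (\<lambda>x. h (a x))"
  using comput_cmp[of h 1 "\<lambda>xs. a (xs ! 0)"] by (simp add: cmp_iff)

lemma cmp_bin: "bin h \<Longrightarrow> cmp a \<Longrightarrow> cmp b \<Longrightarrow> cmp (\<lambda>x. h (a x) (b x))"
  using comput_bin[of h 1 "\<lambda>xs. a (xs ! 0)" "\<lambda>xs. b (xs ! 0)"] by (simp add: cmp_iff)

lemma cmp_Suc: "cmp a \<Longrightarrow> cmp (\<lambda>x. Suc (a x))"
  by (rule cmp_comp[OF cmp_Suc0])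

lemma comput_zero: "comput n (\<lambda>_. 0)"
  unfolding comput_def by (intro exI[of _ Zf]) (auto intro: rf_eval.zero)

lemma cmp_const: "cmp (\<lambda>_. c)"
proof (induction c)
  case 0 show ?case using comput_zero[of 1] by (simp add: cmp_iff)
next
  case (Suc c) then show ?case by (rule cmp_Suc)
qed

text \<open>\<open>Pr\<close> hands the recursive value to the step before the counter, which fixes
  the order of the arguments of \<open>g\<close>.\<close>

lemma bin_rec:
  assumes "cmp f" "comput 3 (\<lambda>xs. g (xs ! 0) (xs ! 1) (xs ! 2))"
  shows "bin (\<lambda>n x. rec_nat (f x) (\<lambda>k r. g r k x) n)"
proof -
  obtain F G where F: "\<And>x. rf_eval F [x] (f x)"
    and G: "\<And>xs. length xs = 3 \<Longrightarrow> rf_eval G xs (g (xs ! 0) (xs ! 1) (xs ! 2))"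
    using assms by (auto simp: cmp_def comput_def)
  have "rf_eval (Pr F G) [n, x] (rec_nat (f x) (\<lambda>k r. g r k x) n)" for n x
  proof (induction n)
    case 0 show ?case using F by (auto intro: rf_eval.prim0)
  next
    case (Suc n)
    show ?case
      using rf_eval.primS[OF Suc.IH] G[of "[rec_nat (f x) (\<lambda>k r. g r k x) n, n, x]"] by simp
  qed
  then show ?thesis unfolding bin_def by blast
qed

lemma bin_swap: "bin h \<Longrightarrow> bin (\<lambda>x y. h y x)"
  unfolding bin_iff[of "\<lambda>x y. h y x"] by (rule comput_bin[of h]) (auto intro: comput_proj)

lemma bin_add: "bin (+)"
proof -
  have "bin (\<lambda>n x. rec_nat x (\<lambda>k r. Suc r) n)"
    by (rule bin_rec[where g="\<lambda>r k x. Suc r"]) (rule cmp_id, rule comput_cmp[OF cmp_Suc0], rule comput_proj, simp)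
  moreover have "rec_nat x (\<lambda>k r. Suc r) n = n + x" for n x :: nat by (induction n) auto
  ultimately show ?thesis by simp
qed

lemma cmp_diag: "bin h \<Longrightarrow> cmp (\<lambda>x. h x x)"
  by (rule cmp_bin[OF _ cmp_id cmp_id])

lemma cmp_pred: "cmp (\<lambda>n. n - 1)"
proof -
  have "bin (\<lambda>n x. rec_nat 0 (\<lambda>k r. k) n)"
    by (rule bin_rec[where g="\<lambda>r k x. k" and f="\<lambda>_. 0"]) (rule cmp_const, rule comput_proj, simp)
  from cmp_diag[OF this] have "cmp (\<lambda>n. rec_nat 0 (\<lambda>k r. k) n)" .
  moreover have "(\<lambda>n. rec_nat 0 (\<lambda>k r. k) n) = (\<lambda>n. n - 1 :: nat)"
    by (rule ext) (case_tac n; simp)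
  ultimately show ?thesis by metis
qed

lemma bin_diff: "bin (-)"
proof -
  have "bin (\<lambda>n x. rec_nat x (\<lambda>k r. r - 1) n)"
    by (rule bin_rec[where g="\<lambda>r k x. r - 1"]) (rule cmp_id, rule comput_cmp[OF cmp_pred], rule comput_proj, simp)
  moreover have "rec_nat x (\<lambda>k r. r - 1) n = x - n" for n x :: nat by (induction n) auto
  ultimately have "bin (\<lambda>n x. x - n)" by simp
  then show ?thesis by (rule bin_swap)
qed

lemma cmp_triangle: "cmp triangle"
proof -
  have "bin (\<lambda>n x. rec_nat 0 (\<lambda>k r. r + Suc k) n)"
    by (rule bin_rec[where g="\<lambda>r k x. r + Suc k" and f="\<lambda>_. 0"])
      (intro cmp_const comput_bin[OF bin_add] comput_cmp[OF cmp_Suc0] comput_proj; simp)+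
  from cmp_diag[OF this] have "cmp (\<lambda>n. rec_nat 0 (\<lambda>k r. r + Suc k) n)" .
  moreover have "rec_nat 0 (\<lambda>k r. r + Suc k) n = triangle n" for n by (induction n) auto
  ultimately show ?thesis by simp
qed

lemma bin_pair: "bin enc_pair"
  unfolding bin_iff enc_pair_def prod_encode_def prod.case
  by (intro comput_bin[OF bin_add] comput_cmp[OF cmp_triangle] comput_proj) auto

text \<open>\<open>h\<close> is total, so all values below the least zero are defined and nonzero,
  as \<open>mini\<close> demands; the existence of a zero makes the search terminate.\<close>

lemma cmp_Least:
  assumes "bin h" "\<And>x. \<exists>w. h w x = 0"
  shows "cmp (\<lambda>x. LEAST w. h w x = 0)"
proof -
  obtain F where F: "\<And>x y. rf_eval F [x, y] (h x y)" using assms(1) by (auto simp: bin_def)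
  have "rf_eval (Mn F) [x] (LEAST w. h w x = 0)" for x
  proof (rule rf_eval.mini)
    have "h (LEAST w. h w x = 0) x = 0" using LeastI_ex[OF assms(2)[of x]] .
    then show "rf_eval F [LEAST w. h w x = 0, x] 0" using F by metis
    show "\<forall>m<LEAST w. h w x = 0. \<exists>k. k \<noteq> 0 \<and> rf_eval F [m, x] k"
      using F not_less_Least by blast
  qed
  then show ?thesis unfolding cmp_def by blast
qed

lemma cmp_plus: "cmp a \<Longrightarrow> cmp b \<Longrightarrow> cmp (\<lambda>x. a x + b x)"
  by (rule cmp_bin[OF bin_add])

lemma cmp_minus: "cmp a \<Longrightarrow> cmp b \<Longrightarrow> cmp (\<lambda>x. a x - b x)"
  by (rule cmp_bin[OF bin_diff])

lemma cmp_pair: "cmp a \<Longrightarrow> cmp b \<Longrightarrow> cmp (\<lambda>x. enc_pair (a x) (b x))"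
  by (rule cmp_bin[OF bin_pair])

text \<open>The code of \<open>(a, b)\<close> is \<open>triangle (a + b) + a\<close>. The search
  finds the diagonal \<open>a + b\<close>, from which both projections follow by
  subtraction.\<close>

definition tri_root :: "nat \<Rightarrow> nat" where
  "tri_root x = (LEAST w. Suc x - triangle (Suc w) = 0)"

lemma tri_root_pair: "tri_root (enc_pair a b) = a + b"
  unfolding tri_root_def
proof (rule Least_equality)
  show "Suc (enc_pair a b) - triangle (Suc (a + b)) = 0"
    by (simp add: enc_pair_def prod_encode_def)
  fix w assume w: "Suc (enc_pair a b) - triangle (Suc w) = 0"
  show "a + b \<le> w"
  proof (rule ccontr)
    assume "\<not> a + b \<le> w"
    then have "Suc w \<le> a + b" by simp
    then have "triangle (Suc w) \<le> triangle (a + b)"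
      unfolding triangle_def by (intro div_le_mono mult_le_mono) auto
    with w show False by (simp add: enc_pair_def prod_encode_def)
  qed
qed

lemma cmp_tri_root: "cmp tri_root"
  unfolding tri_root_def
proof (rule cmp_Least)
  show "bin (\<lambda>w x. Suc x - triangle (Suc w))"
    unfolding bin_iff
    by (intro comput_bin[OF bin_diff] comput_cmp[OF cmp_triangle] comput_cmp[OF cmp_Suc0] comput_proj) auto
  show "\<exists>w. Suc x - triangle (Suc w) = 0" for x
    by (rule exI[of _ x]) simp
qed

lemma pfst_eq: "pfst x = x - triangle (tri_root x)"
proof -
  have "pfst (enc_pair a b) = enc_pair a b - triangle (tri_root (enc_pair a b))" for a b
    by (simp only: tri_root_pair pfst_pair) (simp add: enc_pair_def prod_encode_def)
  from this[of "pfst x" "psnd x"] show ?thesis by simp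
qed

lemma psnd_eq: "psnd x = tri_root x - pfst x"
  using tri_root_pair[of "pfst x" "psnd x"] by simp

lemma cmp_pfst0: "cmp pfst"
  unfolding pfst_eq[abs_def] by (intro cmp_minus cmp_id cmp_comp[OF cmp_triangle] cmp_tri_root)

lemma cmp_psnd0: "cmp psnd"
  unfolding psnd_eq[abs_def] by (intro cmp_minus cmp_tri_root cmp_pfst0)

lemma cmp_pfst: "cmp a \<Longrightarrow> cmp (\<lambda>x. pfst (a x))"
  by (rule cmp_comp[OF cmp_pfst0])

lemma cmp_psnd: "cmp a \<Longrightarrow> cmp (\<lambda>x. psnd (a x))"
  by (rule cmp_comp[OF cmp_psnd0])

lemma cmp_rec:
  assumes "cmp a" "cmp (\<lambda>p. h (pfst p) (pfst (psnd p)) (psnd (psnd p)))" "cmp m"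
  shows "cmp (\<lambda>x. rec_nat (a x) (\<lambda>k r. h k r x) (m x))"
proof -
  let ?g = "\<lambda>p. h (pfst p) (pfst (psnd p)) (psnd (psnd p))"
  have "comput 3 (\<lambda>xs. ?g (enc_pair (xs ! 1) (enc_pair (xs ! 0) (xs ! 2))))"
    by (intro comput_cmp[OF assms(2)] comput_bin[OF bin_pair] comput_proj) auto
  then have "comput 3 (\<lambda>xs. h (xs ! 1) (xs ! 0) (xs ! 2))" by simp
  from bin_rec[OF assms(1), where g="\<lambda>r k x. h k r x", OF this]
  have "bin (\<lambda>n x. rec_nat (a x) (\<lambda>k r. h k r x) n)" .
  from cmp_bin[OF this assms(3) cmp_id] show ?thesis .
qed

lemma cmp_if:
  assumes "dec P" "cmp a" "cmp b"
  shows "cmp (\<lambda>x. if P x then a x else b x)"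
proof -
  \<comment> \<open>Recursion on the truth value as a number: no step yields \<open>b x\<close>, one
    step replaces it by \<open>a x\<close>.\<close>
  have "cmp (\<lambda>x. rec_nat (b x) (\<lambda>k r. a x) (of_bool (P x)))"
    by (rule cmp_rec[where h="\<lambda>k r x. a x"])
      (use assms in \<open>simp_all add: dec_def cmp_comp[OF assms(2)] cmp_psnd cmp_id\<close>)
  moreover have "rec_nat (b x) (\<lambda>k r. a x) (of_bool (P x)) = (if P x then a x else b x)" for x by simp
  ultimately show ?thesis by simp
qed

lemma dec_if:
  assumes "dec P" "dec Q" "dec R"
  shows "dec (\<lambda>x. if P x then Q x else R x)"
proof -
  have "(\<lambda>x. of_bool (if P x then Q x else R x)) = (\<lambda>x. if P x then of_bool (Q x) else (of_bool (R x) :: nat))" by auto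
  then show ?thesis using cmp_if[OF assms(1), of "\<lambda>x. of_bool (Q x)" "\<lambda>x. of_bool (R x)"] assms(2,3)
    by (simp add: dec_def)
qed

lemma dec_const: "dec (\<lambda>_. c)"
  unfolding dec_def by (rule cmp_const)

lemma dec_not: assumes "dec P" shows "dec (\<lambda>x. \<not> P x)"
proof -
  have "(\<lambda>x. \<not> P x) = (\<lambda>x. if P x then False else True)" by auto
  then show ?thesis by (simp only: dec_if[OF assms dec_const dec_const])
qed

lemma dec_and: assumes "dec P" "dec Q" shows "dec (\<lambda>x. P x \<and> Q x)"
proof -
  have "(\<lambda>x. P x \<and> Q x) = (\<lambda>x. if P x then Q x else False)" by auto
  then show ?thesis by (simp only: dec_if[OF assms dec_const])
qed

lemma dec_or: assumes "dec P" "dec Q" shows "dec (\<lambda>x. P x \<or> Q x)"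
  using dec_not[OF dec_and[OF assms[THEN dec_not]]] by simp

lemma dec_imp: assumes "dec P" "dec Q" shows "dec (\<lambda>x. P x \<longrightarrow> Q x)"
  using dec_or[OF dec_not[OF assms(1)] assms(2)] by simp

lemma dec_iff: assumes "dec P" "dec Q" shows "dec (\<lambda>x. P x \<longleftrightarrow> Q x)"
  using dec_and[OF dec_imp[OF assms] dec_imp[OF assms(2,1)]] by (simp only: iff_conv_conj_imp)

lemma dec_le:
  assumes "cmp a" "cmp b" shows "dec (\<lambda>x. a x \<le> b x)"
proof -
  have "cmp (\<lambda>x. 1 - (a x - b x))" by (intro cmp_minus cmp_const assms)
  moreover have "of_bool (a x \<le> b x) = 1 - (a x - b x)" for x by simp
  ultimately show ?thesis by (simp add: dec_def)
qed

lemma dec_less: "cmp a \<Longrightarrow> cmp b \<Longrightarrow> dec (\<lambda>x. a x < b x)"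
  using dec_le[of "\<lambda>x. Suc (a x)" b] by (simp add: Suc_le_eq cmp_Suc)

lemma dec_eq: "cmp a \<Longrightarrow> cmp b \<Longrightarrow> dec (\<lambda>x. a x = b x)"
  using dec_and[OF dec_le[of a b] dec_le[of b a]] by (simp add: eq_iff)

lemma dec_comp: "dec P \<Longrightarrow> cmp a \<Longrightarrow> dec (\<lambda>x. P (a x))"
  unfolding dec_def by (rule cmp_comp[where h="\<lambda>x. of_bool (P x)"])

lemma dec_bex:
  assumes "cmp t" "dec (\<lambda>p. Q (pfst p) (psnd p))"
  shows "dec (\<lambda>e. \<exists>z<t e. Q z e)"
proof -
  have "cmp (\<lambda>e. rec_nat 0 (\<lambda>k r. if Q k e then 1 else r) (t e))"
  proof (rule cmp_rec[OF cmp_const _ assms(1)])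
    show "cmp (\<lambda>p. if Q (pfst p) (psnd (psnd p)) then 1 else pfst (psnd p))"
      using dec_comp[OF assms(2), of "\<lambda>p. enc_pair (pfst p) (psnd (psnd p))"]
      by (intro cmp_if cmp_const cmp_pfst cmp_psnd cmp_id)
        (simp add: cmp_pair cmp_pfst cmp_psnd cmp_id)
  qed
  moreover have "rec_nat 0 (\<lambda>k r. if Q k e then 1 else r) n = (of_bool (\<exists>z<n. Q z e) :: nat)" for e n
    by (induction n) (auto simp: less_Suc_eq)
  ultimately show ?thesis by (simp add: dec_def)
qed

lemma dec_ball:
  assumes "cmp t" "dec (\<lambda>p. Q (pfst p) (psnd p))"
  shows "dec (\<lambda>e. \<forall>z<t e. Q z e)"
  using dec_not[OF dec_bex[OF assms(1) dec_not[OF assms(2)]]] by simp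

lemma cmp_half: "cmp (\<lambda>x. x div 2)"
proof -
  \<comment> \<open>\<open>Suc k div 2 = k - k div 2\<close> makes halving a primitive recursion
    without a test of parity.\<close>
  have "cmp (\<lambda>x. rec_nat 0 (\<lambda>k r. k - r) x)"
    by (rule cmp_rec[where h="\<lambda>k r x. k - r"]) (intro cmp_const cmp_id cmp_minus cmp_pfst cmp_psnd)+
  moreover have "rec_nat 0 (\<lambda>k r. k - r) n = n div 2" for n :: nat
  proof (induction n)
    case (Suc n) then show ?case by (simp; presburger)
  qed simp
  ultimately show ?thesis by simp
qed

lemma dec_mem:
  assumes "cmp a" "cmp t"
  shows "dec (\<lambda>x. a x \<in> set_decode (t x))"
proof -
  have half: "cmp (\<lambda>x. b x div 2)" if "cmp b" for b using cmp_comp[OF cmp_half that] .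
  \<comment> \<open>Halving \<open>a x\<close> times brings the bit in question to the lowest
    position; parity is read off by comparing the result with twice its half.\<close>
  let ?d = "\<lambda>x. rec_nat (t x) (\<lambda>k r. r div 2) (a x)"
  have d: "cmp ?d"
    by (rule cmp_rec[OF assms(2) _ assms(1), where h="\<lambda>k r x. r div 2"]) (intro half cmp_pfst cmp_psnd cmp_id)
  have "rec_nat m (\<lambda>k r. r div 2) n = m div 2 ^ n" for m n :: nat
    by (induction n) (simp_all flip: div_mult2_eq add: mult.commute)
  moreover have "odd n \<longleftrightarrow> n \<noteq> n div 2 + n div 2" for n :: nat by presburger
  ultimately have "a x \<in> set_decode (t x) \<longleftrightarrow> ?d x \<noteq> ?d x div 2 + ?d x div 2" for x
    by (simp only: set_decode_def mem_Collect_eq)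
  moreover have "dec (\<lambda>x. ?d x \<noteq> ?d x div 2 + ?d x div 2)"
    by (intro dec_not dec_eq cmp_plus half d)
  ultimately show ?thesis by simp
qed

text \<open>A bit at position \<open>z\<close> forces \<open>2 ^ z \<le> T\<close>. Quantifiers over
  a coded set thus become quantifiers bounded by the code.\<close>

lemma set_decode_less: "z \<in> set_decode T \<Longrightarrow> z < T"
proof -
  assume "z \<in> set_decode T"
  then have "odd (T div 2 ^ z)" by (simp add: set_decode_def)
  then have "2 ^ z \<le> T" by (metis div_less even_zero not_less)
  then show ?thesis using less_exp[of z] by linarith
qed

lemma dec_bexS:
  assumes "cmp t" "dec (\<lambda>p. Q (pfst p) (psnd p))"
  shows "dec (\<lambda>e. \<exists>z\<in>set_decode (t e). Q z e)"
proof -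
  have "dec (\<lambda>p. pfst p \<in> set_decode (t (psnd p)))"
    by (intro dec_mem cmp_comp[OF assms(1)] cmp_pfst cmp_psnd cmp_id)
  then have "dec (\<lambda>e. \<exists>z<t e. z \<in> set_decode (t e) \<and> Q z e)"
    by (intro dec_bex dec_and assms) simp
  moreover have "(\<exists>z\<in>set_decode (t e). Q z e) \<longleftrightarrow> (\<exists>z<t e. z \<in> set_decode (t e) \<and> Q z e)" for e
    using set_decode_less by blast
  ultimately show ?thesis by simp
qed

lemma dec_ballS:
  assumes "cmp t" "dec (\<lambda>p. Q (pfst p) (psnd p))"
  shows "dec (\<lambda>e. \<forall>z\<in>set_decode (t e). Q z e)"
  using dec_not[OF dec_bexS[OF assms(1) dec_not[OF assms(2)]]] by simp

lemmas cmp_intros = cmp_const cmp_id cmp_Suc cmp_plus cmp_minus cmp_pair cmp_pfst cmp_psnd cmp_if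
  dec_const dec_not dec_and dec_or dec_imp dec_iff dec_eq dec_le dec_less dec_mem
  dec_bex dec_ball dec_bexS dec_ballS dec_if

text \<open>Unbounded search returns the least certificate, whose answer is the right one as soon as
  all certificates of \<open>x\<close> agree. Nothing is claimed where no certificate exists, as the
  search then diverges.\<close>

lemma decide_by_certificate:
  assumes "dec (\<lambda>p. C (pfst p) (psnd p))" "cmp out"
  shows "\<exists>f. \<forall>x y. (\<exists>T. C T x) \<longrightarrow> (\<forall>T. C T x \<longrightarrow> out T = y) \<longrightarrow> rf_eval f [x] y"
proof -
  have "cmp (\<lambda>p. of_bool (\<not> C (pfst p) (psnd p)))" using dec_not[OF assms(1)] by (simp add: dec_def)
  then have "comput 2 (\<lambda>xs. of_bool (\<not> C (pfst (enc_pair (xs ! 0) (xs ! 1))) (psnd (enc_pair (xs ! 0) (xs ! 1)))))"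
    by (rule comput_cmp) (intro comput_bin[OF bin_pair] comput_proj; simp)
  then have "bin (\<lambda>T x. of_bool (\<not> C T x))" by (simp add: bin_iff)
  then obtain F where F: "\<And>T x. rf_eval F [T, x] (of_bool (\<not> C T x))" by (auto simp: bin_def)
  obtain G where G: "\<And>x. rf_eval G [x] (out x)" using assms(2) by (auto simp: cmp_def)
  have "rf_eval (Cn G [Mn F]) [x] y" if ex: "\<exists>T. C T x" and y: "\<forall>T. C T x \<longrightarrow> out T = y" for x y
  proof -
    let ?T = "LEAST T. C T x"
    have CT: "C ?T x" using LeastI_ex[OF ex] .
    have "rf_eval (Mn F) [x] ?T"
    proof (rule rf_eval.mini)
      show "rf_eval F [?T, x] 0" using F[of ?T x] CT by simp
      show "\<forall>m<?T. \<exists>k. k \<noteq> 0 \<and> rf_eval F [m, x] k"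
      proof (intro allI impI)
        fix m assume "m < ?T"
        then have "\<not> C m x" using not_less_Least by blast
        then show "\<exists>k. k \<noteq> 0 \<and> rf_eval F [m, x] k" using F[of m x] by (intro exI[of _ 1]) simp
      qed
    qed
    then show ?thesis
      using G[of ?T] y CT by (intro rf_eval.comp[where ys="[?T]"]) auto
  qed
  then show ?thesis by blast
qed

subsection \<open>The finite algebra of types\<close>

text \<open>A word is a program over registers: \<open>Lt l\<close> executes a letter, and \<open>Ne k l w\<close> runs \<open>w\<close> and then
  stores in register \<open>l\<close> the value that register \<open>k\<close> had before \<open>w\<close>. The letter \<open>enc_pair 0 k\<close> creates a
  fresh element in register \<open>k\<close>, the letter \<open>enc_pair 1 a\<close> performs the action with code \<open>a\<close>, all other
  letters are inert. The number of registers and letters is \<open>K\<close>; registers 0, 1, 2 are never written.\<close>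

datatype 'a item = Lt 'a | Ne nat nat "'a item list"

datatype core = At nat nat nat nat | Nand core core | Ex nat core

text \<open>Types are natural numbers throughout, so that certificates can speak about them
  directly; a Boolean matrix is the coded set of its entries.\<close>

definition enr :: "(nat \<times> nat) set \<Rightarrow> nat" where "enr E = set_encode (prod_encode ` E)"
definition der :: "nat \<Rightarrow> (nat \<times> nat) set" where "der a = prod_decode ` set_decode a"

lemma finite_der [simp]: "finite (der a)"
  by (simp add: der_def)

lemma der_enr [simp]: "finite E \<Longrightarrow> der (enr E) = E"
  by (simp add: der_def enr_def image_image)

lemma enr_der [simp]: "enr (der a) = a"
  by (simp add: der_def enr_def image_image)

lemma mem_der: "(i, j) \<in> der a \<longleftrightarrow> enc_pair i j \<in> set_decode a"
  by (force simp: der_def enc_pair_def image_iff)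

lemma der_inject: "der a = der b \<longleftrightarrow> a = b"
  by (metis enr_der)

text \<open>The matrix of a letter for an atom \<open>At m x y p\<close>. An entry \<open>(i, j)\<close> says that the bit of register
  \<open>i\<close> before the letter flows into the bit of register \<open>j\<close> after it. For \<open>i \<ge> 3\<close> the bit records whether the
  content of the register is an element of \<open>y\<close>; bit 0 is constantly true, bit 1 is the truth value of the
  atom, and bit 2 records that \<open>x\<close> has been met. The modes are: 0 for \<open>x < y\<close>, 1 for \<open>x\<close> meets \<open>y\<close>, 2 for
  register \<open>p\<close> at \<open>x\<close> contains an element of \<open>y\<close>, 3 for \<open>x\<close> performs action \<open>p\<close>, 4 for \<open>x\<close> has a letter
  of kind \<open>p\<close>.\<close>

definition amat :: "nat \<Rightarrow> nat \<Rightarrow> nat \<Rightarrow> nat \<Rightarrow> nat \<Rightarrow> nat \<Rightarrow> nat set \<Rightarrow> nat \<Rightarrow> nat \<Rightarrow> bool" where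
  "amat K m x y p l B i j \<longleftrightarrow> i < K \<and> j < K \<and>
     ((i = j \<and> \<not> (3 \<le> i \<and> l = enc_pair 0 i))
      \<or> (3 \<le> j \<and> l = enc_pair 0 j \<and> i = 0 \<and> y \<in> B)
      \<or> (m = 0 \<and> i = 2 \<and> j = 1 \<and> y \<in> B \<and> pfst l < 2)
      \<or> (m = 0 \<and> i = 0 \<and> j = 2 \<and> x \<in> B \<and> pfst l < 2)
      \<or> (m = 1 \<and> i = 0 \<and> j = 1 \<and> x \<in> B \<and> y \<in> B \<and> pfst l < 2)
      \<or> (m = 2 \<and> i = p \<and> j = 1 \<and> x \<in> B \<and> pfst l = 1)
      \<or> (m = 3 \<and> i = 0 \<and> j = 1 \<and> x \<in> B \<and> l = enc_pair 1 p)
      \<or> (m = 4 \<and> i = 0 \<and> j = 1 \<and> x \<in> B \<and> pfst l = p \<and> p < 2))"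

text \<open>After a nesting, register \<open>l\<close> depends on its beginning alone: column
  \<open>l\<close> is discarded and replaced by the one entry \<open>(k, l)\<close>. The indices
  below 3 carry auxiliary bits and are protected; a nesting that names one of them writes
  nothing.\<close>

definition wmat :: "nat \<Rightarrow> nat \<Rightarrow> nat \<Rightarrow> (nat \<times> nat) set \<Rightarrow> (nat \<times> nat) set" where
  "wmat K k l E = (if 3 \<le> l \<and> l < K \<and> 3 \<le> k \<and> k < K then {(i, j) \<in> E. j \<noteq> l} \<union> {(k, l)} else E)"

text \<open>The type at a quantifier is the set of types of the body for all choices of the
  quantified set on the given word. Choices on different factors are independent, which is why
  product and nesting act elementwise on these sets.\<close>

fun letc :: "nat \<Rightarrow> core \<Rightarrow> nat \<Rightarrow> nat set \<Rightarrow> nat" where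
  "letc K (At m x y p) l B = enr {(i, j). amat K m x y p l B i j}"
| "letc K (Nand f g) l B = enc_pair (letc K f l B) (letc K g l B)"
| "letc K (Ex X f) l B = set_encode {letc K f l (insert X B), letc K f l (B - {X})}"

fun prodc :: "core \<Rightarrow> nat \<Rightarrow> nat \<Rightarrow> nat" where
  "prodc (At m x y p) a b = enr (der a O der b)"
| "prodc (Nand f g) a b = enc_pair (prodc f (pfst a) (pfst b)) (prodc g (psnd a) (psnd b))"
| "prodc (Ex X f) a b = set_encode ((\<lambda>(u, v). prodc f u v) ` (set_decode a \<times> set_decode b))"

fun wrapc :: "nat \<Rightarrow> core \<Rightarrow> nat \<Rightarrow> nat \<Rightarrow> nat \<Rightarrow> nat" where
  "wrapc K (At m x y p) k l a = enr (wmat K k l (der a))"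
| "wrapc K (Nand f g) k l a = enc_pair (wrapc K f k l (pfst a)) (wrapc K g k l (psnd a))"
| "wrapc K (Ex X f) k l a = set_encode (wrapc K f k l ` set_decode a)"

text \<open>\<open>acc\<close> evaluates a formula on the infinite word of type \<open>a\<close> followed by infinitely many factors of the
  idempotent type \<open>e\<close>.\<close>

fun acc :: "core \<Rightarrow> nat \<Rightarrow> nat \<Rightarrow> bool" where
  "acc (At m x y p) a e \<longleftrightarrow> (0, 1) \<in> der a"
| "acc (Nand f g) a e \<longleftrightarrow> \<not> (acc f (pfst a) (pfst e) \<and> acc g (psnd a) (psnd e))"
| "acc (Ex X f) a e \<longleftrightarrow> (\<exists>x\<in>set_decode a. \<exists>y\<in>set_decode e.
      prodc f x y = x \<and> prodc f y y = y \<and> acc f x y)"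

text \<open>The carrier of the algebra: finite for each formula, and the domain on which
  \<open>one\<close> is neutral.\<close>

fun good :: "nat \<Rightarrow> core \<Rightarrow> nat \<Rightarrow> bool" where
  "good K (At m x y p) a \<longleftrightarrow> der a \<subseteq> {..<K} \<times> {..<K}"
| "good K (Nand f g) a \<longleftrightarrow> good K f (pfst a) \<and> good K g (psnd a)"
| "good K (Ex X f) a \<longleftrightarrow> (\<forall>z\<in>set_decode a. good K f z)"

lemma finite_good: "finite {a. good K \<psi> a}"
proof (induction \<psi>)
  case (At m x y p)
  have "inj_on der {a. good K (At m x y p) a}" by (simp add: inj_on_def der_inject)
  moreover have "der ` {a. good K (At m x y p) a} \<subseteq> Pow ({..<K} \<times> {..<K})" by auto
  ultimately show ?case by (meson finite_Pow_iff finite_SigmaI finite_imageD finite_lessThan finite_subset)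
next
  case (Nand f g)
  have "{a. good K (Nand f g) a} \<subseteq> (\<lambda>(a, b). enc_pair a b) ` ({a. good K f a} \<times> {a. good K g a})"
  proof
    fix a assume "a \<in> {a. good K (Nand f g) a}"
    then show "a \<in> (\<lambda>(a, b). enc_pair a b) ` ({a. good K f a} \<times> {a. good K g a})"
      by (intro image_eqI[of _ _ "(pfst a, psnd a)"]) auto
  qed
  with Nand show ?case by (meson finite_SigmaI finite_imageI finite_subset)
next
  case (Ex X f)
  have "{a. good K (Ex X f) a} \<subseteq> set_encode ` Pow {a. good K f a}"
  proof
    fix a assume "a \<in> {a. good K (Ex X f) a}"
    then show "a \<in> set_encode ` Pow {a. good K f a}"
      by (intro image_eqI[of _ _ "set_decode a"]) auto
  qed
  with Ex show ?case by (meson finite_Pow_iff finite_imageI finite_subset)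
qed

lemma finite_amat [simp]: "finite {(i, j). amat K m x y p l B i j}"
  by (rule finite_subset[of _ "{..<K} \<times> {..<K}"]) (auto simp: amat_def)

lemma finite_wmat [simp]: "finite E \<Longrightarrow> finite (wmat K k l E)"
  unfolding wmat_def by (auto intro: finite_subset[of _ E])

lemma der_letc: "(i, j) \<in> der (letc K (At m x y p) l B) \<longleftrightarrow> amat K m x y p l B i j"
  by (simp only: letc.simps der_enr[OF finite_amat] mem_Collect_eq prod.case)

lemma der_prodc: "der (prodc (At m x y p) a b) = der a O der b"
  by (simp add: finite_relcomp)

lemma der_wrapc: "der (wrapc K (At m x y p) k l a) = wmat K k l (der a)"
  by simp

lemma good_letc: "good K \<psi> (letc K \<psi> l B)"
  by (induction \<psi> arbitrary: B) (auto simp: amat_def)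

lemma good_prodc: "good K \<psi> a \<Longrightarrow> good K \<psi> b \<Longrightarrow> good K \<psi> (prodc \<psi> a b)"
  by (induction \<psi> arbitrary: a b) (auto simp: finite_relcomp subset_iff)

lemma good_wrapc: "good K \<psi> a \<Longrightarrow> good K \<psi> (wrapc K \<psi> k l a)"
proof (induction \<psi> arbitrary: a)
  case (At m x y p)
  have "wmat K k l (der a) \<subseteq> der a \<union> {..<K} \<times> {..<K}" by (auto simp: wmat_def)
  with At show ?case by auto
qed auto

lemma prodc_assoc: "prodc \<psi> (prodc \<psi> a b) c = prodc \<psi> a (prodc \<psi> b c)"
proof (induction \<psi> arbitrary: a b c)
  case (At m x y p) then show ?case by (simp add: finite_relcomp O_assoc)
next
  case (Ex X f) then show ?case
    by (auto simp: image_iff intro!: arg_cong[where f=set_encode]) (metis SigmaI)+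
qed simp

abbreviation nop :: nat where "nop \<equiv> enc_pair 2 0"

text \<open>The unit is realised by an inert letter, so it is itself a generated type once
  \<open>nop < K\<close>.\<close>

definition one :: "nat \<Rightarrow> core \<Rightarrow> nat" where "one K \<psi> = letc K \<psi> nop {}"

text \<open>Every clause of \<open>amat\<close> that looks at the set variables asks for a letter of
  kind 0 or 1. Set quantifiers therefore see creations and actions only.\<close>

lemma letc_dead:
  assumes "2 \<le> pfst l"
  shows "letc K \<psi> l B = letc K \<psi> l {}"
proof (induction \<psi> arbitrary: B)
  case (Ex X f)
  show ?case unfolding letc.simps Ex[of "insert X B"] Ex[of "B - {X}"] Ex[of "insert X {}"] Ex[of "{} - {X}"] ..
next
  case (At m x y p)
  have "amat K m x y p l B = amat K m x y p l {}" using assms by (auto simp: amat_def fun_eq_iff)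
  then show ?case by simp
next
  case (Nand f g) show ?case unfolding letc.simps Nand(1)[of B] Nand(2)[of B] ..
qed

lemma letc_nop: "letc K \<psi> nop B = one K \<psi>"
  unfolding one_def by (rule letc_dead) simp

lemma der_one: "(i, j) \<in> der (one K (At m x y p)) \<longleftrightarrow> i < K \<and> j = i"
proof -
  have "amat K m x y p nop {} i j \<longleftrightarrow> i < K \<and> j = i"
    unfolding amat_def pfst_pair enc_pair_inject empty_iff by simp blast
  then show ?thesis by (simp only: one_def der_letc)
qed

lemma one_Nand [simp]: "one K (Nand f g) = enc_pair (one K f) (one K g)"
  by (simp only: one_def letc.simps)

lemma one_Ex [simp]: "set_decode (one K (Ex X f)) = {one K f}"
proof -
  have "one K (Ex X f) = set_encode {one K f, one K f}"
    unfolding one_def[of K "Ex X f"] letc.simps by (simp only: letc_nop)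
  then show ?thesis by (simp only: set_encode_inverse finite.intros insert_absorb2)
qed

lemma one_prodc: "good K \<psi> a \<Longrightarrow> prodc \<psi> (one K \<psi>) a = a"
proof (induction \<psi> arbitrary: a)
  case (At m x y p)
  have "der (one K (At m x y p)) O der a = der a" using At unfolding relcomp_unfold good.simps by (auto simp: der_one)
  then show ?case by simp
next
  case (Ex X f)
  have "(\<lambda>(u, v). prodc f u v) ` (set_decode (one K (Ex X f)) \<times> set_decode a) = set_decode a"
    using Ex by (auto simp: image_iff)
  then show ?case by simp
qed simp

lemma prodc_one: "good K \<psi> a \<Longrightarrow> prodc \<psi> a (one K \<psi>) = a"
proof (induction \<psi> arbitrary: a)
  case (At m x y p)
  have "der a O der (one K (At m x y p)) = der a" using At unfolding relcomp_unfold good.simps by (auto simp: der_one)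
  then show ?case by simp
next
  case (Ex X f)
  have "(\<lambda>(u, v). prodc f u v) ` (set_decode a \<times> set_decode (one K (Ex X f))) = set_decode a"
    using Ex by (auto simp: image_iff)
  then show ?case by simp
qed simp

text \<open>A nesting on the unwritable register 0 is a mere bracket. It packs a finite word into
  one item of an infinite word.\<close>

lemma wrapc_trivial: "wrapc K \<psi> 0 0 a = a"
  by (induction \<psi> arbitrary: a) (simp_all add: wmat_def)

fun ty1 :: "nat \<Rightarrow> core \<Rightarrow> (nat \<times> nat set) item \<Rightarrow> nat"
  and tyl :: "nat \<Rightarrow> core \<Rightarrow> (nat \<times> nat set) item list \<Rightarrow> nat" where
  "ty1 K \<psi> (Lt c) = letc K \<psi> (fst c) (snd c)"
| "ty1 K \<psi> (Ne k l w) = wrapc K \<psi> k l (tyl K \<psi> w)"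
| "tyl K \<psi> [] = one K \<psi>"
| "tyl K \<psi> (i # w) = prodc \<psi> (ty1 K \<psi> i) (tyl K \<psi> w)"

lemma good_ty: "good K \<psi> (ty1 K \<psi> i)" "good K \<psi> (tyl K \<psi> w)"
  by (induction K \<psi> i and K \<psi> w rule: ty1_tyl.induct)
    (auto simp: good_letc good_wrapc good_prodc one_def)

lemma tyl_append: "tyl K \<psi> (u @ v) = prodc \<psi> (tyl K \<psi> u) (tyl K \<psi> v)"
  by (induction u) (simp_all add: one_prodc good_ty prodc_assoc)

lemma tyl_single: "tyl K \<psi> [i] = ty1 K \<psi> i"
  by (simp add: prodc_one good_ty)

lemma ty1_Nand: "ty1 K (Nand f g) i = enc_pair (ty1 K f i) (ty1 K g i)"
  and tyl_Nand: "tyl K (Nand f g) w = enc_pair (tyl K f w) (tyl K g w)"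
  by (induction K "Nand f g" i and K "Nand f g" w rule: ty1_tyl.induct) simp_all

definition vary :: "nat \<Rightarrow> nat \<times> nat set \<Rightarrow> nat \<times> nat set \<Rightarrow> bool" where
  "vary X c c' \<longleftrightarrow> fst c = fst c' \<and> snd c - {X} = snd c' - {X}"

abbreviation variant :: "nat \<Rightarrow> (nat \<times> nat set) item \<Rightarrow> (nat \<times> nat set) item \<Rightarrow> bool" where
  "variant X \<equiv> rel_item (vary X)"

lemma set_decode_letc_Ex:
  "set_decode (letc K (Ex X f) l B) = {letc K f l B' |B'. B - {X} = B' - {X}}"
proof -
  have "B - {X} = B' - {X} \<longleftrightarrow> B' = insert X B \<or> B' = B - {X}" for B'
    by (cases "X \<in> B'") auto
  then show ?thesis by auto
qed

text \<open>Independence of the choices at different occurrences: the sets computed by the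
  operations of the algebra are exactly the types of the words that differ in \<open>X\<close>
  only.\<close>

lemma ty_Ex:
  "set_decode (ty1 K (Ex X f) i) = {ty1 K f i' |i'. variant X i i'}"
  "set_decode (tyl K (Ex X f) w) = {tyl K f w' |w'. list_all2 (variant X) w w'}"
proof (induction K "Ex X f" i and K "Ex X f" w rule: ty1_tyl.induct)
  case (1 K c)
  have rel: "variant X (Lt c) i' \<longleftrightarrow> (\<exists>B'. i' = Lt (fst c, B') \<and> snd c - {X} = B' - {X})" for i'
  proof (cases i')
    case (Lt c')
    then show ?thesis by (cases c') (simp add: vary_def, blast)
  qed simp
  have "{ty1 K f i' |i'. variant X (Lt c) i'} = {ty1 K f (Lt (fst c, B')) |B'. snd c - {X} = B' - {X}}"
    unfolding rel by blast
  then show ?case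
    by (simp only: ty1.simps(1) set_decode_letc_Ex fst_conv snd_conv)
next
  case (2 K k l w)
  have rel: "variant X (Ne k l w) i' \<longleftrightarrow> (\<exists>w'. i' = Ne k l w' \<and> list_all2 (variant X) w w')" for i'
    by (cases i') auto
  have "{ty1 K f i' |i'. variant X (Ne k l w) i'} = wrapc K f k l ` {tyl K f w' |w'. list_all2 (variant X) w w'}"
    unfolding rel image_def by (auto intro: ty1.simps(2)[symmetric])
  moreover have "set_decode (ty1 K (Ex X f) (Ne k l w)) = wrapc K f k l ` set_decode (tyl K (Ex X f) w)" by simp
  ultimately show ?case by (simp only: 2)
next
  case (3 K) then show ?case by simp
next
  case (4 K i w)
  have rel: "list_all2 (variant X) (i # w) u \<longleftrightarrow>
    (\<exists>i' w'. u = i' # w' \<and> variant X i i' \<and> list_all2 (variant X) w w')" for u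
    by (auto simp: list_all2_Cons1)
  have "{tyl K f u |u. list_all2 (variant X) (i # w) u} = (\<lambda>(u, v). prodc f u v) `
      ({ty1 K f i' |i'. variant X i i'} \<times> {tyl K f w' |w'. list_all2 (variant X) w w'})"
    unfolding rel image_def by (auto 0 4 intro: tyl.simps(2)[symmetric])
  moreover have "set_decode (tyl K (Ex X f) (i # w)) =
    (\<lambda>(u, v). prodc f u v) ` (set_decode (ty1 K (Ex X f) i) \<times> set_decode (tyl K (Ex X f) w))" by simp
  ultimately show ?case by (simp only: 4)
qed

section \<open>Infinite words and their idempotent factorisations\<close>

fun sat :: "nat \<Rightarrow> core \<Rightarrow> (nat \<Rightarrow> (nat \<times> nat set) item) \<Rightarrow> bool" where
  "sat K (At m x y p) W \<longleftrightarrow> (\<exists>n. (0, 1) \<in> der (tyl K (At m x y p) (map W [0..<n])))"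
| "sat K (Nand f g) W \<longleftrightarrow> \<not> (sat K f W \<and> sat K g W)"
| "sat K (Ex X f) W \<longleftrightarrow> (\<exists>W'. (\<forall>n. variant X (W n) (W' n)) \<and> sat K f W')"

lemma ramsey_cuts:
  fixes col :: "nat \<Rightarrow> nat \<Rightarrow> nat"
  assumes "\<And>i j. i < j \<Longrightarrow> col i j < s"
  shows "\<exists>(f :: nat \<Rightarrow> nat) t. strict_mono f \<and> (\<forall>i j. i < j \<longrightarrow> col (f i) (f j) = t)"
proof -
  \<comment> \<open>Ramsey's theorem colours two-element sets; minimum and maximum recover the
    ordered pair.\<close>
  let ?c = "\<lambda>A. col (Min A) (Max A)"
  have "\<forall>x\<in>UNIV. \<forall>y\<in>UNIV. x \<noteq> y \<longrightarrow> ?c {x, y} < s"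
    using assms by (auto simp: min_def max_def)
  from Ramsey2[OF infinite_UNIV_nat this] obtain Y t where Y: "infinite Y"
    and t: "\<forall>x\<in>Y. \<forall>y\<in>Y. x \<noteq> y \<longrightarrow> ?c {x, y} = t" by blast
  have "col (enumerate Y i) (enumerate Y j) = t" if "i < j" for i j
    using t[rule_format, of "enumerate Y i" "enumerate Y j"] enumerate_mono[OF that Y] enumerate_in_set[OF Y]
    by (auto simp: min_def max_def)
  then have "strict_mono (enumerate Y) \<and> (\<forall>i j. i < j \<longrightarrow> col (enumerate Y i) (enumerate Y j) = t)"
    using strict_mono_enumerate[OF Y] by simp
  then show ?thesis by (intro exI[of _ "enumerate Y"] exI[of _ t])
qed

lemma ty_bounded: "\<exists>s. \<forall>w. tyl K \<psi> w < s"
proof -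
  obtain s where "\<forall>a\<in>{a. good K \<psi> a}. a < s"
    using finite_good finite_nat_set_iff_bounded by metis
  then show ?thesis using good_ty by blast
qed

text \<open>No letter or nesting erases the verdict bit, so an atom witnessed by a prefix stays
  witnessed by all longer ones. Together with \<open>a e = a\<close> this lets the type
  \<open>a\<close> of the first factor decide an atom.\<close>

lemma verdict_loop:
  assumes "1 < K"
  shows "(1, 1) \<in> der (ty1 K (At m x y p) i)" "(1, 1) \<in> der (tyl K (At m x y p) w)"
  using assms
proof (induction K "At m x y p" i and K "At m x y p" w rule: ty1_tyl.induct)
  case (1 K c) then show ?case unfolding ty1.simps der_letc by (simp add: amat_def)
next
  case (2 K k l w) then show ?case unfolding ty1.simps der_wrapc by (simp add: wmat_def)
next
  case (3 K) then show ?case unfolding tyl.simps der_one by simp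
next
  case (4 K i w) then show ?case unfolding tyl.simps der_prodc by blast
qed

definition seg :: "(nat \<Rightarrow> 'a) \<Rightarrow> nat \<Rightarrow> nat \<Rightarrow> 'a list" where "seg W m n = map W [m..<n]"

lemma seg_append: "m \<le> n \<Longrightarrow> n \<le> q \<Longrightarrow> seg W m n @ seg W n q = seg W m q"
  unfolding seg_def by (metis le_iff_add map_append upt_add_eq_append)

lemma verdict_mono:
  assumes "1 < K" "(0, 1) \<in> der (tyl K (At m x y p) (seg W 0 n))" "n \<le> q"
  shows "(0, 1) \<in> der (tyl K (At m x y p) (seg W 0 q))"
proof -
  have "tyl K (At m x y p) (seg W 0 q) = prodc (At m x y p) (tyl K (At m x y p) (seg W 0 n)) (tyl K (At m x y p) (seg W n q))"
    by (simp only: tyl_append[symmetric] seg_append[OF le0 assms(3)])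
  then show ?thesis
    using relcompI[OF assms(2) verdict_loop(2)[OF assms(1), of m x y p "seg W n q"]] by (simp only: der_prodc)
qed

lemma tyl_blocks:
  assumes "strict_mono f" "\<And>i. tyl K \<psi> (seg W (f i) (f (Suc i))) = e" "prodc \<psi> e e = e" "i < j"
  shows "tyl K \<psi> (seg W (f i) (f j)) = e"
  using assms(4)
proof (induction j)
  case (Suc j)
  show ?case
  proof (cases "i = j")
    case True then show ?thesis using assms(2) by simp
  next
    case False
    then have "i < j" using Suc.prems by simp
    then have "tyl K \<psi> (seg W (f i) (f j)) = e" by (rule Suc.IH)
    moreover have "f i \<le> f j" "f j \<le> f (Suc j)"
      using assms(1) \<open>i < j\<close> by (simp_all add: strict_mono_less_eq)
    ultimately show ?thesis using assms(2)[of j] assms(3) seg_append[of "f i" "f j" "f (Suc j)" W]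
      by (metis tyl_append)
  qed
qed simp

lemma tyl_prefix:
  assumes "strict_mono f" "\<And>i. tyl K \<psi> (seg W (f i) (f (Suc i))) = e" "prodc \<psi> e e = e"
    "tyl K \<psi> (seg W 0 (f 0)) = a" "prodc \<psi> a e = a"
  shows "tyl K \<psi> (seg W 0 (f j)) = a"
proof (cases "j = 0")
  case False
  then have "tyl K \<psi> (seg W (f 0) (f j)) = e" using tyl_blocks[OF assms(1-3)] by blast
  moreover have "f 0 \<le> f j" using assms(1) by (simp add: strict_mono_less_eq)
  ultimately show ?thesis using assms(4,5) seg_append[of 0 "f 0" "f j" W] by (metis tyl_append zero_le)
qed (use assms in simp)

lemma block_index:
  fixes f :: "nat \<Rightarrow> nat"
  assumes "strict_mono f" "f 0 \<le> n"
  shows "\<exists>!i. f i \<le> n \<and> n < f (Suc i)"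
proof -
  let ?i = "GREATEST i. f i \<le> n"
  have b: "\<forall>i. f i \<le> n \<longrightarrow> i \<le> n" using strict_mono_imp_increasing[OF assms(1)] le_trans by blast
  have "f ?i \<le> n" using GreatestI_nat[of "\<lambda>i. f i \<le> n", OF assms(2) ] b by blast
  moreover have "n < f (Suc ?i)"
    using Greatest_le_nat[of "\<lambda>i. f i \<le> n" "Suc ?i" n] b by (metis not_less not_less_eq_eq order_refl)
  moreover have "i = j" if "f i \<le> n" "n < f (Suc i)" "f j \<le> n" "n < f (Suc j)" for i j
  proof -
    have "i < Suc j" "j < Suc i"
      using that assms(1) by (meson le_less_trans strict_mono_less)+
    then show ?thesis by simp
  qed
  ultimately show ?thesis by blast
qed

text \<open>The blocks between consecutive cuts partition the positions, so variants chosen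
  separately for each block amalgamate into a single variant of the infinite word.\<close>

lemma glue:
  fixes f :: "nat \<Rightarrow> nat"
  assumes f: "strict_mono f" and u: "list_all2 R (seg W 0 (f 0)) u"
    and v: "\<And>i. list_all2 R (seg W (f i) (f (Suc i))) (v i)"
  shows "\<exists>W'. (\<forall>n. R (W n) (W' n)) \<and> seg W' 0 (f 0) = u \<and> (\<forall>i. seg W' (f i) (f (Suc i)) = v i)"
proof -
  define ix where "ix n = (THE i. f i \<le> n \<and> n < f (Suc i))" for n
  have ix: "ix n = i" if "f i \<le> n" "n < f (Suc i)" for n i
  proof -
    have "f 0 \<le> n" using f that(1) by (meson le0 le_trans strict_mono_less_eq)
    from block_index[OF f this] that show ?thesis unfolding ix_def by (intro the1_equality) auto
  qed
  define W' where "W' n = (if n < f 0 then u ! n else v (ix n) ! (n - f (ix n)))" for n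
  have lu: "length u = f 0" using list_all2_lengthD[OF u] by (simp add: seg_def)
  have lv: "length (v i) = f (Suc i) - f i" for i using list_all2_lengthD[OF v[of i]] by (simp add: seg_def)
  have ge: "f 0 \<le> f i" for i using f by (simp add: strict_mono_less_eq)
  have W'v: "W' n = v i ! (n - f i)" if "f i \<le> n" "n < f (Suc i)" for n i
    using ix[OF that] ge[of i] that by (simp add: W'_def)
  have "R (W n) (W' n)" for n
  proof (cases "n < f 0")
    case True
    then show ?thesis using list_all2_nthD[OF u, of n] by (simp add: seg_def W'_def)
  next
    case False
    then obtain i where i: "f i \<le> n" "n < f (Suc i)" using block_index[OF f, of n] by auto
    then show ?thesis using list_all2_nthD[OF v[of i], of "n - f i"] W'v[OF i] by (simp add: seg_def)
  qed
  moreover have "seg W' 0 (f 0) = u"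
    by (rule nth_equalityI) (auto simp: seg_def lu W'_def)
  moreover have "seg W' (f i) (f (Suc i)) = v i" for i
  proof (rule nth_equalityI)
    fix k assume "k < length (seg W' (f i) (f (Suc i)))"
    then have "f i + k < f (Suc i)" by (simp add: seg_def less_diff_conv add.commute)
    then show "seg W' (f i) (f (Suc i)) ! k = v i ! k" using W'v[of i "f i + k"] by (simp add: seg_def)
  qed (simp add: seg_def lv)
  ultimately show ?thesis by blast
qed

lemma seg_list_all2: "(\<And>n. R (W n) (W' n)) \<Longrightarrow> list_all2 R (seg W i j) (seg W' i j)"
  by (simp add: seg_def list_all2_conv_all_nth)

lemma ramsey_seg:
  "\<exists>(h :: nat \<Rightarrow> nat) t. strict_mono h \<and> (\<forall>i j. i < j \<longrightarrow> tyl K \<psi> (seg W (f (h i)) (f (h j))) = t)"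
proof -
  obtain s where s: "\<And>w. tyl K \<psi> w < s" using ty_bounded by blast
  show ?thesis by (rule ramsey_cuts[of "\<lambda>i j. tyl K \<psi> (seg W (f i) (f j))" s]) (rule s)
qed

lemma exists_factorization:
  "\<exists>f a e. strict_mono f \<and> tyl K \<psi> (seg W 0 (f 0)) = a \<and> (\<forall>i. tyl K \<psi> (seg W (f i) (f (Suc i))) = e)
    \<and> prodc \<psi> a e = a \<and> prodc \<psi> e e = e" for W :: "nat \<Rightarrow> (nat \<times> nat set) item"
proof -
  obtain f :: "nat \<Rightarrow> nat" and e where fe: "strict_mono f \<and> (\<forall>i j. i < j \<longrightarrow> tyl K \<psi> (seg W (f i) (f j)) = e)"
    using ramsey_seg[of K \<psi> W "\<lambda>i. i"] by (elim exE) (rule that)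
  then have f: "strict_mono f" and e: "\<And>i j. i < j \<Longrightarrow> tyl K \<psi> (seg W (f i) (f j)) = e" by simp_all
  \<comment> \<open>Moving the first cut by one lets the prefix absorb a block of type
    \<open>e\<close>, which gives \<open>a e = a\<close> by idempotency.\<close>
  let ?g = "\<lambda>i. f (Suc i)"
  have g: "strict_mono ?g" using f by (simp add: strict_mono_def)
  have le: "f i \<le> f j" if "i \<le> j" for i j using f that by (simp add: strict_mono_less_eq)
  have "seg W (f 0) (f 1) @ seg W (f 1) (f 2) = seg W (f 0) (f 2)"
    by (rule seg_append) (auto intro: le)
  then have ee: "prodc \<psi> e e = e" using e[of 0 1] e[of 1 2] e[of 0 2]
    by (metis less_2_cases_iff one_less_numeral_iff semiring_norm(76) tyl_append zero_less_one)
  have "seg W 0 (f 0) @ seg W (f 0) (f 1) = seg W 0 (f 1)"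
    by (rule seg_append) (auto intro: le)
  then have "tyl K \<psi> (seg W 0 (f 1)) = prodc \<psi> (tyl K \<psi> (seg W 0 (f 0))) e" using e[of 0 1]
    by (metis tyl_append zero_less_one)
  then have "prodc \<psi> (tyl K \<psi> (seg W 0 (?g 0))) e = tyl K \<psi> (seg W 0 (?g 0))"
    using ee by (simp add: prodc_assoc)
  with g ee e show ?thesis by (intro exI[of _ ?g] exI) auto
qed

text \<open>The quantifier is the only case with an idea. A satisfying variant need not have
  constant types between the given cuts, so Ramsey's theorem is applied again to the types of the
  body; the coarser cuts keep the types \<open>a\<close> and \<open>e\<close>. Conversely, a variant
  of type \<open>x\<close> of the prefix and variants of type \<open>y\<close> of all blocks are
  glued.\<close>

lemma sat_iff_acc:
  assumes "1 < K" "strict_mono f" "tyl K \<psi> (seg W 0 (f 0)) = a"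
    "\<And>i. tyl K \<psi> (seg W (f i) (f (Suc i))) = e" "prodc \<psi> a e = a" "prodc \<psi> e e = e"
  shows "sat K \<psi> W \<longleftrightarrow> acc \<psi> a e"
  using assms(2-)
proof (induction \<psi> arbitrary: W f a e)
  case (At m x y p)
  have pre: "tyl K (At m x y p) (seg W 0 (f j)) = a" for j
    using tyl_prefix[OF At.prems(1,3,5,2,4)] .
  show ?case
  proof
    assume "sat K (At m x y p) W"
    then obtain n where n: "(0, 1) \<in> der (tyl K (At m x y p) (seg W 0 n))" by (auto simp: seg_def)
    have "n \<le> f n" using strict_mono_imp_increasing[OF At.prems(1)] .
    from verdict_mono[OF assms(1) n this] show "acc (At m x y p) a e" by (simp only: pre acc.simps)
  next
    assume "acc (At m x y p) a e"
    then show "sat K (At m x y p) W" using pre[of 0] by (auto simp: seg_def)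
  qed
next
  case (Nand f1 f2)
  note c = arg_cong[where f=pfst] arg_cong[where f=psnd]
  have "sat K f1 W \<longleftrightarrow> acc f1 (pfst a) (pfst e)"
    by (rule Nand.IH(1)[OF Nand.prems(1)])
      (use c[OF Nand.prems(2)] c[OF Nand.prems(3)] c[OF Nand.prems(4)] c[OF Nand.prems(5)] in
        \<open>simp_all only: tyl_Nand prodc.simps pfst_pair psnd_pair\<close>)
  moreover have "sat K f2 W \<longleftrightarrow> acc f2 (psnd a) (psnd e)"
    by (rule Nand.IH(2)[OF Nand.prems(1)])
      (use c[OF Nand.prems(2)] c[OF Nand.prems(3)] c[OF Nand.prems(4)] c[OF Nand.prems(5)] in
        \<open>simp_all only: tyl_Nand prodc.simps pfst_pair psnd_pair\<close>)
  ultimately show ?case by simp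
next
  case (Ex X g)
  show ?case
  proof
    assume "sat K (Ex X g) W"
    then obtain W' where W': "\<And>n. variant X (W n) (W' n)" "sat K g W'" by auto
    obtain h :: "nat \<Rightarrow> nat" and y
      where hy: "strict_mono h \<and> (\<forall>i j. i < j \<longrightarrow> tyl K g (seg W' (f (h i)) (f (h j))) = y)"
      using ramsey_seg[of K g W' f] by (elim exE) (rule that)
    then have h: "strict_mono h" and y: "\<And>i j. i < j \<Longrightarrow> tyl K g (seg W' (f (h i)) (f (h j))) = y"
      by simp_all
    let ?q = "\<lambda>i. f (h (Suc i))"
    have q: "strict_mono ?q" using h Ex.prems(1) by (simp add: strict_mono_def)
    have le: "f (h i) \<le> f (h j)" if "i \<le> j" for i j
      using h Ex.prems(1) that by (simp add: strict_mono_less_eq)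
    define x where "x = tyl K g (seg W' 0 (?q 0))"
    have "seg W' (f (h 0)) (f (h 1)) @ seg W' (f (h 1)) (f (h 2)) = seg W' (f (h 0)) (f (h 2))"
      by (rule seg_append) (auto intro: le)
    then have yy: "prodc g y y = y" using y[of 0 1] y[of 1 2] y[of 0 2]
      by (metis less_2_cases_iff one_less_numeral_iff semiring_norm(76) tyl_append zero_less_one)
    have "seg W' 0 (f (h 0)) @ seg W' (f (h 0)) (f (h 1)) = seg W' 0 (f (h 1))"
      by (rule seg_append) (auto intro: le)
    then have "x = prodc g (tyl K g (seg W' 0 (f (h 0)))) y"
      unfolding x_def using y[of 0 1] by (metis One_nat_def tyl_append zero_less_one)
    then have xy: "prodc g x y = x" by (simp add: prodc_assoc yy)
    have "tyl K (Ex X g) (seg W 0 (?q 0)) = a"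
      using tyl_prefix[OF Ex.prems(1,3,5,2,4)] .
    then have "x \<in> set_decode a"
      unfolding x_def using ty_Ex(2) seg_list_all2[of "variant X" W W', OF W'(1)] by blast
    moreover have "tyl K (Ex X g) (seg W (f (h 0)) (f (h 1))) = e"
      by (rule tyl_blocks[OF Ex.prems(1,3,5)]) (use h in \<open>simp add: strict_mono_less\<close>)
    then have "y \<in> set_decode e"
      using ty_Ex(2) seg_list_all2[of "variant X" W W', OF W'(1)] y[of 0 1] by fastforce
    moreover have "acc g x y"
      using Ex.IH[OF q _ _ xy yy, of W'] W'(2) y x_def by simp
    ultimately show "acc (Ex X g) a e" using xy yy by auto
  next
    assume "acc (Ex X g) a e"
    then obtain x y where x: "x \<in> set_decode a" and y: "y \<in> set_decode e"
      and xy: "prodc g x y = x" "prodc g y y = y" "acc g x y" by auto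
    from x Ex.prems(2) obtain u where u: "list_all2 (variant X) (seg W 0 (f 0)) u" "x = tyl K g u"
      using ty_Ex(2) by blast
    have "\<exists>v. list_all2 (variant X) (seg W (f i) (f (Suc i))) v \<and> y = tyl K g v" for i
      using y Ex.prems(3)[of i] ty_Ex(2) by blast
    then obtain v where v: "\<And>i. list_all2 (variant X) (seg W (f i) (f (Suc i))) (v i)" "\<And>i. y = tyl K g (v i)"
      by metis
    from glue[OF Ex.prems(1) u(1) v(1)] obtain W' where W': "\<forall>n. variant X (W n) (W' n)"
      "seg W' 0 (f 0) = u" "\<forall>i. seg W' (f i) (f (Suc i)) = v i" by blast
    have "sat K g W'"
      using Ex.IH[OF Ex.prems(1) _ _ xy(1,2), of W'] W' u v xy(3) by metis
    with W'(1) show "sat K (Ex X g) W" by auto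
  qed
qed

subsection \<open>Certificates for computations in the algebra\<close>

text \<open>A judgment \<open>J op g u v w\<close> states, for the formula coded by \<open>g\<close>, that \<open>w\<close> is the result of an operation:
  0 type of a letter, 1 product, 2 nesting, 3 acceptance; 4 states that the type \<open>w\<close> is generated by a
  derivation of height at most \<open>u\<close>. A certificate is a finite set \<open>T\<close> of judgments, each of which follows
  from others in \<open>T\<close>.\<close>

definition J :: "nat \<Rightarrow> nat \<Rightarrow> nat \<Rightarrow> nat \<Rightarrow> nat \<Rightarrow> nat" where
  "J op g u v w = enc_pair op (enc_pair g (enc_pair u (enc_pair v w)))"

text \<open>Tags from 3 on are macros that stand for their expansion by \<open>ex\<close>. Expanding lazily makes the
  translation of a formula computable without recursion on formulas.\<close>

inductive codes :: "(nat \<Rightarrow> nat) \<Rightarrow> nat \<Rightarrow> core \<Rightarrow> bool" for ex where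
  codes_At: "codes ex (enc_pair 0 (enc_pair m (enc_pair x (enc_pair y p)))) (At m x y p)"
| codes_Nand: "codes ex g \<phi> \<Longrightarrow> codes ex h \<psi> \<Longrightarrow> codes ex (enc_pair 1 (enc_pair g h)) (Nand \<phi> \<psi>)"
| codes_Ex: "codes ex g \<psi> \<Longrightarrow> codes ex (enc_pair 2 (enc_pair X g)) (Ex X \<psi>)"
| codes_macro: "3 \<le> pfst g \<Longrightarrow> codes ex (ex g) \<psi> \<Longrightarrow> codes ex g \<psi>"

abbreviation mem :: "nat \<Rightarrow> nat \<Rightarrow> bool" (infix "\<in>\<in>" 50) where "a \<in>\<in> T \<equiv> a \<in> set_decode T"

text \<open>Atoms need no premises: the operations on matrices are verified on the codes by bounded
  quantifiers.\<close>

definition okAt :: "nat \<Rightarrow> nat \<Rightarrow> nat \<Rightarrow> nat \<Rightarrow> nat \<Rightarrow> nat \<Rightarrow> bool" where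
  "okAt K r op u v w \<longleftrightarrow>
    (if op = 0 then
       (\<forall>i<K. \<forall>j<K. enc_pair i j \<in>\<in> w \<longleftrightarrow>
          amat K (pfst r) (pfst (psnd r)) (pfst (psnd (psnd r))) (psnd (psnd (psnd r))) u (set_decode v) i j)
       \<and> (\<forall>z\<in>set_decode w. pfst z < K \<and> psnd z < K)
     else if op = 1 then
       (\<forall>z\<in>set_decode w. \<exists>c\<in>set_decode u. pfst c = pfst z \<and> enc_pair (psnd c) (psnd z) \<in>\<in> v)
       \<and> (\<forall>c\<in>set_decode u. \<forall>d\<in>set_decode v. psnd c = pfst d \<longrightarrow> enc_pair (pfst c) (psnd d) \<in>\<in> w)
     else if op = 2 then
       (if 3 \<le> psnd u \<and> psnd u < K \<and> 3 \<le> pfst u \<and> pfst u < K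
        then (\<forall>z\<in>set_decode w. z \<in>\<in> v \<and> psnd z \<noteq> psnd u \<or> z = u)
          \<and> (\<forall>z\<in>set_decode v. psnd z \<noteq> psnd u \<longrightarrow> z \<in>\<in> w) \<and> u \<in>\<in> w
        else w = v)
     else w = (if enc_pair 0 1 \<in>\<in> u then 1 else 0))"

definition okNand :: "nat \<Rightarrow> nat \<Rightarrow> nat \<Rightarrow> nat \<Rightarrow> nat \<Rightarrow> nat \<Rightarrow> bool" where
  "okNand T r op u v w \<longleftrightarrow>
    (if op = 0 then J 0 (pfst r) u v (pfst w) \<in>\<in> T \<and> J 0 (psnd r) u v (psnd w) \<in>\<in> T
     else if op = 1 then
       J 1 (pfst r) (pfst u) (pfst v) (pfst w) \<in>\<in> T \<and> J 1 (psnd r) (psnd u) (psnd v) (psnd w) \<in>\<in> T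
     else if op = 2 then J 2 (pfst r) u (pfst v) (pfst w) \<in>\<in> T \<and> J 2 (psnd r) u (psnd v) (psnd w) \<in>\<in> T
     else \<exists>a<2. \<exists>b<2. J 3 (pfst r) (pfst u) (pfst v) a \<in>\<in> T \<and> J 3 (psnd r) (psnd u) (psnd v) b \<in>\<in> T
       \<and> w = (if a = 1 \<and> b = 1 then 0 else 1))"

text \<open>The sets with and without \<open>X\<close> are searched below \<open>T\<close>, which
  suffices because they occur in judgments of \<open>T\<close>. A negative verdict must be stated
  positively to keep the rules monotone: each pair is refuted by a product different from the
  required one or by a rejection of the body.\<close>

definition okEx :: "nat \<Rightarrow> nat \<Rightarrow> nat \<Rightarrow> nat \<Rightarrow> nat \<Rightarrow> nat \<Rightarrow> bool" where
  "okEx T r op u v w \<longleftrightarrow>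
    (if op = 0 then
       \<exists>B1<T. \<exists>B0<T.
         (\<forall>z\<in>set_decode B1. z = pfst r \<or> z \<in>\<in> v) \<and> pfst r \<in>\<in> B1 \<and> (\<forall>z\<in>set_decode v. z \<in>\<in> B1)
         \<and> (\<forall>z\<in>set_decode B0. z \<in>\<in> v \<and> z \<noteq> pfst r) \<and> (\<forall>z\<in>set_decode v. z \<noteq> pfst r \<longrightarrow> z \<in>\<in> B0)
         \<and> (\<exists>c1\<in>set_decode w. \<exists>c0\<in>set_decode w. J 0 (psnd r) u B1 c1 \<in>\<in> T \<and> J 0 (psnd r) u B0 c0 \<in>\<in> T
              \<and> (\<forall>z\<in>set_decode w. z = c1 \<or> z = c0))
     else if op = 1 then
       (\<forall>x\<in>set_decode u. \<forall>y\<in>set_decode v. \<exists>z\<in>set_decode w. J 1 (psnd r) x y z \<in>\<in> T)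
       \<and> (\<forall>z\<in>set_decode w. \<exists>x\<in>set_decode u. \<exists>y\<in>set_decode v. J 1 (psnd r) x y z \<in>\<in> T)
     else if op = 2 then
       (\<forall>x\<in>set_decode v. \<exists>z\<in>set_decode w. J 2 (psnd r) u x z \<in>\<in> T)
       \<and> (\<forall>z\<in>set_decode w. \<exists>x\<in>set_decode v. J 2 (psnd r) u x z \<in>\<in> T)
     else
       w = 1 \<and> (\<exists>x\<in>set_decode u. \<exists>y\<in>set_decode v.
         J 1 (psnd r) x y x \<in>\<in> T \<and> J 1 (psnd r) y y y \<in>\<in> T \<and> J 3 (psnd r) x y 1 \<in>\<in> T)
       \<or> w = 0 \<and> (\<forall>x\<in>set_decode u. \<forall>y\<in>set_decode v.
         (\<exists>z<T. z \<noteq> x \<and> J 1 (psnd r) x y z \<in>\<in> T) \<or> (\<exists>z<T. z \<noteq> y \<and> J 1 (psnd r) y y z \<in>\<in> T)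
         \<or> J 3 (psnd r) x y 0 \<in>\<in> T))"

text \<open>Generation is the one operation whose premises concern the same formula and the same
  operation; the strictly decreasing height excludes circular support.\<close>

definition okGen :: "nat \<Rightarrow> nat \<Rightarrow> nat \<Rightarrow> nat \<Rightarrow> nat \<Rightarrow> bool" where
  "okGen K T g u w \<longleftrightarrow> (\<exists>l<K. J 0 g l 0 w \<in>\<in> T)
    \<or> (\<exists>n<u. \<exists>b<T. J 4 g n 0 b \<in>\<in> T \<and>
        ((\<exists>m<u. \<exists>c<T. J 4 g m 0 c \<in>\<in> T \<and> J 1 g b c w \<in>\<in> T)
         \<or> (\<exists>k<K. \<exists>l<K. J 2 g (enc_pair k l) b w \<in>\<in> T)))"

definition okJ :: "(nat \<Rightarrow> nat) \<Rightarrow> nat \<Rightarrow> nat \<Rightarrow> nat \<Rightarrow> nat \<Rightarrow> nat \<Rightarrow> nat \<Rightarrow> nat \<Rightarrow> bool" where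
  "okJ ex K T op g u v w \<longleftrightarrow>
    (if 4 \<le> op then okGen K T g u w
     else if 3 \<le> pfst g then J op (ex g) u v w \<in>\<in> T
     else if pfst g = 0 then okAt K (psnd g) op u v w
     else if pfst g = 1 then okNand T (psnd g) op u v w
     else okEx T (psnd g) op u v w)"

text \<open>Mutual support inside \<open>T\<close> cannot create false judgments: operations 0 to 3
  pass to subformulas or expand a macro, both of which go down in the derivation of
  \<open>codes\<close>, and operation 4 goes down in height.\<close>

definition closed :: "(nat \<Rightarrow> nat) \<Rightarrow> nat \<Rightarrow> nat \<Rightarrow> bool" where
  "closed ex K T \<longleftrightarrow> (\<forall>j\<in>set_decode T. okJ ex K T (pfst j) (pfst (psnd j)) (pfst (psnd (psnd j)))
     (pfst (psnd (psnd (psnd j)))) (psnd (psnd (psnd (psnd j)))))"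

lemma cmp_J: "cmp a \<Longrightarrow> cmp b \<Longrightarrow> cmp c \<Longrightarrow> cmp d \<Longrightarrow> cmp e \<Longrightarrow> cmp (\<lambda>x. J (a x) (b x) (c x) (d x) (e x))"
  unfolding J_def by (intro cmp_intros)

text \<open>Closure rules apply to unary predicates, so the arguments are packed first; arbitrary
  computable arguments are substituted afterwards by composition.\<close>

lemma dec_okAt0: "dec (\<lambda>e. okAt (pfst e) (pfst (psnd e)) (pfst (psnd (psnd e))) (pfst (psnd (psnd (psnd e))))
    (pfst (psnd (psnd (psnd (psnd e))))) (psnd (psnd (psnd (psnd (psnd e))))))"
  unfolding okAt_def amat_def by (intro cmp_intros)

lemma dec_okAt:
  assumes "cmp K" "cmp r" "cmp op" "cmp u" "cmp v" "cmp w"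
  shows "dec (\<lambda>x. okAt (K x) (r x) (op x) (u x) (v x) (w x))"
  using dec_comp[OF dec_okAt0, of "\<lambda>x. enc_pair (K x) (enc_pair (r x) (enc_pair (op x) (enc_pair (u x) (enc_pair (v x) (w x)))))"]
    assms by (simp add: cmp_pair)

lemma dec_okNand0: "dec (\<lambda>e. okNand (pfst e) (pfst (psnd e)) (pfst (psnd (psnd e))) (pfst (psnd (psnd (psnd e))))
    (pfst (psnd (psnd (psnd (psnd e))))) (psnd (psnd (psnd (psnd (psnd e))))))"
  unfolding okNand_def by (intro cmp_intros cmp_J)

lemma dec_okNand:
  assumes "cmp K" "cmp r" "cmp op" "cmp u" "cmp v" "cmp w"
  shows "dec (\<lambda>x. okNand (K x) (r x) (op x) (u x) (v x) (w x))"
  using dec_comp[OF dec_okNand0, of "\<lambda>x. enc_pair (K x) (enc_pair (r x) (enc_pair (op x) (enc_pair (u x) (enc_pair (v x) (w x)))))"]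
    assms by (simp add: cmp_pair)

lemma dec_okEx0: "dec (\<lambda>e. okEx (pfst e) (pfst (psnd e)) (pfst (psnd (psnd e))) (pfst (psnd (psnd (psnd e))))
    (pfst (psnd (psnd (psnd (psnd e))))) (psnd (psnd (psnd (psnd (psnd e))))))"
  unfolding okEx_def by (intro cmp_intros cmp_J)

lemma dec_okEx:
  assumes "cmp K" "cmp r" "cmp op" "cmp u" "cmp v" "cmp w"
  shows "dec (\<lambda>x. okEx (K x) (r x) (op x) (u x) (v x) (w x))"
  using dec_comp[OF dec_okEx0, of "\<lambda>x. enc_pair (K x) (enc_pair (r x) (enc_pair (op x) (enc_pair (u x) (enc_pair (v x) (w x)))))"]
    assms by (simp add: cmp_pair)

lemma dec_okGen0: "dec (\<lambda>e. okGen (pfst e) (pfst (psnd e)) (pfst (psnd (psnd e))) (pfst (psnd (psnd (psnd e))))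
    (psnd (psnd (psnd (psnd e)))))"
  unfolding okGen_def by (intro cmp_intros cmp_J)

lemma dec_okGen:
  assumes "cmp K" "cmp r" "cmp op" "cmp u" "cmp v"
  shows "dec (\<lambda>x. okGen (K x) (r x) (op x) (u x) (v x))"
  using dec_comp[OF dec_okGen0, of "\<lambda>x. enc_pair (K x) (enc_pair (r x) (enc_pair (op x) (enc_pair (u x) (v x))))"]
    assms by (simp add: cmp_pair)

lemma dec_closed:
  assumes ex: "cmp ex"
  shows "cmp k \<Longrightarrow> cmp t \<Longrightarrow> dec (\<lambda>e. closed ex (k e) (t e))"
proof -
  have "dec (\<lambda>e. closed ex (pfst e) (psnd e))"
    unfolding closed_def okJ_def
    by (intro dec_okGen dec_okAt dec_okNand dec_okEx cmp_intros cmp_J cmp_comp[OF ex])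
  from dec_comp[OF this, of "\<lambda>e. enc_pair (k e) (t e)"]
  show "cmp k \<Longrightarrow> cmp t \<Longrightarrow> dec (\<lambda>e. closed ex (k e) (t e))" by (simp add: cmp_pair)
qed

text \<open>The code of a pair bounds its components, so the searches below \<open>T\<close> in the
  rules miss no judgment of \<open>T\<close>.\<close>

lemma J_less:
  assumes "J op g u v w \<in>\<in> T"
  shows "u < T" "v < T" "w < T"
proof -
  have "J op g u v w < T" using set_decode_less[OF assms] .
  moreover have "u \<le> J op g u v w" "v \<le> J op g u v w" "w \<le> J op g u v w"
    unfolding J_def by (meson le_enc_pair le_trans)+
  ultimately show "u < T" "v < T" "w < T" by auto
qed

definition tru :: "nat \<Rightarrow> core \<Rightarrow> nat \<Rightarrow> nat \<Rightarrow> nat \<Rightarrow> nat \<Rightarrow> bool" where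
  "tru K \<psi> op u v w \<longleftrightarrow>
    (if op = 0 then w = letc K \<psi> u (set_decode v)
     else if op = 1 then w = prodc \<psi> u v
     else if op = 2 then w = wrapc K \<psi> (pfst u) (psnd u) v
     else w = of_bool (acc \<psi> u v))"

lemma set_decode_eqI: "(\<And>z. z \<in>\<in> a \<longleftrightarrow> z \<in>\<in> b) \<Longrightarrow> a = b"
  using set_eqI[of "set_decode a" "set_decode b"] by (metis set_decode_inverse)

lemma der_eqI: "(\<And>i j. (i, j) \<in> der a \<longleftrightarrow> (i, j) \<in> der b) \<Longrightarrow> a = b"
  by (metis der_inject subrelI subset_antisym)

lemma okAt_iff:
  assumes "op < 4" and r: "r = enc_pair m (enc_pair x (enc_pair y p))"
  shows "okAt K r op u v w \<longleftrightarrow> tru K (At m x y p) op u v w"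
proof -
  have P: "z \<in>\<in> a \<longleftrightarrow> (pfst z, psnd z) \<in> der a" for z a by (simp add: mem_der)
  consider "op = 0" | "op = 1" | "op = 2" | "op = 3" using assms(1) by linarith
  then show ?thesis
  proof cases
    case 1
    have "okAt K r op u v w \<longleftrightarrow> (\<forall>i j. (i, j) \<in> der w \<longleftrightarrow> amat K m x y p u (set_decode v) i j)"
    proof
      assume "okAt K r op u v w"
      then have a: "\<And>i j. i < K \<Longrightarrow> j < K \<Longrightarrow> enc_pair i j \<in>\<in> w \<longleftrightarrow> amat K m x y p u (set_decode v) i j"
        and b: "\<And>z. z \<in>\<in> w \<Longrightarrow> pfst z < K \<and> psnd z < K"
        unfolding okAt_def 1 r by simp_all
      have "(i, j) \<in> der w \<longleftrightarrow> amat K m x y p u (set_decode v) i j" for i j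
      proof (cases "i < K \<and> j < K")
        case True then show ?thesis using a by (simp add: mem_der)
      next
        case False
        then have "\<not> amat K m x y p u (set_decode v) i j" unfolding amat_def by blast
        moreover have "(i, j) \<notin> der w" using b[of "enc_pair i j"] False by (simp add: mem_der) blast
        ultimately show ?thesis by blast
      qed
      then show "\<forall>i j. (i, j) \<in> der w \<longleftrightarrow> amat K m x y p u (set_decode v) i j" by blast
    next
      assume "\<forall>i j. (i, j) \<in> der w \<longleftrightarrow> amat K m x y p u (set_decode v) i j"
      then show "okAt K r op u v w"
        unfolding okAt_def 1 r by (auto simp: P amat_def)
    qed
    moreover have "w = letc K (At m x y p) u (set_decode v) \<longleftrightarrow>
        (\<forall>i j. (i, j) \<in> der w \<longleftrightarrow> amat K m x y p u (set_decode v) i j)" (is "_ = ?R")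
    proof
      assume ?R then show "w = letc K (At m x y p) u (set_decode v)"
        by (intro der_eqI) (simp only: der_letc)
    qed (simp only: der_letc simp_thms)
    ultimately show ?thesis by (simp only: tru_def 1 simp_thms if_True)
  next
    case 2
    have "w = prodc (At m x y p) u v \<longleftrightarrow> (\<forall>i j. (i, j) \<in> der w \<longleftrightarrow> (i, j) \<in> der u O der v)"
      by (metis (full_types) der_eqI der_prodc)
    also have "\<dots> \<longleftrightarrow> okAt K r op u v w"
    proof
      assume L: "\<forall>i j. (i, j) \<in> der w \<longleftrightarrow> (i, j) \<in> der u O der v"
      have "\<exists>c\<in>set_decode u. pfst c = pfst z \<and> enc_pair (psnd c) (psnd z) \<in>\<in> v" if "z \<in>\<in> w" for z
      proof -
        from that L obtain q where "(pfst z, q) \<in> der u" "(q, psnd z) \<in> der v" by (auto simp: P)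
        then show ?thesis by (intro bexI[of _ "enc_pair (pfst z) q"]) (simp_all add: mem_der)
      qed
      moreover have "enc_pair (pfst c) (psnd d) \<in>\<in> w" if "c \<in>\<in> u" "d \<in>\<in> v" "psnd c = pfst d" for c d
        using that L by (auto simp: P)
      ultimately show "okAt K r op u v w" unfolding okAt_def 2 by simp
    next
      assume "okAt K r op u v w"
      then have a: "\<And>z. z \<in>\<in> w \<Longrightarrow> \<exists>c\<in>set_decode u. pfst c = pfst z \<and> enc_pair (psnd c) (psnd z) \<in>\<in> v"
        and b: "\<And>c d. c \<in>\<in> u \<Longrightarrow> d \<in>\<in> v \<Longrightarrow> psnd c = pfst d \<Longrightarrow> enc_pair (pfst c) (psnd d) \<in>\<in> w"
        unfolding okAt_def 2 by simp_all
      show "\<forall>i j. (i, j) \<in> der w \<longleftrightarrow> (i, j) \<in> der u O der v"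
      proof (intro allI iffI)
        fix i j assume "(i, j) \<in> der w"
        with a[of "enc_pair i j"] obtain c where "c \<in>\<in> u" "pfst c = i" "enc_pair (psnd c) j \<in>\<in> v"
          by (auto simp: mem_der)
        then show "(i, j) \<in> der u O der v" by (auto simp: P mem_der[symmetric])
      next
        fix i j assume "(i, j) \<in> der u O der v"
        then obtain q where "(i, q) \<in> der u" "(q, j) \<in> der v" by auto
        with b[of "enc_pair i q" "enc_pair q j"] show "(i, j) \<in> der w" by (simp add: mem_der)
      qed
    qed
    finally show ?thesis by (simp add: tru_def 2)
  next
    case 3
    have "w = wrapc K (At m x y p) (pfst u) (psnd u) v
        \<longleftrightarrow> (\<forall>i j. (i, j) \<in> der w \<longleftrightarrow> (i, j) \<in> wmat K (pfst u) (psnd u) (der v))"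
      (is "_ = ?R")
    proof
      assume ?R then show "w = wrapc K (At m x y p) (pfst u) (psnd u) v"
        by (intro der_eqI) (simp only: der_wrapc)
    qed (simp only: der_wrapc simp_thms)
    also have "\<dots> \<longleftrightarrow> (\<forall>z. z \<in>\<in> w \<longleftrightarrow> (pfst z, psnd z) \<in> wmat K (pfst u) (psnd u) (der v))"
      (is "?R1 = ?R2")
    proof
      assume ?R1 then show ?R2 by (simp add: P)
    next
      assume R2: ?R2
      show ?R1
      proof (intro allI)
        fix i j show "(i, j) \<in> der w \<longleftrightarrow> (i, j) \<in> wmat K (pfst u) (psnd u) (der v)"
          using R2[rule_format, of "enc_pair i j"] by (simp only: mem_der pfst_pair psnd_pair)
      qed
    qed
    also have "\<dots> \<longleftrightarrow> okAt K r op u v w"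
    proof (cases "3 \<le> psnd u \<and> psnd u < K \<and> 3 \<le> pfst u \<and> pfst u < K")
      case True
      have iff: "(pfst z, psnd z) \<in> wmat K (pfst u) (psnd u) (der v) \<longleftrightarrow> z \<in>\<in> v \<and> psnd z \<noteq> psnd u \<or> z = u" for z
      proof -
        have "z = u \<longleftrightarrow> pfst z = pfst u \<and> psnd z = psnd u" by (metis pair_proj)
        then show ?thesis unfolding wmat_def using True by (simp add: P) blast
      qed
      have ok: "okAt K r 2 u v w \<longleftrightarrow> (\<forall>z\<in>set_decode w. z \<in>\<in> v \<and> psnd z \<noteq> psnd u \<or> z = u)
          \<and> (\<forall>z\<in>set_decode v. psnd z \<noteq> psnd u \<longrightarrow> z \<in>\<in> w) \<and> u \<in>\<in> w"
        using True by (simp add: okAt_def)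
      show ?thesis unfolding iff 3 ok
      proof (intro iffI allI)
        assume "\<forall>z. z \<in>\<in> w \<longleftrightarrow> z \<in>\<in> v \<and> psnd z \<noteq> psnd u \<or> z = u"
        then show "(\<forall>z\<in>set_decode w. z \<in>\<in> v \<and> psnd z \<noteq> psnd u \<or> z = u)
          \<and> (\<forall>z\<in>set_decode v. psnd z \<noteq> psnd u \<longrightarrow> z \<in>\<in> w) \<and> u \<in>\<in> w" by simp
      next
        fix z
        assume a: "(\<forall>z\<in>set_decode w. z \<in>\<in> v \<and> psnd z \<noteq> psnd u \<or> z = u)
          \<and> (\<forall>z\<in>set_decode v. psnd z \<noteq> psnd u \<longrightarrow> z \<in>\<in> w) \<and> u \<in>\<in> w"
        show "z \<in>\<in> v \<and> psnd z \<noteq> psnd u \<or> z = u" if "z \<in>\<in> w" using a that by simp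
        show "z \<in>\<in> w" if "z \<in>\<in> v \<and> psnd z \<noteq> psnd u \<or> z = u" using a that by (elim disjE) simp_all
      qed
    next
      case False
      then have "okAt K r 2 u v w \<longleftrightarrow> w = v" by (auto simp: okAt_def)
      moreover have "wmat K (pfst u) (psnd u) (der v) = der v" using False by (auto simp: wmat_def)
      ultimately show ?thesis unfolding 3 by (simp only: P[symmetric]) (blast intro: set_decode_eqI)
    qed
    finally show ?thesis by (simp add: tru_def 3)
  next
    case 4
    then show ?thesis by (simp add: okAt_def tru_def mem_der)
  qed
qed

lemma okEx_letc_iff:
  "okEx T (enc_pair X f) 0 u v w \<longleftrightarrow> (\<exists>B1 B0 c1 c0. set_decode B1 = insert X (set_decode v)
     \<and> set_decode B0 = set_decode v - {X} \<and> set_decode w = {c1, c0} \<and> J 0 f u B1 c1 \<in>\<in> T \<and> J 0 f u B0 c0 \<in>\<in> T)"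
  (is "_ \<longleftrightarrow> ?R")
proof
  assume "okEx T (enc_pair X f) 0 u v w"
  then obtain B1 B0 c1 c0 where B: "\<forall>z\<in>set_decode B1. z = X \<or> z \<in>\<in> v" "X \<in>\<in> B1" "\<forall>z\<in>set_decode v. z \<in>\<in> B1"
      "\<forall>z\<in>set_decode B0. z \<in>\<in> v \<and> z \<noteq> X" "\<forall>z\<in>set_decode v. z \<noteq> X \<longrightarrow> z \<in>\<in> B0"
      and c: "c1 \<in>\<in> w" "c0 \<in>\<in> w" "\<forall>z\<in>set_decode w. z = c1 \<or> z = c0"
      and j: "J 0 f u B1 c1 \<in>\<in> T" "J 0 f u B0 c0 \<in>\<in> T"
    unfolding okEx_def by auto
  have "set_decode B1 = insert X (set_decode v)" using B(1-3) by blast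
  moreover have "set_decode B0 = set_decode v - {X}" using B(4,5) by blast
  moreover have "set_decode w = {c1, c0}" using c by blast
  ultimately show ?R using j by blast
next
  assume ?R
  then obtain B1 B0 c1 c0 where d: "set_decode B1 = insert X (set_decode v)"
     "set_decode B0 = set_decode v - {X}" "set_decode w = {c1, c0}" and j: "J 0 f u B1 c1 \<in>\<in> T" "J 0 f u B0 c0 \<in>\<in> T"
    by blast
  have lt: "B1 < T" "B0 < T" using J_less j by blast+
  have B: "\<forall>z\<in>set_decode B1. z = X \<or> z \<in>\<in> v" "X \<in>\<in> B1" "\<forall>z\<in>set_decode v. z \<in>\<in> B1"
      "\<forall>z\<in>set_decode B0. z \<in>\<in> v \<and> z \<noteq> X" "\<forall>z\<in>set_decode v. z \<noteq> X \<longrightarrow> z \<in>\<in> B0"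
    unfolding d by blast+
  have c: "\<exists>c1\<in>set_decode w. \<exists>c0\<in>set_decode w. J 0 f u B1 c1 \<in>\<in> T \<and> J 0 f u B0 c0 \<in>\<in> T
              \<and> (\<forall>z\<in>set_decode w. z = c1 \<or> z = c0)"
    unfolding d(3) using j by blast
  show "okEx T (enc_pair X f) 0 u v w"
    unfolding okEx_def if_P[OF refl] pfst_pair psnd_pair
    by (intro exI[of _ B1] exI[of _ B0] conjI lt B c)
qed

lemma closedD:
  "closed ex K T \<Longrightarrow> J op g u v w \<in>\<in> T \<Longrightarrow> okJ ex K T op g u v w"
  unfolding closed_def by (drule bspec, assumption) (simp add: J_def)

text \<open>Induction on how the code denotes its formula, so that a macro costs one step of the
  induction just as a connective does.\<close>

lemma closed_sound:
  assumes "closed ex K T" "codes ex g \<psi>" "J op g u v w \<in>\<in> T" "op < 4"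
  shows "tru K \<psi> op u v w"
  using assms(2-4)
proof (induction arbitrary: op u v w)
  case (codes_At m x y p)
  from closedD[OF assms(1) codes_At(1)] codes_At(2) show ?case
    by (simp add: okJ_def okAt_iff)
next
  case (codes_Nand g \<phi> h \<psi>)
  have ok: "okNand T (enc_pair g h) op u v w"
    using closedD[OF assms(1) codes_Nand.prems(1)] codes_Nand.prems(2) by (simp add: okJ_def)
  note IH = codes_Nand.IH(1)[of 0] codes_Nand.IH(1)[of 1] codes_Nand.IH(1)[of 2] codes_Nand.IH(1)[of 3]
    codes_Nand.IH(2)[of 0] codes_Nand.IH(2)[of 1] codes_Nand.IH(2)[of 2] codes_Nand.IH(2)[of 3]
  note IH' = IH[unfolded tru_def, simplified]
  consider "op = 0" | "op = 1" | "op = 2" | "op = 3" using codes_Nand.prems(2) by linarith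
  then show ?case
  proof cases
    case 1
    with ok IH'(1)[of u v "pfst w"] IH'(5)[of u v "psnd w"] show ?thesis
      by (simp add: okNand_def tru_def) (metis pair_proj)
  next
    case 2
    with ok IH'(2)[of "pfst u" "pfst v" "pfst w"] IH'(6)[of "psnd u" "psnd v" "psnd w"] show ?thesis
      by (simp add: okNand_def tru_def) (metis pair_proj)
  next
    case 3
    with ok IH'(3)[of u "pfst v" "pfst w"] IH'(7)[of u "psnd v" "psnd w"] show ?thesis
      by (simp add: okNand_def tru_def) (metis pair_proj)
  next
    case 4
    with ok obtain a b where ab: "J 3 g (pfst u) (pfst v) a \<in>\<in> T" "J 3 h (psnd u) (psnd v) b \<in>\<in> T"
      "w = (if a = 1 \<and> b = 1 then 0 else 1)" by (auto simp: okNand_def)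
    from IH'(4)[OF ab(1)] IH'(8)[OF ab(2)] ab(3) 4 show ?thesis by (simp add: tru_def)
  qed
next
  case (codes_Ex g \<psi> X)
  have ok: "okEx T (enc_pair X g) op u v w"
    using closedD[OF assms(1) codes_Ex.prems(1)] codes_Ex.prems(2) by (simp add: okJ_def)
  note IH = codes_Ex.IH[of 0, unfolded tru_def, simplified] codes_Ex.IH[of 1, unfolded tru_def, simplified]
    codes_Ex.IH[of 2, unfolded tru_def, simplified] codes_Ex.IH[of 3, unfolded tru_def, simplified]
  consider "op = 0" | "op = 1" | "op = 2" | "op = 3" using codes_Ex.prems(2) by linarith
  then show ?case
  proof cases
    case 1
    then obtain B1 B0 c1 c0 where d: "set_decode B1 = insert X (set_decode v)"
     "set_decode B0 = set_decode v - {X}" "set_decode w = {c1, c0}" and j: "J 0 g u B1 c1 \<in>\<in> T" "J 0 g u B0 c0 \<in>\<in> T"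
      using ok[unfolded 1 okEx_letc_iff] by blast
    have "w = set_encode {c1, c0}" using d(3) by (metis set_decode_inverse)
    then show ?thesis using IH(1)[OF j(1)] IH(1)[OF j(2)] d 1 by (simp only: tru_def letc.simps simp_thms if_True)
  next
    case 2
    with ok have a: "\<And>x y. x \<in>\<in> u \<Longrightarrow> y \<in>\<in> v \<Longrightarrow> prodc \<psi> x y \<in>\<in> w"
      and b: "\<And>z. z \<in>\<in> w \<Longrightarrow> \<exists>x\<in>set_decode u. \<exists>y\<in>set_decode v. z = prodc \<psi> x y"
      unfolding okEx_def by (fastforce dest: IH(2))+
    have "set_decode w = (\<lambda>(x, y). prodc \<psi> x y) ` (set_decode u \<times> set_decode v)"
      using a b by (fastforce simp: image_iff)
    then have "w = prodc (Ex X \<psi>) u v" by (metis prodc.simps(3) set_decode_inverse)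
    then show ?thesis by (simp only: tru_def 2) simp
  next
    case 3
    with ok have a: "\<And>x. x \<in>\<in> v \<Longrightarrow> wrapc K \<psi> (pfst u) (psnd u) x \<in>\<in> w"
      and b: "\<And>z. z \<in>\<in> w \<Longrightarrow> \<exists>x\<in>set_decode v. z = wrapc K \<psi> (pfst u) (psnd u) x"
      unfolding okEx_def by (fastforce dest: IH(3))+
    have "set_decode w = wrapc K \<psi> (pfst u) (psnd u) ` set_decode v"
      using a b by (fastforce simp: image_iff)
    then have "w = wrapc K (Ex X \<psi>) (pfst u) (psnd u) v" by (metis wrapc.simps(3) set_decode_inverse)
    then show ?thesis by (simp only: tru_def 3) simp
  next
    case 4
    with ok consider
      x y where "w = 1" "x \<in>\<in> u" "y \<in>\<in> v" "J 1 g x y x \<in>\<in> T" "J 1 g y y y \<in>\<in> T" "J 3 g x y 1 \<in>\<in> T"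
      | "w = 0" "\<And>x y. x \<in>\<in> u \<Longrightarrow> y \<in>\<in> v \<Longrightarrow> (\<exists>z. z \<noteq> x \<and> J 1 g x y z \<in>\<in> T)
          \<or> (\<exists>z. z \<noteq> y \<and> J 1 g y y z \<in>\<in> T) \<or> J 3 g x y 0 \<in>\<in> T"
      unfolding okEx_def by (simp, blast)
    then show ?thesis
    proof cases
      case 1
      have "x = prodc \<psi> x y" by (rule IH(2)) (use 1(4) in simp)
      moreover have "y = prodc \<psi> y y" by (rule IH(2)) (use 1(5) in simp)
      moreover have "1 = (of_bool (acc \<psi> x y) :: nat)" by (rule IH(4)) (use 1(6) in simp)
      then have "acc \<psi> x y" by (cases "acc \<psi> x y") simp_all
      ultimately have "acc (Ex X \<psi>) u v" using 1(2,3) unfolding acc.simps by metis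
      then show ?thesis using 1 4 by (simp add: tru_def)
    next
      case 2
      have "\<not> acc (Ex X \<psi>) u v"
      proof
        assume "acc (Ex X \<psi>) u v"
        then obtain x y where xy: "x \<in>\<in> u" "y \<in>\<in> v" "prodc \<psi> x y = x" "prodc \<psi> y y = y" "acc \<psi> x y" by auto
        from 2(2)[OF xy(1,2)] show False
          using IH(2)[of x y] IH(2)[of y y] IH(4)[of x y 0] xy(3-) by auto
      qed
      then show ?thesis using 2(1) 4 by (simp add: tru_def)
    qed
  qed
next
  case (codes_macro g \<psi>)
  from closedD[OF assms(1) codes_macro.prems(1)] codes_macro.prems(2) codes_macro.hyps(1)
  have "J op (ex g) u v w \<in>\<in> T" by (simp add: okJ_def)
  then show ?case using codes_macro.IH codes_macro.prems(2) by blast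
qed


definition drv :: "(nat \<Rightarrow> nat) \<Rightarrow> nat \<Rightarrow> nat \<Rightarrow> bool" where
  "drv ex K j \<longleftrightarrow> (\<exists>T. closed ex K T \<and> j \<in>\<in> T)"

lemma set_decode_mono: "set_decode T \<subseteq> set_decode T' \<Longrightarrow> T \<le> T'"
  using sum_mono2[of "set_decode T'" "set_decode T" "\<lambda>i. 2 ^ i"]
  by (metis set_encode_def set_decode_inverse finite_set_decode zero_le)

text \<open>The rules use \<open>T\<close> only to ask for the presence of judgments and to bound
  existential searches. Monotonicity makes unions of closed sets closed, so that derivations can be
  combined.\<close>

lemma okJ_mono:
  assumes "okJ ex K T op g u v w" "set_decode T \<subseteq> set_decode T'"
  shows "okJ ex K T' op g u v w"
proof -
  have le: "\<And>z. z < T \<Longrightarrow> z < T'" using set_decode_mono[OF assms(2)] by simp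
  have m: "\<And>z. z \<in>\<in> T \<Longrightarrow> z \<in>\<in> T'" using assms(2) by blast
  have "okGen K T g u w \<longrightarrow> okGen K T' g u w" unfolding okGen_def using le m by meson
  moreover have "okNand T r op u v w \<longrightarrow> okNand T' r op u v w" for r
    unfolding okNand_def using m by (auto split: if_splits; meson)
  moreover have "okEx T r op u v w \<longrightarrow> okEx T' r op u v w" for r
  proof
    assume ok: "okEx T r op u v w"
    consider "op = 0" | "op = 1" | "op = 2" | "op \<noteq> 0" "op \<noteq> 1" "op \<noteq> 2" by blast
    then show "okEx T' r op u v w"
    proof cases
      case 1
      from ok have "okEx T (enc_pair (pfst r) (psnd r)) 0 u v w" using 1 by simp
      then have "okEx T' (enc_pair (pfst r) (psnd r)) 0 u v w" unfolding okEx_letc_iff using m by blast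
      then show ?thesis using 1 by simp
    next
      case 2 with ok show ?thesis unfolding okEx_def using le m by simp meson
    next
      case 3 with ok show ?thesis unfolding okEx_def using le m by simp meson
    next
      case 4 with ok show ?thesis unfolding okEx_def using le m by simp meson
    qed
  qed
  ultimately show ?thesis using assms(1) m unfolding okJ_def by (auto split: if_splits)
qed

lemma drv_finite:
  assumes "finite F" "\<And>j. j \<in> F \<Longrightarrow> drv ex K j"
  shows "\<exists>T. closed ex K T \<and> F \<subseteq> set_decode T"
  using assms
proof (induction F)
  case empty
  show ?case by (rule exI[of _ 0]) (simp add: closed_def)
next
  case (insert j F)
  then obtain T where T: "closed ex K T" "F \<subseteq> set_decode T" by auto
  from insert.prems obtain T1 where T1: "closed ex K T1" "j \<in>\<in> T1" unfolding drv_def by blast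
  let ?T = "set_encode (set_decode T \<union> set_decode T1)"
  have "set_decode ?T = set_decode T \<union> set_decode T1" by simp
  then have "closed ex K ?T" using T(1) T1(1) unfolding closed_def
    by (metis (no_types, lifting) Un_iff okJ_mono sup_ge1 sup_ge2)
  then show ?case using T T1 by (intro exI[of _ ?T]) auto
qed

text \<open>Derivable premises can be assembled in one closed set; by monotonicity the conclusion
  may be added to it.\<close>

lemma drv_rule:
  assumes "finite F" "\<And>j. j \<in> F \<Longrightarrow> drv ex K j"
    "\<And>T. F \<subseteq> set_decode T \<Longrightarrow> okJ ex K T op g u v w"
  shows "drv ex K (J op g u v w)"
proof -
  obtain T where T: "closed ex K T" "F \<subseteq> set_decode T" using drv_finite[OF assms(1,2)] by blast
  obtain T' where dT: "set_decode T' = insert (J op g u v w) (set_decode T)"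
    by (metis finite_insert finite_set_decode set_encode_inverse)
  then have sub: "set_decode T \<subseteq> set_decode T'" by blast
  have ok: "okJ ex K T' op g u v w" using T(2) dT by (intro assms(3)) blast
  have "closed ex K T'" unfolding closed_def
  proof
    fix j assume "j \<in>\<in> T'"
    then consider "j = J op g u v w" | "j \<in>\<in> T" using dT by blast
    then show "okJ ex K T' (pfst j) (pfst (psnd j)) (pfst (psnd (psnd j)))
     (pfst (psnd (psnd (psnd j)))) (psnd (psnd (psnd (psnd j))))"
    proof cases
      case 1 then show ?thesis using ok by (simp add: J_def)
    next
      case 2 then show ?thesis using T(1) okJ_mono[OF _ sub] unfolding closed_def by blast
    qed
  qed
  then show ?thesis unfolding drv_def using dT by blast
qed

lemma drv_complete:
  assumes "codes ex g \<psi>" "tru K \<psi> op u v w" "op < 4"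
  shows "drv ex K (J op g u v w)"
  using assms
proof (induction arbitrary: op u v w)
  case (codes_At m x y p)
  show ?case by (rule drv_rule[of "{}"]) (use codes_At in \<open>auto simp: okJ_def okAt_iff\<close>)
next
  case (codes_Nand g \<phi> h \<psi>)
  consider "op = 0" | "op = 1" | "op = 2" | "op = 3" using codes_Nand.prems(2) by linarith
  then show ?case
  proof cases
    case 1
    show ?thesis
      by (rule drv_rule[of "{J 0 g u v (pfst w), J 0 h u v (psnd w)}"])
        (use codes_Nand 1 in \<open>auto simp: okJ_def okNand_def tru_def\<close>)
  next
    case 2
    show ?thesis
      by (rule drv_rule[of "{J 1 g (pfst u) (pfst v) (pfst w), J 1 h (psnd u) (psnd v) (psnd w)}"])
        (use codes_Nand 2 in \<open>auto simp: okJ_def okNand_def tru_def\<close>)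
  next
    case 3
    show ?thesis
      by (rule drv_rule[of "{J 2 g u (pfst v) (pfst w), J 2 h u (psnd v) (psnd w)}"])
        (use codes_Nand 3 in \<open>auto simp: okJ_def okNand_def tru_def\<close>)
  next
    case 4
    let ?a = "of_bool (acc \<phi> (pfst u) (pfst v)) :: nat" and ?b = "of_bool (acc \<psi> (psnd u) (psnd v)) :: nat"
    show ?thesis
    proof (rule drv_rule[of "{J 3 g (pfst u) (pfst v) ?a, J 3 h (psnd u) (psnd v) ?b}"])
      show "okJ ex K T op (enc_pair 1 (enc_pair g h)) u v w"
        if "{J 3 g (pfst u) (pfst v) ?a, J 3 h (psnd u) (psnd v) ?b} \<subseteq> set_decode T" for T
      proof -
        have "?a < 2" "?b < 2" by auto
        moreover have "w = (if ?a = 1 \<and> ?b = 1 then 0 else 1)" using codes_Nand.prems(1) 4 by (auto simp: tru_def)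
        moreover have "J 3 g (pfst u) (pfst v) ?a \<in>\<in> T" "J 3 h (psnd u) (psnd v) ?b \<in>\<in> T" using that by blast+
        ultimately have "\<exists>a<2. \<exists>b<2. J 3 g (pfst u) (pfst v) a \<in>\<in> T \<and> J 3 h (psnd u) (psnd v) b \<in>\<in> T
          \<and> w = (if a = 1 \<and> b = 1 then 0 else 1)" by blast
        then have "okNand T (enc_pair g h) op u v w"
          unfolding okNand_def pfst_pair psnd_pair using 4 by simp
        then show ?thesis using 4 by (simp add: okJ_def)
      qed
    qed (use codes_Nand.IH in \<open>auto simp: tru_def\<close>)
  qed
next
  case (codes_Ex g \<psi> X)
  have okI: "okJ ex K T op (enc_pair 2 (enc_pair X g)) u v w" if "okEx T (enc_pair X g) op u v w" for T
    using that codes_Ex.prems(2) by (simp add: okJ_def)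
  consider "op = 0" | "op = 1" | "op = 2" | "op = 3" using codes_Ex.prems(2) by linarith
  then show ?case
  proof cases
    case 1
    let ?B1 = "set_encode (insert X (set_decode v))" and ?B0 = "set_encode (set_decode v - {X})"
    let ?c1 = "letc K \<psi> u (set_decode ?B1)" and ?c0 = "letc K \<psi> u (set_decode ?B0)"
    have d: "set_decode ?B1 = insert X (set_decode v)" "set_decode ?B0 = set_decode v - {X}"
      by (simp_all only: set_encode_inverse finite_set_decode finite_insert finite_Diff)
    have w: "set_decode w = {?c1, ?c0}" using codes_Ex.prems(1) 1
      by (simp only: tru_def if_True letc.simps d) (simp only: set_encode_inverse finite.intros)
    show ?thesis
    proof (rule drv_rule[of "{J 0 g u ?B1 ?c1, J 0 g u ?B0 ?c0}"])
      fix T assume T: "{J 0 g u ?B1 ?c1, J 0 g u ?B0 ?c0} \<subseteq> set_decode T"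
      then have j: "J 0 g u ?B1 ?c1 \<in>\<in> T" "J 0 g u ?B0 ?c0 \<in>\<in> T" by (simp_all only: insert_subset)
      have "okEx T (enc_pair X g) 0 u v w"
        unfolding okEx_letc_iff
        by (intro exI[of _ ?B1] exI[of _ ?B0] exI[of _ ?c1] exI[of _ ?c0] conjI d w j)
      then have "okEx T (enc_pair X g) op u v w" using 1 by simp
      then show "okJ ex K T op (enc_pair 2 (enc_pair X g)) u v w" by (rule okI)
    qed (use codes_Ex.IH in \<open>auto simp: tru_def\<close>)
  next
    case 2
    have w: "set_decode w = (\<lambda>(x, y). prodc \<psi> x y) ` (set_decode u \<times> set_decode v)"
      using codes_Ex.prems(1) 2 by (simp add: tru_def)
    show ?thesis
    proof (rule drv_rule[of "(\<lambda>(x, y). J 1 g x y (prodc \<psi> x y)) ` (set_decode u \<times> set_decode v)"])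
      fix T assume T: "(\<lambda>(x, y). J 1 g x y (prodc \<psi> x y)) ` (set_decode u \<times> set_decode v) \<subseteq> set_decode T"
      have "okEx T (enc_pair X g) op u v w"
        unfolding okEx_def 2 w using T by (auto simp: image_subset_iff)
      then show "okJ ex K T op (enc_pair 2 (enc_pair X g)) u v w" by (rule okI)
    qed (use codes_Ex.IH in \<open>auto simp: tru_def\<close>)
  next
    case 3
    have w: "set_decode w = wrapc K \<psi> (pfst u) (psnd u) ` set_decode v"
      using codes_Ex.prems(1) 3 by (simp add: tru_def)
    show ?thesis
    proof (rule drv_rule[of "(\<lambda>x. J 2 g u x (wrapc K \<psi> (pfst u) (psnd u) x)) ` set_decode v"])
      fix T assume T: "(\<lambda>x. J 2 g u x (wrapc K \<psi> (pfst u) (psnd u) x)) ` set_decode v \<subseteq> set_decode T"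
      have "okEx T (enc_pair X g) op u v w"
        unfolding okEx_def 3 w using T by (auto simp: image_subset_iff)
      then show "okJ ex K T op (enc_pair 2 (enc_pair X g)) u v w" by (rule okI)
    qed (use codes_Ex.IH in \<open>auto simp: tru_def\<close>)
  next
    case 4
    let ?F = "(\<lambda>(x, y). J 1 g x y (prodc \<psi> x y)) ` (set_decode u \<times> set_decode v)
      \<union> (\<lambda>y. J 1 g y y (prodc \<psi> y y)) ` set_decode v
      \<union> (\<lambda>(x, y). J 3 g x y (of_bool (acc \<psi> x y))) ` (set_decode u \<times> set_decode v)"
    show ?thesis
    proof (rule drv_rule[of ?F])
      fix T assume "?F \<subseteq> set_decode T"
      then have T: "J 1 g x y (prodc \<psi> x y) \<in>\<in> T" "J 1 g y y (prodc \<psi> y y) \<in>\<in> T"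
        "J 3 g x y (of_bool (acc \<psi> x y)) \<in>\<in> T" if "x \<in>\<in> u" "y \<in>\<in> v" for x y
        using that by auto
      have "okEx T (enc_pair X g) op u v w"
      proof (cases "acc (Ex X \<psi>) u v")
        case True
        then obtain x y where xy: "x \<in>\<in> u" "y \<in>\<in> v" "prodc \<psi> x y = x" "prodc \<psi> y y = y" "acc \<psi> x y" by auto
        from True have "w = 1" using codes_Ex.prems(1) 4 by (simp add: tru_def)
        moreover have "J 1 g x y x \<in>\<in> T" "J 1 g y y y \<in>\<in> T" "J 3 g x y 1 \<in>\<in> T"
          using T[OF xy(1,2)] xy(3-) by simp_all
        ultimately show ?thesis unfolding okEx_def using 4 xy(1,2) by auto
      next
        case False
        then have "w = 0" using codes_Ex.prems(1) 4 by (simp add: tru_def)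
        moreover have "(\<exists>z<T. z \<noteq> x \<and> J 1 g x y z \<in>\<in> T) \<or> (\<exists>z<T. z \<noteq> y \<and> J 1 g y y z \<in>\<in> T)
          \<or> J 3 g x y 0 \<in>\<in> T" if "x \<in>\<in> u" "y \<in>\<in> v" for x y
        proof -
          have "\<not> (prodc \<psi> x y = x \<and> prodc \<psi> y y = y \<and> acc \<psi> x y)" using False that by auto
          then consider "prodc \<psi> x y \<noteq> x" | "prodc \<psi> y y \<noteq> y" | "\<not> acc \<psi> x y" by argo
          then show ?thesis using T[OF that] J_less(3) by cases (blast, blast, simp)
        qed
        ultimately show ?thesis unfolding okEx_def using 4 by simp
      qed
      then show "okJ ex K T op (enc_pair 2 (enc_pair X g)) u v w" by (rule okI)
    qed (use codes_Ex.IH in \<open>auto simp: tru_def\<close>)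
  qed
next
  case (codes_macro g \<psi>)
  show ?case
    by (rule drv_rule[of "{J op (ex g) u v w}"]) (use codes_macro in \<open>auto simp: okJ_def\<close>)
qed

section \<open>Generated types and certificates for satisfiability\<close>

inductive_set gen :: "nat \<Rightarrow> core \<Rightarrow> nat set" for K \<psi> where
  gen_let: "l < K \<Longrightarrow> letc K \<psi> l {} \<in> gen K \<psi>"
| gen_prod: "a \<in> gen K \<psi> \<Longrightarrow> b \<in> gen K \<psi> \<Longrightarrow> prodc \<psi> a b \<in> gen K \<psi>"
| gen_wrap: "a \<in> gen K \<psi> \<Longrightarrow> k < K \<Longrightarrow> l < K \<Longrightarrow> wrapc K \<psi> k l a \<in> gen K \<psi>"

lemma gen_sound:
  assumes "closed ex K T" "codes ex g \<psi>" "J 4 g n 0 a \<in>\<in> T"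
  shows "a \<in> gen K \<psi>"
  using assms(3)
proof (induction n arbitrary: a rule: less_induct)
  case (less n)
  note snd = closed_sound[OF assms(1,2), unfolded tru_def]
  from closedD[OF assms(1) less.prems] have "okGen K T g n a" by (simp add: okJ_def)
  then consider l where "l < K" "J 0 g l 0 a \<in>\<in> T"
    | k b m c where "k < n" "J 4 g k 0 b \<in>\<in> T" "m < n" "J 4 g m 0 c \<in>\<in> T" "J 1 g b c a \<in>\<in> T"
    | k b i l where "k < n" "J 4 g k 0 b \<in>\<in> T" "i < K" "l < K" "J 2 g (enc_pair i l) b a \<in>\<in> T"
    unfolding okGen_def by blast
  then show ?case
  proof cases
    case 1 then show ?thesis using snd[OF 1(2)] gen_let by simp
  next
    case 2 then show ?thesis using snd[OF 2(5)] gen_prod less.IH by simp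
  next
    case 3 then show ?thesis using snd[OF 3(5)] gen_wrap less.IH by simp
  qed
qed

lemma gen_complete:
  assumes "codes ex g \<psi>" "a \<in> gen K \<psi>"
  shows "\<exists>n. drv ex K (J 4 g n 0 a)"
  using assms(2)
proof induction
  case (gen_let l)
  have "drv ex K (J 0 g l 0 (letc K \<psi> l {}))"
    by (rule drv_complete[OF assms(1)]) (simp_all add: tru_def)
  then have "drv ex K (J 4 g 0 0 (letc K \<psi> l {}))"
    by (intro drv_rule[of "{J 0 g l 0 (letc K \<psi> l {})}"]) (use gen_let in \<open>auto simp: okJ_def okGen_def\<close>)
  then show ?case ..
next
  case (gen_prod a b)
  then obtain n m where nm: "drv ex K (J 4 g n 0 a)" "drv ex K (J 4 g m 0 b)" by blast
  have p: "drv ex K (J 1 g a b (prodc \<psi> a b))"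
    by (rule drv_complete[OF assms(1)]) (simp_all add: tru_def)
  let ?F = "{J 4 g n 0 a, J 4 g m 0 b, J 1 g a b (prodc \<psi> a b)}"
  have "drv ex K (J 4 g (Suc (n + m)) 0 (prodc \<psi> a b))"
  proof (rule drv_rule[of ?F])
    fix T assume "?F \<subseteq> set_decode T"
    then have T: "J 4 g n 0 a \<in>\<in> T" "J 4 g m 0 b \<in>\<in> T" "J 1 g a b (prodc \<psi> a b) \<in>\<in> T" by blast+
    moreover have "a < T" "b < T" "n < Suc (n + m)" "m < Suc (n + m)" using J_less[OF T(1)] J_less[OF T(2)] by simp_all
    ultimately have "okGen K T g (Suc (n + m)) (prodc \<psi> a b)" unfolding okGen_def by blast
    then show "okJ ex K T 4 g (Suc (n + m)) 0 (prodc \<psi> a b)" by (simp add: okJ_def)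
  qed (use nm p in auto)
  then show ?case ..
next
  case (gen_wrap a k l)
  then obtain n where n: "drv ex K (J 4 g n 0 a)" by blast
  have p: "drv ex K (J 2 g (enc_pair k l) a (wrapc K \<psi> k l a))"
    by (rule drv_complete[OF assms(1)]) (simp_all add: tru_def)
  let ?F = "{J 4 g n 0 a, J 2 g (enc_pair k l) a (wrapc K \<psi> k l a)}"
  have "drv ex K (J 4 g (Suc n) 0 (wrapc K \<psi> k l a))"
  proof (rule drv_rule[of ?F])
    fix T assume "?F \<subseteq> set_decode T"
    then have T: "J 4 g n 0 a \<in>\<in> T" "J 2 g (enc_pair k l) a (wrapc K \<psi> k l a) \<in>\<in> T" by blast+
    moreover have "a < T" "n < Suc n" using J_less[OF T(1)] by simp_all
    ultimately have "okGen K T g (Suc n) (wrapc K \<psi> k l a)" unfolding okGen_def using gen_wrap.hyps by blast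
    then show "okJ ex K T 4 g (Suc n) 0 (wrapc K \<psi> k l a)" by (simp add: okJ_def)
  qed (use n p in auto)
  then show ?case ..
qed

definition satisfiable :: "nat \<Rightarrow> core \<Rightarrow> bool" where
  "satisfiable K \<psi> \<longleftrightarrow> (\<exists>a\<in>gen K \<psi>. \<exists>e\<in>gen K \<psi>. prodc \<psi> a e = a \<and> prodc \<psi> e e = e \<and> acc \<psi> a e)"

text \<open>A positive certificate exhibits two generated types with the required equations. A
  negative one exhibits a set \<open>G\<close> that contains the types of the letters and is closed
  under both operations, hence contains \<open>gen\<close>, and refutes every pair in it;
  \<open>G\<close> may well be larger than \<open>gen\<close>.\<close>

definition cert :: "(nat \<Rightarrow> nat) \<Rightarrow> nat \<Rightarrow> nat \<Rightarrow> nat \<Rightarrow> nat \<Rightarrow> nat \<Rightarrow> bool" where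
  "cert ex K g ans T G \<longleftrightarrow> closed ex K T \<and>
    (if ans = 0 then \<exists>a<T. \<exists>e<T. \<exists>n<T. \<exists>m<T. J 4 g n 0 a \<in>\<in> T \<and> J 4 g m 0 e \<in>\<in> T
        \<and> J 1 g a e a \<in>\<in> T \<and> J 1 g e e e \<in>\<in> T \<and> J 3 g a e 1 \<in>\<in> T
     else ans = 1 \<and> (\<forall>l<K. \<exists>a\<in>set_decode G. J 0 g l 0 a \<in>\<in> T)
        \<and> (\<forall>b\<in>set_decode G. \<forall>c\<in>set_decode G. \<exists>a\<in>set_decode G. J 1 g b c a \<in>\<in> T)
        \<and> (\<forall>b\<in>set_decode G. \<forall>k<K. \<forall>l<K. \<exists>a\<in>set_decode G. J 2 g (enc_pair k l) b a \<in>\<in> T)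
        \<and> (\<forall>a\<in>set_decode G. \<forall>e\<in>set_decode G. (\<exists>z<T. z \<noteq> a \<and> J 1 g a e z \<in>\<in> T)
              \<or> (\<exists>z<T. z \<noteq> e \<and> J 1 g e e z \<in>\<in> T) \<or> J 3 g a e 0 \<in>\<in> T))"

lemma cert_sound:
  assumes c: "cert ex K g ans T G" and "codes ex g \<psi>"
  shows "ans = (if satisfiable K \<psi> then 0 else 1)"
proof -
  have cl: "closed ex K T" using c by (simp add: cert_def)
  note snd = closed_sound[OF cl assms(2), unfolded tru_def]
  note snd0 = snd[of 0, simplified] and snd1 = snd[of 1, simplified]
    and snd2 = snd[of 2, simplified] and snd3 = snd[of 3, simplified]
  show ?thesis
  proof (cases "ans = 0")
    case True
    with c obtain a e n m where "J 4 g n 0 a \<in>\<in> T" "J 4 g m 0 e \<in>\<in> T"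
        "J 1 g a e a \<in>\<in> T" "J 1 g e e e \<in>\<in> T" and a: "J 3 g a e 1 \<in>\<in> T" unfolding cert_def by auto
    then have "a \<in> gen K \<psi>" "e \<in> gen K \<psi>" "prodc \<psi> a e = a" "prodc \<psi> e e = e"
      using gen_sound[OF cl assms(2)] snd1[of a e a] snd1[of e e e] by simp_all
    moreover have "acc \<psi> a e" using snd3[OF a] by (simp add: of_bool_def split: if_splits)
    ultimately show ?thesis using True unfolding satisfiable_def by auto
  next
    case False
    have a: "ans = 1"
      and g0: "\<And>l. l < K \<Longrightarrow> \<exists>a\<in>set_decode G. J 0 g l 0 a \<in>\<in> T"
      and g1: "\<And>b c. b \<in>\<in> G \<Longrightarrow> c \<in>\<in> G \<Longrightarrow> \<exists>a\<in>set_decode G. J 1 g b c a \<in>\<in> T"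
      and g2: "\<And>b k l. b \<in>\<in> G \<Longrightarrow> k < K \<Longrightarrow> l < K \<Longrightarrow> \<exists>a\<in>set_decode G. J 2 g (enc_pair k l) b a \<in>\<in> T"
      and g3: "\<And>a e. a \<in>\<in> G \<Longrightarrow> e \<in>\<in> G \<Longrightarrow> (\<exists>z<T. z \<noteq> a \<and> J 1 g a e z \<in>\<in> T)
              \<or> (\<exists>z<T. z \<noteq> e \<and> J 1 g e e z \<in>\<in> T) \<or> J 3 g a e 0 \<in>\<in> T"
      using c False unfolding cert_def by simp_all
    have G: "x \<in>\<in> G" if "x \<in> gen K \<psi>" for x
      using that
    proof induction
      case (gen_let l) then show ?case using g0[of l] snd0 by fastforce
    next
      case (gen_prod a b) then show ?case using g1[of a b] snd1 by fastforce
    next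
      case (gen_wrap a k l) then show ?case using g2[of a k l] snd2 by fastforce
    qed
    have "\<not> satisfiable K \<psi>"
    proof
      assume "satisfiable K \<psi>"
      then obtain a e where ae: "a \<in> gen K \<psi>" "e \<in> gen K \<psi>" "prodc \<psi> a e = a" "prodc \<psi> e e = e" "acc \<psi> a e"
        unfolding satisfiable_def by blast
      from g3[OF G[OF ae(1)] G[OF ae(2)]] show False
        using snd1[of a e] snd1[of e e] snd3[of a e 0] ae(3-) by auto
    qed
    with a show ?thesis by simp
  qed
qed

lemma gen_good: "a \<in> gen K \<psi> \<Longrightarrow> good K \<psi> a"
  by (induction rule: gen.induct) (simp_all add: good_letc good_prodc good_wrapc)

lemma cert_exists:
  assumes "codes ex g \<psi>"
  shows "\<exists>ans T G. cert ex K g ans T G"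
proof (cases "satisfiable K \<psi>")
  case True
  then obtain a e where ae: "a \<in> gen K \<psi>" "e \<in> gen K \<psi>" "prodc \<psi> a e = a" "prodc \<psi> e e = e" "acc \<psi> a e"
    unfolding satisfiable_def by blast
  obtain n m where nm: "drv ex K (J 4 g n 0 a)" "drv ex K (J 4 g m 0 e)"
    using gen_complete[OF assms] ae(1,2) by blast
  let ?F = "{J 4 g n 0 a, J 4 g m 0 e, J 1 g a e a, J 1 g e e e, J 3 g a e 1}"
  have p: "drv ex K (J 1 g a e a)" "drv ex K (J 1 g e e e)" "drv ex K (J 3 g a e 1)"
    by (rule drv_complete[OF assms]; simp add: tru_def ae)+
  obtain T where T: "closed ex K T" "?F \<subseteq> set_decode T" using drv_finite[of ?F ex K] nm p by auto
  then have T': "J 4 g n 0 a \<in>\<in> T" "J 4 g m 0 e \<in>\<in> T" by blast+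
  have "a < T" "e < T" "n < T" "m < T" using J_less[OF T'(1)] J_less[OF T'(2)] by simp_all
  then have "cert ex K g 0 T 0" unfolding cert_def using T by auto
  then show ?thesis by blast
next
  case False
  \<comment> \<open>The generated types themselves, finitely many inside the carrier, serve as the
    closed set of the negative certificate.\<close>
  have fin: "finite (gen K \<psi>)" by (rule finite_subset[OF _ finite_good[of K \<psi>]]) (auto simp: gen_good)
  define G where "G = set_encode (gen K \<psi>)"
  have G: "set_decode G = gen K \<psi>" unfolding G_def using fin by simp
  let ?F = "(\<lambda>l. J 0 g l 0 (letc K \<psi> l {})) ` {..<K}
    \<union> (\<lambda>(a, b). J 1 g a b (prodc \<psi> a b)) ` (gen K \<psi> \<times> gen K \<psi>)
    \<union> (\<lambda>(a, k, l). J 2 g (enc_pair k l) a (wrapc K \<psi> k l a)) ` (gen K \<psi> \<times> {..<K} \<times> {..<K})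
    \<union> (\<lambda>(a, b). J 3 g a b (of_bool (acc \<psi> a b))) ` (gen K \<psi> \<times> gen K \<psi>)"
  have "\<exists>T. closed ex K T \<and> ?F \<subseteq> set_decode T"
    by (rule drv_finite) (use fin in \<open>auto intro!: drv_complete[OF assms] simp: tru_def\<close>)
  then obtain T where T: "closed ex K T" "?F \<subseteq> set_decode T" by blast
  then have F: "\<And>l. l < K \<Longrightarrow> J 0 g l 0 (letc K \<psi> l {}) \<in>\<in> T"
    "\<And>a b. a \<in> gen K \<psi> \<Longrightarrow> b \<in> gen K \<psi> \<Longrightarrow> J 1 g a b (prodc \<psi> a b) \<in>\<in> T"
    "\<And>a k l. a \<in> gen K \<psi> \<Longrightarrow> k < K \<Longrightarrow> l < K \<Longrightarrow> J 2 g (enc_pair k l) a (wrapc K \<psi> k l a) \<in>\<in> T"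
    "\<And>a b. a \<in> gen K \<psi> \<Longrightarrow> b \<in> gen K \<psi> \<Longrightarrow> J 3 g a b (of_bool (acc \<psi> a b)) \<in>\<in> T"
    by (auto simp: image_subset_iff)
  have "(\<exists>z<T. z \<noteq> a \<and> J 1 g a e z \<in>\<in> T) \<or> (\<exists>z<T. z \<noteq> e \<and> J 1 g e e z \<in>\<in> T) \<or> J 3 g a e 0 \<in>\<in> T"
    if ae: "a \<in> gen K \<psi>" "e \<in> gen K \<psi>" for a e
  proof -
    consider "prodc \<psi> a e \<noteq> a" | "prodc \<psi> e e \<noteq> e" | "\<not> acc \<psi> a e"
      using False ae unfolding satisfiable_def by blast
    then show ?thesis
    proof cases
      case 1 then show ?thesis using F(2)[OF ae] J_less(3) by blast
    next
      case 2 then show ?thesis using F(2)[OF ae(2,2)] J_less(3) by blast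
    next
      case 3 then show ?thesis using F(4)[OF ae] by simp
    qed
  qed
  moreover have "\<forall>l<K. \<exists>a\<in>gen K \<psi>. J 0 g l 0 a \<in>\<in> T" using F(1) gen_let by blast
  moreover have "\<forall>b\<in>gen K \<psi>. \<forall>c\<in>gen K \<psi>. \<exists>a\<in>gen K \<psi>. J 1 g b c a \<in>\<in> T" using F(2) gen_prod by blast
  moreover have "\<forall>b\<in>gen K \<psi>. \<forall>k<K. \<forall>l<K. \<exists>a\<in>gen K \<psi>. J 2 g (enc_pair k l) b a \<in>\<in> T"
    using F(3) gen_wrap by blast
  ultimately have "cert ex K g 1 T G" unfolding cert_def G using T(1) by simp
  then show ?thesis by blast
qed

text \<open>The answer for a satisfiable formula is 0 because its models will be counterexamples to
  the model-checking problem.\<close>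

theorem satisfiable_computable:
  assumes "cmp ex" "cmp tp" "cmp kof"
  shows "\<exists>f. \<forall>x \<psi>. codes ex (tp x) \<psi> \<longrightarrow> rf_eval f [x] (if satisfiable (kof x) \<psi> then 0 else 1)"
proof -
  let ?C = "\<lambda>T x. cert ex (kof x) (tp x) (pfst T) (pfst (psnd T)) (psnd (psnd T))"
  have "dec (\<lambda>p. ?C (pfst p) (psnd p))"
    unfolding cert_def
    by (intro dec_closed[OF assms(1)] cmp_intros cmp_J cmp_comp[OF assms(2)] cmp_comp[OF assms(3)])
  from decide_by_certificate[OF this cmp_pfst0] obtain f where
    f: "\<And>x y. (\<exists>T. ?C T x) \<Longrightarrow> (\<forall>T. ?C T x \<longrightarrow> pfst T = y) \<Longrightarrow> rf_eval f [x] y" by blast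
  have "rf_eval f [x] (if satisfiable (kof x) \<psi> then 0 else 1)" if cx: "codes ex (tp x) \<psi>" for x \<psi>
  proof (rule f)
    obtain ans T G where "cert ex (kof x) (tp x) ans T G" using cert_exists[OF cx] by blast
    then show "\<exists>T. ?C T x" by (intro exI[of _ "enc_pair ans (enc_pair T G)"]) simp
    show "\<forall>T. ?C T x \<longrightarrow> pfst T = (if satisfiable (kof x) \<psi> then 0 else 1)"
      using cert_sound[OF _ cx] by blast
  qed
  then show ?thesis by blast
qed


section \<open>Satisfiability over nested words\<close>

fun wfi :: "nat \<Rightarrow> nat item \<Rightarrow> bool" where
  "wfi K (Lt l) \<longleftrightarrow> l < K"
| "wfi K (Ne k l w) \<longleftrightarrow> k < K \<and> l < K \<and> (\<forall>i\<in>set w. wfi K i)"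

abbreviation bare :: "nat item \<Rightarrow> (nat \<times> nat set) item" where
  "bare \<equiv> map_item (\<lambda>l. (l, {}))"

lemma tyl_gen:
  assumes "nop < K" "\<And>i. i \<in> set w \<Longrightarrow> ty1 K \<psi> i \<in> gen K \<psi>"
  shows "tyl K \<psi> w \<in> gen K \<psi>"
  using assms(2)
proof (induction w)
  case Nil
  show ?case using gen_let[OF assms(1)] by (simp add: one_def)
next
  case (Cons i w)
  then show ?case by (simp add: gen_prod)
qed

lemma ty1_gen:
  assumes "nop < K" "wfi K i"
  shows "ty1 K \<psi> (bare i) \<in> gen K \<psi>"
  using assms(2)
proof (induction i)
  case (Lt l) then show ?case by (simp add: gen_let)
next
  case (Ne k l w)
  have "tyl K \<psi> (map bare w) \<in> gen K \<psi>"
    by (rule tyl_gen[OF assms(1)]) (use Ne in auto)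
  then show ?case using Ne.prems by (simp add: gen_wrap)
qed

lemma gen_ty1:
  assumes "0 < K" "a \<in> gen K \<psi>"
  shows "\<exists>i. wfi K i \<and> ty1 K \<psi> (bare i) = a"
  using assms(2)
proof induction
  case (gen_let l) then show ?case by (intro exI[of _ "Lt l"]) simp
next
  case (gen_prod a b)
  then obtain i j where "wfi K i" "ty1 K \<psi> (bare i) = a" "wfi K j" "ty1 K \<psi> (bare j) = b" by blast
  moreover have "prodc \<psi> b (one K \<psi>) = b" by (rule prodc_one[OF gen_good]) (rule gen_prod)
  ultimately show ?case using assms(1)
    by (intro exI[of _ "Ne 0 0 [i, j]"]) (simp add: wrapc_trivial)
next
  case (gen_wrap a k l)
  then obtain i where "wfi K i" "ty1 K \<psi> (bare i) = a" by blast
  moreover have "prodc \<psi> a (one K \<psi>) = a" by (rule prodc_one[OF gen_good]) (rule gen_wrap)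
  ultimately show ?case using gen_wrap by (intro exI[of _ "Ne k l [i]"]) simp
qed

text \<open>Two items realising \<open>a\<close> and \<open>e\<close> give the ultimately periodic
  model \<open>i j j j ...\<close>; conversely, a Ramsey factorisation of any model has generated
  types.\<close>

theorem satisfiable_iff:
  assumes "nop < K"
  shows "satisfiable K \<psi> \<longleftrightarrow> (\<exists>W. (\<forall>n. wfi K (W n)) \<and> sat K \<psi> (\<lambda>n. bare (W n)))"
proof
  have K: "1 < K" "0 < K" using le_enc_pair(1)[of 2 0] assms by simp_all
  assume "satisfiable K \<psi>"
  then obtain a e where ae: "a \<in> gen K \<psi>" "e \<in> gen K \<psi>" "prodc \<psi> a e = a" "prodc \<psi> e e = e" "acc \<psi> a e"
    unfolding satisfiable_def by blast
  obtain i j where ij: "wfi K i" "ty1 K \<psi> (bare i) = a" "wfi K j" "ty1 K \<psi> (bare j) = e"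
    using gen_ty1[OF K(2)] ae(1,2) by metis
  define W where "W n = (if n = 0 then i else j)" for n :: nat
  let ?W = "\<lambda>n. bare (W n)"
  have s: "tyl K \<psi> (seg ?W n (Suc n)) = ty1 K \<psi> (?W n)" for n
    using tyl_single by (simp add: seg_def)
  have "sat K \<psi> ?W \<longleftrightarrow> acc \<psi> a e"
  proof (rule sat_iff_acc[OF K(1), of Suc])
    show "tyl K \<psi> (seg ?W 0 (Suc 0)) = a" unfolding s by (simp add: W_def ij)
    show "tyl K \<psi> (seg ?W (Suc n) (Suc (Suc n))) = e" for n unfolding s by (simp add: W_def ij)
  qed (use ae in \<open>simp_all add: strict_mono_def\<close>)
  then show "\<exists>W. (\<forall>n. wfi K (W n)) \<and> sat K \<psi> (\<lambda>n. bare (W n))"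
    using ae(5) ij by (intro exI[of _ W]) (simp add: W_def)
next
  have K: "1 < K" using le_enc_pair(1)[of 2 0] assms by simp
  assume "\<exists>W. (\<forall>n. wfi K (W n)) \<and> sat K \<psi> (\<lambda>n. bare (W n))"
  then obtain W where W: "\<And>n. wfi K (W n)" "sat K \<psi> (\<lambda>n. bare (W n))" by blast
  let ?W = "\<lambda>n. bare (W n)"
  obtain f a e where f: "strict_mono f" "tyl K \<psi> (seg ?W 0 (f 0)) = a"
    "\<And>i. tyl K \<psi> (seg ?W (f i) (f (Suc i))) = e" "prodc \<psi> a e = a" "prodc \<psi> e e = e"
    using exists_factorization[of K \<psi> ?W] by blast
  have "tyl K \<psi> (seg ?W i j) \<in> gen K \<psi>" for i j
    by (rule tyl_gen[OF assms]) (use ty1_gen[OF assms W(1)] in \<open>auto simp: seg_def\<close>)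
  then have "a \<in> gen K \<psi>" "e \<in> gen K \<psi>" using f(2) f(3)[of 0] by metis+
  moreover have "acc \<psi> a e" using sat_iff_acc[OF K f] W(2) by blast
  ultimately show "satisfiable K \<psi>" unfolding satisfiable_def using f(4,5) by blast
qed

subsection \<open>Words with identifiers\<close>

fun ids1 :: "(nat \<times> nat) item \<Rightarrow> nat list" and idsl :: "(nat \<times> nat) item list \<Rightarrow> nat list" where
  "ids1 (Lt c) = [snd c]"
| "ids1 (Ne k l w) = idsl w"
| "idsl [] = []"
| "idsl (i # w) = ids1 i @ idsl w"

fun ex1 :: "nat \<Rightarrow> (nat \<times> nat) item \<Rightarrow> (nat \<Rightarrow> nat) \<Rightarrow> nat \<Rightarrow> nat"
  and exl :: "nat \<Rightarrow> (nat \<times> nat) item list \<Rightarrow> (nat \<Rightarrow> nat) \<Rightarrow> nat \<Rightarrow> nat" where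
  "ex1 K (Lt c) r = (if pfst (fst c) = 0 \<and> 3 \<le> psnd (fst c) then r(psnd (fst c) := snd c) else r)"
| "ex1 K (Ne k l w) r = (if 3 \<le> l \<and> l < K \<and> 3 \<le> k \<and> k < K then (exl K w r)(l := r k) else exl K w r)"
| "exl K [] r = r"
| "exl K (i # w) r = exl K w (ex1 K i r)"

text \<open>The occurrences of letters in order of execution, each with its identifier and the register
  contents at that point.\<close>

fun oc1 :: "nat \<Rightarrow> (nat \<times> nat) item \<Rightarrow> (nat \<Rightarrow> nat) \<Rightarrow> (nat \<times> nat \<times> (nat \<Rightarrow> nat)) list"
  and ocl :: "nat \<Rightarrow> (nat \<times> nat) item list \<Rightarrow> (nat \<Rightarrow> nat) \<Rightarrow> (nat \<times> nat \<times> (nat \<Rightarrow> nat)) list" where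
  "oc1 K (Lt c) r = [(fst c, snd c, r)]"
| "oc1 K (Ne k l w) r = ocl K w r"
| "ocl K [] r = []"
| "ocl K (i # w) r = oc1 K i r @ ocl K w (ex1 K i r)"

lemma oc_ids: "map (\<lambda>c. fst (snd c)) (oc1 K i r) = ids1 i" "map (\<lambda>c. fst (snd c)) (ocl K w r) = idsl w"
  by (induction K i r and K w r rule: oc1_ocl.induct) simp_all

lemma exl_append: "exl K (u @ v) r = exl K v (exl K u r)"
  by (induction u arbitrary: r) simp_all

lemma ocl_append: "ocl K (u @ v) r = ocl K u r @ ocl K v (exl K u r)"
  by (induction u arbitrary: r) simp_all

lemma idsl_append: "idsl (u @ v) = idsl u @ idsl v"
  by (induction u) simp_all

definition ann :: "(nat \<Rightarrow> nat set) \<Rightarrow> (nat \<times> nat) item \<Rightarrow> (nat \<times> nat set) item" where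
  "ann \<beta> = map_item (\<lambda>c. (fst c, {v. snd c \<in> \<beta> v}))"

lemma ann_simps [simp]:
  "ann \<beta> (Lt c) = Lt (fst c, {v. snd c \<in> \<beta> v})"
  "ann \<beta> (Ne k l w) = Ne k l (map (ann \<beta>) w)"
  by (simp_all add: ann_def)

definition hit :: "nat set \<Rightarrow> (nat \<times> nat \<times> (nat \<Rightarrow> nat)) \<Rightarrow> bool" where
  "hit S q \<longleftrightarrow> fst (snd q) \<in> S \<and> pfst (fst q) < 2"

definition local_test :: "nat \<Rightarrow> nat set \<Rightarrow> nat set \<Rightarrow> nat \<Rightarrow> (nat \<times> nat \<times> (nat \<Rightarrow> nat)) \<Rightarrow> bool" where
  "local_test m X Y p q \<longleftrightarrow>
     (m = 1 \<and> hit X q \<and> hit Y q)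
     \<or> (m = 2 \<and> hit X q \<and> pfst (fst q) = 1 \<and> snd (snd q) p \<in> Y)
     \<or> (m = 3 \<and> hit X q \<and> fst q = enc_pair 1 p)
     \<or> (m = 4 \<and> hit X q \<and> pfst (fst q) = p)"

text \<open>The verdict of an atom as a scan with one bit of memory: \<open>s\<close> records that
  \<open>x\<close> has been met, which only the order atom consults.\<close>

fun tst :: "nat \<Rightarrow> nat set \<Rightarrow> nat set \<Rightarrow> nat \<Rightarrow> bool \<Rightarrow> (nat \<times> nat \<times> (nat \<Rightarrow> nat)) list \<Rightarrow> bool" where
  "tst m X Y p s [] \<longleftrightarrow> False"
| "tst m X Y p s (q # L) \<longleftrightarrow> (m = 0 \<and> s \<and> hit Y q) \<or> local_test m X Y p q \<or> tst m X Y p (s \<or> hit X q) L"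

lemma tst_append:
  "tst m X Y p s (L @ M) \<longleftrightarrow> tst m X Y p s L \<or> tst m X Y p (s \<or> (\<exists>q\<in>set L. hit X q)) M"
proof (induction L arbitrary: s)
  case (Cons q L)
  have "(s \<or> hit X q) \<or> (\<exists>q\<in>set L. hit X q) \<longleftrightarrow> s \<or> (\<exists>q\<in>set (q # L). hit X q)" by auto
  with Cons show ?case by (simp only: append_Cons tst.simps) blast
qed simp

lemma tst_local: "m \<noteq> 0 \<Longrightarrow> tst m X Y p s L \<longleftrightarrow> (\<exists>q\<in>set L. local_test m X Y p q)"
  by (induction L arbitrary: s) auto

lemma tst_order:
  assumes "sorted_wrt (<) (map (\<lambda>q. fst (snd q)) L)"
  shows "tst 0 X Y p s L \<longleftrightarrow> (s \<and> (\<exists>q\<in>set L. hit Y q))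
     \<or> (\<exists>q\<in>set L. \<exists>q'\<in>set L. hit X q \<and> hit Y q' \<and> fst (snd q) < fst (snd q'))"
  using assms
proof (induction L arbitrary: s)
  case (Cons q L)
  have lt: "fst (snd q) < fst (snd q')" if "q' \<in> set L" for q' using Cons.prems that by auto
  have nl: "\<not> local_test 0 X Y p q" by (simp add: local_test_def)
  have "tst 0 X Y p s (q # L) \<longleftrightarrow> (s \<and> hit Y q) \<or> ((s \<or> hit X q) \<and> (\<exists>q\<in>set L. hit Y q))
     \<or> (\<exists>q\<in>set L. \<exists>q'\<in>set L. hit X q \<and> hit Y q' \<and> fst (snd q) < fst (snd q'))"
    using Cons nl by simp
  moreover have "(\<exists>a\<in>set (q # L). \<exists>b\<in>set (q # L). hit X a \<and> hit Y b \<and> fst (snd a) < fst (snd b))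
     \<longleftrightarrow> (hit X q \<and> (\<exists>q\<in>set L. hit Y q))
     \<or> (\<exists>q\<in>set L. \<exists>q'\<in>set L. hit X q \<and> hit Y q' \<and> fst (snd q) < fst (snd q'))"
  proof -
    have "\<not> fst (snd a) < fst (snd q)" if "a \<in> set (q # L)" for a using lt that by fastforce
    then show ?thesis using lt by (simp only: list.set bex_simps insert_iff) blast
  qed
  ultimately show ?case by auto
qed simp

text \<open>\<open>S\<close> is the set of bits that are true at the present point: the constant,
  the verdict \<open>v\<close>, the memory \<open>s\<close>, and for each register whether it holds
  an element of \<open>Y\<close>. A type acts on it by relational image.\<close>

definition inv :: "nat \<Rightarrow> nat \<Rightarrow> nat set \<Rightarrow> nat set \<Rightarrow> (nat \<Rightarrow> nat) \<Rightarrow> bool \<Rightarrow> bool \<Rightarrow> bool" where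
  "inv K m Y S r s v \<longleftrightarrow> 0 \<in> S \<and> (1 \<in> S \<longleftrightarrow> v) \<and> (m = 0 \<longrightarrow> (2 \<in> S \<longleftrightarrow> s))
     \<and> (\<forall>q. 3 \<le> q \<and> q < K \<longrightarrow> (q \<in> S \<longleftrightarrow> r q \<in> Y))"

lemma inv_letter:
  assumes K: "3 < K" and i: "inv K m (\<beta> y) S r s v" and p: "m = 2 \<longrightarrow> 3 \<le> p \<and> p < K"
    and p4: "m = 4 \<longrightarrow> p < 2"
  shows "inv K m (\<beta> y) (der (ty1 K (At m x y p) (ann \<beta> (Lt (l, n)))) `` S) (ex1 K (Lt (l, n)) r)
     (s \<or> hit (\<beta> x) (l, n, r)) (v \<or> (m = 0 \<and> s \<and> hit (\<beta> y) (l, n, r)) \<or> local_test m (\<beta> x) (\<beta> y) p (l, n, r))"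
proof -
  let ?B = "{v. n \<in> \<beta> v}"
  have im: "j \<in> der (ty1 K (At m x y p) (ann \<beta> (Lt (l, n)))) `` S \<longleftrightarrow> (\<exists>i\<in>S. amat K m x y p l ?B i j)" for j
    by (simp only: Image_iff ann_simps ty1.simps der_letc fst_conv snd_conv)
  have S: "0 \<in> S" "1 \<in> S \<longleftrightarrow> v" "m = 0 \<Longrightarrow> 2 \<in> S \<longleftrightarrow> s" "\<And>q. 3 \<le> q \<Longrightarrow> q < K \<Longrightarrow> q \<in> S \<longleftrightarrow> r q \<in> \<beta> y"
    using i by (auto simp: inv_def)
  have "amat K m x y p l ?B 0 0" using K by (simp add: amat_def)
  then have j0: "\<exists>i\<in>S. amat K m x y p l ?B i 0" using S(1) by blast
  have e1: "amat K m x y p l ?B i 1 \<longleftrightarrow> i < K \<and> (i = 1 \<or> (m = 0 \<and> i = 2 \<and> hit (\<beta> y) (l, n, r))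
      \<or> (m = 1 \<and> i = 0 \<and> hit (\<beta> x) (l, n, r) \<and> hit (\<beta> y) (l, n, r))
      \<or> (m = 2 \<and> i = p \<and> hit (\<beta> x) (l, n, r) \<and> pfst l = 1)
      \<or> (m = 3 \<and> i = 0 \<and> hit (\<beta> x) (l, n, r) \<and> l = enc_pair 1 p)
      \<or> (m = 4 \<and> i = 0 \<and> hit (\<beta> x) (l, n, r) \<and> pfst l = p))" for i
  proof -
    have eq: "amat K m x y p l ?B i 1 \<longleftrightarrow> i < K \<and> (i = 1 \<or> (m = 0 \<and> i = 2 \<and> n \<in> \<beta> y \<and> pfst l < 2)
      \<or> (m = 1 \<and> i = 0 \<and> n \<in> \<beta> x \<and> n \<in> \<beta> y \<and> pfst l < 2)
      \<or> (m = 2 \<and> i = p \<and> n \<in> \<beta> x \<and> pfst l = 1)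
      \<or> (m = 3 \<and> i = 0 \<and> n \<in> \<beta> x \<and> l = enc_pair 1 p)
      \<or> (m = 4 \<and> i = 0 \<and> n \<in> \<beta> x \<and> pfst l = p \<and> p < 2))"
      unfolding amat_def mem_Collect_eq using K by (cases "i = 1"; simp)
    have a1: "m = 1 \<and> i = 0 \<and> n \<in> \<beta> x \<and> n \<in> \<beta> y \<and> pfst l < 2 \<longleftrightarrow>
        m = 1 \<and> i = 0 \<and> (n \<in> \<beta> x \<and> pfst l < 2) \<and> n \<in> \<beta> y \<and> pfst l < 2" by blast
    have a2: "m = 2 \<and> i = p \<and> n \<in> \<beta> x \<and> pfst l = 1 \<longleftrightarrow>
        m = 2 \<and> i = p \<and> (n \<in> \<beta> x \<and> pfst l < 2) \<and> pfst l = 1" by auto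
    have a3: "m = 3 \<and> i = 0 \<and> n \<in> \<beta> x \<and> l = enc_pair 1 p \<longleftrightarrow>
        m = 3 \<and> i = 0 \<and> (n \<in> \<beta> x \<and> pfst l < 2) \<and> l = enc_pair 1 p" by auto
    have a4: "m = 4 \<and> i = 0 \<and> n \<in> \<beta> x \<and> pfst l = p \<and> p < 2 \<longleftrightarrow>
        m = 4 \<and> i = 0 \<and> (n \<in> \<beta> x \<and> pfst l < 2) \<and> pfst l = p"
      using p4 by auto
    show ?thesis by (simp only: eq a1 a2 a3 a4 hit_def fst_conv snd_conv)
  qed
  have j1: "(\<exists>i\<in>S. amat K m x y p l ?B i 1) \<longleftrightarrow>
     (v \<or> (m = 0 \<and> s \<and> hit (\<beta> y) (l, n, r)) \<or> local_test m (\<beta> x) (\<beta> y) p (l, n, r))"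
  proof -
    have eq: "(\<exists>i\<in>S. amat K m x y p l ?B i 1) \<longleftrightarrow> 1 \<in> S \<or> (m = 0 \<and> 2 \<in> S \<and> hit (\<beta> y) (l, n, r))
      \<or> (m = 1 \<and> 0 \<in> S \<and> hit (\<beta> x) (l, n, r) \<and> hit (\<beta> y) (l, n, r))
      \<or> (m = 2 \<and> p \<in> S \<and> hit (\<beta> x) (l, n, r) \<and> pfst l = 1)
      \<or> (m = 3 \<and> 0 \<in> S \<and> hit (\<beta> x) (l, n, r) \<and> l = enc_pair 1 p)
      \<or> (m = 4 \<and> 0 \<in> S \<and> hit (\<beta> x) (l, n, r) \<and> pfst l = p)"
      (is "_ \<longleftrightarrow> ?R")
    proof
      assume "\<exists>i\<in>S. amat K m x y p l ?B i 1"
      then show ?R unfolding e1 by (elim bexE conjE disjE) simp_all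
    next
      assume ?R
      then show "\<exists>i\<in>S. amat K m x y p l ?B i 1"
        unfolding e1 using K p by (elim disjE conjE) (rule bexI[rotated], assumption, simp)+
    qed
    have b: "0 \<in> S \<longleftrightarrow> True" "m = 0 \<and> 2 \<in> S \<and> hit (\<beta> y) (l, n, r) \<longleftrightarrow> m = 0 \<and> s \<and> hit (\<beta> y) (l, n, r)"
      "m = 2 \<and> p \<in> S \<and> hit (\<beta> x) (l, n, r) \<and> pfst l = 1 \<longleftrightarrow>
        m = 2 \<and> hit (\<beta> x) (l, n, r) \<and> pfst l = 1 \<and> r p \<in> \<beta> y"
      using S p by auto
    show ?thesis unfolding eq S(2) b local_test_def fst_conv snd_conv simp_thms ..
  qed
  have j2: "(\<exists>i\<in>S. amat K m x y p l ?B i 2) \<longleftrightarrow> (s \<or> hit (\<beta> x) (l, n, r))" if m: "m = 0"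
  proof -
    have eq: "amat K m x y p l ?B i 2 \<longleftrightarrow> i = 2 \<or> (i = 0 \<and> hit (\<beta> x) (l, n, r))" for i
      using K m unfolding amat_def hit_def by auto
    show ?thesis unfolding eq using S(1) S(3)[OF m] by auto
  qed
  have jq: "(\<exists>i\<in>S. amat K m x y p l ?B i q) \<longleftrightarrow> ex1 K (Lt (l, n)) r q \<in> \<beta> y" if q: "3 \<le> q" "q < K" for q
  proof -
    have l: "l = enc_pair 0 q \<longleftrightarrow> pfst l = 0 \<and> psnd l = q" by (metis pair_proj pfst_pair psnd_pair)
    have "amat K m x y p l ?B i q \<longleftrightarrow> (if l = enc_pair 0 q then i = 0 \<and> n \<in> \<beta> y else i = q)" for i
      using K q unfolding amat_def by auto
    then have "(\<exists>i\<in>S. amat K m x y p l ?B i q) \<longleftrightarrow> (if l = enc_pair 0 q then n \<in> \<beta> y else q \<in> S)"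
      using S(1) by auto
    then show ?thesis using S(4)[OF q] q by (auto simp: l)
  qed
  show ?thesis unfolding inv_def im using j0 j1 j2 jq by blast
qed

text \<open>Images compose along products, and the column written by a nesting transports the bit of
  register \<open>k\<close> from the beginning of the nesting, just as \<open>ex1\<close> transports
  its content.\<close>

lemma inv_run:
  assumes K: "3 < K" and p: "m = 2 \<longrightarrow> 3 \<le> p \<and> p < K" and p4: "m = 4 \<longrightarrow> p < 2"
  shows "inv K m (\<beta> y) S r s v \<Longrightarrow>
      inv K m (\<beta> y) (der (ty1 K (At m x y p) (ann \<beta> i)) `` S) (ex1 K i r)
        (s \<or> (\<exists>q\<in>set (oc1 K i r). hit (\<beta> x) q)) (v \<or> tst m (\<beta> x) (\<beta> y) p s (oc1 K i r))"
    "inv K m (\<beta> y) S r s v \<Longrightarrow>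
      inv K m (\<beta> y) (der (tyl K (At m x y p) (map (ann \<beta>) w)) `` S) (exl K w r)
        (s \<or> (\<exists>q\<in>set (ocl K w r). hit (\<beta> x) q)) (v \<or> tst m (\<beta> x) (\<beta> y) p s (ocl K w r))"
  using K p
proof (induction K i r and K w r arbitrary: S s v and S s v rule: oc1_ocl.induct)
  case (1 K c r)
  then show ?case using inv_letter[where \<beta>=\<beta> and y=y and l="fst c" and n="snd c", OF 1(2,1,3) p4] by simp
next
  case (2 K k l w r)
  let ?E = "der (tyl K (At m x y p) (map (ann \<beta>) w))"
  have IH: "inv K m (\<beta> y) (?E `` S) (exl K w r)
        (s \<or> (\<exists>q\<in>set (ocl K w r). hit (\<beta> x) q)) (v \<or> tst m (\<beta> x) (\<beta> y) p s (ocl K w r))"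
    by (rule 2(1)[OF 2(2-4)])
  show ?case
  proof (cases "3 \<le> l \<and> l < K \<and> 3 \<le> k \<and> k < K")
    case True
    have im: "j \<in> wmat K k l ?E `` S \<longleftrightarrow> (if j = l then k \<in> S else j \<in> ?E `` S)" for j
      using True by (auto simp: wmat_def Image_iff)
    have k: "k \<in> S \<longleftrightarrow> r k \<in> \<beta> y" using 2(2) True by (auto simp: inv_def)
    have "l \<noteq> 0" "l \<noteq> 1" "l \<noteq> 2" using True by auto
    then show ?thesis using IH True k unfolding inv_def ann_simps ty1.simps der_wrapc im ex1.simps oc1.simps
      by simp
  next
    case False
    then have "wmat K k l ?E = ?E" unfolding wmat_def by auto
    then show ?thesis using IH False unfolding ann_simps ty1.simps der_wrapc ex1.simps oc1.simps by auto
  qed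
next
  case (3 K r)
  have "der (one K (At m x y p)) `` S = S \<inter> {..<K}" by (auto simp: der_one Image_iff)
  then show ?case using 3 by (auto simp: inv_def)
next
  case (4 K i w r)
  have "inv K m (\<beta> y) (der (ty1 K (At m x y p) (ann \<beta> i)) `` S) (ex1 K i r)
        (s \<or> (\<exists>q\<in>set (oc1 K i r). hit (\<beta> x) q)) (v \<or> tst m (\<beta> x) (\<beta> y) p s (oc1 K i r))"
    by (rule 4(1)[OF 4(3-5)])
  from 4(2)[OF this 4(4,5)]
  show ?case
    by (simp add: der_prodc relcomp_Image tst_append bex_Un disj_assoc)
qed

lemma type_At_iff:
  assumes K: "3 < K" and p: "m = 2 \<longrightarrow> 3 \<le> p \<and> p < K" and p4: "m = 4 \<longrightarrow> p < 2" and "0 \<notin> \<beta> y"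
  shows "(0, 1) \<in> der (tyl K (At m x y p) (map (ann \<beta>) w)) \<longleftrightarrow>
    tst m (\<beta> x) (\<beta> y) p False (ocl K w (\<lambda>_. 0))"
proof -
  \<comment> \<open>All registers start with 0, which is not in the set denoted by \<open>y\<close>;
    so bit 0 is the only one set.\<close>
  have "inv K m (\<beta> y) {0} (\<lambda>_. 0) False False" using assms(4) by (auto simp: inv_def)
  from inv_run(2)[where \<beta>=\<beta> and y=y and x=x and w=w, OF K p p4 this] show ?thesis by (simp add: inv_def)
qed

text \<open>The identifier 0 is excluded because it is the initial content of the registers.\<close>

locale labelled =
  fixes K :: nat and W :: "nat \<Rightarrow> (nat \<times> nat) item"
  assumes K: "3 < K" and sorted: "\<And>n. sorted_wrt (<) (idsl (seg W 0 n))"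
    and pos: "\<And>n. 0 \<notin> set (idsl (seg W 0 n))"
begin

definition OC :: "(nat \<times> nat \<times> (nat \<Rightarrow> nat)) set" where
  "OC = (\<Union>n. set (ocl K (seg W 0 n) (\<lambda>_. 0)))"

lemma ocl_mono: "n \<le> q \<Longrightarrow> set (ocl K (seg W 0 n) r) \<subseteq> set (ocl K (seg W 0 q) r)"
  using seg_append[of 0 n q W] by (metis Un_upper1 le0 ocl_append set_append)

lemma OC_inject:
  assumes "q \<in> OC" "q' \<in> OC" "fst (snd q) = fst (snd q')"
  shows "q = q'"
proof -
  obtain n n' where "q \<in> set (ocl K (seg W 0 n) (\<lambda>_. 0))" "q' \<in> set (ocl K (seg W 0 n') (\<lambda>_. 0))"
    using assms(1,2) unfolding OC_def by blast
  then have "q \<in> set (ocl K (seg W 0 (max n n')) (\<lambda>_. 0))" "q' \<in> set (ocl K (seg W 0 (max n n')) (\<lambda>_. 0))"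
    using ocl_mono[of n "max n n'"] ocl_mono[of n' "max n n'"] by auto
  moreover have "distinct (map (\<lambda>c. fst (snd c)) (ocl K (seg W 0 (max n n')) (\<lambda>_. 0)))"
    unfolding oc_ids using sorted strict_sorted_iff by blast
  ultimately show ?thesis using assms(3) by (simp add: distinct_map inj_on_def)
qed

lemma OC_pos: "q \<in> OC \<Longrightarrow> 0 < fst (snd q)"
proof -
  assume "q \<in> OC"
  then obtain n where "q \<in> set (ocl K (seg W 0 n) (\<lambda>_. 0))" unfolding OC_def by blast
  then have "fst (snd q) \<in> set (map (\<lambda>c. fst (snd c)) (ocl K (seg W 0 n) (\<lambda>_. 0)))" by auto
  then show ?thesis unfolding oc_ids using pos by (metis gr0I)
qed

definition holds :: "core \<Rightarrow> (nat \<Rightarrow> nat set) \<Rightarrow> bool" where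
  "holds \<psi> \<beta> \<longleftrightarrow> sat K \<psi> (\<lambda>n. ann \<beta> (W n))"

lemma seg_ann: "seg (\<lambda>n. ann \<beta> (W n)) i j = map (ann \<beta>) (seg W i j)"
  by (simp add: seg_def)

lemma holds_At:
  assumes p: "m = 2 \<longrightarrow> 3 \<le> p \<and> p < K" and p4: "m = 4 \<longrightarrow> p < 2" and "0 \<notin> \<beta> y"
  shows "holds (At m x y p) \<beta> \<longleftrightarrow> (\<exists>n. tst m (\<beta> x) (\<beta> y) p False (ocl K (seg W 0 n) (\<lambda>_. 0)))"
  unfolding holds_def sat.simps seg_def[symmetric] seg_ann type_At_iff[where \<beta>=\<beta> and y=y, OF K p p4 assms(3)] ..

lemma holds_local:
  assumes "m = 2 \<longrightarrow> 3 \<le> p \<and> p < K" "m = 4 \<longrightarrow> p < 2" "0 \<notin> \<beta> y" "m \<noteq> 0"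
  shows "holds (At m x y p) \<beta> \<longleftrightarrow> (\<exists>q\<in>OC. local_test m (\<beta> x) (\<beta> y) p q)"
  unfolding holds_At[where \<beta>=\<beta> and y=y, OF assms(1-3)] tst_local[OF assms(4)] OC_def by blast

lemma holds_less:
  assumes "0 \<notin> \<beta> y"
  shows "holds (At 0 x y p) \<beta> \<longleftrightarrow>
    (\<exists>q\<in>OC. \<exists>q'\<in>OC. hit (\<beta> x) q \<and> hit (\<beta> y) q' \<and> fst (snd q) < fst (snd q'))"
proof -
  have "sorted_wrt (<) (map (\<lambda>q. fst (snd q)) (ocl K (seg W 0 n) (\<lambda>_. 0)))" for n
    unfolding oc_ids by (rule sorted)
  then have "holds (At 0 x y p) \<beta> \<longleftrightarrow> (\<exists>n. \<exists>q\<in>set (ocl K (seg W 0 n) (\<lambda>_. 0)).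
      \<exists>q'\<in>set (ocl K (seg W 0 n) (\<lambda>_. 0)). hit (\<beta> x) q \<and> hit (\<beta> y) q' \<and> fst (snd q) < fst (snd q'))"
    using holds_At[of 0 p \<beta> y x] assms by (simp add: tst_order)
  also have "\<dots> \<longleftrightarrow> (\<exists>q\<in>OC. \<exists>q'\<in>OC. hit (\<beta> x) q \<and> hit (\<beta> y) q' \<and> fst (snd q) < fst (snd q'))" (is "?L \<longleftrightarrow> ?R")
  proof
    assume ?L then show ?R unfolding OC_def by blast
  next
    assume ?R
    then obtain q q' n n' where q: "q \<in> set (ocl K (seg W 0 n) (\<lambda>_. 0))" "q' \<in> set (ocl K (seg W 0 n') (\<lambda>_. 0))"
      "hit (\<beta> x) q \<and> hit (\<beta> y) q' \<and> fst (snd q) < fst (snd q')" unfolding OC_def by blast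
    then have "q \<in> set (ocl K (seg W 0 (max n n')) (\<lambda>_. 0))" "q' \<in> set (ocl K (seg W 0 (max n n')) (\<lambda>_. 0))"
      using ocl_mono[of n "max n n'"] ocl_mono[of n' "max n n'"] by auto
    with q(3) show ?L by blast
  qed
  finally show ?thesis .
qed

lemma holds_Nand: "holds (Nand \<phi> \<psi>) \<beta> \<longleftrightarrow> \<not> (holds \<phi> \<beta> \<and> holds \<psi> \<beta>)"
  by (simp add: holds_def)

end

lemma ann_cong:
  "(\<And>v i. i \<in> set (ids1 t) \<Longrightarrow> i \<in> \<beta> v \<longleftrightarrow> i \<in> \<gamma> v) \<Longrightarrow> ann \<beta> t = ann \<gamma> t"
  "(\<And>v i. i \<in> set (idsl w) \<Longrightarrow> i \<in> \<beta> v \<longleftrightarrow> i \<in> \<gamma> v) \<Longrightarrow> map (ann \<beta>) w = map (ann \<gamma>) w"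
  by (induction t and w rule: ids1_idsl.induct) auto

lemma ann_variant: "variant X (ann \<beta> t) (ann (\<beta>(X := S)) t)"
  by (induction t) (auto simp: vary_def list_all2_conv_all_nth)

text \<open>Distinct identifiers allow the local changes of \<open>X\<close> to be merged into one
  set without interference.\<close>

lemma variant_ann:
  "distinct (ids1 t) \<Longrightarrow> variant X (ann \<beta> t) t' \<Longrightarrow> \<exists>S\<subseteq>set (ids1 t). t' = ann (\<beta>(X := S)) t"
  "distinct (idsl w) \<Longrightarrow> list_all2 (variant X) (map (ann \<beta>) w) w' \<Longrightarrow>
    \<exists>S\<subseteq>set (idsl w). w' = map (ann (\<beta>(X := S))) w"
proof (induction t and w arbitrary: t' and w' rule: ids1_idsl.induct)
  case (1 c)
  from 1(2) obtain d where t': "t' = Lt d" and d: "fst c = fst d" "{v. snd c \<in> \<beta> v} - {X} = snd d - {X}"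
    by (cases t') (auto simp: vary_def)
  let ?S = "if X \<in> snd d then {snd c} else {}"
  have "{v. snd c \<in> (\<beta>(X := ?S)) v} = snd d"
    using d(2) by (auto simp: set_eq_iff split: if_splits)
  then show ?case using t' d(1) by (intro exI[of _ ?S]) (cases d, simp)
next
  case (2 k l w)
  from 2(3) obtain w' where t': "t' = Ne k l w'" and w': "list_all2 (variant X) (map (ann \<beta>) w) w'"
    by (cases t') auto
  have "distinct (idsl w)" using 2(2) by simp
  from 2(1)[OF this w'] obtain S where "S \<subseteq> set (idsl w)" "w' = map (ann (\<beta>(X := S))) w" by blast
  with t' have "S \<subseteq> set (ids1 (Ne k l w))" "t' = ann (\<beta>(X := S)) (Ne k l w)" by (simp_all only: ann_simps ids1.simps)
  then show ?case by blast
next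
  case 3 then show ?case by simp
next
  case (4 i w)
  from 4(4) obtain i' u where w': "w' = i' # u" "variant X (ann \<beta> i) i'" "list_all2 (variant X) (map (ann \<beta>) w) u"
    by (auto simp: list_all2_Cons1)
  have d: "distinct (ids1 i)" "distinct (idsl w)" using 4(3) by simp_all
  from 4(1)[OF d(1) w'(2)] obtain S where S: "S \<subseteq> set (ids1 i)" "i' = ann (\<beta>(X := S)) i" by blast
  from 4(2)[OF d(2) w'(3)] obtain S' where S': "S' \<subseteq> set (idsl w)" "u = map (ann (\<beta>(X := S'))) w" by blast
  have dj: "set (ids1 i) \<inter> set (idsl w) = {}" using 4(3) by simp
  have "ann (\<beta>(X := S)) i = ann (\<beta>(X := S \<union> S')) i" by (rule ann_cong(1)) (use S'(1) dj in auto)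
  moreover have "map (ann (\<beta>(X := S'))) w = map (ann (\<beta>(X := S \<union> S'))) w"
    by (rule ann_cong(2)) (use S(1) dj in auto)
  ultimately have "w' = map (ann (\<beta>(X := S \<union> S'))) (i # w)" using S(2) S'(2) w'(1) by simp
  moreover have "S \<union> S' \<subseteq> set (idsl (i # w))" using S(1) S'(1) by auto
  ultimately show ?case by blast
qed

lemma ty_ann_cong:
  "(\<And>v q. q \<in> set (oc1 K t r) \<Longrightarrow> pfst (fst q) < 2 \<Longrightarrow> fst (snd q) \<in> \<beta> v \<longleftrightarrow> fst (snd q) \<in> \<gamma> v) \<Longrightarrow>
    ty1 K \<psi> (ann \<beta> t) = ty1 K \<psi> (ann \<gamma> t)"
  "(\<And>v q. q \<in> set (ocl K w r) \<Longrightarrow> pfst (fst q) < 2 \<Longrightarrow> fst (snd q) \<in> \<beta> v \<longleftrightarrow> fst (snd q) \<in> \<gamma> v) \<Longrightarrow>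
    tyl K \<psi> (map (ann \<beta>) w) = tyl K \<psi> (map (ann \<gamma>) w)"
proof (induction K t r and K w r rule: oc1_ocl.induct)
  case (1 K c r)
  show ?case
  proof (cases "pfst (fst c) < 2")
    case True
    then have "{v. snd c \<in> \<beta> v} = {v. snd c \<in> \<gamma> v}" using 1 by auto
    then show ?thesis by simp
  next
    case False
    then show ?thesis
      using letc_dead[of "fst c" K \<psi> "{v. snd c \<in> \<beta> v}"] letc_dead[of "fst c" K \<psi> "{v. snd c \<in> \<gamma> v}"] by simp
  qed
qed auto

context labelled
begin

lemma distinct_ids: "distinct (idsl (seg W 0 n))"
  using sorted strict_sorted_iff by blast

lemma ids_seg_Suc: "idsl (seg W 0 (Suc n)) = idsl (seg W 0 n) @ ids1 (W n)"
  by (simp add: seg_def idsl_append)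

lemma ids_mem: "n < q \<Longrightarrow> set (ids1 (W n)) \<subseteq> set (idsl (seg W 0 q))"
proof (induction q)
  case (Suc q) then show ?case by (cases "n = q") (auto simp: ids_seg_Suc)
qed simp

lemma ids_disjoint: "n < q \<Longrightarrow> set (ids1 (W n)) \<inter> set (ids1 (W q)) = {}"
  using ids_mem[of n q] distinct_ids[of "Suc q"] by (auto simp: ids_seg_Suc)

text \<open>Different items have disjoint identifiers, so the union of the sets chosen for the
  single items induces each of these choices.\<close>

lemma holds_Ex0: "holds (Ex X \<psi>) \<beta> \<longleftrightarrow> (\<exists>S. holds \<psi> (\<beta>(X := S)))"
proof
  assume "holds (Ex X \<psi>) \<beta>"
  then obtain W' where W': "\<And>n. variant X (ann \<beta> (W n)) (W' n)" "sat K \<psi> W'" by (auto simp: holds_def)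
  have "distinct (ids1 (W n))" for n using distinct_ids[of "Suc n"] by (simp add: ids_seg_Suc)
  then have "\<exists>S\<subseteq>set (ids1 (W n)). W' n = ann (\<beta>(X := S)) (W n)" for n using variant_ann(1) W'(1) by blast
  then obtain S where S: "\<And>n. S n \<subseteq> set (ids1 (W n))" "\<And>n. W' n = ann (\<beta>(X := S n)) (W n)" by metis
  let ?S = "\<Union>n. S n"
  have "W' n = ann (\<beta>(X := ?S)) (W n)" for n
    unfolding S(2)
  proof (rule ann_cong(1))
    fix v i assume i: "i \<in> set (ids1 (W n))"
    have "i \<in> S n" if "i \<in> S m" for m
    proof (cases m n rule: linorder_cases)
      case less then show ?thesis using ids_disjoint[of m n] S(1) that i by blast
    next
      case greater then show ?thesis using ids_disjoint[of n m] S(1) that i by blast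
    qed (use that in simp)
    then have "i \<in> S n \<longleftrightarrow> i \<in> ?S" by blast
    then show "i \<in> (\<beta>(X := S n)) v \<longleftrightarrow> i \<in> (\<beta>(X := ?S)) v" by simp
  qed
  then have "W' = (\<lambda>n. ann (\<beta>(X := ?S)) (W n))" by blast
  with W'(2) show "\<exists>S. holds \<psi> (\<beta>(X := S))" unfolding holds_def by blast
next
  assume "\<exists>S. holds \<psi> (\<beta>(X := S))"
  then obtain S where S: "sat K \<psi> (\<lambda>n. ann (\<beta>(X := S)) (W n))" unfolding holds_def by blast
  show "holds (Ex X \<psi>) \<beta>" unfolding holds_def sat.simps
    by (rule exI[of _ "\<lambda>n. ann (\<beta>(X := S)) (W n)"]) (use S ann_variant in blast)
qed

definition live :: "nat set" where "live = {i. \<exists>q\<in>OC. fst (snd q) = i \<and> pfst (fst q) < 2}"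

lemma holds_cong: "(\<And>v. \<beta> v \<inter> live = \<gamma> v \<inter> live) \<Longrightarrow> holds \<psi> \<beta> \<longleftrightarrow> holds \<psi> \<gamma>"
proof (induction \<psi> arbitrary: \<beta> \<gamma>)
  case (At m x y p)
  have "tyl K (At m x y p) (map (ann \<beta>) (seg W 0 n)) = tyl K (At m x y p) (map (ann \<gamma>) (seg W 0 n))" for n
  proof (rule ty_ann_cong(2)[where r="\<lambda>_. 0"])
    fix v q assume "q \<in> set (ocl K (seg W 0 n) (\<lambda>_. 0))" "pfst (fst q) < 2"
    then have "fst (snd q) \<in> live" unfolding live_def OC_def by blast
    then show "fst (snd q) \<in> \<beta> v \<longleftrightarrow> fst (snd q) \<in> \<gamma> v" using At[of v] by blast
  qed
  then show ?case unfolding holds_def sat.simps seg_def[symmetric] seg_ann by simp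
next
  case (Nand f g)
  have "holds f \<beta> \<longleftrightarrow> holds f \<gamma>" by (rule Nand.IH(1)) (rule Nand.prems)
  moreover have "holds g \<beta> \<longleftrightarrow> holds g \<gamma>" by (rule Nand.IH(2)) (rule Nand.prems)
  ultimately show ?case by (simp add: holds_Nand)
next
  case (Ex X f)
  have "holds f (\<beta>(X := S)) \<longleftrightarrow> holds f (\<gamma>(X := S))" for S by (rule Ex.IH) (use Ex.prems in simp)
  then show ?case by (simp add: holds_Ex0)
qed

text \<open>Inert letters are invisible to formulas, so a quantified set may be cut down to the
  identifiers of creations and actions.\<close>

lemma holds_Ex: "holds (Ex X \<psi>) \<beta> \<longleftrightarrow> (\<exists>S\<subseteq>live. holds \<psi> (\<beta>(X := S)))"
proof -
  have "holds \<psi> (\<beta>(X := S)) \<longleftrightarrow> holds \<psi> (\<beta>(X := S \<inter> live))" for S by (rule holds_cong) simp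
  then show ?thesis unfolding holds_Ex0 by (meson inf_le2)
qed

end

section \<open>Labelling a word with consecutive identifiers\<close>

fun nl1 :: "'a item \<Rightarrow> nat" and nll :: "'a item list \<Rightarrow> nat" where
  "nl1 (Lt c) = 1"
| "nl1 (Ne k l w) = nll w"
| "nll [] = 0"
| "nll (i # w) = nl1 i + nll w"

fun lab1 :: "nat \<Rightarrow> 'a item \<Rightarrow> ('a \<times> nat) item" and labl :: "nat \<Rightarrow> 'a item list \<Rightarrow> ('a \<times> nat) item list" where
  "lab1 n (Lt c) = Lt (c, n)"
| "lab1 n (Ne k l w) = Ne k l (labl n w)"
| "labl n [] = []"
| "labl n (i # w) = lab1 n i # labl (n + nl1 i) w"

lemma lab_ids: "ids1 (lab1 n i) = [n..<n + nl1 i]" "idsl (labl n w) = [n..<n + nll w]"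
proof (induction n i and n w rule: lab1_labl.induct)
  case (4 n i w)
  have "[n..<n + nl1 i + nll w] = [n..<n + nl1 i] @ [n + nl1 i..<n + nl1 i + nll w]"
    by (rule upt_add_eq_append) simp
  with 4 show ?case by (simp add: add.assoc)
qed simp_all

lemma lab_fst:
  fixes i :: "'a item" and w :: "'a item list"
  shows "map_item fst (lab1 n i) = i" "map (map_item fst) (labl n w) = w"
  by (induction n i and n w rule: lab1_labl.induct) simp_all

lemma labelling_exists:
  assumes "3 < K"
  shows "\<exists>W. labelled K W \<and> (\<forall>n. map_item fst (W n) = W0 n)"
proof -
  \<comment> \<open>Numbering starts with 1, since 0 is the initial content of the
    registers.\<close>
  define b where "b n = 1 + (\<Sum>m<n. nl1 (W0 m))" for n
  let ?W = "\<lambda>n. lab1 (b n) (W0 n)"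
  have ids: "idsl (seg ?W 0 n) = [1..<b n]" for n
  proof (induction n)
    case 0 show ?case by (simp add: seg_def b_def)
  next
    case (Suc n)
    have "seg ?W 0 (Suc n) = seg ?W 0 n @ [?W n]" by (simp add: seg_def)
    moreover have "b (Suc n) = b n + nl1 (W0 n)" by (simp add: b_def)
    moreover have "[1..<b n + nl1 (W0 n)] = [1..<b n] @ [b n..<b n + nl1 (W0 n)]"
      by (rule upt_add_eq_append) (simp add: b_def)
    ultimately show ?case using Suc by (simp add: idsl_append lab_ids)
  qed
  have "labelled K ?W"
  proof
    show "sorted_wrt (<) (idsl (seg ?W 0 n))" for n unfolding ids by (rule sorted_wrt_upt)
    show "0 \<notin> set (idsl (seg ?W 0 n))" for n unfolding ids by simp
  qed (rule assms)
  then show ?thesis by (intro exI[of _ ?W]) (simp add: lab_fst)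
qed

subsection \<open>Codes of formulas\<close>

lemma list_encode_Cons [simp]: "list_encode (x # xs) = Suc (enc_pair x (list_encode xs))"
  by (simp add: enc_pair_def)

declare list_encode.simps(2) [simp del]

definition lhd :: "nat \<Rightarrow> nat" where "lhd l = pfst (l - 1)"
definition ltl :: "nat \<Rightarrow> nat" where "ltl l = psnd (l - 1)"

lemma lhd_ltl [simp]: "lhd (Suc (enc_pair x l)) = x" "ltl (Suc (enc_pair x l)) = l"
  by (simp_all add: lhd_def ltl_def)

text \<open>All variables denote sets of identifiers; \<open>cMem x y\<close> says that \<open>x\<close> and \<open>y\<close> intersect. The offset 3
  skips the reserved registers.\<close>

definition cAt :: "nat \<Rightarrow> nat \<Rightarrow> nat \<Rightarrow> nat \<Rightarrow> nat" where
  "cAt m x y p = enc_pair 0 (enc_pair m (enc_pair x (enc_pair y p)))"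
definition cNand :: "nat \<Rightarrow> nat \<Rightarrow> nat" where "cNand g h = enc_pair 1 (enc_pair g h)"
definition cEx :: "nat \<Rightarrow> nat \<Rightarrow> nat" where "cEx X g = enc_pair 2 (enc_pair X g)"
definition cNot :: "nat \<Rightarrow> nat" where "cNot g = cNand g g"
definition cAnd :: "nat \<Rightarrow> nat \<Rightarrow> nat" where "cAnd g h = cNot (cNand g h)"
definition cOr :: "nat \<Rightarrow> nat \<Rightarrow> nat" where "cOr g h = cNand (cNot g) (cNot h)"
text \<open>There is no mode 5, so no letter ever sets the verdict bit of this atom.\<close>

definition cF :: nat where "cF = cAt 5 0 0 0"
definition cT :: nat where "cT = cNot cF"
definition cLess :: "nat \<Rightarrow> nat \<Rightarrow> nat" where "cLess x y = cAt 0 x y 0"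
definition cMem :: "nat \<Rightarrow> nat \<Rightarrow> nat" where "cMem x y = cAt 1 x y 0"
definition cBind :: "nat \<Rightarrow> nat \<Rightarrow> nat \<Rightarrow> nat" where "cBind x U c = cAt 2 x U (c + 3)"
definition cLet :: "nat \<Rightarrow> nat \<Rightarrow> nat" where "cLet x a = cAt 3 x 0 a"
definition cKind :: "nat \<Rightarrow> nat \<Rightarrow> nat" where "cKind x p = cAt 4 x 0 p"
text \<open>Individuals are simulated by sets without an atom for equality: a singleton is a
  nonempty set without two comparable elements.\<close>

definition cSing :: "nat \<Rightarrow> nat" where "cSing x = cAnd (cMem x x) (cNot (cLess x x))"
definition cExK :: "nat \<Rightarrow> nat \<Rightarrow> nat \<Rightarrow> nat" where
  "cExK p x g = cEx x (cAnd (cSing x) (cAnd (cKind x p) g))"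

abbreviation cExD :: "nat \<Rightarrow> nat \<Rightarrow> nat" where "cExD \<equiv> cExK 0"
abbreviation cExA :: "nat \<Rightarrow> nat \<Rightarrow> nat" where "cExA \<equiv> cExK (Suc 0)"
text \<open>The tags keep apart the positions and sets of the sentence, the data variables of the
  sentence and of the actions, the chain of newer elements used for recency, and auxiliary positions
  and elements.\<close>

abbreviation pv :: "nat \<Rightarrow> nat" where "pv x \<equiv> enc_pair 0 x"
abbreviation sv :: "nat \<Rightarrow> nat" where "sv x \<equiv> enc_pair 1 x"
abbreviation dv :: "nat \<Rightarrow> nat" where "dv x \<equiv> enc_pair 2 x"
abbreviation cv :: "nat \<Rightarrow> nat" where "cv x \<equiv> enc_pair 3 x"
abbreviation av :: "nat \<Rightarrow> nat" where "av x \<equiv> enc_pair 4 x"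

text \<open>The macros traverse a list parameter one element at a time, with one macro step for each element.\<close>

definition e_zipsame :: "nat \<Rightarrow> nat" where
  "e_zipsame a = (if pfst a = 0 then (if psnd a = 0 then cT else cF)
     else if psnd a = 0 then cF
     else cAnd (cExD (av 2) (cAnd (cBind (av 0) (av 2) (lhd (pfst a))) (cBind (av 1) (av 2) (lhd (psnd a)))))
       (enc_pair 3 (enc_pair (ltl (pfst a)) (ltl (psnd a)))))"

text \<open>The fact is given by its pattern \<open>R(cs)\<close> at the action \<open>av 0\<close>
  that added it; the list contains patterns of the action \<open>av 1\<close>. Each pattern is read
  with the register contents at its own action.\<close>

definition e_delfacts :: "nat \<Rightarrow> nat" where
  "e_delfacts a = (if pfst a = 0 then cF else
     cOr (if pfst (lhd (pfst a)) = pfst (psnd a)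
          then enc_pair 3 (enc_pair (psnd (psnd a)) (psnd (lhd (pfst a)))) else cF)
       (enc_pair 4 (enc_pair (ltl (pfst a)) (psnd a))))"

definition del_of :: "nat \<Rightarrow> nat" where "del_of a = lhd (ltl (ltl (ltl a)))"
definition add_of :: "nat \<Rightarrow> nat" where "add_of a = lhd (ltl (ltl (ltl (ltl a))))"

definition e_delacts :: "nat \<Rightarrow> nat" where
  "e_delacts a = (if pfst a = 0 then cF else
     cOr (cAnd (cLet (av 1) (lhd (pfst a))) (enc_pair 4 (enc_pair (del_of (lhd (pfst a))) (psnd a))))
       (enc_pair 5 (enc_pair (ltl (pfst a)) (psnd a))))"

definition cPersist :: "nat \<Rightarrow> nat \<Rightarrow> nat \<Rightarrow> nat" where
  "cPersist A f x = cNot (cExA (av 1) (cAnd (cLess (av 0) (av 1)) (cAnd (cLess (av 1) x) (enc_pair 5 (enc_pair A f)))))"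

definition e_zipbind :: "nat \<Rightarrow> nat" where
  "e_zipbind a = (if pfst a = 0 then (if psnd a = 0 then cT else cF)
     else if psnd a = 0 then cF
     else cAnd (cBind (av 0) (dv (lhd (psnd a))) (lhd (pfst a)))
       (enc_pair 6 (enc_pair (ltl (pfst a)) (ltl (psnd a)))))"

definition e_anybind :: "nat \<Rightarrow> nat" where
  "e_anybind a = (if pfst a = 0 then cF else
     cOr (cBind (av 0) (psnd a) (lhd (pfst a))) (enc_pair 7 (enc_pair (ltl (pfst a)) (psnd a))))"

text \<open>A fact query \<open>q\<close> is either \<open>(0, R, us)\<close>, asking for the fact \<open>R(us)\<close>, or \<open>(1, U)\<close>, asking for
  any fact in which the element \<open>U\<close> occurs.\<close>

definition cQuery :: "nat \<Rightarrow> nat \<Rightarrow> nat" where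
  "cQuery q f = (if pfst q = 0
     then (if pfst f = pfst (psnd q) then enc_pair 6 (enc_pair (psnd f) (psnd (psnd q))) else cF)
     else enc_pair 7 (enc_pair (psnd f) (psnd q)))"

definition e_addfacts :: "nat \<Rightarrow> nat" where
  "e_addfacts a = (if pfst a = 0 then cF else
     cOr (cAnd (cQuery (pfst (psnd (psnd a))) (lhd (pfst a)))
            (cPersist (pfst (psnd a)) (lhd (pfst a)) (psnd (psnd (psnd a)))))
       (enc_pair 8 (enc_pair (ltl (pfst a)) (psnd a))))"

definition e_addacts :: "nat \<Rightarrow> nat" where
  "e_addacts a = (if pfst a = 0 then cF else
     cOr (cAnd (cLet (av 0) (lhd (pfst a))) (enc_pair 8 (enc_pair (add_of (lhd (pfst a))) (psnd a))))
       (enc_pair 9 (enc_pair (ltl (pfst a)) (psnd a))))"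

text \<open>The list of actions is passed twice: one copy is consumed while looking for the action
  that added the fact, the other is kept to express that no later action deletes it.\<close>

definition cFact :: "nat \<Rightarrow> nat \<Rightarrow> nat \<Rightarrow> nat" where
  "cFact A q x = cExA (av 0) (cAnd (cLess (av 0) x) (enc_pair 9 (enc_pair A (enc_pair A (enc_pair q x)))))"

definition cAlive :: "nat \<Rightarrow> nat \<Rightarrow> nat \<Rightarrow> nat" where
  "cAlive A U x = cFact A (enc_pair 1 U) x"

definition e_fol :: "nat \<Rightarrow> nat" where
  "e_fol a = (let t = pfst (pfst a); r = psnd (pfst a); A = pfst (psnd a); x = psnd (psnd a) in
     if t = 0 then cFact A (enc_pair 0 r) x
     else if t = 1 then cMem (dv (pfst r)) (dv (psnd r))
     else if t = 2 then cNot (enc_pair 10 (enc_pair r (psnd a)))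
     else if t = 3 then cAnd (enc_pair 10 (enc_pair (pfst r) (psnd a))) (enc_pair 10 (enc_pair (psnd r) (psnd a)))
     else cExD (dv (pfst r)) (cAnd (cAlive A (dv (pfst r)) x) (enc_pair 10 (enc_pair (psnd r) (psnd a)))))"

definition e_allalive :: "nat \<Rightarrow> nat" where
  "e_allalive a = (if pfst a = 0 then cT else
     cAnd (cOr (cNot (cMem (dv (lhd (pfst a))) (dv (lhd (pfst a)))))
         (cAlive (pfst (psnd a)) (dv (lhd (pfst a))) (psnd (psnd a))))
       (enc_pair 11 (enc_pair (ltl (pfst a)) (psnd a))))"

text \<open>The bound variable of a quantifier is reinterpreted by an arbitrary set, which may be empty; for
  empty sets the requirement of lying in the active domain is void.\<close>

definition e_fvalive :: "nat \<Rightarrow> nat" where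
  "e_fvalive a = (let t = pfst (pfst a); r = psnd (pfst a) in
     if t = 0 then enc_pair 11 (enc_pair (psnd r) (psnd a))
     else if t = 1 then enc_pair 11 (enc_pair (Suc (enc_pair (pfst r) (Suc (enc_pair (psnd r) 0)))) (psnd a))
     else if t = 2 then enc_pair 12 (enc_pair r (psnd a))
     else if t = 3 then cAnd (enc_pair 12 (enc_pair (pfst r) (psnd a))) (enc_pair 12 (enc_pair (psnd r) (psnd a)))
     else cEx (dv (pfst r)) (enc_pair 12 (enc_pair (psnd r) (psnd a))))"

text \<open>The first action builds the initial instance. A position of the run is represented by
  the action performed in its instance, so the positions are the actions that are not first.\<close>

definition cLater :: "nat \<Rightarrow> nat" where "cLater x = cExA (av 0) (cLess (av 0) x)"

definition e_mso :: "nat \<Rightarrow> nat" where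
  "e_mso a = (let t = pfst (pfst a); r = psnd (pfst a); A = psnd a in
     if t = 0 then cAnd (enc_pair 12 (enc_pair (pfst r) (enc_pair A (pv (psnd r)))))
       (enc_pair 10 (enc_pair (pfst r) (enc_pair A (pv (psnd r)))))
     else if t = 1 then cLess (pv (pfst r)) (pv (psnd r))
     else if t = 2 then cMem (pv (pfst r)) (sv (psnd r))
     else if t = 3 then cNot (enc_pair 13 (enc_pair r A))
     else if t = 4 then cAnd (enc_pair 13 (enc_pair (pfst r) A)) (enc_pair 13 (enc_pair (psnd r) A))
     else if t = 5 then cExA (pv (pfst r)) (cAnd (cLater (pv (pfst r))) (enc_pair 13 (enc_pair (psnd r) A)))
     else if t = 6 then cEx (sv (pfst r)) (enc_pair 13 (enc_pair (psnd r) A))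
     else cExD (dv (pfst r)) (cAnd (cExA (av 3) (cAlive A (dv (pfst r)) (av 3))) (enc_pair 13 (enc_pair (psnd r) A))))"

text \<open>Counting \<open>n\<close> newer live elements amounts to an ascending chain
  \<open>cv n\<close>, \<open>cv (n - 1)\<close>, ...; the order makes its members distinct.\<close>

definition e_newer :: "nat \<Rightarrow> nat" where
  "e_newer a = (if pfst a = 0 then cT else
     cExD (cv (pfst a)) (cAnd (cLess (pfst (psnd a)) (cv (pfst a)))
       (cAnd (cAlive (pfst (psnd (psnd a))) (cv (pfst a)) (psnd (psnd (psnd a))))
         (enc_pair 14 (enc_pair (pfst a - 1) (enc_pair (cv (pfst a)) (psnd (psnd a))))))))"

text \<open>Each parameter is bound to the element in the register bearing its name. It has to be
  alive, and recency is the absence of \<open>b\<close> newer live elements; the guard of the action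
  is evaluated after the last binding.\<close>

definition e_bindall :: "nat \<Rightarrow> nat" where
  "e_bindall a = (let us = pfst a; Q = pfst (psnd a); A = pfst (psnd (psnd a)); b = pfst (psnd (psnd (psnd a)));
      x = psnd (psnd (psnd (psnd a))) in
    if us = 0 then enc_pair 10 (enc_pair Q (enc_pair A x))
    else cExD (dv (lhd us)) (cAnd (cBind x (dv (lhd us)) (lhd us))
      (cAnd (cAnd (cAlive A (dv (lhd us)) x) (cNot (enc_pair 14 (enc_pair b (enc_pair (dv (lhd us)) (enc_pair A x))))))
        (enc_pair 15 (enc_pair (ltl us) (psnd a))))))"

text \<open>One ascending chain, started above an earlier position, expresses freshness, injectivity
  and the order of the sequence numbers at once.\<close>

definition e_news :: "nat \<Rightarrow> nat" where
  "e_news a = (if pfst a = 0 then cT else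
     cExD (dv (lhd (pfst a))) (cAnd (cLess (pfst (psnd a)) (dv (lhd (pfst a))))
       (cAnd (cBind (psnd (psnd a)) (dv (lhd (pfst a))) (lhd (pfst a)))
         (enc_pair 16 (enc_pair (ltl (pfst a)) (enc_pair (dv (lhd (pfst a))) (psnd (psnd a))))))))"

text \<open>The chain of new elements has to start above every earlier action. Registers at an
  action contain only elements created before it, so the new elements are newer than everything
  introduced so far.\<close>

definition e_guard :: "nat \<Rightarrow> nat" where
  "e_guard a = (if pfst a = 0 then cF else
     let \<alpha> = lhd (pfst a); A = pfst (psnd a); b = psnd (psnd a) in
     cOr (cAnd (cLet (av 3) \<alpha>)
        (cAnd (cNot (cExA (av 4) (cAnd (cLess (av 4) (av 3))
                (cNot (enc_pair 16 (enc_pair (lhd (ltl \<alpha>)) (enc_pair (av 4) (av 3))))))))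
           (enc_pair 15 (enc_pair (lhd \<alpha>) (enc_pair (lhd (ltl (ltl \<alpha>))) (enc_pair A (enc_pair b (av 3))))))))
       (enc_pair 17 (enc_pair (ltl (pfst a)) (psnd a))))"

definition expand :: "nat \<Rightarrow> nat" where
  "expand g = (let t = pfst g; a = psnd g in
     if t = 3 then e_zipsame a else if t = 4 then e_delfacts a else if t = 5 then e_delacts a
     else if t = 6 then e_zipbind a else if t = 7 then e_anybind a else if t = 8 then e_addfacts a
     else if t = 9 then e_addacts a else if t = 10 then e_fol a else if t = 11 then e_allalive a
     else if t = 12 then e_fvalive a else if t = 13 then e_mso a else if t = 14 then e_newer a
     else if t = 15 then e_bindall a else if t = 16 then e_news a else e_guard a)"

text \<open>Infinitely many actions are demanded as nonemptiness without a last element. Identifiers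
  are natural numbers, so a first action exists, and it is required to be the initial one.\<close>

definition cValid :: "nat \<Rightarrow> nat \<Rightarrow> nat \<Rightarrow> nat" where
  "cValid i L b = (let A = Suc (enc_pair i L) in
     cAnd (cAnd (cExA (av 3) cT) (cNot (cExA (av 3) (cNot (cExA (av 4) (cLess (av 3) (av 4)))))))
       (cNot (cExA (av 3) (cNot (cOr (cAnd (cNot (cLater (av 3))) (cLet (av 3) i))
         (cAnd (cLater (av 3)) (enc_pair 17 (enc_pair L (enc_pair A b)))))))))"

text \<open>The initial instance is produced by an additional first action that only adds facts.\<close>

definition init_code :: "nat \<Rightarrow> nat" where
  "init_code I = Suc (enc_pair 0 (Suc (enc_pair 0 (Suc (enc_pair 0 (Suc (enc_pair 0 (Suc (enc_pair I 0)))))))))"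

definition start :: "nat \<Rightarrow> nat" where
  "start x = (let S = lhd x; i = init_code (lhd (ltl S)); L = lhd (ltl (ltl S)) in
     cAnd (cValid i L (lhd (ltl (ltl x)))) (cNot (enc_pair 13 (enc_pair (lhd (ltl x)) (Suc (enc_pair i L))))))"

section \<open>Computability of the translation\<close>

lemma cmp_lhd: "cmp a \<Longrightarrow> cmp (\<lambda>x. lhd (a x))" and cmp_ltl: "cmp a \<Longrightarrow> cmp (\<lambda>x. ltl (a x))"
  unfolding lhd_def ltl_def by (intro cmp_intros; assumption)+

lemma cmp_cAt: "cmp a \<Longrightarrow> cmp b \<Longrightarrow> cmp c \<Longrightarrow> cmp d \<Longrightarrow> cmp (\<lambda>x. cAt (a x) (b x) (c x) (d x))"
  and cmp_cNand: "cmp a \<Longrightarrow> cmp b \<Longrightarrow> cmp (\<lambda>x. cNand (a x) (b x))"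
  and cmp_cEx: "cmp a \<Longrightarrow> cmp b \<Longrightarrow> cmp (\<lambda>x. cEx (a x) (b x))"
  unfolding cAt_def cNand_def cEx_def by (intro cmp_intros; assumption)+

lemma cmp_cNot: "cmp a \<Longrightarrow> cmp (\<lambda>x. cNot (a x))"
  unfolding cNot_def by (intro cmp_cNand; assumption)

lemma cmp_cAnd: "cmp a \<Longrightarrow> cmp b \<Longrightarrow> cmp (\<lambda>x. cAnd (a x) (b x))"
  and cmp_cOr: "cmp a \<Longrightarrow> cmp b \<Longrightarrow> cmp (\<lambda>x. cOr (a x) (b x))"
  unfolding cAnd_def cOr_def by (intro cmp_cNand cmp_cNot; assumption)+

lemma cmp_cLess: "cmp a \<Longrightarrow> cmp b \<Longrightarrow> cmp (\<lambda>x. cLess (a x) (b x))"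
  and cmp_cMem: "cmp a \<Longrightarrow> cmp b \<Longrightarrow> cmp (\<lambda>x. cMem (a x) (b x))"
  and cmp_cLet: "cmp a \<Longrightarrow> cmp b \<Longrightarrow> cmp (\<lambda>x. cLet (a x) (b x))"
  and cmp_cKind: "cmp a \<Longrightarrow> cmp b \<Longrightarrow> cmp (\<lambda>x. cKind (a x) (b x))"
  and cmp_cBind: "cmp a \<Longrightarrow> cmp b \<Longrightarrow> cmp c \<Longrightarrow> cmp (\<lambda>x. cBind (a x) (b x) (c x))"
  unfolding cLess_def cMem_def cLet_def cKind_def cBind_def by (intro cmp_cAt cmp_plus cmp_const; assumption)+

lemma cmp_cExK: "cmp a \<Longrightarrow> cmp b \<Longrightarrow> cmp (\<lambda>x. cExK p (a x) (b x))"
  unfolding cExK_def cSing_def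
  by (intro cmp_cEx cmp_cAnd cmp_cNot cmp_cMem cmp_cLess cmp_cKind cmp_const; assumption)

lemma cmp_fields: "cmp a \<Longrightarrow> cmp (\<lambda>x. del_of (a x))" "cmp a \<Longrightarrow> cmp (\<lambda>x. add_of (a x))"
  unfolding del_of_def add_of_def by (intro cmp_lhd cmp_ltl; assumption)+

lemmas c_intros = cmp_lhd cmp_ltl cmp_cNot cmp_cAnd cmp_cOr cmp_cLess cmp_cMem cmp_cLet cmp_cBind cmp_cEx
  cmp_cExK cmp_fields

lemma cmp_cPersist: "cmp a \<Longrightarrow> cmp b \<Longrightarrow> cmp c \<Longrightarrow> cmp (\<lambda>x. cPersist (a x) (b x) (c x))"
  and cmp_cQuery: "cmp a \<Longrightarrow> cmp b \<Longrightarrow> cmp (\<lambda>x. cQuery (a x) (b x))"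
  and cmp_cFact: "cmp a \<Longrightarrow> cmp b \<Longrightarrow> cmp c \<Longrightarrow> cmp (\<lambda>x. cFact (a x) (b x) (c x))"
  and cmp_cLater: "cmp a \<Longrightarrow> cmp (\<lambda>x. cLater (a x))"
  unfolding cPersist_def cQuery_def cFact_def cLater_def by (intro cmp_intros c_intros; assumption)+

lemma cmp_cAlive: "cmp a \<Longrightarrow> cmp b \<Longrightarrow> cmp c \<Longrightarrow> cmp (\<lambda>x. cAlive (a x) (b x) (c x))"
  unfolding cAlive_def by (intro cmp_cFact cmp_pair cmp_const; assumption)

lemmas m_intros = cmp_cPersist cmp_cQuery cmp_cFact cmp_cLater cmp_cAlive

lemma cmp_expanders: "cmp e_zipsame" "cmp e_delfacts" "cmp e_delacts" "cmp e_zipbind" "cmp e_anybind" "cmp e_addfacts"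
  "cmp e_addacts" "cmp e_fol" "cmp e_allalive" "cmp e_fvalive" "cmp e_mso" "cmp e_newer" "cmp e_bindall" "cmp e_news"
  "cmp e_guard"
  unfolding e_zipsame_def[abs_def] e_delfacts_def[abs_def] e_delacts_def[abs_def] e_zipbind_def[abs_def]
    e_anybind_def[abs_def] e_addfacts_def[abs_def] e_addacts_def[abs_def] e_fol_def[abs_def]
    e_allalive_def[abs_def] e_fvalive_def[abs_def] e_mso_def[abs_def] e_newer_def[abs_def]
    e_bindall_def[abs_def] e_news_def[abs_def] e_guard_def[abs_def] Let_def
  by (intro cmp_intros c_intros m_intros)+

lemma cmp_expand: "cmp expand"
  unfolding expand_def[abs_def] Let_def
  by (intro cmp_intros cmp_expanders[THEN cmp_comp])

lemma cmp_start: "cmp start"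
  unfolding start_def[abs_def] cValid_def init_code_def Let_def by (intro cmp_intros c_intros m_intros)

lemma expand_simps [simp]:
  "expand (enc_pair 3 a) = e_zipsame a" "expand (enc_pair 4 a) = e_delfacts a" "expand (enc_pair 5 a) = e_delacts a"
  "expand (enc_pair 6 a) = e_zipbind a" "expand (enc_pair 7 a) = e_anybind a" "expand (enc_pair 8 a) = e_addfacts a"
  "expand (enc_pair 9 a) = e_addacts a" "expand (enc_pair 10 a) = e_fol a" "expand (enc_pair 11 a) = e_allalive a"
  "expand (enc_pair 12 a) = e_fvalive a" "expand (enc_pair 13 a) = e_mso a" "expand (enc_pair 14 a) = e_newer a"
  "expand (enc_pair 15 a) = e_bindall a" "expand (enc_pair 16 a) = e_news a" "expand (enc_pair 17 a) = e_guard a"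
  by (simp_all add: expand_def)

text \<open>Lazy unfolding could run forever on arbitrary numbers. The laws for evaluating codes
  presuppose that unfolding reaches a formula, which holds for the macros on well-formed parameters
  by induction on these.\<close>

definition dfd :: "nat \<Rightarrow> bool" where "dfd g \<longleftrightarrow> (\<exists>\<psi>. codes expand g \<psi>)"

lemma dfd_At [simp]: "dfd (cAt m x y p)"
  unfolding dfd_def cAt_def using codes_At by blast

lemma dfd_Nand: "dfd g \<Longrightarrow> dfd h \<Longrightarrow> dfd (cNand g h)"
  unfolding dfd_def cNand_def using codes_Nand by blast

lemma dfd_Ex [simp]: "dfd g \<Longrightarrow> dfd (cEx X g)"
  unfolding dfd_def cEx_def using codes_Ex by blast

lemma dfd_macro: "3 \<le> t \<Longrightarrow> dfd (expand (enc_pair t a)) \<Longrightarrow> dfd (enc_pair t a)"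
  unfolding dfd_def using codes_macro[of "enc_pair t a" expand] by auto

lemma dfd_intros [simp]:
  "dfd g \<Longrightarrow> dfd (cNot g)" "dfd g \<Longrightarrow> dfd h \<Longrightarrow> dfd (cAnd g h)" "dfd g \<Longrightarrow> dfd h \<Longrightarrow> dfd (cOr g h)"
  "dfd cF" "dfd cT" "dfd (cLess x y)" "dfd (cMem x y)" "dfd (cBind x U c)" "dfd (cLet x a)" "dfd (cKind x p)"
  "dfd g \<Longrightarrow> dfd (cExK p x g)" "dfd (cLater x)"
  by (simp_all add: cNot_def cAnd_def cOr_def cF_def cT_def cLess_def cMem_def cBind_def cLet_def cKind_def
      cExK_def cSing_def cLater_def dfd_Nand)

abbreviation le :: "nat list \<Rightarrow> nat" where "le \<equiv> list_encode"
abbreviation leA :: "action list \<Rightarrow> nat" where "leA L \<equiv> list_encode (map enc_action L)"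

lemma action_fields [simp]:
  "del_of (enc_action \<alpha>) = enc_facts (act_Del \<alpha>)" "add_of (enc_action \<alpha>) = enc_facts (act_Add \<alpha>)"
  "lhd (enc_action \<alpha>) = le (act_u \<alpha>)" "lhd (ltl (enc_action \<alpha>)) = le (act_v \<alpha>)"
  "lhd (ltl (ltl (enc_action \<alpha>))) = enc_fol (act_Q \<alpha>)"
  by (cases \<alpha>; simp add: del_of_def add_of_def)+

lemma enc_facts_simps [simp]:
  "enc_facts [] = 0" "enc_facts (f # fs) = Suc (enc_pair (enc_pair (fst f) (le (snd f))) (enc_facts fs))"
  by (simp_all add: enc_facts_def enc_fact_def)

lemma dfd_zipsame [simp]: "dfd (enc_pair 3 (enc_pair (le cs) (le ds)))"
proof (induction cs arbitrary: ds)
  case Nil show ?case by (rule dfd_macro) (simp_all add: e_zipsame_def)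
next
  case (Cons c cs) show ?case by (rule dfd_macro) (cases ds; simp add: e_zipsame_def Cons)+
qed

lemma dfd_delfacts [simp]: "dfd (enc_pair 4 (enc_pair (enc_facts fs) (enc_pair R (le cs))))"
  by (induction fs) (rule dfd_macro; simp add: e_delfacts_def)+

lemma dfd_delacts [simp]: "dfd (enc_pair 5 (enc_pair (leA L) (enc_pair R (le cs))))"
  by (induction L) (rule dfd_macro; simp add: e_delacts_def)+

lemma dfd_persist [simp]: "dfd (cPersist (leA L) (enc_pair R (le cs)) x)"
  by (simp add: cPersist_def)

lemma dfd_zipbind [simp]: "dfd (enc_pair 6 (enc_pair (le cs) (le ds)))"
proof (induction cs arbitrary: ds)
  case Nil show ?case by (rule dfd_macro) (simp_all add: e_zipbind_def)
next
  case (Cons c cs) show ?case by (rule dfd_macro) (cases ds; simp add: e_zipbind_def Cons)+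
qed

lemma dfd_anybind [simp]: "dfd (enc_pair 7 (enc_pair (le cs) U))"
  by (induction cs) (rule dfd_macro; simp add: e_anybind_def)+

inductive isq :: "nat \<Rightarrow> bool" where
  "isq (enc_pair 0 (enc_pair R (le us)))"
| "isq (enc_pair (Suc 0) U)"

lemma dfd_query [simp]: "isq q \<Longrightarrow> dfd (cQuery q (enc_pair R (le cs)))"
  by (induction rule: isq.induct) (simp_all add: cQuery_def)

lemma dfd_addfacts [simp]: "isq q \<Longrightarrow> dfd (enc_pair 8 (enc_pair (enc_facts fs) (enc_pair (leA L) (enc_pair q x))))"
  by (induction fs) (rule dfd_macro; simp add: e_addfacts_def)+

lemma dfd_addacts [simp]: "isq q \<Longrightarrow> dfd (enc_pair 9 (enc_pair (leA M) (enc_pair (leA L) (enc_pair q x))))"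
  by (induction M) (rule dfd_macro; simp add: e_addacts_def)+

lemma dfd_fact [simp]: "isq q \<Longrightarrow> dfd (cFact (leA L) q x)"
  by (simp add: cFact_def)

lemma dfd_alive [simp]: "dfd (cAlive (leA L) U x)"
  by (simp add: cAlive_def isq.intros)

lemma dfd_fol [simp]: "dfd (enc_pair 10 (enc_pair (enc_fol q) (enc_pair (leA L) x)))"
  by (induction q) (rule dfd_macro; simp add: Let_def e_fol_def isq.intros)+

lemma dfd_allalive [simp]: "dfd (enc_pair 11 (enc_pair (le us) (enc_pair (leA L) x)))"
  by (induction us) (rule dfd_macro; simp add: e_allalive_def)+

lemma dfd_fvalive [simp]: "dfd (enc_pair 12 (enc_pair (enc_fol q) (enc_pair (leA L) x)))"
proof (induction q)
  case (FEq u v)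
  have "dfd (enc_pair 11 (enc_pair (le [u, v]) (enc_pair (leA L) x)))" by (rule dfd_allalive)
  then show ?case by (intro dfd_macro) (simp_all add: Let_def e_fvalive_def)
qed (rule dfd_macro; simp add: Let_def e_fvalive_def)+

lemma dfd_mso [simp]: "dfd (enc_pair 13 (enc_pair (enc_mso \<phi>) (leA L)))"
  by (induction \<phi>) (rule dfd_macro; simp add: Let_def e_mso_def)+

lemma dfd_newer [simp]: "dfd (enc_pair 14 (enc_pair n (enc_pair U (enc_pair (leA L) x))))"
  by (induction n arbitrary: U) (rule dfd_macro; simp add: e_newer_def)+

lemma dfd_bindall [simp]:
  "dfd (enc_pair 15 (enc_pair (le us) (enc_pair (enc_fol q) (enc_pair (leA L) (enc_pair b x)))))"
  by (induction us) (rule dfd_macro; simp add: Let_def e_bindall_def)+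

lemma dfd_news [simp]: "dfd (enc_pair 16 (enc_pair (le vs) (enc_pair P x)))"
  by (induction vs arbitrary: P) (rule dfd_macro; simp add: e_news_def)+

lemma dfd_guard [simp]: "dfd (enc_pair 17 (enc_pair (leA M) (enc_pair (leA L) b)))"
  by (induction M) (rule dfd_macro; simp add: e_guard_def Let_def)+

abbreviation init_action :: "fact list \<Rightarrow> action" where
  "init_action I \<equiv> Action [] [] (FAtom 0 []) [] I"

lemma init_code [simp]: "init_code (enc_facts I) = enc_action (init_action I)"
  by (simp add: init_code_def) (simp add: enc_pair_def prod_encode_def)

definition allacts :: "dms \<Rightarrow> action list" where
  "allacts S = init_action (dms_init S) # dms_acts S"

lemma start_enc: "start (enc_instance S \<phi> b) =
  cAnd (cValid (enc_action (init_action (dms_init S))) (leA (dms_acts S)) b)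
    (cNot (enc_pair 13 (enc_pair (enc_mso \<phi>) (leA (allacts S)))))"
  by (cases S) (simp add: start_def enc_instance_def allacts_def Let_def del: enc_action.simps)

lemma cValid_unfold: "cValid (enc_action \<alpha>) (leA L) b =
     cAnd (cAnd (cExA (av 3) cT) (cNot (cExA (av 3) (cNot (cExA (av 4) (cLess (av 3) (av 4)))))))
       (cNot (cExA (av 3) (cNot (cOr (cAnd (cNot (cLater (av 3))) (cLet (av 3) (enc_action \<alpha>)))
         (cAnd (cLater (av 3)) (enc_pair 17 (enc_pair (leA L) (enc_pair (leA (\<alpha> # L)) b))))))))"
  by (simp add: cValid_def)

lemma dfd_valid [simp]: "dfd (cValid (enc_action \<alpha>) (leA L) b)"
  unfolding cValid_unfold by (intro dfd_intros dfd_guard)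

lemma dfd_start [simp]: "dfd (start (enc_instance S \<phi> b))"
  unfolding start_enc by (intro dfd_intros dfd_valid dfd_mso)

lemma codes_unique:
  "codes ex g \<phi> \<Longrightarrow> codes ex g \<psi> \<Longrightarrow> \<phi> = \<psi>"
proof (induction arbitrary: \<psi> rule: codes.induct)
  case (codes_At m x y p)
  from this show ?case by (cases rule: codes.cases) simp_all
next
  case (codes_Nand g \<phi> h \<phi>')
  from codes_Nand.prems show ?case by (cases rule: codes.cases) (use codes_Nand.IH in auto)
next
  case (codes_Ex g \<phi> X)
  from codes_Ex.prems show ?case by (cases rule: codes.cases) (use codes_Ex.IH in auto)
next
  case (codes_macro g \<phi>)
  from codes_macro.prems show ?case
    by (cases rule: codes.cases) (use codes_macro.IH codes_macro.hyps(1) in auto)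
qed

subsection \<open>Meaning of the formula codes\<close>

lemma enc_fol_inject: "enc_fol p = enc_fol q \<Longrightarrow> p = q"
proof (induction p arbitrary: q)
  case (FAtom r xs) then show ?case by (cases q) (simp_all add: list_encode_eq)
next
  case (FEq x y) then show ?case by (cases q) simp_all
next
  case (FNot p) then show ?case by (cases q) simp_all
next
  case (FAnd p1 p2) then show ?case by (cases q) simp_all
next
  case (FEx x p) then show ?case by (cases q) simp_all
qed

lemma enc_facts_inject: "enc_facts fs = enc_facts gs \<Longrightarrow> fs = gs"
proof (induction fs arbitrary: gs)
  case Nil then show ?case by (cases gs) simp_all
next
  case (Cons f fs) then show ?case by (cases gs) (simp_all add: prod_eq_iff list_encode_eq)
qed

text \<open>An occurrence of an action letter carries only a code; injectivity recovers the action
  from it.\<close>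

lemma enc_action_inject: "enc_action \<alpha> = enc_action \<beta> \<longleftrightarrow> \<alpha> = \<beta>"
  by (cases \<alpha>; cases \<beta>) (auto simp: list_encode_eq dest: enc_fol_inject enc_facts_inject)

primrec chainlt :: "nat set \<Rightarrow> (nat \<Rightarrow> nat) \<Rightarrow> nat \<Rightarrow> nat list \<Rightarrow> bool" where
  "chainlt N f e [] \<longleftrightarrow> True"
| "chainlt N f e (v # vs) \<longleftrightarrow> e < f v \<and> f v \<in> N \<and> chainlt N f (f v) vs"

lemma chainlt_iff: "chainlt N f e vs \<longleftrightarrow> sorted_wrt (<) (e # map f vs) \<and> f ` set vs \<subseteq> N"
proof (induction vs arbitrary: e)
  case (Cons v vs)
  then show ?case by (auto dest: less_trans)
qed simp

text \<open>\<open>A\<close> are the positions of actions and \<open>N\<close> the created elements; both are identifiers and share one linear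
  order.\<close>

locale trace =
  fixes K :: nat and A N :: "nat set" and act :: "nat \<Rightarrow> nat" and reg :: "nat \<Rightarrow> nat \<Rightarrow> nat"
    and ev :: "nat \<Rightarrow> (nat \<Rightarrow> nat set) \<Rightarrow> bool"
  assumes disj: "A \<inter> N = {}" and zero: "0 \<notin> A \<union> N"
    and ev_Nand: "\<And>g h \<beta>. dfd g \<Longrightarrow> dfd h \<Longrightarrow> ev (cNand g h) \<beta> \<longleftrightarrow> \<not> (ev g \<beta> \<and> ev h \<beta>)"
    and ev_Ex: "\<And>X g \<beta>. dfd g \<Longrightarrow> ev (cEx X g) \<beta> \<longleftrightarrow> (\<exists>S\<subseteq>A \<union> N. ev g (\<beta>(X := S)))"
    and ev_macro: "\<And>t a \<beta>. 3 \<le> t \<Longrightarrow> ev (enc_pair t a) \<beta> \<longleftrightarrow> ev (expand (enc_pair t a)) \<beta>"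
    and ev_F: "\<And>\<beta>. \<not> ev cF \<beta>"
    and ev_Less: "\<And>x y \<beta>. 0 \<notin> \<beta> y \<Longrightarrow> ev (cLess x y) \<beta> \<longleftrightarrow> (\<exists>i\<in>A \<union> N. \<exists>j\<in>A \<union> N. i \<in> \<beta> x \<and> j \<in> \<beta> y \<and> i < j)"
    and ev_Mem: "\<And>x y \<beta>. 0 \<notin> \<beta> y \<Longrightarrow> ev (cMem x y) \<beta> \<longleftrightarrow> (\<exists>i\<in>A \<union> N. i \<in> \<beta> x \<and> i \<in> \<beta> y)"
    and ev_Bind: "\<And>x U c \<beta>. 0 \<notin> \<beta> U \<Longrightarrow> c + 3 < K \<Longrightarrow>
      ev (cBind x U c) \<beta> \<longleftrightarrow> (\<exists>i\<in>A. i \<in> \<beta> x \<and> reg i (c + 3) \<in> \<beta> U)"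
    and ev_Let: "\<And>x a \<beta>. 0 \<notin> \<beta> 0 \<Longrightarrow> ev (cLet x a) \<beta> \<longleftrightarrow> (\<exists>i\<in>A. i \<in> \<beta> x \<and> act i = a)"
    and ev_KindD: "\<And>x \<beta>. 0 \<notin> \<beta> 0 \<Longrightarrow> ev (cKind x 0) \<beta> \<longleftrightarrow> (\<exists>i\<in>N. i \<in> \<beta> x)"
    and ev_KindA: "\<And>x \<beta>. 0 \<notin> \<beta> 0 \<Longrightarrow> ev (cKind x (Suc 0)) \<beta> \<longleftrightarrow> (\<exists>i\<in>A. i \<in> \<beta> x)"
begin

definition bd :: "(nat \<Rightarrow> nat set) \<Rightarrow> bool" where "bd \<beta> \<longleftrightarrow> (\<forall>v. \<beta> v \<subseteq> A \<union> N)"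

lemma bd_zero: "bd \<beta> \<Longrightarrow> 0 \<notin> \<beta> v"
  using zero unfolding bd_def by blast

lemma bd_upd [simp]: "bd \<beta> \<Longrightarrow> S \<subseteq> A \<union> N \<Longrightarrow> bd (\<beta>(v := S))"
  unfolding bd_def by simp

lemma bd_updD [simp]: "bd \<beta> \<Longrightarrow> u \<in> N \<Longrightarrow> bd (\<beta>(v := {u}))"
  and bd_updA [simp]: "bd \<beta> \<Longrightarrow> i \<in> A \<Longrightarrow> bd (\<beta>(v := {i}))"
  by simp_all

lemma ev_Not [simp]: "dfd g \<Longrightarrow> ev (cNot g) \<beta> \<longleftrightarrow> \<not> ev g \<beta>"
  by (simp add: cNot_def ev_Nand)

lemma ev_And [simp]: "dfd g \<Longrightarrow> dfd h \<Longrightarrow> ev (cAnd g h) \<beta> \<longleftrightarrow> ev g \<beta> \<and> ev h \<beta>"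
  by (simp add: cAnd_def ev_Nand dfd_Nand)

lemma ev_Or [simp]: "dfd g \<Longrightarrow> dfd h \<Longrightarrow> ev (cOr g h) \<beta> \<longleftrightarrow> ev g \<beta> \<or> ev h \<beta>"
  by (simp add: cOr_def ev_Nand)

lemma ev_T [simp]: "ev cT \<beta>" and ev_F' [simp]: "\<not> ev cF \<beta>"
  by (simp_all add: cT_def ev_F)

lemma ev_less [simp]:
  "bd \<beta> \<Longrightarrow> \<beta> x = {i} \<Longrightarrow> \<beta> y = {j} \<Longrightarrow> ev (cLess x y) \<beta> \<longleftrightarrow> i < j"
  using ev_Less[where \<beta>=\<beta> and x=x and y=y] bd_zero[of \<beta> y] unfolding bd_def by auto

lemma ev_mem: "bd \<beta> \<Longrightarrow> ev (cMem x y) \<beta> \<longleftrightarrow> \<beta> x \<inter> \<beta> y \<noteq> {}"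
  using ev_Mem[where \<beta>=\<beta> and x=x and y=y] bd_zero[of \<beta> y] unfolding bd_def by auto

lemma ev_bind: "bd \<beta> \<Longrightarrow> \<beta> x = {i} \<Longrightarrow> i \<in> A \<Longrightarrow> c + 3 < K \<Longrightarrow>
    ev (cBind x U c) \<beta> \<longleftrightarrow> reg i (c + 3) \<in> \<beta> U"
  using ev_Bind[where \<beta>=\<beta> and x=x and U=U and c=c] bd_zero[of \<beta> U] by auto

lemma ev_let [simp]: "bd \<beta> \<Longrightarrow> \<beta> x = {i} \<Longrightarrow> i \<in> A \<Longrightarrow> ev (cLet x a) \<beta> \<longleftrightarrow> act i = a"
  using ev_Let[where \<beta>=\<beta> and x=x and a=a] bd_zero[of \<beta> 0] by auto

lemma ev_sing:
  assumes "bd \<beta>" shows "ev (cSing x) \<beta> \<longleftrightarrow> (\<exists>i\<in>A \<union> N. \<beta> x = {i})"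
proof -
  have "\<beta> x \<subseteq> A \<union> N" using assms by (simp add: bd_def)
  then have "ev (cSing x) \<beta> \<longleftrightarrow> \<beta> x \<noteq> {} \<and> \<not> (\<exists>i\<in>\<beta> x. \<exists>j\<in>\<beta> x. i < j)"
    unfolding cSing_def using ev_Less[where \<beta>=\<beta> and x=x and y=x] bd_zero[OF assms, of x] ev_mem[OF assms, of x x] by auto
  also have "\<dots> \<longleftrightarrow> (\<exists>i. \<beta> x = {i})" by (auto, metis linorder_less_linear singletonI subsetI subset_singletonD empty_iff)
  finally show ?thesis using \<open>\<beta> x \<subseteq> A \<union> N\<close> by auto
qed

lemma ev_ExK:
  assumes "dfd g" "bd \<beta>" "M \<subseteq> A \<union> N" "\<And>\<gamma>. bd \<gamma> \<Longrightarrow> ev (cKind x p) \<gamma> \<longleftrightarrow> (\<exists>i\<in>M. i \<in> \<gamma> x)"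
  shows "ev (cExK p x g) \<beta> \<longleftrightarrow> (\<exists>i\<in>M. ev g (\<beta>(x := {i})))"
proof -
  have d: "dfd (cSing x)" by (simp add: cSing_def)
  have step: "ev (cAnd (cSing x) (cAnd (cKind x p) g)) (\<beta>(x := S)) \<longleftrightarrow>
      (\<exists>i\<in>A \<union> N. S = {i}) \<and> (\<exists>i\<in>M. i \<in> S) \<and> ev g (\<beta>(x := S))" if "S \<subseteq> A \<union> N" for S
    using ev_sing[of "\<beta>(x := S)" x] assms(4)[of "\<beta>(x := S)"] bd_upd[OF assms(2) that] d assms(1) by simp
  have "dfd (cAnd (cSing x) (cAnd (cKind x p) g))" using d assms(1) by simp
  from ev_Ex[OF this] have "ev (cExK p x g) \<beta> \<longleftrightarrow>
      (\<exists>S\<subseteq>A \<union> N. ev (cAnd (cSing x) (cAnd (cKind x p) g)) (\<beta>(x := S)))"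
    unfolding cExK_def .
  also have "\<dots> \<longleftrightarrow> (\<exists>S\<subseteq>A \<union> N. (\<exists>i\<in>A \<union> N. S = {i}) \<and> (\<exists>i\<in>M. i \<in> S) \<and> ev g (\<beta>(x := S)))"
    by (intro iff_exI conj_cong refl step)
  also have "\<dots> \<longleftrightarrow> (\<exists>i\<in>M. ev g (\<beta>(x := {i})))" (is "?L \<longleftrightarrow> ?R")
  proof
    assume ?L
    then obtain S i j where "S = {i}" "j \<in> M" "j \<in> S" "ev g (\<beta>(x := S))" by blast
    then show ?R by (intro bexI[of _ i]) simp_all
  next
    assume ?R
    then obtain i where i: "i \<in> M" "ev g (\<beta>(x := {i}))" by blast
    then show ?L using assms(3) by (intro exI[of _ "{i}"]) blast
  qed
  finally show ?thesis .
qed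

lemma ev_ExD [simp]:
  assumes "dfd g" "bd \<beta>" shows "ev (cExD x g) \<beta> \<longleftrightarrow> (\<exists>u\<in>N. ev g (\<beta>(x := {u})))"
  by (rule ev_ExK[OF assms]) (use bd_zero ev_KindD in auto)

lemma ev_ExA [simp]:
  assumes "dfd g" "bd \<beta>" shows "ev (cExA x g) \<beta> \<longleftrightarrow> (\<exists>i\<in>A. ev g (\<beta>(x := {i})))"
  by (rule ev_ExK[OF assms]) (use bd_zero ev_KindA in auto)

section \<open>Facts expressed by addition and later deletion\<close>

definition rg :: "nat \<Rightarrow> nat \<Rightarrow> nat" where "rg i c = reg i (c + 3)"
definition inst :: "nat \<Rightarrow> fact \<Rightarrow> fact" where "inst i f = (fst f, map (rg i) (snd f))"

definition deletes :: "action list \<Rightarrow> nat \<Rightarrow> fact \<Rightarrow> bool" where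
  "deletes L z f \<longleftrightarrow> (\<exists>\<alpha>\<in>set L. act z = enc_action \<alpha> \<and> f \<in> inst z ` set (act_Del \<alpha>))"

definition adds :: "action list \<Rightarrow> nat \<Rightarrow> fact \<Rightarrow> bool" where
  "adds L z f \<longleftrightarrow> (\<exists>\<alpha>\<in>set L. act z = enc_action \<alpha> \<and> f \<in> inst z ` set (act_Add \<alpha>))"

text \<open>The instance in which the action at \<open>i\<close> is performed, defined without
  recursion over the steps so that MSO can express it. Only strictly later deletions count, since an
  action adds after it deletes.\<close>

definition Fat :: "action list \<Rightarrow> nat \<Rightarrow> fact set" where
  "Fat L i = {f. \<exists>y\<in>A. y < i \<and> adds L y f \<and> (\<forall>z\<in>A. y < z \<and> z < i \<longrightarrow> \<not> deletes L z f)}"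

text \<open>A register may still contain the initial 0, which no variable can denote; comparisons of
  arguments through common elements are correct only when the registers involved hold created
  elements.\<close>

definition defined_regs :: "action list \<Rightarrow> bool" where
  "defined_regs L \<longleftrightarrow> (\<forall>i\<in>A. \<forall>\<alpha>\<in>set L. act i = enc_action \<alpha> \<longrightarrow>
     (\<forall>f\<in>set (act_Add \<alpha>) \<union> set (act_Del \<alpha>). \<forall>c\<in>set (snd f). c + 3 < K \<and> rg i c \<in> N))"

lemma ev_zipsame:
  assumes "bd \<beta>" "\<beta> (av 0) = {y}" "\<beta> (av 1) = {z}" "y \<in> A" "z \<in> A"
    "\<forall>c\<in>set cs. c + 3 < K \<and> rg y c \<in> N" "\<forall>c\<in>set ds. c + 3 < K \<and> rg z c \<in> N"
  shows "ev (enc_pair 3 (enc_pair (le cs) (le ds))) \<beta> \<longleftrightarrow> map (rg y) cs = map (rg z) ds"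
  using assms(6,7)
proof (induction cs arbitrary: ds)
  case (Nil ds) show ?case by (subst ev_macro, simp) (cases ds; simp add: e_zipsame_def)
next
  case (Cons c cs ds)
  show ?case
  proof (cases ds)
    case Nil then show ?thesis by (subst ev_macro) (simp_all add: e_zipsame_def)
  next
    case D: (Cons d ds')
    have s: "ev (cExD (av 2) (cAnd (cBind (av 0) (av 2) c) (cBind (av (Suc 0)) (av 2) d))) \<beta> \<longleftrightarrow> rg y c = rg z d"
      using assms(1-5) Cons.prems D by (auto simp: ev_bind rg_def)
    show ?thesis using Cons D by (subst ev_macro) (simp_all add: e_zipsame_def s)
  qed
qed

lemma ev_delfacts:
  assumes "bd \<beta>" "\<beta> (av 0) = {y}" "\<beta> (av 1) = {z}" "y \<in> A" "z \<in> A"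
    "\<forall>c\<in>set cs. c + 3 < K \<and> rg y c \<in> N" "\<forall>g\<in>set fs. \<forall>c\<in>set (snd g). c + 3 < K \<and> rg z c \<in> N"
  shows "ev (enc_pair 4 (enc_pair (enc_facts fs) (enc_pair R (le cs)))) \<beta> \<longleftrightarrow> inst y (R, cs) \<in> inst z ` set fs"
  using assms(7)
proof (induction fs)
  case Nil then show ?case by (subst ev_macro) (simp_all add: e_delfacts_def)
next
  case (Cons f fs)
  have "ev (enc_pair 3 (enc_pair (le cs) (le (snd f)))) \<beta> \<longleftrightarrow> map (rg y) cs = map (rg z) (snd f)"
    using Cons.prems by (intro ev_zipsame assms(1-6)) simp
  then show ?case using Cons by (subst ev_macro) (auto simp: e_delfacts_def inst_def)
qed

lemma ev_delacts:
  assumes "bd \<beta>" "\<beta> (av 0) = {y}" "\<beta> (av 1) = {z}" "y \<in> A" "z \<in> A"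
    "\<forall>c\<in>set cs. c + 3 < K \<and> rg y c \<in> N" "defined_regs L"
  shows "ev (enc_pair 5 (enc_pair (leA L) (enc_pair R (le cs)))) \<beta> \<longleftrightarrow> deletes L z (inst y (R, cs))"
  using assms(7)
proof (induction L)
  case Nil then show ?case by (subst ev_macro) (simp_all add: e_delacts_def deletes_def)
next
  case (Cons a L)
  have IH: "ev (enc_pair 5 (enc_pair (leA L) (enc_pair R (le cs)))) \<beta> \<longleftrightarrow> deletes L z (inst y (R, cs))"
    using Cons by (simp add: defined_regs_def)
  have "act z = enc_action a \<Longrightarrow>
     ev (enc_pair 4 (enc_pair (enc_facts (act_Del a)) (enc_pair R (le cs)))) \<beta> \<longleftrightarrow> inst y (R, cs) \<in> inst z ` set (act_Del a)"
    using Cons.prems assms(5) by (intro ev_delfacts assms(1-6)) (auto simp: defined_regs_def)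
  then show ?case using IH assms(1,3,5)
    by (subst ev_macro) (auto simp: e_delacts_def deletes_def)
qed

lemma ev_persist:
  assumes "bd \<beta>" "\<beta> (av 0) = {y}" "\<beta> x = {i}" "x \<noteq> av 1" "y \<in> A" "i \<in> A"
    "\<forall>c\<in>set cs. c + 3 < K \<and> rg y c \<in> N" "defined_regs L"
  shows "ev (cPersist (leA L) (enc_pair R (le cs)) x) \<beta> \<longleftrightarrow>
    (\<forall>z\<in>A. y < z \<and> z < i \<longrightarrow> \<not> deletes L z (inst y (R, cs)))"
proof -
  have "ev (enc_pair 5 (enc_pair (leA L) (enc_pair R (le cs)))) (\<beta>(av 1 := {z})) \<longleftrightarrow> deletes L z (inst y (R, cs))"
    if "z \<in> A" for z using assms that by (intro ev_delacts) simp_all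
  then show ?thesis using assms(1-6) by (auto simp: cPersist_def)
qed

lemma ev_zipbind:
  assumes "bd \<beta>" "\<beta> (av 0) = {y}" "y \<in> A" "\<forall>c\<in>set cs. c + 3 < K"
  shows "ev (enc_pair 6 (enc_pair (le cs) (le us))) \<beta> \<longleftrightarrow> list_all2 (\<lambda>c u. rg y c \<in> \<beta> (dv u)) cs us"
  using assms(4)
proof (induction cs arbitrary: us)
  case (Nil us) show ?case by (subst ev_macro, simp) (cases us; simp add: e_zipbind_def)
next
  case (Cons c cs us)
  then show ?case using assms(1-3)
    by (subst ev_macro, simp) (cases us; simp add: e_zipbind_def ev_bind rg_def)
qed

lemma ev_anybind:
  assumes "bd \<beta>" "\<beta> (av 0) = {y}" "y \<in> A" "\<forall>c\<in>set cs. c + 3 < K"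
  shows "ev (enc_pair 7 (enc_pair (le cs) U)) \<beta> \<longleftrightarrow> (\<exists>c\<in>set cs. rg y c \<in> \<beta> U)"
  using assms(4)
proof (induction cs)
  case Nil then show ?case by (subst ev_macro) (simp_all add: e_anybind_def)
next
  case (Cons c cs)
  then show ?case using assms(1-3) by (subst ev_macro) (simp_all add: e_anybind_def ev_bind rg_def)
qed

lemma ev_addfacts:
  assumes q: "isq q" and b: "bd \<beta>" "\<beta> (av 0) = {y}" "\<beta> x = {i}" "x \<noteq> av 1" "y \<in> A" "i \<in> A" "defined_regs L"
    and Q: "\<And>R cs. \<forall>c\<in>set cs. c + 3 < K \<Longrightarrow> ev (cQuery q (enc_pair R (le cs))) \<beta> \<longleftrightarrow> P (inst y (R, cs))"
    and fs: "\<forall>g\<in>set fs. \<forall>c\<in>set (snd g). c + 3 < K \<and> rg y c \<in> N"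
  shows "ev (enc_pair 8 (enc_pair (enc_facts fs) (enc_pair (leA L) (enc_pair q x)))) \<beta> \<longleftrightarrow>
    (\<exists>f\<in>inst y ` set fs. P f \<and> (\<forall>z\<in>A. y < z \<and> z < i \<longrightarrow> \<not> deletes L z f))"
  using fs
proof (induction fs)
  case Nil then show ?case by (subst ev_macro) (simp_all add: e_addfacts_def)
next
  case (Cons f fs)
  have p: "ev (cPersist (leA L) (enc_pair (fst f) (le (snd f))) x) \<beta> \<longleftrightarrow>
    (\<forall>z\<in>A. y < z \<and> z < i \<longrightarrow> \<not> deletes L z (inst y f))"
    using ev_persist[OF b(1-6) _ b(7), of "snd f" "fst f"] Cons.prems by simp
  have "ev (cQuery q (enc_pair (fst f) (le (snd f)))) \<beta> \<longleftrightarrow> P (inst y f)"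
    using Q[of "snd f" "fst f"] Cons.prems by simp
  then show ?case using Cons q p by (subst ev_macro) (simp_all add: e_addfacts_def)
qed

lemma ev_addacts:
  assumes q: "isq q" and b: "bd \<beta>" "\<beta> (av 0) = {y}" "\<beta> x = {i}" "x \<noteq> av 1" "y \<in> A" "i \<in> A" "defined_regs L"
    and Q: "\<And>R cs. \<forall>c\<in>set cs. c + 3 < K \<Longrightarrow> ev (cQuery q (enc_pair R (le cs))) \<beta> \<longleftrightarrow> P (inst y (R, cs))"
    and M: "set M \<subseteq> set L"
  shows "ev (enc_pair 9 (enc_pair (leA M) (enc_pair (leA L) (enc_pair q x)))) \<beta> \<longleftrightarrow>
    (\<exists>f. adds M y f \<and> P f \<and> (\<forall>z\<in>A. y < z \<and> z < i \<longrightarrow> \<not> deletes L z f))"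
  using M
proof (induction M)
  case Nil then show ?case by (subst ev_macro) (simp_all add: e_addacts_def adds_def)
next
  case (Cons a M)
  have "act y = enc_action a \<Longrightarrow>
    ev (enc_pair 8 (enc_pair (enc_facts (act_Add a)) (enc_pair (leA L) (enc_pair q x)))) \<beta> \<longleftrightarrow>
    (\<exists>f\<in>inst y ` set (act_Add a). P f \<and> (\<forall>z\<in>A. y < z \<and> z < i \<longrightarrow> \<not> deletes L z f))"
    using Cons.prems b(5,7) by (intro ev_addfacts[OF q b Q]) (auto simp: defined_regs_def)
  moreover have "adds (a # M) y f \<longleftrightarrow> (act y = enc_action a \<and> f \<in> inst y ` set (act_Add a)) \<or> adds M y f" for f
    by (auto simp: adds_def)
  moreover have "ev (enc_pair 9 (enc_pair (leA M) (enc_pair (leA L) (enc_pair q x)))) \<beta> \<longleftrightarrow>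
    (\<exists>f. adds M y f \<and> P f \<and> (\<forall>z\<in>A. y < z \<and> z < i \<longrightarrow> \<not> deletes L z f))"
    using Cons by simp
  moreover have "ev (enc_pair 9 (enc_pair (leA (a # M)) (enc_pair (leA L) (enc_pair q x)))) \<beta> \<longleftrightarrow>
      (act y = enc_action a \<and> ev (enc_pair 8 (enc_pair (enc_facts (act_Add a)) (enc_pair (leA L) (enc_pair q x)))) \<beta>)
      \<or> ev (enc_pair 9 (enc_pair (leA M) (enc_pair (leA L) (enc_pair q x)))) \<beta>"
    using q b(1,2,5) by (subst ev_macro) (simp_all add: e_addacts_def)
  ultimately show ?case by blast
qed

text \<open>The predicate \<open>P\<close> covers both kinds of query. The last hypothesis ranges
  over \<open>y\<close> because a query is read with the registers of the action that adds the
  fact.\<close>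

lemma ev_fact:
  assumes q: "isq q" and b: "bd \<beta>" "\<beta> x = {i}" "x \<noteq> av 0" "x \<noteq> av 1" "i \<in> A" "defined_regs L"
    and Q: "\<And>R cs y. y \<in> A \<Longrightarrow> \<forall>c\<in>set cs. c + 3 < K \<Longrightarrow>
      ev (cQuery q (enc_pair R (le cs))) (\<beta>(av 0 := {y})) \<longleftrightarrow> P (inst y (R, cs))"
  shows "ev (cFact (leA L) q x) \<beta> \<longleftrightarrow> (\<exists>f\<in>Fat L i. P f)"
proof -
  have "ev (enc_pair 9 (enc_pair (leA L) (enc_pair (leA L) (enc_pair q x)))) (\<beta>(av 0 := {y})) \<longleftrightarrow>
    (\<exists>f. adds L y f \<and> P f \<and> (\<forall>z\<in>A. y < z \<and> z < i \<longrightarrow> \<not> deletes L z f))" if "y \<in> A" for y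
    using b that by (intro ev_addacts[OF q]) (simp_all add: Q)
  then show ?thesis using q b unfolding cFact_def Fat_def by auto
qed

lemma ev_alive:
  assumes "bd \<beta>" "\<beta> x = {i}" "x \<noteq> av 0" "x \<noteq> av 1" "i \<in> A" "defined_regs L" "U \<noteq> av 0"
  shows "ev (cAlive (leA L) U x) \<beta> \<longleftrightarrow> \<beta> U \<inter> adom (Fat L i) \<noteq> {}"
proof -
  have "ev (cAlive (leA L) U x) \<beta> \<longleftrightarrow> (\<exists>f\<in>Fat L i. \<exists>e\<in>set (snd f). e \<in> \<beta> U)"
    unfolding cAlive_def
  proof (rule ev_fact[OF _ assms(1-6)])
    show "isq (enc_pair 1 U)" using isq.intros(2) by simp
    fix R cs y assume "y \<in> A" "\<forall>c\<in>set cs. c + 3 < K"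
    then have "ev (enc_pair 7 (enc_pair (le cs) U)) (\<beta>(av 0 := {y})) \<longleftrightarrow> (\<exists>c\<in>set cs. rg y c \<in> (\<beta>(av 0 := {y})) U)"
      by (intro ev_anybind) (simp_all add: assms(1))
    then show "ev (cQuery (enc_pair 1 U) (enc_pair R (le cs))) (\<beta>(av 0 := {y})) \<longleftrightarrow>
        (\<exists>e\<in>set (snd (inst y (R, cs))). e \<in> \<beta> U)"
      using assms(7) by (simp add: cQuery_def inst_def)
  qed
  then show ?thesis by (auto simp: adom_def)
qed

lemma ev_alive1 [simp]:
  assumes "bd \<beta>" "\<beta> x = {i}" "x \<noteq> av 0" "x \<noteq> av 1" "i \<in> A" "defined_regs L" "U \<noteq> av 0" "\<beta> U = {u}"
  shows "ev (cAlive (leA L) U x) \<beta> \<longleftrightarrow> u \<in> adom (Fat L i)"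
  using ev_alive[OF assms(1-7)] assms(8) by simp

lemma ev_holds:
  assumes "bd \<beta>" "\<beta> x = {i}" "x \<noteq> av 0" "x \<noteq> av 1" "i \<in> A" "defined_regs L" "\<forall>u\<in>set us. \<beta> (dv u) = {d u}"
  shows "ev (cFact (leA L) (enc_pair 0 (enc_pair R (le us))) x) \<beta> \<longleftrightarrow> (R, map d us) \<in> Fat L i"
proof -
  have "ev (cFact (leA L) (enc_pair 0 (enc_pair R (le us))) x) \<beta> \<longleftrightarrow> (\<exists>f\<in>Fat L i. f = (R, map d us))"
  proof (rule ev_fact[OF _ assms(1-6)])
    show "isq (enc_pair 0 (enc_pair R (le us)))" by (rule isq.intros)
    fix R' cs y assume y: "y \<in> A" "\<forall>c\<in>set cs. c + 3 < K"
    then have "ev (enc_pair 6 (enc_pair (le cs) (le us))) (\<beta>(av 0 := {y})) \<longleftrightarrow>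
        list_all2 (\<lambda>c u. rg y c \<in> (\<beta>(av 0 := {y})) (dv u)) cs us"
      by (intro ev_zipbind) (simp_all add: assms(1))
    also have "\<dots> \<longleftrightarrow> map (rg y) cs = map d us"
      using assms(7) by (auto simp: list_all2_conv_all_nth list_eq_iff_nth_eq)
    finally show "ev (cQuery (enc_pair 0 (enc_pair R (le us))) (enc_pair R' (le cs))) (\<beta>(av 0 := {y})) \<longleftrightarrow>
        inst y (R', cs) = (R, map d us)"
      by (simp add: cQuery_def inst_def)
  qed
  then show ?thesis by simp
qed

lemma adom_Fat: "defined_regs L \<Longrightarrow> adom (Fat L i) \<subseteq> N"
proof
  fix e assume D: "defined_regs L" and "e \<in> adom (Fat L i)"
  then obtain f where f: "f \<in> Fat L i" "e \<in> set (snd f)" by (auto simp: adom_def)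
  then obtain y where y: "y \<in> A" "adds L y f" by (auto simp: Fat_def)
  then obtain \<alpha> g where "\<alpha> \<in> set L" "act y = enc_action \<alpha>" "g \<in> set (act_Add \<alpha>)" "f = inst y g"
    by (auto simp: adds_def)
  then show "e \<in> N" using f(2) y(1) D by (auto simp: defined_regs_def inst_def)
qed

lemma finite_Fat: "finite (Fat L i)"
proof -
  have "Fat L i \<subseteq> (\<Union>y\<in>{..<i}. \<Union>\<alpha>\<in>set L. inst y ` set (act_Add \<alpha>))"
    unfolding Fat_def adds_def by auto
  then show ?thesis by (rule finite_subset) auto
qed

lemma finite_adom_Fat: "finite (adom (Fat L i))"
  unfolding adom_def using finite_Fat by auto

lemma ev_fol:
  assumes "bd \<beta>" "\<beta> x = {i}" "x \<noteq> av 0" "x \<noteq> av 1" "\<And>u. x \<noteq> dv u" "i \<in> A" "defined_regs L"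
    "\<forall>u\<in>fv_fol q. \<beta> (dv u) = {d u}"
  shows "ev (enc_pair 10 (enc_pair (enc_fol q) (enc_pair (leA L) x))) \<beta> \<longleftrightarrow> fol_sat (Fat L i) d q"
  using assms(1,2,8)
proof (induction q arbitrary: \<beta> d)
  case (FAtom R us)
  then have "ev (cFact (leA L) (enc_pair 0 (enc_pair R (le us))) x) \<beta> \<longleftrightarrow> (R, map d us) \<in> Fat L i"
    using assms(3-7) by (intro ev_holds) simp_all
  then show ?case by (subst ev_macro) (simp_all add: e_fol_def Let_def)
next
  case (FEq u v)
  then show ?case by (subst ev_macro) (auto simp: e_fol_def Let_def ev_mem)
next
  case (FNot q)
  then show ?case by (subst ev_macro) (simp_all add: e_fol_def Let_def)
next
  case (FAnd q1 q2)
  have "ev (enc_pair 10 (enc_pair (enc_fol q1) (enc_pair (leA L) x))) \<beta> \<longleftrightarrow> fol_sat (Fat L i) d q1"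
    by (rule FAnd.IH(1)) (use FAnd.prems in simp_all)
  moreover have "ev (enc_pair 10 (enc_pair (enc_fol q2) (enc_pair (leA L) x))) \<beta> \<longleftrightarrow> fol_sat (Fat L i) d q2"
    by (rule FAnd.IH(2)) (use FAnd.prems in simp_all)
  ultimately show ?case by (subst ev_macro) (simp_all add: e_fol_def Let_def)
next
  case (FEx u q)
  have IH: "ev (enc_pair 10 (enc_pair (enc_fol q) (enc_pair (leA L) x))) (\<beta>(dv u := {e})) \<longleftrightarrow>
      fol_sat (Fat L i) (d(u := e)) q" if "e \<in> N" for e
    using FEx.prems assms(5) by (intro FEx.IH bd_updD[OF FEx.prems(1) that]) simp_all
  have al: "ev (cAlive (leA L) (dv u) x) (\<beta>(dv u := {e})) \<longleftrightarrow> e \<in> adom (Fat L i)" if "e \<in> N" for e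
    using FEx.prems assms(3-7) that by (intro ev_alive1) simp_all
  have "ev (enc_pair 10 (enc_pair (enc_fol (FEx u q)) (enc_pair (leA L) x))) \<beta> \<longleftrightarrow>
      (\<exists>e\<in>N. e \<in> adom (Fat L i) \<and> fol_sat (Fat L i) (d(u := e)) q)"
    using FEx.prems by (subst ev_macro) (simp_all add: e_fol_def Let_def IH al cong: bex_cong)
  then show ?case using adom_Fat[OF assms(7)] by auto
qed

lemma ev_allalive:
  assumes "bd \<beta>" "\<beta> x = {i}" "x \<noteq> av 0" "x \<noteq> av 1" "i \<in> A" "defined_regs L"
  shows "ev (enc_pair 11 (enc_pair (le us) (enc_pair (leA L) x))) \<beta> \<longleftrightarrow>
    (\<forall>u\<in>set us. \<beta> (dv u) = {} \<or> \<beta> (dv u) \<inter> adom (Fat L i) \<noteq> {})"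
proof (induction us)
  case Nil show ?case by (subst ev_macro) (simp_all add: e_allalive_def)
next
  case (Cons u us)
  have "ev (cAlive (leA L) (dv u) x) \<beta> \<longleftrightarrow> \<beta> (dv u) \<inter> adom (Fat L i) \<noteq> {}"
    using assms by (intro ev_alive) simp_all
  with Cons show ?case using assms(1) by (subst ev_macro) (simp_all add: e_allalive_def ev_mem)
qed

lemma ev_fvalive:
  assumes "bd \<beta>" "\<beta> x = {i}" "x \<noteq> av 0" "x \<noteq> av 1" "\<And>u. x \<noteq> dv u" "i \<in> A" "defined_regs L"
  shows "ev (enc_pair 12 (enc_pair (enc_fol q) (enc_pair (leA L) x))) \<beta> \<longleftrightarrow>
    (\<forall>u\<in>fv_fol q. \<beta> (dv u) = {} \<or> \<beta> (dv u) \<inter> adom (Fat L i) \<noteq> {})"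
  using assms(1,2)
proof (induction q arbitrary: \<beta>)
  case (FAtom R us)
  then show ?case using ev_allalive[OF FAtom assms(3,4,6,7), of us]
    by (subst ev_macro) (simp_all add: e_fvalive_def Let_def)
next
  case (FEq u v)
  then show ?case using ev_allalive[OF FEq assms(3,4,6,7), of "[u, v]"]
    by (subst ev_macro) (simp_all add: e_fvalive_def Let_def)
next
  case (FNot q)
  then show ?case by (subst ev_macro) (simp_all add: e_fvalive_def Let_def)
next
  case (FAnd q1 q2)
  then show ?case by (subst ev_macro) (auto simp: e_fvalive_def Let_def)
next
  case (FEx u q)
  let ?ok = "\<lambda>\<beta> v. \<beta> (dv v) = {} \<or> \<beta> (dv v) \<inter> adom (Fat L i) \<noteq> {}"
  have IH: "ev (enc_pair 12 (enc_pair (enc_fol q) (enc_pair (leA L) x))) (\<beta>(dv u := S)) \<longleftrightarrow>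
      (\<forall>v\<in>fv_fol q. ?ok (\<beta>(dv u := S)) v)" if "S \<subseteq> A \<union> N" for S
    using FEx.prems assms(5) by (intro FEx.IH bd_upd[OF FEx.prems(1) that]) simp_all
  have "ev (enc_pair 12 (enc_pair (enc_fol (FEx u q)) (enc_pair (leA L) x))) \<beta> \<longleftrightarrow>
      (\<exists>S\<subseteq>A \<union> N. \<forall>v\<in>fv_fol q. ?ok (\<beta>(dv u := S)) v)"
    using FEx.prems by (subst ev_macro) (simp_all add: e_fvalive_def Let_def ev_Ex IH cong: conj_cong)
  also have "\<dots> \<longleftrightarrow> (\<forall>v\<in>fv_fol q - {u}. ?ok \<beta> v)"
  proof
    assume "\<exists>S\<subseteq>A \<union> N. \<forall>v\<in>fv_fol q. ?ok (\<beta>(dv u := S)) v"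
    then show "\<forall>v\<in>fv_fol q - {u}. ?ok \<beta> v" by fastforce
  next
    assume "\<forall>v\<in>fv_fol q - {u}. ?ok \<beta> v"
    then show "\<exists>S\<subseteq>A \<union> N. \<forall>v\<in>fv_fol q. ?ok (\<beta>(dv u := S)) v" by (intro exI[of _ "{}"]) auto
  qed
  finally show ?case by simp
qed

lemma ev_later [simp]:
  "bd \<beta> \<Longrightarrow> \<beta> x = {i} \<Longrightarrow> x \<noteq> av 0 \<Longrightarrow> i \<in> A \<Longrightarrow> ev (cLater x) \<beta> \<longleftrightarrow> (\<exists>y\<in>A. y < i)"
  by (simp add: cLater_def)

lemma card_Suc_le_iff:
  fixes D :: "nat set"
  assumes "finite D"
  shows "Suc n \<le> card {e'\<in>D. e < e'} \<longleftrightarrow> (\<exists>v\<in>D. e < v \<and> n \<le> card {e'\<in>D. v < e'})"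
proof
  let ?S = "{e'\<in>D. e < e'}"
  have f: "finite ?S" using assms by simp
  assume n: "Suc n \<le> card ?S"
  then have ne: "?S \<noteq> {}" by (metis card.empty not_less_eq_eq le0)
  \<comment> \<open>The successor of \<open>e\<close> in \<open>D\<close>: all other elements above
    \<open>e\<close> are above it, so the count drops by exactly one.\<close>
  let ?v = "Min ?S"
  have v: "?v \<in> ?S" using Min_in[OF f ne] .
  have "?S = insert ?v {e'\<in>D. ?v < e'}" using v Min_le[OF f] by (auto simp: le_less)
  then have "card ?S = Suc (card {e'\<in>D. ?v < e'})"
    by (metis (no_types, lifting) assms card_insert_disjoint finite_Collect_conjI finite_subset less_irrefl mem_Collect_eq subsetI)
  with n v show "\<exists>v\<in>D. e < v \<and> n \<le> card {e'\<in>D. v < e'}" by (intro bexI[of _ ?v]) auto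
next
  assume "\<exists>v\<in>D. e < v \<and> n \<le> card {e'\<in>D. v < e'}"
  then obtain v where v: "v \<in> D" "e < v" "n \<le> card {e'\<in>D. v < e'}" by blast
  have "insert v {e'\<in>D. v < e'} \<subseteq> {e'\<in>D. e < e'}" using v by auto
  then have "card (insert v {e'\<in>D. v < e'}) \<le> card {e'\<in>D. e < e'}" using assms by (intro card_mono) simp_all
  moreover have "card (insert v {e'\<in>D. v < e'}) = Suc (card {e'\<in>D. v < e'})" using assms by simp
  ultimately show "Suc n \<le> card {e'\<in>D. e < e'}" using v(3) by linarith
qed

text \<open>The chain rebinds \<open>cv m\<close> for decreasing \<open>m\<close>; the last
  hypothesis keeps \<open>U\<close> out of the reach of these bindings.\<close>

lemma ev_newer:
  assumes "bd \<beta>" "\<beta> x = {i}" "x \<noteq> av 0" "x \<noteq> av 1" "\<And>u. x \<noteq> cv u" "i \<in> A" "defined_regs L"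
    "\<beta> U = {e}" "\<And>m. m \<le> n \<Longrightarrow> U \<noteq> cv m"
  shows "ev (enc_pair 14 (enc_pair n (enc_pair U (enc_pair (leA L) x)))) \<beta> \<longleftrightarrow>
    n \<le> card {e'\<in>adom (Fat L i). e < e'}"
  using assms(1,2,8,9)
proof (induction n arbitrary: \<beta> U e)
  case 0 show ?case by (subst ev_macro) (simp_all add: e_newer_def)
next
  case (Suc n)
  have U: "U \<noteq> cv (Suc n)" by (rule Suc.prems(4)) simp
  have IH: "ev (enc_pair 14 (enc_pair n (enc_pair (cv (Suc n)) (enc_pair (leA L) x)))) (\<beta>(cv (Suc n) := {v})) \<longleftrightarrow>
      n \<le> card {e'\<in>adom (Fat L i). v < e'}" if "v \<in> N" for v
    using Suc.prems assms(5) by (intro Suc.IH bd_updD[OF Suc.prems(1) that]) simp_all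
  have al: "ev (cAlive (leA L) (cv (Suc n)) x) (\<beta>(cv (Suc n) := {v})) \<longleftrightarrow> v \<in> adom (Fat L i)" if "v \<in> N" for v
    using Suc.prems assms(3-7) that by (intro ev_alive1) simp_all
  have "ev (enc_pair 14 (enc_pair (Suc n) (enc_pair U (enc_pair (leA L) x)))) \<beta> \<longleftrightarrow>
      (\<exists>v\<in>N. e < v \<and> v \<in> adom (Fat L i) \<and> n \<le> card {e'\<in>adom (Fat L i). v < e'})"
    using Suc.prems(1-3) U by (subst ev_macro) (simp_all add: e_newer_def IH al cong: bex_cong)
  also have "\<dots> \<longleftrightarrow> (\<exists>v\<in>adom (Fat L i). e < v \<and> n \<le> card {e'\<in>adom (Fat L i). v < e'})"
    using adom_Fat[OF assms(7)] by auto
  finally show ?case using card_Suc_le_iff[OF finite_adom_Fat] by simp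
qed

lemma ev_news:
  assumes "bd \<beta>" "\<beta> x = {i}" "\<And>u. x \<noteq> dv u" "i \<in> A" "\<beta> P = {e}" "P \<notin> dv ` set vs" "distinct vs"
    "\<forall>v\<in>set vs. v + 3 < K"
  shows "ev (enc_pair 16 (enc_pair (le vs) (enc_pair P x))) \<beta> \<longleftrightarrow> chainlt N (rg i) e vs"
  using assms(1,2,5-8)
proof (induction vs arbitrary: \<beta> P e)
  case Nil show ?case by (subst ev_macro) (simp_all add: e_news_def)
next
  case (Cons v vs)
  have IH: "ev (enc_pair 16 (enc_pair (le vs) (enc_pair (dv v) x))) (\<beta>(dv v := {u})) \<longleftrightarrow> chainlt N (rg i) u vs"
    if "u \<in> N" for u
    using Cons.prems assms(3) by (intro Cons.IH bd_updD[OF Cons.prems(1) that]) auto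
  have b: "ev (cBind x (dv v) v) (\<beta>(dv v := {u})) \<longleftrightarrow> rg i v = u" if "u \<in> N" for u
    using Cons.prems assms(3,4) that by (simp add: ev_bind rg_def)
  have "P \<noteq> dv v" using Cons.prems by auto
  then have "ev (enc_pair 16 (enc_pair (le (v # vs)) (enc_pair P x))) \<beta> \<longleftrightarrow>
      (\<exists>u\<in>N. e < u \<and> rg i v = u \<and> chainlt N (rg i) u vs)"
    using Cons.prems by (subst ev_macro) (simp_all add: e_news_def IH b cong: bex_cong)
  then show ?case by auto
qed

text \<open>This does not presuppose \<open>defined_regs\<close>, and so breaks the circle between
  the truth of the guards and the definedness of the registers on which their meaning rests: binding
  a parameter already forces its register to hold a created element.\<close>

lemma ev_bindall_defined:
  assumes "bd \<beta>" "\<beta> x = {i}" "\<And>u. x \<noteq> dv u" "i \<in> A" "\<forall>u\<in>set us. u + 3 < K"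
    "ev (enc_pair 15 (enc_pair (le us) (enc_pair (enc_fol q) (enc_pair (leA L) (enc_pair b x))))) \<beta>"
  shows "\<forall>u\<in>set us. rg i u \<in> N"
  using assms(1,2,5,6)
proof (induction us arbitrary: \<beta>)
  case (Cons u us)
  from Cons.prems(4) obtain e where e: "e \<in> N" "ev (cBind x (dv u) u) (\<beta>(dv u := {e}))"
    "ev (enc_pair 15 (enc_pair (le us) (enc_pair (enc_fol q) (enc_pair (leA L) (enc_pair b x))))) (\<beta>(dv u := {e}))"
    using Cons.prems(1) by (subst (asm) ev_macro) (auto simp: e_bindall_def Let_def)
  have "rg i u = e" using e(1,2) Cons.prems assms(3,4) by (simp add: ev_bind rg_def)
  moreover have "\<forall>u\<in>set us. rg i u \<in> N"
    by (rule Cons.IH[OF bd_updD[OF Cons.prems(1) e(1)] _ _ e(3)]) (use Cons.prems assms(3) in simp_all)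
  ultimately show ?case using e(1) by simp
qed simp

lemma ev_bindall:
  assumes "bd \<beta>" "\<beta> x = {i}" "x \<noteq> av 0" "x \<noteq> av 1" "\<And>u. x \<noteq> dv u" "\<And>u. x \<noteq> cv u" "i \<in> A" "defined_regs L"
    "\<forall>u\<in>set us. u + 3 < K" "\<forall>u\<in>fv_fol q - set us. \<beta> (dv u) = {rg i u}"
  shows "ev (enc_pair 15 (enc_pair (le us) (enc_pair (enc_fol q) (enc_pair (leA L) (enc_pair b x))))) \<beta> \<longleftrightarrow>
    (\<forall>u\<in>set us. rg i u \<in> N \<and> rg i u \<in> adom (Fat L i) \<and> card {e'\<in>adom (Fat L i). rg i u < e'} < b)
    \<and> fol_sat (Fat L i) (rg i) q"
  using assms(1,2,9,10)
proof (induction us arbitrary: \<beta>)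
  case Nil
  then have "ev (enc_pair 10 (enc_pair (enc_fol q) (enc_pair (leA L) x))) \<beta> \<longleftrightarrow> fol_sat (Fat L i) (rg i) q"
    using assms(3-8) by (intro ev_fol) simp_all
  then show ?case by (subst ev_macro) (simp_all add: e_bindall_def Let_def)
next
  case (Cons u us)
  let ?D = "adom (Fat L i)"
  have b: "ev (cBind x (dv u) u) (\<beta>(dv u := {e})) \<longleftrightarrow> rg i u = e" if "e \<in> N" for e
    using Cons.prems assms(5,7) that by (simp add: ev_bind rg_def)
  have al: "ev (cAlive (leA L) (dv u) x) (\<beta>(dv u := {e})) \<longleftrightarrow> e \<in> ?D" if "e \<in> N" for e
    using Cons.prems assms(3-8) that by (intro ev_alive1) simp_all
  have nw: "ev (enc_pair 14 (enc_pair b (enc_pair (dv u) (enc_pair (leA L) x)))) (\<beta>(dv u := {e})) \<longleftrightarrow>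
      b \<le> card {e'\<in>?D. e < e'}" if "e \<in> N" for e
    using Cons.prems assms(3-8) that by (intro ev_newer) simp_all
  have IH: "ev (enc_pair 15 (enc_pair (le us) (enc_pair (enc_fol q) (enc_pair (leA L) (enc_pair b x))))) (\<beta>(dv u := {e})) \<longleftrightarrow>
    (\<forall>u\<in>set us. rg i u \<in> N \<and> rg i u \<in> ?D \<and> card {e'\<in>?D. rg i u < e'} < b) \<and> fol_sat (Fat L i) (rg i) q"
    if "e \<in> N" "e = rg i u" for e
    using Cons.prems assms(5) that(2) by (intro Cons.IH bd_updD[OF Cons.prems(1) that(1)]) auto
  have "ev (enc_pair 15 (enc_pair (le (u # us)) (enc_pair (enc_fol q) (enc_pair (leA L) (enc_pair b x))))) \<beta> \<longleftrightarrow>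
      (\<exists>e\<in>N. rg i u = e \<and> (e \<in> ?D \<and> \<not> b \<le> card {e'\<in>?D. e < e'}) \<and>
        ev (enc_pair 15 (enc_pair (le us) (enc_pair (enc_fol q) (enc_pair (leA L) (enc_pair b x))))) (\<beta>(dv u := {e})))"
    using Cons.prems by (subst ev_macro) (simp_all add: e_bindall_def Let_def b al nw cong: bex_cong)
  also have "\<dots> \<longleftrightarrow> rg i u \<in> N \<and> rg i u \<in> ?D \<and> card {e'\<in>?D. rg i u < e'} < b \<and>
      (\<forall>u\<in>set us. rg i u \<in> N \<and> rg i u \<in> ?D \<and> card {e'\<in>?D. rg i u < e'} < b) \<and> fol_sat (Fat L i) (rg i) q"
    using IH by auto
  finally show ?case by auto
qed

end

subsection \<open>Validity of traces and MSO-FO formulas\<close>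

definition okact :: "nat \<Rightarrow> action \<Rightarrow> bool" where
  "okact K \<alpha> \<longleftrightarrow> distinct (act_v \<alpha>) \<and> (\<forall>c\<in>set (act_u \<alpha>) \<union> set (act_v \<alpha>). c + 3 < K) \<and>
     fv_fol (act_Q \<alpha>) \<subseteq> set (act_u \<alpha>) \<and>
     (\<forall>f\<in>set (act_Add \<alpha>) \<union> set (act_Del \<alpha>). set (snd f) \<subseteq> set (act_u \<alpha>) \<union> set (act_v \<alpha>))"

context trace
begin

definition enabled :: "action list \<Rightarrow> nat \<Rightarrow> nat \<Rightarrow> action \<Rightarrow> bool" where
  "enabled L b i \<alpha> \<longleftrightarrow> (\<forall>u\<in>set (act_u \<alpha>). rg i u \<in> N \<and> rg i u \<in> adom (Fat L i) \<and>
      card {e'\<in>adom (Fat L i). rg i u < e'} < b) \<and> fol_sat (Fat L i) (rg i) (act_Q \<alpha>)"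

lemma ev_fresh:
  assumes "bd \<beta>" "\<beta> (av 3) = {i}" "i \<in> A" "okact K \<alpha>"
  shows "ev (cNot (cExA (av 4) (cAnd (cLess (av 4) (av 3)) (cNot (enc_pair 16 (enc_pair (le (act_v \<alpha>)) (enc_pair (av 4) (av 3)))))))) \<beta>
    \<longleftrightarrow> (\<forall>y\<in>A. y < i \<longrightarrow> chainlt N (rg i) y (act_v \<alpha>))"
proof -
  have "ev (enc_pair 16 (enc_pair (le (act_v \<alpha>)) (enc_pair (av 4) (av 3)))) (\<beta>(av 4 := {y})) \<longleftrightarrow> chainlt N (rg i) y (act_v \<alpha>)"
    if "y \<in> A" for y
    by (rule ev_news[OF bd_updA[OF assms(1) that]]) (use assms in \<open>auto simp: okact_def\<close>)
  then show ?thesis using assms(1-3) by (simp cong: bex_cong)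
qed

lemma ev_guard_step:
  assumes "bd \<beta>" "\<beta> (av 3) = {i}" "i \<in> A" "okact K \<alpha>"
  shows "ev (enc_pair 17 (enc_pair (leA (\<alpha> # M)) (enc_pair (leA L) b))) \<beta> \<longleftrightarrow>
    act i = enc_action \<alpha> \<and> (\<forall>y\<in>A. y < i \<longrightarrow> chainlt N (rg i) y (act_v \<alpha>)) \<and>
      ev (enc_pair 15 (enc_pair (le (act_u \<alpha>)) (enc_pair (enc_fol (act_Q \<alpha>)) (enc_pair (leA L) (enc_pair b (av 3)))))) \<beta>
    \<or> ev (enc_pair 17 (enc_pair (leA M) (enc_pair (leA L) b))) \<beta>"
proof -
  let ?F = "cNot (cExA (av 4) (cAnd (cLess (av 4) (av 3)) (cNot (enc_pair 16 (enc_pair (le (act_v \<alpha>)) (enc_pair (av 4) (av 3)))))))"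
  let ?B = "enc_pair 15 (enc_pair (le (act_u \<alpha>)) (enc_pair (enc_fol (act_Q \<alpha>)) (enc_pair (leA L) (enc_pair b (av 3)))))"
  have d: "dfd ?F" "dfd ?B" "dfd (enc_pair 17 (enc_pair (leA M) (enc_pair (leA L) b)))" "dfd (cLet (av 3) (enc_action \<alpha>))"
    by (intro dfd_intros dfd_news dfd_bindall dfd_guard)+
  have "ev (enc_pair 17 (enc_pair (leA (\<alpha> # M)) (enc_pair (leA L) b))) \<beta> \<longleftrightarrow>
      ev (cOr (cAnd (cLet (av 3) (enc_action \<alpha>)) (cAnd ?F ?B)) (enc_pair 17 (enc_pair (leA M) (enc_pair (leA L) b)))) \<beta>"
    by (subst ev_macro) (simp_all add: e_guard_def Let_def del: ev_Or ev_And ev_Not ev_ExA)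
  also have "\<dots> \<longleftrightarrow> (ev (cLet (av 3) (enc_action \<alpha>)) \<beta> \<and> ev ?F \<beta> \<and> ev ?B \<beta>)
      \<or> ev (enc_pair 17 (enc_pair (leA M) (enc_pair (leA L) b))) \<beta>"
    by (simp only: ev_Or[OF dfd_intros(2)[OF d(4) dfd_intros(2)[OF d(1,2)]] d(3)]
        ev_And[OF d(4) dfd_intros(2)[OF d(1,2)]] ev_And[OF d(1,2)])
  finally show ?thesis using ev_let[OF assms(1-3)] ev_fresh[OF assms] by (simp only:)
qed

lemma ev_guard_Nil: "\<not> ev (enc_pair 17 (enc_pair 0 a)) \<beta>"
  by (subst ev_macro) (simp_all add: e_guard_def)

lemma ev_guard_defined:
  assumes "bd \<beta>" "\<beta> (av 3) = {i}" "i \<in> A" "\<forall>\<alpha>\<in>set M. okact K \<alpha>"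
    "ev (enc_pair 17 (enc_pair (leA M) (enc_pair (leA L) b))) \<beta>"
  shows "\<exists>\<alpha>\<in>set M. act i = enc_action \<alpha> \<and> (\<forall>y\<in>A. y < i \<longrightarrow> chainlt N (rg i) y (act_v \<alpha>)) \<and> (\<forall>u\<in>set (act_u \<alpha>). rg i u \<in> N)"
  using assms(4,5)
proof (induction M)
  case Nil then show ?case using ev_guard_Nil by simp
next
  case (Cons \<alpha> M)
  have ok: "okact K \<alpha>" using Cons.prems by simp
  show ?case
  proof (cases "ev (enc_pair 17 (enc_pair (leA M) (enc_pair (leA L) b))) \<beta>")
    case True then show ?thesis using Cons by auto
  next
    case False
    then have g: "act i = enc_action \<alpha>" "\<forall>y\<in>A. y < i \<longrightarrow> chainlt N (rg i) y (act_v \<alpha>)"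
      "ev (enc_pair 15 (enc_pair (le (act_u \<alpha>)) (enc_pair (enc_fol (act_Q \<alpha>)) (enc_pair (leA L) (enc_pair b (av 3)))))) \<beta>"
      using Cons.prems(2) unfolding ev_guard_step[OF assms(1-3) ok] by simp_all
    have "\<forall>u\<in>set (act_u \<alpha>). rg i u \<in> N"
      by (rule ev_bindall_defined[OF assms(1,2) _ assms(3) _ g(3)]) (use ok in \<open>auto simp: okact_def\<close>)
    with g show ?thesis by auto
  qed
qed

lemma ev_guard:
  assumes "bd \<beta>" "\<beta> (av 3) = {i}" "i \<in> A" "\<forall>\<alpha>\<in>set M. okact K \<alpha>" "defined_regs L"
  shows "ev (enc_pair 17 (enc_pair (leA M) (enc_pair (leA L) b))) \<beta> \<longleftrightarrow>
    (\<exists>\<alpha>\<in>set M. act i = enc_action \<alpha> \<and> (\<forall>y\<in>A. y < i \<longrightarrow> chainlt N (rg i) y (act_v \<alpha>)) \<and> enabled L b i \<alpha>)"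
  using assms(4)
proof (induction M)
  case Nil then show ?case using ev_guard_Nil by simp
next
  case (Cons \<alpha> M)
  have ok: "okact K \<alpha>" using Cons.prems by simp
  have "ev (enc_pair 15 (enc_pair (le (act_u \<alpha>)) (enc_pair (enc_fol (act_Q \<alpha>)) (enc_pair (leA L) (enc_pair b (av 3)))))) \<beta>
    \<longleftrightarrow> enabled L b i \<alpha>"
    unfolding enabled_def
    by (rule ev_bindall[OF assms(1,2) _ _ _ _ assms(3,5)]) (use ok in \<open>auto simp: okact_def\<close>)
  with Cons show ?case unfolding ev_guard_step[OF assms(1-3) ok] by simp
qed

definition valid :: "action \<Rightarrow> action list \<Rightarrow> nat \<Rightarrow> bool" where
  "valid \<iota> M b \<longleftrightarrow> A \<noteq> {} \<and> (\<forall>x\<in>A. \<exists>y\<in>A. x < y) \<and>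
     (\<forall>x\<in>A. if \<exists>y\<in>A. y < x
       then \<exists>\<alpha>\<in>set M. act x = enc_action \<alpha> \<and> (\<forall>y\<in>A. y < x \<longrightarrow> chainlt N (rg x) y (act_v \<alpha>)) \<and> enabled (\<iota> # M) b x \<alpha>
       else act x = enc_action \<iota>)"

text \<open>Arguments of facts are parameters or new elements, and a chain places the latter in
  \<open>N\<close>; the facts of the initial action have no arguments.\<close>

lemma defined_regsI:
  assumes ok: "\<forall>\<alpha>\<in>set M. okact K \<alpha>" and \<iota>: "\<forall>f\<in>set (act_Add \<iota>) \<union> set (act_Del \<iota>). snd f = []"
    and g: "\<And>x. x \<in> A \<Longrightarrow> if \<exists>y\<in>A. y < x
       then \<exists>\<alpha>\<in>set M. act x = enc_action \<alpha> \<and> (\<forall>y\<in>A. y < x \<longrightarrow> chainlt N (rg x) y (act_v \<alpha>)) \<and> (\<forall>u\<in>set (act_u \<alpha>). rg x u \<in> N)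
       else act x = enc_action \<iota>"
  shows "defined_regs (\<iota> # M)"
  unfolding defined_regs_def
proof (intro ballI impI)
  fix x \<alpha> f c
  assume a: "x \<in> A" "\<alpha> \<in> set (\<iota> # M)" "act x = enc_action \<alpha>" "f \<in> set (act_Add \<alpha>) \<union> set (act_Del \<alpha>)" "c \<in> set (snd f)"
  show "c + 3 < K \<and> rg x c \<in> N"
  proof (cases "\<exists>y\<in>A. y < x")
    case False
    then have "\<alpha> = \<iota>" using g[OF a(1)] a(3) by (simp add: enc_action_inject)
    then have "snd f = []" using a(4) \<iota> by blast
    then show ?thesis using a(5) by simp
  next
    case True
    then obtain y where y: "y \<in> A" "y < x" by blast
    from g[OF a(1)] True a(3) have al: "\<alpha> \<in> set M" "chainlt N (rg x) y (act_v \<alpha>)" "\<forall>u\<in>set (act_u \<alpha>). rg x u \<in> N"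
      using y by (auto simp: enc_action_inject)
    have "set (snd f) \<subseteq> set (act_u \<alpha>) \<union> set (act_v \<alpha>)" "\<forall>c\<in>set (act_u \<alpha>) \<union> set (act_v \<alpha>). c + 3 < K"
      using ok al(1) a(4) unfolding okact_def by blast+
    then show ?thesis using a(5) al(2,3) unfolding chainlt_iff by blast
  qed
qed

lemma valid_defined:
  assumes "\<forall>\<alpha>\<in>set M. okact K \<alpha>" "\<forall>f\<in>set (act_Add \<iota>) \<union> set (act_Del \<iota>). snd f = []" "valid \<iota> M b"
  shows "defined_regs (\<iota> # M)"
proof (rule defined_regsI[OF assms(1,2)])
  fix x assume x: "x \<in> A"
  have v: "if \<exists>y\<in>A. y < x
       then \<exists>\<alpha>\<in>set M. act x = enc_action \<alpha> \<and> (\<forall>y\<in>A. y < x \<longrightarrow> chainlt N (rg x) y (act_v \<alpha>)) \<and> enabled (\<iota> # M) b x \<alpha>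
       else act x = enc_action \<iota>" using assms(3) x unfolding valid_def by blast
  show "if \<exists>y\<in>A. y < x
       then \<exists>\<alpha>\<in>set M. act x = enc_action \<alpha> \<and> (\<forall>y\<in>A. y < x \<longrightarrow> chainlt N (rg x) y (act_v \<alpha>)) \<and> (\<forall>u\<in>set (act_u \<alpha>). rg x u \<in> N)
       else act x = enc_action \<iota>"
  proof (cases "\<exists>y\<in>A. y < x")
    case True
    then obtain \<alpha> where "\<alpha> \<in> set M" "act x = enc_action \<alpha>" "\<forall>y\<in>A. y < x \<longrightarrow> chainlt N (rg x) y (act_v \<alpha>)"
      "enabled (\<iota> # M) b x \<alpha>" using v by (simp only: if_True) blast
    then show ?thesis using True unfolding enabled_def by auto
  next
    case False then show ?thesis using v by (simp only: if_False)
  qed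
qed

lemma ev_valid:
  assumes b: "bd \<beta>" and ok: "\<forall>\<alpha>\<in>set M. okact K \<alpha>" "\<forall>f\<in>set (act_Add \<iota>) \<union> set (act_Del \<iota>). snd f = []"
  shows "ev (cValid (enc_action \<iota>) (leA M) b) \<beta> \<longleftrightarrow> valid \<iota> M b"
proof -
  let ?G = "\<lambda>x. ev (enc_pair 17 (enc_pair (leA M) (enc_pair (leA (\<iota> # M)) b))) (\<beta>(av 3 := {x}))"
  let ?g = "enc_pair 17 (enc_pair (leA M) (enc_pair (leA (\<iota> # M)) b))"
  have dg: "dfd ?g" by (rule dfd_guard)
  have body: "ev (cOr (cAnd (cNot (cLater (av 3))) (cLet (av 3) (enc_action \<iota>))) (cAnd (cLater (av 3)) ?g)) (\<beta>(av 3 := {x})) \<longleftrightarrow>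
     (if \<exists>y\<in>A. y < x then ?G x else act x = enc_action \<iota>)" if x: "x \<in> A" for x
  proof -
    have "bd (\<beta>(av 3 := {x}))" using b x by (rule bd_updA)
    then have "ev (cLater (av 3)) (\<beta>(av 3 := {x})) \<longleftrightarrow> (\<exists>y\<in>A. y < x)"
      "ev (cLet (av 3) (enc_action \<iota>)) (\<beta>(av 3 := {x})) \<longleftrightarrow> act x = enc_action \<iota>"
      using x by simp_all
    then show ?thesis using dg by (simp only: ev_Or ev_And ev_Not dfd_intros) auto
  qed
  have db: "dfd (cOr (cAnd (cNot (cLater (av 3))) (cLet (av 3) (enc_action \<iota>))) (cAnd (cLater (av 3)) ?g))"
    using dg by (intro dfd_intros)
  have inf: "ev (cAnd (cExA (av 3) cT) (cNot (cExA (av 3) (cNot (cExA (av 4) (cLess (av 3) (av 4))))))) \<beta> \<longleftrightarrow>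
      A \<noteq> {} \<and> (\<forall>x\<in>A. \<exists>y\<in>A. x < y)"
    using b by (auto cong: bex_cong)
  have "ev (cValid (enc_action \<iota>) (leA M) b) \<beta> \<longleftrightarrow> A \<noteq> {} \<and> (\<forall>x\<in>A. \<exists>y\<in>A. x < y) \<and>
      (\<forall>x\<in>A. if \<exists>y\<in>A. y < x then ?G x else act x = enc_action \<iota>)"
  proof -
    have "ev (cNot (cExA (av 3) (cNot (cOr (cAnd (cNot (cLater (av 3))) (cLet (av 3) (enc_action \<iota>)))
         (cAnd (cLater (av 3)) ?g))))) \<beta> \<longleftrightarrow> (\<forall>x\<in>A. if \<exists>y\<in>A. y < x then ?G x else act x = enc_action \<iota>)"
      unfolding ev_Not[OF dfd_intros(11)[OF dfd_intros(1)[OF db]]] ev_ExA[OF dfd_intros(1)[OF db] b] ev_Not[OF db]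
      using body by blast
    moreover have "dfd (cAnd (cExA (av 3) cT) (cNot (cExA (av 3) (cNot (cExA (av 4) (cLess (av 3) (av 4)))))))"
      by (intro dfd_intros)
    ultimately show ?thesis unfolding cValid_unfold
      using inf db by (simp only: ev_And dfd_intros conj_assoc)
  qed
  also have "\<dots> \<longleftrightarrow> valid \<iota> M b"
  \<comment> \<open>The meaning of the guards is known only for defined registers. Otherwise both
    sides are false, because each of them would imply definedness.\<close>
  proof (cases "defined_regs (\<iota> # M)")
    case True
    have "?G x \<longleftrightarrow> (\<exists>\<alpha>\<in>set M. act x = enc_action \<alpha> \<and> (\<forall>y\<in>A. y < x \<longrightarrow> chainlt N (rg x) y (act_v \<alpha>)) \<and> enabled (\<iota> # M) b x \<alpha>)"
      if "x \<in> A" for x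
      by (rule ev_guard[OF bd_updA[OF b that] _ that ok(1) True]) simp
    then show ?thesis unfolding valid_def by auto
  next
    case False
    have "\<not> valid \<iota> M b" using valid_defined[OF ok] False by blast
    moreover have "\<not> (\<forall>x\<in>A. if \<exists>y\<in>A. y < x then ?G x else act x = enc_action \<iota>)"
    proof
      assume G: "\<forall>x\<in>A. if \<exists>y\<in>A. y < x then ?G x else act x = enc_action \<iota>"
      have "defined_regs (\<iota> # M)"
      proof (rule defined_regsI[OF ok])
        fix x assume x: "x \<in> A"
        show "if \<exists>y\<in>A. y < x
         then \<exists>\<alpha>\<in>set M. act x = enc_action \<alpha> \<and> (\<forall>y\<in>A. y < x \<longrightarrow> chainlt N (rg x) y (act_v \<alpha>)) \<and> (\<forall>u\<in>set (act_u \<alpha>). rg x u \<in> N)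
         else act x = enc_action \<iota>"
        proof (cases "\<exists>y\<in>A. y < x")
          case True
          then have "?G x" using bspec[OF G x] by (simp only: if_True)
          from ev_guard_defined[OF bd_updA[OF b x] _ x ok(1) this] True show ?thesis by simp
        next
          case False then show ?thesis using G x by simp
        qed
      qed
      with False show False by blast
    qed
    ultimately show ?thesis by blast
  qed
  finally show ?thesis .
qed

lemma Fat_first: "(\<And>y. y \<in> A \<Longrightarrow> \<not> y < i) \<Longrightarrow> Fat L i = {}"
  unfolding Fat_def by blast

text \<open>Position \<open>k\<close> is represented by the action \<open>a (Suc k)\<close>, and a
  set of positions by any set of identifiers with the right trace on these actions; the traces
  exhaust all sets because \<open>a\<close> is injective.\<close>

lemma ev_mso:
  assumes A: "A = range a" "strict_mono a" and D: "defined_regs L"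
    and "bd \<beta>" "\<forall>x\<in>fvp \<phi>. \<beta> (pv x) = {a (Suc (p x))}" "\<forall>Y\<in>fvs \<phi>. \<forall>k. a (Suc k) \<in> \<beta> (sv Y) \<longleftrightarrow> k \<in> X Y"
      "\<forall>u\<in>fvd \<phi>. \<beta> (dv u) = {d u}"
  shows "ev (enc_pair 13 (enc_pair (enc_mso \<phi>) (leA L))) \<beta> \<longleftrightarrow> mso_sat (\<lambda>k. Fat L (a (Suc k))) p X d \<phi>"
  using assms(4-)
proof (induction \<phi> arbitrary: \<beta> p X d)
  case (MQAt q x)
  let ?i = "a (Suc (p x))"
  have i: "?i \<in> A" "\<beta> (pv x) = {?i}" using A MQAt by auto
  have 1: "ev (enc_pair 12 (enc_pair (enc_fol q) (enc_pair (leA L) (pv x)))) \<beta> \<longleftrightarrow>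
      (\<forall>u\<in>fv_fol q. \<beta> (dv u) = {} \<or> \<beta> (dv u) \<inter> adom (Fat L ?i) \<noteq> {})"
    by (rule ev_fvalive[OF MQAt(1) i(2) _ _ _ i(1) D]) simp_all
  have 2: "ev (enc_pair 10 (enc_pair (enc_fol q) (enc_pair (leA L) (pv x)))) \<beta> \<longleftrightarrow> fol_sat (Fat L ?i) d q"
    by (rule ev_fol[OF MQAt(1) i(2) _ _ _ i(1) D]) (use MQAt in simp_all)
  show ?case using MQAt(4) by (subst ev_macro) (simp_all add: e_mso_def Let_def 1 2)
next
  case (MLess x y)
  then show ?case using A(2) by (subst ev_macro) (simp_all add: e_mso_def Let_def strict_mono_less)
next
  case (MIn x Y)
  then show ?case by (subst ev_macro) (simp_all add: e_mso_def Let_def ev_mem)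
next
  case (MNot \<phi>)
  then show ?case by (subst ev_macro) (simp_all add: e_mso_def Let_def)
next
  case (MAnd \<phi> \<psi>)
  have "ev (enc_pair 13 (enc_pair (enc_mso \<phi>) (leA L))) \<beta> \<longleftrightarrow> mso_sat (\<lambda>k. Fat L (a (Suc k))) p X d \<phi>"
    by (rule MAnd.IH(1)) (use MAnd.prems in simp_all)
  moreover have "ev (enc_pair 13 (enc_pair (enc_mso \<psi>) (leA L))) \<beta> \<longleftrightarrow> mso_sat (\<lambda>k. Fat L (a (Suc k))) p X d \<psi>"
    by (rule MAnd.IH(2)) (use MAnd.prems in simp_all)
  ultimately show ?case by (subst ev_macro) (simp_all add: e_mso_def Let_def)
next
  case (MExPos x \<phi>)
  have IH: "ev (enc_pair 13 (enc_pair (enc_mso \<phi>) (leA L))) (\<beta>(pv x := {a (Suc k)})) \<longleftrightarrow>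
      mso_sat (\<lambda>k. Fat L (a (Suc k))) (p(x := k)) X d \<phi>" for k
    by (rule MExPos.IH[OF bd_updA[OF MExPos.prems(1)]]) (use MExPos.prems A(1) in simp_all)
  have lt: "ev (cLater (pv x)) (\<beta>(pv x := {i})) \<longleftrightarrow> (\<exists>y\<in>A. y < i)" if "i \<in> A" for i
    by (rule ev_later[OF bd_updA[OF MExPos.prems(1) that]]) (use that in simp_all)
  have "ev (enc_pair 13 (enc_pair (enc_mso (MExPos x \<phi>)) (leA L))) \<beta> \<longleftrightarrow>
      (\<exists>i\<in>A. (\<exists>y\<in>A. y < i) \<and> ev (enc_pair 13 (enc_pair (enc_mso \<phi>) (leA L))) (\<beta>(pv x := {i})))"
    using MExPos.prems(1) by (subst ev_macro) (simp_all add: e_mso_def Let_def lt cong: bex_cong)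
  also have "\<dots> \<longleftrightarrow> (\<exists>k. ev (enc_pair 13 (enc_pair (enc_mso \<phi>) (leA L))) (\<beta>(pv x := {a (Suc k)})))"
  proof -
    have "i \<in> A \<and> (\<exists>y\<in>A. y < i) \<longleftrightarrow> (\<exists>k. i = a (Suc k))" for i
    proof
      assume "i \<in> A \<and> (\<exists>y\<in>A. y < i)"
      then obtain m n where "i = a m" "a n < a m" using A(1) by auto
      then have "m \<noteq> 0" using A(2) by (metis not_less_zero strict_mono_less)
      then show "\<exists>k. i = a (Suc k)" using \<open>i = a m\<close> by (metis not0_implies_Suc)
    next
      assume "\<exists>k. i = a (Suc k)"
      then show "i \<in> A \<and> (\<exists>y\<in>A. y < i)" using A by (auto simp: strict_mono_less intro!: bexI[of _ "a 0"])
    qed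
    then have "(\<exists>i. (i \<in> A \<and> (\<exists>y\<in>A. y < i)) \<and> ev (enc_pair 13 (enc_pair (enc_mso \<phi>) (leA L))) (\<beta>(pv x := {i}))) \<longleftrightarrow>
        (\<exists>k. ev (enc_pair 13 (enc_pair (enc_mso \<phi>) (leA L))) (\<beta>(pv x := {a (Suc k)})))" by metis
    then show ?thesis by (simp only: Bex_def conj_assoc)
  qed
  finally show ?case by (simp add: IH)
next
  case (MExSet Y \<phi>)
  have IH: "ev (enc_pair 13 (enc_pair (enc_mso \<phi>) (leA L))) (\<beta>(sv Y := S)) \<longleftrightarrow>
      mso_sat (\<lambda>k. Fat L (a (Suc k))) p (X(Y := {k. a (Suc k) \<in> S})) d \<phi>" if "S \<subseteq> A \<union> N" for S
    by (rule MExSet.IH[OF bd_upd[OF MExSet.prems(1) that]]) (use MExSet.prems in simp_all)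
  have "ev (enc_pair 13 (enc_pair (enc_mso (MExSet Y \<phi>)) (leA L))) \<beta> \<longleftrightarrow>
      (\<exists>S\<subseteq>A \<union> N. mso_sat (\<lambda>k. Fat L (a (Suc k))) p (X(Y := {k. a (Suc k) \<in> S})) d \<phi>)"
    by (subst ev_macro) (use IH in \<open>simp_all add: e_mso_def Let_def ev_Ex cong: conj_cong\<close>)
  also have "\<dots> \<longleftrightarrow> (\<exists>B. mso_sat (\<lambda>k. Fat L (a (Suc k))) p (X(Y := B)) d \<phi>)"
  proof
    assume "\<exists>B. mso_sat (\<lambda>k. Fat L (a (Suc k))) p (X(Y := B)) d \<phi>"
    then obtain B where B: "mso_sat (\<lambda>k. Fat L (a (Suc k))) p (X(Y := B)) d \<phi>" by blast
    have "inj a" using A(2) by (rule strict_mono_imp_inj_on)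
    then have "{k. a (Suc k) \<in> (\<lambda>k. a (Suc k)) ` B} = B" by (auto dest: injD)
    then show "\<exists>S\<subseteq>A \<union> N. mso_sat (\<lambda>k. Fat L (a (Suc k))) p (X(Y := {k. a (Suc k) \<in> S})) d \<phi>"
      using B A(1) by (intro exI[of _ "(\<lambda>k. a (Suc k)) ` B"]) auto
  qed blast
  finally show ?case by simp
next
  case (MExData u \<phi>)
  have IH: "ev (enc_pair 13 (enc_pair (enc_mso \<phi>) (leA L))) (\<beta>(dv u := {e})) \<longleftrightarrow>
      mso_sat (\<lambda>k. Fat L (a (Suc k))) p X (d(u := e)) \<phi>" if "e \<in> N" for e
    by (rule MExData.IH[OF bd_updD[OF MExData.prems(1) that]]) (use MExData.prems in simp_all)
  have al: "ev (cExA (av 3) (cAlive (leA L) (dv u) (av 3))) (\<beta>(dv u := {e})) \<longleftrightarrow> (\<exists>i\<in>A. e \<in> adom (Fat L i))" if "e \<in> N" for e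
  proof -
    have b: "bd (\<beta>(dv u := {e}))" by (rule bd_updD[OF MExData.prems(1) that])
    have "ev (cAlive (leA L) (dv u) (av 3)) ((\<beta>(dv u := {e}))(av 3 := {i})) \<longleftrightarrow> e \<in> adom (Fat L i)" if "i \<in> A" for i
      by (rule ev_alive1[OF bd_updA[OF b that] _ _ _ that D]) simp_all
    then show ?thesis unfolding ev_ExA[OF dfd_alive b] by blast
  qed
  \<comment> \<open>The translation quantifies over all actions, including the first one; the
    instance before it is empty and contributes no element.\<close>
  have g: "gadom (\<lambda>k. Fat L (a (Suc k))) = (\<Union>i\<in>A. adom (Fat L i))"
  proof -
    have "Fat L (a 0) = {}" by (rule Fat_first) (use A in \<open>auto simp: strict_mono_less\<close>)
    then have "adom (Fat L (a 0)) = {}" by (simp add: adom_def)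
    then have "adom (Fat L (a n)) \<subseteq> (\<Union>k. adom (Fat L (a (Suc k))))" for n by (cases n) auto
    then show ?thesis unfolding gadom_def A(1) by auto
  qed
  have "ev (enc_pair 13 (enc_pair (enc_mso (MExData u \<phi>)) (leA L))) \<beta> \<longleftrightarrow>
      (\<exists>e\<in>N. (\<exists>i\<in>A. e \<in> adom (Fat L i)) \<and> mso_sat (\<lambda>k. Fat L (a (Suc k))) p X (d(u := e)) \<phi>)"
  proof -
    have "ev (enc_pair 13 (enc_pair (enc_mso (MExData u \<phi>)) (leA L))) \<beta> \<longleftrightarrow>
      ev (cExD (dv u) (cAnd (cExA (av 3) (cAlive (leA L) (dv u) (av 3))) (enc_pair 13 (enc_pair (enc_mso \<phi>) (leA L))))) \<beta>"
      by (subst ev_macro) (simp_all add: e_mso_def Let_def del: ev_ExD ev_ExA ev_And)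
    also have "\<dots> \<longleftrightarrow> (\<exists>e\<in>N. ev (cAnd (cExA (av 3) (cAlive (leA L) (dv u) (av 3))) (enc_pair 13 (enc_pair (enc_mso \<phi>) (leA L)))) (\<beta>(dv u := {e})))"
      by (rule ev_ExD[OF _ MExData.prems(1)]) (intro dfd_intros dfd_alive dfd_mso)
    also have "\<dots> \<longleftrightarrow> (\<exists>e\<in>N. (\<exists>i\<in>A. e \<in> adom (Fat L i)) \<and> mso_sat (\<lambda>k. Fat L (a (Suc k))) p X (d(u := e)) \<phi>)"
      using al IH by (intro bex_cong refl) (simp only: ev_And[OF dfd_intros(11)[OF dfd_alive] dfd_mso])
    finally show ?thesis .
  qed
  also have "\<dots> \<longleftrightarrow> (\<exists>e\<in>gadom (\<lambda>k. Fat L (a (Suc k))). mso_sat (\<lambda>k. Fat L (a (Suc k))) p X (d(u := e)) \<phi>)"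
    unfolding g using adom_Fat[OF D] by blast
  finally show ?case by simp
qed

lemma valid_enumeration:
  assumes "valid \<iota> M b"
  shows "\<exists>a :: nat \<Rightarrow> nat. A = range a \<and> strict_mono a"
proof -
  have "infinite A"
  proof
    assume "finite A"
    moreover have "A \<noteq> {}" using assms by (simp add: valid_def)
    ultimately obtain y where "y \<in> A" "Max A < y" using assms Max_in unfolding valid_def by blast
    then show False using Max_ge[OF \<open>finite A\<close>] by (meson not_less)
  qed
  then have "A = range (enumerate A) \<and> strict_mono (enumerate A)"
    using range_enumerate[of A] strict_mono_enumerate[of A] by simp
  then show ?thesis by (rule exI[of _ "enumerate A"])
qed

lemma ev_start:
  assumes "\<forall>\<alpha>\<in>set (dms_acts S). okact K \<alpha>" "adom (set (dms_init S)) = {}" "sentence \<phi>"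
  shows "ev (start (enc_instance S \<phi> b)) (\<lambda>_. {}) \<longleftrightarrow>
    valid (init_action (dms_init S)) (dms_acts S) b \<and>
    (\<exists>a. A = range a \<and> strict_mono a \<and> \<not> mso_sat (\<lambda>k. Fat (allacts S) (a (Suc k))) (\<lambda>_. 0) (\<lambda>_. {}) (\<lambda>_. 0) \<phi>)"
proof -
  let ?\<iota> = "init_action (dms_init S)" and ?\<beta> = "\<lambda>_. {} :: nat set"
  have b: "bd ?\<beta>" by (simp add: bd_def)
  have \<iota>: "\<forall>f\<in>set (act_Add ?\<iota>) \<union> set (act_Del ?\<iota>). snd f = []"
    using assms(2) by (auto simp: adom_def)
  have "ev (start (enc_instance S \<phi> b)) ?\<beta> \<longleftrightarrow>
      ev (cValid (enc_action ?\<iota>) (leA (dms_acts S)) b) ?\<beta> \<and> \<not> ev (enc_pair 13 (enc_pair (enc_mso \<phi>) (leA (allacts S)))) ?\<beta>"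
    unfolding start_enc by (simp only: ev_And ev_Not dfd_intros dfd_valid dfd_mso)
  moreover have "ev (enc_pair 13 (enc_pair (enc_mso \<phi>) (leA (allacts S)))) ?\<beta> \<longleftrightarrow>
      mso_sat (\<lambda>k. Fat (allacts S) (a (Suc k))) (\<lambda>_. 0) (\<lambda>_. {}) (\<lambda>_. 0) \<phi>"
    if "valid ?\<iota> (dms_acts S) b" "A = range a" "strict_mono a" for a
    by (rule ev_mso[OF that(2,3) _ b])
      (use assms(3) valid_defined[OF assms(1) \<iota> that(1)] in \<open>simp_all add: sentence_def allacts_def\<close>)
  moreover have "\<exists>a :: nat \<Rightarrow> nat. A = range a \<and> strict_mono a" if "valid ?\<iota> (dms_acts S) b"
    using valid_enumeration[OF that] .
  ultimately show ?thesis unfolding ev_valid[OF b assms(1) \<iota>] by blast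
qed

end

subsection \<open>From words to runs\<close>

lemma subst_inst_no_args: "adom I = {} \<Longrightarrow> subst_inst \<sigma> I = I"
proof -
  assume "adom I = {}"
  then have "snd g = []" if "g \<in> I" for g using that by (auto simp: adom_def)
  then have "(case g of (r, args) \<Rightarrow> (r, map \<sigma> args)) = g" if "g \<in> I" for g
    using that by (cases g) fastforce
  then show ?thesis unfolding subst_inst_def by simp
qed

context trace
begin

text \<open>No action lies strictly between \<open>a k\<close> and \<open>a (Suc k)\<close>, so the
  description by the last addition obeys the update rule of a transition.\<close>

lemma Fat_Suc:
  assumes A: "A = range a" "strict_mono a" and \<alpha>: "\<alpha> \<in> set L" "act (a k) = enc_action \<alpha>"
  shows "Fat L (a (Suc k)) = (Fat L (a k) - subst_inst (rg (a k)) (set (act_Del \<alpha>))) \<union> subst_inst (rg (a k)) (set (act_Add \<alpha>))"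
proof -
  have i: "subst_inst (rg (a k)) X = inst (a k) ` X" for X
    by (auto simp: subst_inst_def inst_def image_iff case_prod_beta)
  have lt: "y < a (Suc k) \<longleftrightarrow> y < a k \<or> y = a k" if y: "y \<in> A" for y
  proof -
    obtain m where "y = a m" using y A(1) by blast
    then show ?thesis using A(2) by (auto simp: strict_mono_less strict_mono_eq less_Suc_eq)
  qed
  have ad: "adds L (a k) f \<longleftrightarrow> f \<in> inst (a k) ` set (act_Add \<alpha>)" "deletes L (a k) f \<longleftrightarrow> f \<in> inst (a k) ` set (act_Del \<alpha>)" for f
    using \<alpha> unfolding adds_def deletes_def by (auto simp: enc_action_inject)
  have ak: "a k \<in> A" using A(1) by blast
  have "f \<in> Fat L (a (Suc k)) \<longleftrightarrow> adds L (a k) f \<or> (f \<in> Fat L (a k) \<and> \<not> deletes L (a k) f)" for f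
  proof
    assume "f \<in> Fat L (a (Suc k))"
    then obtain y where y: "y \<in> A" "y < a (Suc k)" "adds L y f" "\<And>z. z \<in> A \<Longrightarrow> y < z \<Longrightarrow> z < a (Suc k) \<Longrightarrow> \<not> deletes L z f"
      unfolding Fat_def by blast
    show "adds L (a k) f \<or> (f \<in> Fat L (a k) \<and> \<not> deletes L (a k) f)"
    proof (cases "y = a k")
      case True then show ?thesis using y(3) by simp
    next
      case False
      then have "y < a k" using lt[OF y(1)] y(2) by simp
      moreover have "\<not> deletes L z f" if "z \<in> A" "y < z" "z < a k" for z using y(4)[OF that(1,2)] lt[OF that(1)] that(3) by simp
      moreover have "\<not> deletes L (a k) f" using y(4)[OF ak] lt[OF ak] \<open>y < a k\<close> by simp
      ultimately show ?thesis using y(1,3) unfolding Fat_def by blast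
    qed
  next
    assume "adds L (a k) f \<or> (f \<in> Fat L (a k) \<and> \<not> deletes L (a k) f)"
    then show "f \<in> Fat L (a (Suc k))"
    proof
      assume "adds L (a k) f"
      moreover have "\<not> (a k < z \<and> z < a (Suc k))" if "z \<in> A" for z using lt[OF that] by auto
      ultimately show ?thesis using ak lt[OF ak] unfolding Fat_def by blast
    next
      assume f: "f \<in> Fat L (a k) \<and> \<not> deletes L (a k) f"
      then obtain y where y: "y \<in> A" "y < a k" "adds L y f" "\<And>z. z \<in> A \<Longrightarrow> y < z \<Longrightarrow> z < a k \<Longrightarrow> \<not> deletes L z f"
        unfolding Fat_def by blast
      have "\<not> deletes L z f" if "z \<in> A" "y < z" "z < a (Suc k)" for z using y(4)[OF that(1,2)] lt[OF that(1)] that(3) f by auto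
      moreover have "y < a (Suc k)" using lt[OF y(1)] y(2) by simp
      ultimately show ?thesis using y(1,3) unfolding Fat_def by blast
    qed
  qed
  then show ?thesis unfolding i using ad by blast
qed

text \<open>Elements keep their identifiers as names and the sequence numbering is the identity.
  Registers at an action hold smaller identifiers, so everything created in the steps before
  \<open>k\<close> lies below \<open>a k\<close>, while the new elements of step \<open>k\<close>
  lie above it: they are fresh.\<close>

lemma valid_run:
  assumes S: "\<forall>\<alpha>\<in>set (dms_acts S). okact K \<alpha>" "adom (set (dms_init S)) = {}"
    and v: "valid (init_action (dms_init S)) (dms_acts S) b"
    and A: "A = range a" "strict_mono a" and less: "\<And>i p. i \<in> A \<Longrightarrow> reg i p < i"
  shows "(\<lambda>k. Fat (allacts S) (a (Suc k))) \<in> Runs b S"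
proof -
  let ?L = "allacts S" and ?\<iota> = "init_action (dms_init S)"
  let ?F = "\<lambda>k. Fat ?L (a k)"
  have lt: "a m < a n \<longleftrightarrow> m < n" for m n using A(2) by (simp add: strict_mono_less)
  have first: "(\<exists>y\<in>A. y < a k) \<longleftrightarrow> k \<noteq> 0" for k using A(1) lt by auto
  have ak: "a k \<in> A" for k using A(1) by blast
  have V: "if \<exists>y\<in>A. y < x
       then \<exists>\<alpha>\<in>set (dms_acts S). act x = enc_action \<alpha> \<and> (\<forall>y\<in>A. y < x \<longrightarrow> chainlt N (rg x) y (act_v \<alpha>)) \<and>
         enabled ?L b x \<alpha>
       else act x = enc_action ?\<iota>" if "x \<in> A" for x
    using v that unfolding valid_def allacts_def by blast
  have a0: "act (a 0) = enc_action ?\<iota>" using V[OF ak[of 0]] first[of 0] by (simp only: if_False simp_thms)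
  have "\<exists>\<alpha>\<in>set (dms_acts S). act (a (Suc k)) = enc_action \<alpha> \<and> (\<forall>y\<in>A. y < a (Suc k) \<longrightarrow> chainlt N (rg (a (Suc k))) y (act_v \<alpha>)) \<and>
      enabled ?L b (a (Suc k)) \<alpha>" for k
    using V[OF ak[of "Suc k"]] first[of "Suc k"] by (simp only: if_True nat.distinct simp_thms)
  then obtain \<alpha> where \<alpha>: "\<And>k. \<alpha> k \<in> set (dms_acts S)" "\<And>k. act (a (Suc k)) = enc_action (\<alpha> k)"
    "\<And>k y. y \<in> A \<Longrightarrow> y < a (Suc k) \<Longrightarrow> chainlt N (rg (a (Suc k))) y (act_v (\<alpha> k))" "\<And>k. enabled ?L b (a (Suc k)) (\<alpha> k)"
    by metis
  define \<sigma> where "\<sigma> k = rg (a (Suc k))" for k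
  have F1: "?F (Suc 0) = set (dms_init S)"
  proof -
    have "?F 0 = {}" by (rule Fat_first) (use first[of 0] in auto)
    moreover have "?F (Suc 0) = (?F 0 - subst_inst (rg (a 0)) (set (act_Del ?\<iota>))) \<union> subst_inst (rg (a 0)) (set (act_Add ?\<iota>))"
      by (rule Fat_Suc[OF A _ a0]) (simp add: allacts_def)
    moreover have "subst_inst f (set (dms_init S)) = set (dms_init S)" for f by (rule subst_inst_no_args[OF S(2)])
    ultimately show ?thesis by simp
  qed
  define H where "H k = (\<Union>j<k. \<sigma> j ` set (act_v (\<alpha> j)))" for k
  have H: "e \<le> a k" if "e \<in> H k" for e k
  proof -
    from that obtain j c where j: "j < k" "e = \<sigma> j c" unfolding H_def by blast
    have "e < a (Suc j)" unfolding j \<sigma>_def rg_def by (rule less[OF ak])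
    also have "\<dots> \<le> a k" using j(1) A(2) by (simp add: strict_mono_less_eq)
    finally show ?thesis by simp
  qed
  have srt: "sorted_wrt (<) (a k # map (\<sigma> k) (act_v (\<alpha> k)))" for k
    using \<alpha>(3)[OF ak, of k k] lt unfolding chainlt_iff \<sigma>_def by simp
  define cs :: "nat \<Rightarrow> config" where "cs k = (?F (Suc k), H k, \<lambda>e. e)" for k
  have "dms_step b (cs k) (\<alpha> k) (\<sigma> k) (cs (Suc k))" for k
  proof -
    have fr: "a k < \<sigma> k c" if "c \<in> set (act_v (\<alpha> k))" for c using srt[of k] that by auto
    have "distinct (map (\<sigma> k) (act_v (\<alpha> k)))" using srt[of k] strict_sorted_iff by auto
    then have "inj_on (\<sigma> k) (set (act_v (\<alpha> k)))" by (simp add: distinct_map)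
    moreover have "\<sigma> k c \<notin> H k" if "c \<in> set (act_v (\<alpha> k))" for c using fr[OF that] H by fastforce
    moreover have "e < \<sigma> k c" if "c \<in> set (act_v (\<alpha> k))" "e \<in> H k" for c e using fr[OF that(1)] H[OF that(2)] by simp
    moreover have "\<sigma> k (act_v (\<alpha> k) ! i) < \<sigma> k (act_v (\<alpha> k) ! j)" if "i < j" "j < length (act_v (\<alpha> k))" for i j
      using srt[of k] that sorted_wrt_nth_less[of "(<)" "map (\<sigma> k) (act_v (\<alpha> k))" i j] by simp
    moreover have "\<sigma> k u \<in> adom (?F (Suc k))" "\<sigma> k u \<in> Recent b (?F (Suc k)) (\<lambda>e. e)" if "u \<in> set (act_u (\<alpha> k))" for u
      using \<alpha>(4)[of k] that unfolding enabled_def \<sigma>_def Recent_def by auto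
    moreover have "fol_sat (?F (Suc k)) (\<sigma> k) (act_Q (\<alpha> k))" using \<alpha>(4)[of k] unfolding enabled_def \<sigma>_def by simp
    moreover have "?F (Suc (Suc k)) = (?F (Suc k) - subst_inst (\<sigma> k) (set (act_Del (\<alpha> k)))) \<union> subst_inst (\<sigma> k) (set (act_Add (\<alpha> k)))"
      unfolding \<sigma>_def by (rule Fat_Suc[OF A _ \<alpha>(2)]) (simp add: allacts_def \<alpha>(1))
    moreover have "H (Suc k) = H k \<union> \<sigma> k ` set (act_v (\<alpha> k))" by (simp add: H_def lessThan_Suc Un_commute)
    ultimately show ?thesis unfolding dms_step_def cs_def by simp
  qed
  then have "ext_run b S cs"
    unfolding ext_run_def using \<alpha>(1) F1 by (auto simp: cs_def H_def)
  then show ?thesis unfolding Runs_def by (auto simp: cs_def fun_eq_iff)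
qed

end

lemma codes_macroD: "codes ex g \<psi> \<Longrightarrow> 3 \<le> pfst g \<Longrightarrow> codes ex (ex g) \<psi>"
  by (induction rule: codes.induct) simp_all

section \<open>Register contents and traces of labelled words\<close>

lemma exl_range: "ex1 K i r p \<in> range r \<union> {fst (snd q) |q. q \<in> set (oc1 K i r) \<and> pfst (fst q) = 0}"
  "exl K w r p \<in> range r \<union> {fst (snd q) |q. q \<in> set (ocl K w r) \<and> pfst (fst q) = 0}"
proof (induction K i r and K w r arbitrary: p and p rule: oc1_ocl.induct)
  case (4 K i w r)
  have "exl K w (ex1 K i r) p \<in> range (ex1 K i r) \<union> {fst (snd q) |q. q \<in> set (ocl K w (ex1 K i r)) \<and> pfst (fst q) = 0}"
    by (rule 4(2))
  then show ?case using 4(1) by fastforce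
qed auto

lemma oc_reg_range:
  "q \<in> set (oc1 K i r) \<Longrightarrow> snd (snd q) p \<in> range r \<union> {fst (snd q) |q. q \<in> set (oc1 K i r) \<and> pfst (fst q) = 0}"
  "q \<in> set (ocl K w r) \<Longrightarrow> snd (snd q) p \<in> range r \<union> {fst (snd q) |q. q \<in> set (ocl K w r) \<and> pfst (fst q) = 0}"
proof (induction K i r and K w r arbitrary: q p and q p rule: oc1_ocl.induct)
  case (4 K i w r)
  from 4(3) consider "q \<in> set (oc1 K i r)" | "q \<in> set (ocl K w (ex1 K i r))" by auto
  then show ?case
  proof cases
    case 1 then show ?thesis using 4(1)[OF 1, of p] by auto
  next
    case 2
    from 4(2)[OF 2, of p] consider p' where "snd (snd q) p = ex1 K i r p'"
      | q' where "snd (snd q) p = fst (snd q')" "q' \<in> set (ocl K w (ex1 K i r))" "pfst (fst q') = 0" by blast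
    then show ?thesis
    proof cases
      case 1 then show ?thesis using exl_range(1)[of K i r p'] by auto
    next
      case 2
      then have "q' \<in> set (ocl K (i # w) r)" by simp
      with 2 show ?thesis by blast
    qed
  qed
qed auto

text \<open>A register can only contain its initial value or the identifier of an earlier creation,
  and identifiers increase along the execution.\<close>

lemma oc_regs:
  "sorted_wrt (<) (ids1 i) \<Longrightarrow> \<forall>p. \<forall>j\<in>set (ids1 i). r p < j \<Longrightarrow> q \<in> set (oc1 K i r) \<Longrightarrow> snd (snd q) p < fst (snd q)"
  "sorted_wrt (<) (idsl w) \<Longrightarrow> \<forall>p. \<forall>j\<in>set (idsl w). r p < j \<Longrightarrow> q \<in> set (ocl K w r) \<Longrightarrow> snd (snd q) p < fst (snd q)"
proof (induction K i r and K w r arbitrary: q p and q p rule: oc1_ocl.induct)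
  case (4 K i w r)
  have s: "sorted_wrt (<) (ids1 i)" "sorted_wrt (<) (idsl w)" "\<forall>j\<in>set (ids1 i). \<forall>k\<in>set (idsl w). j < k"
    using 4(3) by (auto simp: sorted_wrt_append)
  have "ex1 K i r p < j" if "j \<in> set (idsl w)" for p j
  proof -
    from exl_range(1)[of K i r p] consider p' where "ex1 K i r p = r p'"
      | q where "ex1 K i r p = fst (snd q)" "q \<in> set (oc1 K i r)" by blast
    then show ?thesis
    proof cases
      case 1 then show ?thesis using 4(4) that by simp
    next
      case 2
      then have "fst (snd q) \<in> set (map (\<lambda>c. fst (snd c)) (oc1 K i r))" by simp
      then show ?thesis using s(3) that 2(1) unfolding oc_ids by simp
    qed
  qed
  then show ?case using 4(1)[OF s(1), of q p] 4(2)[OF s(2), of q p] 4(4,5) by auto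
qed auto

context labelled
begin

definition occ :: "nat \<Rightarrow> nat \<times> nat \<times> (nat \<Rightarrow> nat)" where "occ i = (THE q. q \<in> OC \<and> fst (snd q) = i)"
definition AA :: "nat set" where "AA = {i. \<exists>q\<in>OC. fst (snd q) = i \<and> pfst (fst q) = 1}"
definition NN :: "nat set" where "NN = {i. \<exists>q\<in>OC. fst (snd q) = i \<and> pfst (fst q) = 0}"
definition actf :: "nat \<Rightarrow> nat" where "actf i = psnd (fst (occ i))"
definition regf :: "nat \<Rightarrow> nat \<Rightarrow> nat" where "regf i = snd (snd (occ i))"
definition evw :: "nat \<Rightarrow> (nat \<Rightarrow> nat set) \<Rightarrow> bool" where
  "evw g \<beta> \<longleftrightarrow> (\<exists>\<psi>. codes expand g \<psi> \<and> holds \<psi> \<beta>)"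

lemma occ: "q \<in> OC \<Longrightarrow> occ (fst (snd q)) = q"
  unfolding occ_def by (rule the_equality) (auto intro: OC_inject)

lemma live_eq: "live = AA \<union> NN"
proof -
  have "pfst x < 2 \<longleftrightarrow> pfst x = 1 \<or> pfst x = 0" for x by auto
  then show ?thesis unfolding live_def AA_def NN_def by auto
qed

lemma AA_occ: "i \<in> AA \<Longrightarrow> occ i \<in> OC \<and> fst (snd (occ i)) = i \<and> pfst (fst (occ i)) = 1"
  unfolding AA_def using occ by force

lemma NN_occ: "i \<in> NN \<Longrightarrow> occ i \<in> OC \<and> fst (snd (occ i)) = i \<and> pfst (fst (occ i)) = 0"
  unfolding NN_def using occ by force

lemma OC_hit: "(\<exists>q\<in>OC. hit X q \<and> P q) \<longleftrightarrow> (\<exists>i\<in>AA \<union> NN. i \<in> X \<and> P (occ i))"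
proof
  assume "\<exists>q\<in>OC. hit X q \<and> P q"
  then obtain q where q: "q \<in> OC" "fst (snd q) \<in> X" "pfst (fst q) < 2" "P q" by (auto simp: hit_def)
  then have "fst (snd q) \<in> AA \<union> NN" unfolding live_eq[symmetric] live_def by blast
  then show "\<exists>i\<in>AA \<union> NN. i \<in> X \<and> P (occ i)" using q occ by metis
next
  assume "\<exists>i\<in>AA \<union> NN. i \<in> X \<and> P (occ i)"
  then obtain i where i: "i \<in> AA \<union> NN" "i \<in> X" "P (occ i)" by blast
  then have "occ i \<in> OC" "hit X (occ i)" using AA_occ[of i] NN_occ[of i] by (auto simp: hit_def)
  then show "\<exists>q\<in>OC. hit X q \<and> P q" using i by blast
qed

lemma evw_codes: "codes expand g \<psi> \<Longrightarrow> evw g \<beta> \<longleftrightarrow> holds \<psi> \<beta>"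
  unfolding evw_def using codes_unique by blast

lemma evw_At: "evw (cAt m x y p) \<beta> \<longleftrightarrow> holds (At m x y p) (\<lambda>v. \<beta> v \<inter> (AA \<union> NN))"
proof -
  have "evw (cAt m x y p) \<beta> \<longleftrightarrow> holds (At m x y p) \<beta>" unfolding cAt_def by (rule evw_codes[OF codes_At])
  also have "\<dots> \<longleftrightarrow> holds (At m x y p) (\<lambda>v. \<beta> v \<inter> (AA \<union> NN))" by (rule holds_cong) (simp add: live_eq)
  finally show ?thesis .
qed

lemma zero_notin: "0 \<notin> AA \<union> NN"
  unfolding AA_def NN_def using OC_pos by fastforce

lemma oc_news:
  assumes "q \<in> set (ocl K (seg W 0 n) (\<lambda>_. 0))"
  shows "snd (snd q) p = 0 \<or> snd (snd q) p \<in> NN"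
proof -
  from oc_reg_range(2)[OF assms, of p] consider "snd (snd q) p = 0"
    | q' where "snd (snd q) p = fst (snd q')" "q' \<in> set (ocl K (seg W 0 n) (\<lambda>_. 0))" "pfst (fst q') = 0"
    by auto
  then show ?thesis
  proof cases
    case 2
    then have "q' \<in> OC" unfolding OC_def by blast
    with 2 show ?thesis unfolding NN_def by auto
  qed simp
qed

lemma evw_local:
  assumes "m = 2 \<longrightarrow> 3 \<le> p \<and> p < K" "m = 4 \<longrightarrow> p < 2" "m \<noteq> 0"
  shows "evw (cAt m x y p) \<beta> \<longleftrightarrow> (\<exists>q\<in>OC. local_test m (\<beta> x \<inter> (AA \<union> NN)) (\<beta> y \<inter> (AA \<union> NN)) p q)"
  unfolding evw_At by (rule holds_local[OF assms(1,2) _ assms(3)]) (use zero_notin in blast)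

text \<open>Through this instance, everything derived about codes from the laws of
  \<open>trace\<close> speaks about words: positions are the identifiers of action letters, elements
  those of creation letters.\<close>

sublocale trace K AA NN actf regf evw
proof
  show "AA \<inter> NN = {}" using AA_occ NN_occ by fastforce
  show "0 \<notin> AA \<union> NN" by (rule zero_notin)
  show "evw (cNand g h) \<beta> \<longleftrightarrow> \<not> (evw g \<beta> \<and> evw h \<beta>)" if d: "dfd g" "dfd h" for g h \<beta>
  proof -
    obtain \<phi> \<psi> where c: "codes expand g \<phi>" "codes expand h \<psi>" using d unfolding dfd_def by blast
    show ?thesis unfolding cNand_def evw_codes[OF codes_Nand[OF c]] evw_codes[OF c(1)] evw_codes[OF c(2)] by (rule holds_Nand)
  qed
  show "evw (cEx X g) \<beta> \<longleftrightarrow> (\<exists>S\<subseteq>AA \<union> NN. evw g (\<beta>(X := S)))" if d: "dfd g" for X g \<beta>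
  proof -
    obtain \<phi> where c: "codes expand g \<phi>" using d unfolding dfd_def by blast
    show ?thesis unfolding cEx_def evw_codes[OF codes_Ex[OF c]] evw_codes[OF c] holds_Ex live_eq ..
  qed
  show "evw (enc_pair t a) \<beta> \<longleftrightarrow> evw (expand (enc_pair t a)) \<beta>" if "3 \<le> t" for t a \<beta>
  proof -
    have "codes expand (enc_pair t a) \<psi> \<longleftrightarrow> codes expand (expand (enc_pair t a)) \<psi>" for \<psi>
    proof
      assume "codes expand (enc_pair t a) \<psi>"
      then show "codes expand (expand (enc_pair t a)) \<psi>" by (rule codes_macroD) (use that in simp)
    next
      assume "codes expand (expand (enc_pair t a)) \<psi>"
      then show "codes expand (enc_pair t a) \<psi>" by (rule codes_macro[rotated]) (use that in simp)
    qed
    then show ?thesis unfolding evw_def by blast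
  qed
  show "\<not> evw cF \<beta>" for \<beta>
  proof -
    have "evw (cAt 5 0 0 0) \<beta> \<longleftrightarrow> (\<exists>q\<in>OC. local_test 5 (\<beta> 0 \<inter> (AA \<union> NN)) (\<beta> 0 \<inter> (AA \<union> NN)) 0 q)"
      by (rule evw_local) simp_all
    then show ?thesis unfolding cF_def by (simp add: local_test_def)
  qed
  have h: "hit (X \<inter> (AA \<union> NN)) q \<longleftrightarrow> hit X q" if "q \<in> OC" for X q
    using that unfolding hit_def live_eq[symmetric] live_def by blast
  show "evw (cLess x y) \<beta> \<longleftrightarrow> (\<exists>i\<in>AA \<union> NN. \<exists>j\<in>AA \<union> NN. i \<in> \<beta> x \<and> j \<in> \<beta> y \<and> i < j)" for x y \<beta>
  proof -
    have "evw (cLess x y) \<beta> \<longleftrightarrow> (\<exists>q\<in>OC. \<exists>q'\<in>OC. hit (\<beta> x \<inter> (AA \<union> NN)) q \<and> hit (\<beta> y \<inter> (AA \<union> NN)) q' \<and> fst (snd q) < fst (snd q'))"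
      unfolding cLess_def evw_At by (rule holds_less) (use zero_notin in blast)
    also have "\<dots> \<longleftrightarrow> (\<exists>q\<in>OC. hit (\<beta> x) q \<and> (\<exists>q'\<in>OC. hit (\<beta> y) q' \<and> fst (snd q) < fst (snd q')))" using h by blast
    also have "\<dots> \<longleftrightarrow> (\<exists>i\<in>AA \<union> NN. i \<in> \<beta> x \<and> (\<exists>j\<in>AA \<union> NN. j \<in> \<beta> y \<and> fst (snd (occ i)) < fst (snd (occ j))))"
      unfolding OC_hit ..
    also have "\<dots> \<longleftrightarrow> (\<exists>i\<in>AA \<union> NN. \<exists>j\<in>AA \<union> NN. i \<in> \<beta> x \<and> j \<in> \<beta> y \<and> i < j)"
    proof -
      have "fst (snd (occ i)) = i" if "i \<in> AA \<union> NN" for i using that AA_occ NN_occ by blast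
      then show ?thesis by auto
    qed
    finally show ?thesis .
  qed
  show "evw (cMem x y) \<beta> \<longleftrightarrow> (\<exists>i\<in>AA \<union> NN. i \<in> \<beta> x \<and> i \<in> \<beta> y)" for x y \<beta>
  proof -
    have "evw (cMem x y) \<beta> \<longleftrightarrow> (\<exists>q\<in>OC. hit (\<beta> x) q \<and> hit (\<beta> y) q)"
      unfolding cMem_def by (subst evw_local) (auto simp: local_test_def h)
    also have "\<dots> \<longleftrightarrow> (\<exists>i\<in>AA \<union> NN. i \<in> \<beta> x \<and> hit (\<beta> y) (occ i))" unfolding OC_hit ..
    also have "\<dots> \<longleftrightarrow> (\<exists>i\<in>AA \<union> NN. i \<in> \<beta> x \<and> i \<in> \<beta> y)"
      by (intro bex_cong conj_cong refl) (use AA_occ NN_occ in \<open>auto simp: hit_def\<close>)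
    finally show ?thesis .
  qed
  show "evw (cBind x U c) \<beta> \<longleftrightarrow> (\<exists>i\<in>AA. i \<in> \<beta> x \<and> regf i (c + 3) \<in> \<beta> U)" if "0 \<notin> \<beta> U" "c + 3 < K" for x U c \<beta>
  proof -
    \<comment> \<open>A register holds 0 or a created element. Since 0 is excluded from
      \<open>\<beta> U\<close>, cutting the set down to the visible identifiers does not change the
      test.\<close>
    have rl: "snd (snd q) (c + 3) \<in> \<beta> U \<longleftrightarrow> snd (snd q) (c + 3) \<in> \<beta> U \<inter> (AA \<union> NN)" if "q \<in> OC" for q
    proof -
      obtain n where "q \<in> set (ocl K (seg W 0 n) (\<lambda>_. 0))" using \<open>q \<in> OC\<close> unfolding OC_def by blast
      then have "snd (snd q) (c + 3) = 0 \<or> snd (snd q) (c + 3) \<in> NN" by (rule oc_news)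
      then show ?thesis using \<open>0 \<notin> \<beta> U\<close> by auto
    qed
    have "evw (cBind x U c) \<beta> \<longleftrightarrow> (\<exists>q\<in>OC. hit (\<beta> x) q \<and> (pfst (fst q) = 1 \<and> snd (snd q) (c + 3) \<in> \<beta> U))"
      unfolding cBind_def by (subst evw_local) (use that(2) rl in \<open>auto simp: local_test_def h\<close>)
    also have "\<dots> \<longleftrightarrow> (\<exists>i\<in>AA \<union> NN. i \<in> \<beta> x \<and> (pfst (fst (occ i)) = 1 \<and> regf i (c + 3) \<in> \<beta> U))"
      unfolding OC_hit regf_def ..
    also have "\<dots> \<longleftrightarrow> (\<exists>i\<in>AA. i \<in> \<beta> x \<and> regf i (c + 3) \<in> \<beta> U)" using AA_occ NN_occ by fastforce
    finally show ?thesis .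
  qed
  show "evw (cLet x a) \<beta> \<longleftrightarrow> (\<exists>i\<in>AA. i \<in> \<beta> x \<and> actf i = a)" for x a \<beta>
  proof -
    have "evw (cLet x a) \<beta> \<longleftrightarrow> (\<exists>q\<in>OC. hit (\<beta> x) q \<and> fst q = enc_pair 1 a)"
      unfolding cLet_def by (subst evw_local) (auto simp: local_test_def h)
    also have "\<dots> \<longleftrightarrow> (\<exists>i\<in>AA \<union> NN. i \<in> \<beta> x \<and> fst (occ i) = enc_pair 1 a)" unfolding OC_hit ..
    also have "\<dots> \<longleftrightarrow> (\<exists>i\<in>AA. i \<in> \<beta> x \<and> actf i = a)"
    proof -
      have "fst (occ i) = enc_pair 1 a \<longleftrightarrow> pfst (fst (occ i)) = 1 \<and> actf i = a" for i
        unfolding actf_def by (metis pair_proj pfst_pair psnd_pair)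
      then show ?thesis using AA_occ NN_occ by fastforce
    qed
    finally show ?thesis .
  qed
  have kind: "evw (cKind x p) \<beta> \<longleftrightarrow> (\<exists>i\<in>AA \<union> NN. i \<in> \<beta> x \<and> pfst (fst (occ i)) = p)" if "p < 2" for x p \<beta>
  proof -
    have "evw (cKind x p) \<beta> \<longleftrightarrow> (\<exists>q\<in>OC. hit (\<beta> x) q \<and> pfst (fst q) = p)"
      unfolding cKind_def by (subst evw_local) (use that in \<open>auto simp: local_test_def h\<close>)
    then show ?thesis unfolding OC_hit .
  qed
  show "evw (cKind x 0) \<beta> \<longleftrightarrow> (\<exists>i\<in>NN. i \<in> \<beta> x)" for x \<beta>
    by (subst kind) (use AA_occ NN_occ in fastforce)+
  show "evw (cKind x (Suc 0)) \<beta> \<longleftrightarrow> (\<exists>i\<in>AA. i \<in> \<beta> x)" for x \<beta>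
    by (subst kind) (use AA_occ NN_occ in fastforce)+
qed

lemma regf_less: "i \<in> AA \<Longrightarrow> regf i p < i"
proof -
  assume "i \<in> AA"
  then have q: "occ i \<in> OC" "fst (snd (occ i)) = i" using AA_occ by blast+
  then obtain n where n: "occ i \<in> set (ocl K (seg W 0 n) (\<lambda>_. 0))" unfolding OC_def by blast
  have "\<forall>p. \<forall>j\<in>set (idsl (seg W 0 n)). (\<lambda>_. 0) p < j" using pos[of n] by (metis gr0I)
  from oc_regs(2)[OF sorted this n, of p] show ?thesis unfolding regf_def q(2) .
qed

end

subsection \<open>From runs to words\<close>

text \<open>The features of a run that matter for the simulation: \<open>E i\<close> is the active
  domain before step \<open>i\<close>, its natural order is age, and only parameters of a step can
  leave it. Registers below \<open>lo\<close> serve the parameters and new elements of the current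
  action; the \<open>n\<close> registers from \<open>lo\<close> on store live elements.\<close>

locale sim =
  fixes K lo n b :: nat and E :: "nat \<Rightarrow> nat set" and \<sigma> :: "nat \<Rightarrow> nat \<Rightarrow> nat"
    and us vs :: "nat \<Rightarrow> nat list" and aid ac :: "nat \<Rightarrow> nat"
  assumes fin: "finite (E i)" and E0: "E 0 = {}"
    and U: "u \<in> set (us i) \<Longrightarrow> \<sigma> i u \<in> E i \<and> card {e'\<in>E i. \<sigma> i u < e'} < b"
    and E_Suc: "E (Suc i) \<subseteq> E i \<union> \<sigma> i ` set (vs i)" "E i - \<sigma> i ` set (us i) \<subseteq> E (Suc i)"
    and V: "v \<in> set (vs i) \<Longrightarrow> e \<in> E i \<Longrightarrow> e < \<sigma> i v"
    and lo: "c \<in> set (us i) \<union> set (vs i) \<Longrightarrow> c + 3 < lo" and lo3: "3 \<le> lo"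
    and dist: "distinct (vs i)" "set (us i) \<inter> set (vs i) = {}"
    and K: "lo + n \<le> K" and n: "b + length (vs i) \<le> n" and n0: "0 < n"
    and lets: "v \<in> set (vs i) \<Longrightarrow> enc_pair 0 (v + 3) < K" "enc_pair 1 (ac i) < K"
begin

abbreviation Rg :: "nat set" where "Rg \<equiv> {lo..<lo + n}"

definition ids :: "nat \<Rightarrow> nat list" where "ids t = map (\<sigma> t) (vs t) @ [aid (Suc t)]"
definition Ids :: "nat \<Rightarrow> nat \<Rightarrow> nat list" where "Ids i j = concat (map ids [i..<j])"

definition okq :: "nat \<Rightarrow> nat \<Rightarrow> nat \<times> nat \<times> (nat \<Rightarrow> nat) \<Rightarrow> bool" where
  "okq i j q \<longleftrightarrow> (pfst (fst q) = 0 \<and> (\<exists>t. i \<le> t \<and> t < j \<and> fst (snd q) \<in> \<sigma> t ` set (vs t))) \<or>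
     (\<exists>t. i \<le> t \<and> t < j \<and> fst q = enc_pair 1 (ac t) \<and> fst (snd q) = aid (Suc t) \<and>
       (\<forall>c\<in>set (us t) \<union> set (vs t). snd (snd q) (c + 3) = \<sigma> t c))"

text \<open>\<open>w\<close> carries out the steps from \<open>i\<close> up to but excluding
  \<open>j\<close>. The identifiers are prescribed in order, so that concatenated pieces are
  labelled consistently.\<close>

definition runs :: "nat \<Rightarrow> nat \<Rightarrow> (nat \<times> nat) item list \<Rightarrow> (nat \<Rightarrow> nat) \<Rightarrow> (nat \<Rightarrow> nat) \<Rightarrow> bool" where
  "runs i j w r r' \<longleftrightarrow> idsl w = Ids i j \<and> exl K w r = r' \<and> (\<forall>q\<in>set (ocl K w r). okq i j q) \<and>
     (\<forall>x\<in>set w. wfi K (map_item fst x))"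

lemma okq_mono: "okq i j q \<Longrightarrow> i' \<le> i \<Longrightarrow> j \<le> j' \<Longrightarrow> okq i' j' q"
  unfolding okq_def by (meson le_trans less_le_trans)

lemma Ids_append: "i \<le> j \<Longrightarrow> j \<le> k \<Longrightarrow> Ids i k = Ids i j @ Ids j k"
  unfolding Ids_def by (metis concat_append le_Suc_ex map_append upt_add_eq_append)

lemma Ids_Suc: "Ids i (Suc i) = ids i"
  by (simp add: Ids_def)

lemma runs_append:
  assumes "runs i j w r r'" "runs j k w' r' r''" "i \<le> j" "j \<le> k"
  shows "runs i k (w @ w') r r''"
  using assms unfolding runs_def
  by (auto simp: idsl_append exl_append ocl_append Ids_append[OF assms(3,4)] intro: okq_mono[of i j _ i k] okq_mono[of j k _ i k])

lemma runs_Nil: "runs i i [] r r"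
  by (simp add: runs_def Ids_def)

lemma runs_nest:
  assumes "runs i j w r r'" "s \<in> Rg" "s' \<in> Rg"
  shows "runs i j [Ne s s' w] r (r'(s' := r s))"
  using assms K lo3 unfolding runs_def by auto

lemma runs_nop: "runs i j w r r' \<Longrightarrow> runs i j [Ne 0 0 w] r r'"
  using K n0 unfolding runs_def by auto

text \<open>One register for each element of \<open>F\<close> suffices to keep it, so with fewer
  than \<open>n\<close> elements some register can be overwritten.\<close>

lemma free_register:
  assumes "F \<subseteq> r ` Rg" "finite F" "card F < n"
  shows "\<exists>s\<in>Rg. F \<subseteq> r ` (Rg - {s})"
proof -
  have "\<forall>e\<in>F. \<exists>s. s \<in> Rg \<and> r s = e" using assms(1) by (blast elim!: imageE)
  then obtain g where g: "\<forall>e\<in>F. g e \<in> Rg \<and> r (g e) = e" by (rule bchoice[THEN exE])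
  have "card (g ` F) < card Rg" using card_image_le[OF assms(2), of g] assms(3) by simp
  then obtain s where "s \<in> Rg" "s \<notin> g ` F" using card_mono[of "g ` F" Rg] assms(2)
    by (metis finite_imageI not_less subsetI)
  moreover have "F \<subseteq> r ` (Rg - {s})" using g \<open>s \<notin> g ` F\<close> by force
  ultimately show ?thesis by blast
qed

text \<open>A nesting around the empty word is a copy instruction between registers.\<close>

lemma copy_in:
  assumes "\<sigma> i ` set ul \<subseteq> r ` Rg" "\<forall>u\<in>set ul. u + 3 < lo"
  shows "\<exists>w r'. exl K w r = r' \<and> idsl w = [] \<and> ocl K w r = [] \<and> (\<forall>x\<in>set w. wfi K (map_item fst x)) \<and>
    (\<forall>u\<in>set ul. r' (u + 3) = \<sigma> i u) \<and> (\<forall>s\<ge>lo. r' s = r s)"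
  using assms
proof (induction ul)
  case Nil then show ?case by (intro exI[of _ "[]"]) simp
next
  case (Cons u ul)
  then obtain w r' where w: "exl K w r = r'" "idsl w = []" "ocl K w r = []" "\<forall>x\<in>set w. wfi K (map_item fst x)"
    "\<forall>u\<in>set ul. r' (u + 3) = \<sigma> i u" "\<forall>s\<ge>lo. r' s = r s" by auto
  obtain s where s: "s \<in> Rg" "r s = \<sigma> i u" using Cons.prems(1) by auto
  have "r' s = \<sigma> i u" using s w(6) by auto
  moreover have "u + 3 < lo" using Cons.prems(2) by simp
  ultimately show ?case using w s K lo3
    by (intro exI[of _ "w @ [Ne s (u + 3) []]"] exI[of _ "r'(u + 3 := \<sigma> i u)"])
      (auto simp: exl_append idsl_append ocl_append)
qed

lemma create:
  assumes "\<forall>v\<in>set vl. 3 \<le> v + 3 \<and> v + 3 < lo \<and> enc_pair 0 (v + 3) < K" "distinct vl"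
  shows "\<exists>w r'. exl K w r = r' \<and> idsl w = map f vl \<and>
    (\<forall>q\<in>set (ocl K w r). pfst (fst q) = 0 \<and> fst (snd q) \<in> f ` set vl) \<and> (\<forall>x\<in>set w. wfi K (map_item fst x)) \<and>
    (\<forall>v\<in>set vl. r' (v + 3) = f v) \<and> (\<forall>s. s \<notin> (\<lambda>v. v + 3) ` set vl \<longrightarrow> r' s = r s)"
  using assms
proof (induction vl arbitrary: r)
  case Nil then show ?case by (intro exI[of _ "[]"]) simp
next
  case (Cons v vl)
  have "\<forall>v\<in>set vl. 3 \<le> v + 3 \<and> v + 3 < lo \<and> enc_pair 0 (v + 3) < K" "distinct vl" using Cons.prems by auto
  from Cons.IH[OF this, of "r(v + 3 := f v)"] obtain w r' where
    w: "exl K w (r(v + 3 := f v)) = r'" "idsl w = map f vl"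
    "\<forall>q\<in>set (ocl K w (r(v + 3 := f v))). pfst (fst q) = 0 \<and> fst (snd q) \<in> f ` set vl" "\<forall>x\<in>set w. wfi K (map_item fst x)"
    "\<forall>v\<in>set vl. r' (v + 3) = f v" "\<forall>s. s \<notin> (\<lambda>v. v + 3) ` set vl \<longrightarrow> r' s = (r(v + 3 := f v)) s" by blast
  have "v + 3 \<notin> (\<lambda>v. v + 3) ` set vl" using Cons.prems(2) by auto
  then show ?case using w Cons.prems
    by (intro exI[of _ "Lt (enc_pair 0 (v + 3), f v) # w"] exI[of _ r']) auto
qed

lemma copy_out:
  assumes "F \<subseteq> r ` Rg" "finite F" "card F + length vl \<le> n" "\<forall>v\<in>set vl. v + 3 < lo \<and> r (v + 3) = f v"
  shows "\<exists>w r'. exl K w r = r' \<and> idsl w = [] \<and> ocl K w r = [] \<and> (\<forall>x\<in>set w. wfi K (map_item fst x)) \<and>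
    F \<union> f ` set vl \<subseteq> r' ` Rg"
  using assms
proof (induction vl arbitrary: r F)
  case Nil then show ?case by (intro exI[of _ "[]"]) simp
next
  case (Cons v vl)
  then obtain s where s: "s \<in> Rg" "F \<subseteq> r ` (Rg - {s})" using free_register[of F r] by auto
  let ?r = "r(s := f v)"
  have p1: "insert (f v) F \<subseteq> ?r ` Rg"
  proof -
    have "?r ` (Rg - {s}) = r ` (Rg - {s})" by (rule image_cong) simp_all
    then have "F \<subseteq> ?r ` (Rg - {s})" using s(2) by simp
    moreover have "f v \<in> ?r ` Rg" by (rule image_eqI[of _ _ s]) (use s(1) in simp_all)
    ultimately show ?thesis by blast
  qed
  have p2: "card (insert (f v) F) + length vl \<le> n"
    using Cons.prems(2,3) card_insert_le_m1[of "Suc (card F)" F "f v"] by (simp add: card_insert_if)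
  have p3: "\<forall>v\<in>set vl. v + 3 < lo \<and> ?r (v + 3) = f v" using Cons.prems(4) s(1) by auto
  have "finite (insert (f v) F)" using Cons.prems(2) by simp
  from Cons.IH[OF p1 this p2 p3] obtain w r' where w: "exl K w ?r = r'" "idsl w = []" "ocl K w ?r = []" "\<forall>x\<in>set w. wfi K (map_item fst x)"
    "insert (f v) F \<union> f ` set vl \<subseteq> r' ` Rg" by blast
  have e: "ex1 K (Ne (v + 3) s []) r = ?r" using s(1) Cons.prems(4) K lo3 by auto
  have "exl K (Ne (v + 3) s [] # w) r = r' \<and> idsl (Ne (v + 3) s [] # w) = [] \<and> ocl K (Ne (v + 3) s [] # w) r = []"
    using w(1-3) by (simp only: exl.simps ocl.simps oc1.simps idsl.simps ids1.simps e append_Nil simp_thms)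
  moreover have "\<forall>x\<in>set (Ne (v + 3) s [] # w). wfi K (map_item fst x)" using w(4) s(1) Cons.prems(4) K by auto
  ultimately show ?case using w(5) by (intro exI[of _ "Ne (v + 3) s [] # w"] exI[of _ r']) simp
qed

text \<open>The word of a step loads the parameters, creates the new elements, performs the action
  and stores the new elements. At most \<open>b\<close> old elements have to be kept, so
  \<open>b + length (vs i) \<le> n\<close> leaves room for the new ones.\<close>

lemma runs_step:
  assumes F: "F \<subseteq> r ` Rg" "finite F" "card F \<le> b" "\<sigma> i ` set (us i) \<subseteq> F"
  shows "\<exists>w r'. runs i (Suc i) w r r' \<and> F \<union> \<sigma> i ` set (vs i) \<subseteq> r' ` Rg"
proof -
  have u: "\<forall>u\<in>set (us i). u + 3 < lo" using lo by blast
  have sub: "\<sigma> i ` set (us i) \<subseteq> r ` Rg" using F(1,4) by blast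
  from copy_in[OF sub u] obtain w1 r1 where
    w1: "exl K w1 r = r1" "idsl w1 = []" "ocl K w1 r = []" "\<forall>x\<in>set w1. wfi K (map_item fst x)"
    "\<forall>u\<in>set (us i). r1 (u + 3) = \<sigma> i u" "\<forall>s\<ge>lo. r1 s = r s" by blast
  have "\<forall>v\<in>set (vs i). 3 \<le> v + 3 \<and> v + 3 < lo \<and> enc_pair 0 (v + 3) < K" using lo lets by auto
  from create[OF this dist(1), of r1 "\<sigma> i"] obtain w2 r2 where
    w2: "exl K w2 r1 = r2" "idsl w2 = map (\<sigma> i) (vs i)"
    "\<forall>q\<in>set (ocl K w2 r1). pfst (fst q) = 0 \<and> fst (snd q) \<in> \<sigma> i ` set (vs i)" "\<forall>x\<in>set w2. wfi K (map_item fst x)"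
    "\<forall>v\<in>set (vs i). r2 (v + 3) = \<sigma> i v" "\<forall>s. s \<notin> (\<lambda>v. v + 3) ` set (vs i) \<longrightarrow> r2 s = r1 s" by blast
  have r2u: "r2 (u + 3) = \<sigma> i u" if "u \<in> set (us i)" for u
    using w1(5) w2(6) that dist(2)[of i] by (metis (no_types, lifting) add_right_imp_eq disjoint_iff imageE)
  have r2s: "r2 s = r s" if "s \<in> Rg" for s
  proof -
    have "s \<notin> (\<lambda>v. v + 3) ` set (vs i)" using lo[of _ i] that by fastforce
    then show ?thesis using w2(6) w1(6) that by auto
  qed
  have F2: "F \<subseteq> r2 ` Rg" using F(1) r2s by (metis (no_types, lifting) image_cong)
  have "\<forall>v\<in>set (vs i). v + 3 < lo \<and> r2 (v + 3) = \<sigma> i v" using lo w2(5) by blast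
  moreover have "card F + length (vs i) \<le> n" using F(3) n[of i] by linarith
  ultimately obtain w3 r3 where
    w3: "exl K w3 r2 = r3" "idsl w3 = []" "ocl K w3 r2 = []" "\<forall>x\<in>set w3. wfi K (map_item fst x)"
    "F \<union> \<sigma> i ` set (vs i) \<subseteq> r3 ` Rg" using copy_out[OF F2 F(2)] by blast
  let ?a = "Lt (enc_pair 1 (ac i), aid (Suc i)) :: (nat \<times> nat) item"
  let ?w = "w1 @ w2 @ ?a # w3"
  have "exl K ?w r = r3" using w1(1) w2(1) w3(1) by (simp add: exl_append)
  moreover have "idsl ?w = Ids i (Suc i)" using w1(2) w2(2) w3(2) by (simp add: idsl_append Ids_Suc ids_def)
  moreover have "\<forall>q\<in>set (ocl K ?w r). okq i (Suc i) q"
  proof -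
    have o: "ocl K ?w r = ocl K w2 r1 @ [(enc_pair 1 (ac i), aid (Suc i), r2)]"
      using w1(1,3) w2(1) w3(3) by (simp add: ocl_append)
    have "okq i (Suc i) (enc_pair 1 (ac i), aid (Suc i), r2)" unfolding okq_def using r2u w2(5) by auto
    moreover have "okq i (Suc i) q" if "q \<in> set (ocl K w2 r1)" for q
      using w2(3) that unfolding okq_def by auto
    ultimately show ?thesis unfolding o by auto
  qed
  moreover have "\<forall>x\<in>set ?w. wfi K (map_item fst x)" using w1(4) w2(4) w3(4) lets(2) by auto
  ultimately show ?thesis using w3(5) unfolding runs_def by blast
qed

text \<open>\<open>D\<close> consists of the elements put aside: an initial segment of the active
  domain with respect to age.\<close>

definition okD :: "nat set \<Rightarrow> nat \<Rightarrow> bool" where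
  "okD D i \<longleftrightarrow> D \<subseteq> E i \<and> (\<forall>x\<in>D. \<forall>y\<in>E i - D. x < y)"

text \<open>With \<open>b\<close> newer elements alive, no element of \<open>D\<close> is recent. It
  is thus no parameter of the step, and only parameters can leave the active domain.\<close>

lemma okD_step:
  assumes "okD D i" "D = {} \<or> b \<le> card (E i - D)"
  shows "okD D (Suc i)" "\<sigma> i ` set (us i) \<inter> D = {}"
proof -
  show dj: "\<sigma> i ` set (us i) \<inter> D = {}"
  proof (rule ccontr)
    assume "\<sigma> i ` set (us i) \<inter> D \<noteq> {}"
    then obtain u where u: "u \<in> set (us i)" "\<sigma> i u \<in> D" by blast
    then have "E i - D \<subseteq> {e'\<in>E i. \<sigma> i u < e'}" using assms(1) unfolding okD_def by blast
    then have "card (E i - D) \<le> card {e'\<in>E i. \<sigma> i u < e'}" by (rule card_mono[rotated]) (use fin in simp)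
    then show False using U[OF u(1)] assms(2) u(2) by auto
  qed
  have "D \<subseteq> E (Suc i)" using E_Suc(2)[of i] dj assms(1) unfolding okD_def by blast
  moreover have "x < y" if "x \<in> D" "y \<in> E (Suc i) - D" for x y
  proof -
    from that(2) E_Suc(1)[of i] consider "y \<in> E i - D" | v where "v \<in> set (vs i)" "y = \<sigma> i v" by blast
    then show ?thesis
    proof cases
      case 1 then show ?thesis using assms(1) that(1) unfolding okD_def by blast
    next
      case 2 then show ?thesis using V assms(1) that(1) unfolding okD_def by blast
    qed
  qed
  ultimately show "okD D (Suc i)" unfolding okD_def by blast
qed

lemma okD_insert:
  assumes "okD D i" "E i - D \<noteq> {}"
  shows "okD (insert (Min (E i - D)) D) i" "Min (E i - D) \<in> E i - D"
proof -
  have f: "finite (E i - D)" using fin by simp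
  show m: "Min (E i - D) \<in> E i - D" using Min_in[OF f assms(2)] .
  have "Min (E i - D) < y" if "y \<in> E i - insert (Min (E i - D)) D" for y
    using Min_le[OF f, of y] that by fastforce
  then show "okD (insert (Min (E i - D)) D) i" using assms(1) m unfolding okD_def by blast
qed

lemma act_step:
  assumes "okD D i" "E i - D \<subseteq> r ` Rg" "D = {} \<or> b \<le> card (E i - D)" "card (E i - D) \<le> b"
  shows "\<exists>w r'. runs i (Suc i) w r r' \<and> E (Suc i) - D \<subseteq> r' ` Rg \<and> okD D (Suc i)"
proof -
  have "\<sigma> i ` set (us i) \<subseteq> E i" using U by blast
  then have "\<sigma> i ` set (us i) \<subseteq> E i - D" using okD_step(2)[OF assms(1,3)] by blast
  from runs_step[OF assms(2) _ assms(4) this] fin obtain w r' where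
    "runs i (Suc i) w r r'" and sub: "(E i - D) \<union> \<sigma> i ` set (vs i) \<subseteq> r' ` Rg" by auto
  moreover have "E (Suc i) - D \<subseteq> r' ` Rg"
  proof (rule order_trans[OF _ sub])
    show "E (Suc i) - D \<subseteq> (E i - D) \<union> \<sigma> i ` set (vs i)" using E_Suc(1)[of i] by blast
  qed
  ultimately show ?thesis using okD_step(1)[OF assms(1,3)] by (intro exI conjI)
qed

text \<open>The oldest element leaves the registers for as long as more than \<open>b\<close> elements newer than \<open>D\<close>
  are alive: it is saved by a nesting that spans the maximal interval of this kind.\<close>

lemma nest_step:
  assumes i: "okD D i" "E i - D \<subseteq> r ` Rg" "b < card (E i - D)"
    and j: "i < j" "card (E j - D) \<le> b" "\<And>t. i \<le> t \<Longrightarrow> t < j \<Longrightarrow> b < card (E t - D)"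
    and IH: "\<And>D'. okD D' i \<Longrightarrow> E i - D' \<subseteq> r ` Rg \<Longrightarrow> (\<forall>t. i \<le> t \<and> t < j \<longrightarrow> D' = {} \<or> b \<le> card (E t - D')) \<Longrightarrow>
       card (E j - D') \<le> b \<Longrightarrow> card (E i - D') < card (E i - D) \<Longrightarrow>
       \<exists>w r'. runs i j w r r' \<and> E j - D' \<subseteq> r' ` Rg \<and> okD D' j"
  shows "\<exists>w r'. runs i j w r r' \<and> E j - D \<subseteq> r' ` Rg \<and> okD D j"
proof -
  let ?x = "Min (E i - D)"
  let ?D = "insert ?x D"
  have ne: "E i - D \<noteq> {}" using i(3) by force
  note x = okD_insert[OF i(1) ne]
  have rem: "E t - ?D = (E t - D) - {?x}" for t by blast
  have c1: "b \<le> card (E t - ?D)" if "i \<le> t" "t < j" for t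
    using j(3)[OF that] fin unfolding rem by (auto simp: card_Diff_singleton_if)
  have c2: "card (E j - ?D) \<le> b" using j(2) fin unfolding rem by (auto simp: card_Diff_singleton_if)
  have c3: "card (E i - ?D) < card (E i - D)" using x(2) fin i(3) unfolding rem by simp
  have "\<exists>w r'. runs i j w r r' \<and> E j - ?D \<subseteq> r' ` Rg \<and> okD ?D j"
    by (rule IH[OF x(1) _ _ c2 c3]) (use i(2) c1 in auto)
  then obtain w r' where w: "runs i j w r r'" "E j - ?D \<subseteq> r' ` Rg" "okD ?D j" by blast
  have xj: "?x \<in> E j - D" using w(3) x(2) unfolding okD_def by blast
  obtain s where s: "s \<in> Rg" "r s = ?x" using x(2) i(2) by (metis imageE subsetD)
  \<comment> \<open>The element put aside is still alive at \<open>j\<close>, so the others outside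
    \<open>D\<close> number fewer than \<open>b\<close> and leave a register for its return.\<close>
  have "card (E j - ?D) < n"
  proof -
    have "card (E j - ?D) < card (E j - D)" using xj fin unfolding rem by (intro psubset_card_mono) auto
    then show ?thesis using j(2) n[of 0] by linarith
  qed
  from free_register[OF w(2) _ this] fin obtain s' where s': "s' \<in> Rg" "E j - ?D \<subseteq> r' ` (Rg - {s'})" by auto
  let ?r = "r'(s' := r s)"
  have "E j - D \<subseteq> ?r ` Rg"
  proof -
    have "?r ` (Rg - {s'}) = r' ` (Rg - {s'})" by (rule image_cong) simp_all
    then have "E j - ?D \<subseteq> ?r ` (Rg - {s'})" using s'(2) by simp
    moreover have "?x \<in> ?r ` Rg" by (rule image_eqI[of _ _ s']) (use s(2) s'(1) in simp_all)
    moreover have "E j - D \<subseteq> insert ?x (E j - ?D)" by blast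
    ultimately show ?thesis by blast
  qed
  moreover have "okD D j"
  proof -
    have "?x > y" if "y \<in> D" for y using that i(1) x(2) unfolding okD_def by blast
    then show ?thesis using w(3) xj unfolding okD_def by blast
  qed
  ultimately show ?thesis using runs_nest[OF w(1) s(1) s'(1)] by blast
qed

text \<open>If more than \<open>b\<close> elements are stored, the oldest is put aside up to the
  first time \<open>k\<close> when at most \<open>b\<close> remain. If \<open>k < j\<close>, the
  interval gets shorter; if \<open>k = j\<close>, it stays the same but fewer elements are stored.
  This is why the induction on the length contains an induction on the number of stored
  elements.\<close>

lemma finite_part:
  "i \<le> j \<Longrightarrow> okD D i \<Longrightarrow> E i - D \<subseteq> r ` Rg \<Longrightarrow> (\<forall>t. i \<le> t \<and> t < j \<longrightarrow> D = {} \<or> b \<le> card (E t - D)) \<Longrightarrow>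
    card (E j - D) \<le> b \<Longrightarrow> \<exists>w r'. runs i j w r r' \<and> E j - D \<subseteq> r' ` Rg \<and> okD D j"
proof (induction "j - i" arbitrary: i j D r rule: less_induct)
  case less
  from less.prems(2-) show ?case
  proof (induction "card (E i - D)" arbitrary: D rule: less_induct)
    case inner: less
    have c: "D = {} \<or> b \<le> card (E i - D)" if "i < j" using inner.prems(3) that by blast
    show ?case
    proof (cases "i = j")
      case True then show ?thesis using runs_Nil inner.prems by blast
    next
      case ij: False
      then have lt: "i < j" using less.prems(1) by simp
      show ?thesis
      proof (cases "card (E i - D) \<le> b")
        case True
        from act_step[OF inner.prems(1,2) c[OF lt] True] obtain w r1 where
          w: "runs i (Suc i) w r r1" "E (Suc i) - D \<subseteq> r1 ` Rg" "okD D (Suc i)" by blast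
        have "\<exists>w r'. runs (Suc i) j w r1 r' \<and> E j - D \<subseteq> r' ` Rg \<and> okD D j"
          by (rule less.hyps[OF _ _ w(3,2) _ inner.prems(4)]) (use lt inner.prems(3) in auto)
        then obtain w' r' where w': "runs (Suc i) j w' r1 r'" "E j - D \<subseteq> r' ` Rg" "okD D j" by blast
        have "runs i j (w @ w') r r'" by (rule runs_append[OF w(1) w'(1)]) (use lt in auto)
        with w' show ?thesis by blast
      next
        case False
        define k where "k = (LEAST t. i \<le> t \<and> card (E t - D) \<le> b)"
        have k: "i \<le> k" "card (E k - D) \<le> b" "k \<le> j"
          unfolding k_def using LeastI[of "\<lambda>t. i \<le> t \<and> card (E t - D) \<le> b" j]
            Least_le[of "\<lambda>t. i \<le> t \<and> card (E t - D) \<le> b" j] less.prems(1) inner.prems(4) by auto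
        have kt: "b < card (E t - D)" if "i \<le> t" "t < k" for t
          using not_less_Least[of t "\<lambda>t. i \<le> t \<and> card (E t - D) \<le> b"] that unfolding k_def by auto
        have "i < k" using k(1,2) False by (metis le_neq_implies_less)
        have "\<exists>w r'. runs i k w r r' \<and> E k - D \<subseteq> r' ` Rg \<and> okD D k"
        proof (rule nest_step[OF inner.prems(1,2) _ \<open>i < k\<close> k(2) kt])
          show "b < card (E i - D)" using False by simp
          fix D' assume D': "okD D' i" "E i - D' \<subseteq> r ` Rg" "\<forall>t. i \<le> t \<and> t < k \<longrightarrow> D' = {} \<or> b \<le> card (E t - D')"
            "card (E k - D') \<le> b" "card (E i - D') < card (E i - D)"
          show "\<exists>w r'. runs i k w r r' \<and> E k - D' \<subseteq> r' ` Rg \<and> okD D' k"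
          proof (cases "k = j")
            case True
            then show ?thesis using inner.hyps[OF D'(5,1,2)] D'(3,4) by blast
          next
            case False
            then have "k - i < j - i" using k(3) \<open>i < k\<close> by linarith
            from less.hyps[OF this k(1) D'(1-4)] show ?thesis .
          qed
        qed
        then obtain w r1 where w: "runs i k w r r1" "E k - D \<subseteq> r1 ` Rg" "okD D k" by blast
        have "\<exists>w r'. runs k j w r1 r' \<and> E j - D \<subseteq> r' ` Rg \<and> okD D j"
          by (rule less.hyps[OF _ k(3) w(3,2) _ inner.prems(4)]) (use k \<open>i < k\<close> lt inner.prems(3) in auto)
        then obtain w' r' where w': "runs k j w' r1 r'" "E j - D \<subseteq> r' ` Rg" "okD D j" by blast
        have "runs i j (w @ w') r r'" by (rule runs_append[OF w(1) w'(1) k(1,3)])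
        with w' show ?thesis by blast
      qed
    qed
  qed
qed

definition state :: "nat \<Rightarrow> nat set \<Rightarrow> (nat \<Rightarrow> nat) \<Rightarrow> bool" where
  "state i D r \<longleftrightarrow> okD D i \<and> E i - D \<subseteq> r ` Rg \<and> (\<forall>t\<ge>i. D = {} \<or> b \<le> card (E t - D))"

lemma infinite_step:
  "state i D r \<Longrightarrow> \<exists>j w D' r'. i < j \<and> runs i j w r r' \<and> state j D' r'"
proof (induction "card (E i - D)" arbitrary: D rule: less_induct)
  case less
  from less.prems have s: "okD D i" "E i - D \<subseteq> r ` Rg" "\<forall>t\<ge>i. D = {} \<or> b \<le> card (E t - D)"
    unfolding state_def by simp_all
  show ?case
  proof (cases "card (E i - D) \<le> b")
    case True
    from act_step[OF s(1,2) _ True] s(3) obtain w r' where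
      "runs i (Suc i) w r r'" "E (Suc i) - D \<subseteq> r' ` Rg" "okD D (Suc i)" by blast
    moreover from this s(3) have "state (Suc i) D r'" unfolding state_def by auto
    ultimately show ?thesis by blast
  next
    case False
    show ?thesis
    proof (cases "\<exists>t\<ge>i. card (E t - D) \<le> b")
      case True
      define k where "k = (LEAST t. i \<le> t \<and> card (E t - D) \<le> b)"
      have k: "i \<le> k" "card (E k - D) \<le> b"
        unfolding k_def using LeastI_ex[of "\<lambda>t. i \<le> t \<and> card (E t - D) \<le> b"] True by auto
      have "\<exists>w r'. runs i k w r r' \<and> E k - D \<subseteq> r' ` Rg \<and> okD D k"
        by (rule finite_part[OF k(1) s(1,2) _ k(2)]) (use s(3) in auto)
      then obtain w r' where w: "runs i k w r r'" "E k - D \<subseteq> r' ` Rg" "okD D k" by blast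
      have "i < k" using k False by (metis le_neq_implies_less)
      moreover have "state k D r'" using w(2,3) s(3) k(1) unfolding state_def by simp
      ultimately show ?thesis using w(1) by (intro exI conjI)
    next
      case never: False
      have ne: "E i - D \<noteq> {}" using False by force
      let ?D = "insert (Min (E i - D)) D"
      note x = okD_insert[OF s(1) ne]
      have rem: "E t - ?D = (E t - D) - {Min (E i - D)}" for t by blast
      have "b \<le> card (E t - ?D)" if "i \<le> t" for t
      proof -
        have "b < card (E t - D)" using never that by auto
        then show ?thesis using fin unfolding rem by (auto simp: card_Diff_singleton_if)
      qed
      then have "state i ?D r" using x(1) s(2) unfolding state_def by auto
      moreover have "card (E i - ?D) < card (E i - D)" using x(2) fin unfolding rem by (intro psubset_card_mono) auto
      ultimately show ?thesis using less.hyps by blast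
    qed
  qed
qed

text \<open>Dependent choice concatenates pieces that each perform at least one step, so all steps
  of the run are covered.\<close>

lemma simulation_exists:
  "\<exists>t w r. t 0 = 0 \<and> strict_mono t \<and> r 0 = (\<lambda>_. 0) \<and> (\<forall>k::nat. runs (t k) (t (Suc k)) (w k) (r k) (r (Suc k)))"
proof -
  have s0: "state 0 {} (\<lambda>_. 0)" unfolding state_def okD_def E0 by simp
  have "\<exists>f. \<forall>k::nat. (case f k of (i, D, r) \<Rightarrow> state i D r \<and> (k = 0 \<longrightarrow> i = 0 \<and> r = (\<lambda>_. 0))) \<and>
      (case f k of (i, D, r) \<Rightarrow> case f (Suc k) of (j, D', r') \<Rightarrow> i < j \<and> (\<exists>w. runs i j w r r'))"
  proof (rule dependent_nat_choice)
    show "\<exists>x. case x of (i, D, r) \<Rightarrow> state i D r \<and> ((0::nat) = 0 \<longrightarrow> i = 0 \<and> r = (\<lambda>_. 0))"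
      using s0 by (intro exI[of _ "(0, {}, \<lambda>_. 0)"]) simp
    fix x :: "nat \<times> nat set \<times> (nat \<Rightarrow> nat)" and k :: nat
    assume "case x of (i, D, r) \<Rightarrow> state i D r \<and> (k = 0 \<longrightarrow> i = 0 \<and> r = (\<lambda>_. 0))"
    then obtain i D r where x: "x = (i, D, r)" "state i D r" by (cases x) auto
    from infinite_step[OF x(2)] obtain j w D' r' where "i < j" "runs i j w r r'" "state j D' r'" by blast
    then show "\<exists>y. (case y of (i, D, r) \<Rightarrow> state i D r \<and> (Suc k = 0 \<longrightarrow> i = 0 \<and> r = (\<lambda>_. 0))) \<and>
        (case x of (i, D, r) \<Rightarrow> case y of (j, D', r') \<Rightarrow> i < j \<and> (\<exists>w. runs i j w r r'))"
      unfolding x(1) by (intro exI[of _ "(j, D', r')"]) auto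
  qed
  then obtain f where ff: "\<forall>k::nat. (case f k of (i, D, r) \<Rightarrow> state i D r \<and> (k = 0 \<longrightarrow> i = 0 \<and> r = (\<lambda>_. 0))) \<and>
      (case f k of (i, D, r) \<Rightarrow> case f (Suc k) of (j, D', r') \<Rightarrow> i < j \<and> (\<exists>w. runs i j w r r'))" by (rule exE)
  note f = ff[rule_format, THEN conjunct1] ff[rule_format, THEN conjunct2]
  define t where "t k = fst (f k)" for k
  define r where "r k = snd (snd (f k))" for k
  have "\<forall>k. \<exists>w. runs (t k) (t (Suc k)) w (r k) (r (Suc k))"
    using f(2) unfolding t_def r_def by (auto simp: case_prod_beta)
  then obtain w where "\<forall>k. runs (t k) (t (Suc k)) (w k) (r k) (r (Suc k))" by metis
  moreover have "strict_mono t" unfolding strict_mono_Suc_iff t_def using f(2) by (auto simp: case_prod_beta)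
  moreover have "t 0 = 0" "r 0 = (\<lambda>_. 0)" using f(1)[of 0] unfolding t_def r_def by (auto simp: case_prod_beta)
  ultimately show ?thesis by blast
qed

end

locale simword = sim +
  fixes a0 :: nat
  assumes a0: "enc_pair 1 a0 < K" and aid_pos: "0 < aid 0"
    and ids_sorted: "sorted_wrt (<) (aid t # ids t)"
    and aid_fresh: "v \<in> set (vs t) \<Longrightarrow> \<sigma> t v \<noteq> aid k"
begin

lemma aid_mono: "strict_mono aid"
  unfolding strict_mono_Suc_iff using ids_sorted by (simp add: ids_def)

lemma Ids_sorted: "sorted_wrt (<) (aid 0 # Ids 0 j) \<and> (\<forall>x\<in>set (aid 0 # Ids 0 j). x \<le> aid j)"
proof (induction j)
  case 0 then show ?case by (simp add: Ids_def)
next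
  case (Suc j)
  have I: "Ids 0 (Suc j) = Ids 0 j @ ids j" using Ids_append[of 0 j "Suc j"] by (simp add: Ids_Suc)
  have s: "\<forall>x\<in>set (ids j). aid j < x" "sorted_wrt (<) (ids j)" using ids_sorted[of j] by auto
  have l: "\<forall>x\<in>set (ids j). x \<le> aid (Suc j)" using s(2) unfolding ids_def by (auto simp: sorted_wrt_append)
  have "aid j \<le> aid (Suc j)" using aid_mono by (simp add: strict_mono_less_eq)
  moreover have "\<forall>x\<in>set (aid 0 # Ids 0 j). \<forall>y\<in>set (ids j). x < y" using Suc s(1) by (meson le_less_trans)
  moreover have "aid 0 # Ids 0 (Suc j) = (aid 0 # Ids 0 j) @ ids j" using I by simp
  moreover have "sorted_wrt (<) ((aid 0 # Ids 0 j) @ ids j)"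
    unfolding sorted_wrt_append using Suc s(2) calculation(2) by blast
  moreover have "\<forall>x\<in>set ((aid 0 # Ids 0 j) @ ids j). x \<le> aid (Suc j)"
    unfolding set_append using Suc l calculation(1) by (meson Un_iff le_trans)
  ultimately show ?case by simp
qed

lemma word_exists:
  "\<exists>W. labelled K W \<and> (\<forall>k. wfi K (map_item fst (W k))) \<and>
    labelled.AA K W = range aid \<and> labelled.actf K W (aid 0) = a0 \<and>
    (\<forall>t. labelled.actf K W (aid (Suc t)) = ac t \<and>
      (\<forall>c\<in>set (us t) \<union> set (vs t). labelled.regf K W (aid (Suc t)) (c + 3) = \<sigma> t c) \<and>
      \<sigma> t ` set (vs t) \<subseteq> labelled.NN K W)"
proof -
  obtain t w r where s: "t 0 = 0" "strict_mono t" "r 0 = (\<lambda>_. 0)" "\<And>k. runs (t k) (t (Suc k)) (w k) (r k) (r (Suc k))"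
    using simulation_exists by blast
  \<comment> \<open>The letter of the initial action comes first; each finite stretch of steps is
    bracketed by a trivial nesting to become one item.\<close>
  define W where "W k = (case k of 0 \<Rightarrow> Lt (enc_pair 1 a0, aid 0) | Suc k \<Rightarrow> Ne 0 0 (w k))" for k
  have R: "runs 0 (t k) (seg W 1 (Suc k)) (\<lambda>_. 0) (r k)" for k
  proof (induction k)
    case 0 then show ?case using runs_Nil s(1,3) by (simp add: seg_def)
  next
    case (Suc k)
    have "seg W 1 (Suc (Suc k)) = seg W 1 (Suc k) @ [Ne 0 0 (w k)]" by (simp add: seg_def W_def)
    moreover have "t k \<le> t (Suc k)" using s(2) by (simp add: strict_mono_less_eq)
    ultimately show ?case using runs_append[OF Suc runs_nop[OF s(4)]] by simp
  qed
  have sg: "seg W 0 (Suc k) = W 0 # seg W 1 (Suc k)" for k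
    unfolding seg_def by (simp only: upt_conv_Cons zero_less_Suc list.map One_nat_def)
  have W0: "W 0 = Lt (enc_pair 1 a0, aid 0)" by (simp add: W_def)
  have idsW: "idsl (seg W 0 (Suc k)) = aid 0 # Ids 0 (t k)" for k
    using R[of k] unfolding sg W0 runs_def by simp
  have srt: "sorted_wrt (<) (idsl (seg W 0 k)) \<and> 0 \<notin> set (idsl (seg W 0 k))" for k
  proof (cases k)
    case 0 then show ?thesis by (simp add: seg_def)
  next
    case (Suc m)
    then show ?thesis using Ids_sorted[of "t m"] aid_pos unfolding Suc idsW by auto
  qed
  have lab: "labelled K W" by unfold_locales (use srt K lo3 n0 in auto)
  interpret L: labelled K W by (rule lab)
  have ocW: "ocl K (seg W 0 (Suc k)) (\<lambda>_. 0) = (enc_pair 1 a0, aid 0, \<lambda>_. 0) # ocl K (seg W 1 (Suc k)) (\<lambda>_. 0)" for k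
    unfolding sg W0 by simp
  have OC: "q = (enc_pair 1 a0, aid 0, \<lambda>_. 0) \<or> (\<exists>j. okq 0 j q)" if q: "q \<in> L.OC" for q
  proof -
    obtain k where "q \<in> set (ocl K (seg W 0 k) (\<lambda>_. 0))" using q unfolding L.OC_def by blast
    then have "q \<in> set (ocl K (seg W 0 (Suc k)) (\<lambda>_. 0))" using L.ocl_mono[of k "Suc k" "\<lambda>_. 0"] by auto
    then show ?thesis unfolding ocW using R[of k] unfolding runs_def by auto
  qed
  have ex0: "(enc_pair 1 a0, aid 0, \<lambda>_. 0) \<in> L.OC" unfolding L.OC_def using ocW[of 0] by (intro UN_I[of "Suc 0"]) simp_all
  have ex: "\<exists>q\<in>L.OC. fst (snd q) = i" if i: "i \<in> set (ids j)" for i j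
  proof -
    have "j < t (Suc j)" using strict_mono_imp_increasing[OF s(2), of "Suc j"] by simp
    then have "i \<in> set (Ids 0 (t (Suc j)))" using i unfolding Ids_def by auto
    then have "i \<in> set (map (\<lambda>q. fst (snd q)) (ocl K (seg W 0 (Suc (Suc j))) (\<lambda>_. 0)))" unfolding oc_ids idsW by simp
    then obtain q where "q \<in> set (ocl K (seg W 0 (Suc (Suc j))) (\<lambda>_. 0))" "i = fst (snd q)"
      unfolding set_map by (rule imageE)
    then show ?thesis unfolding L.OC_def by (intro bexI[of _ q] UN_I[of "Suc (Suc j)"]) simp_all
  qed
  have inj: "aid i = aid j \<longleftrightarrow> i = j" for i j using aid_mono by (simp add: strict_mono_eq)
  have act0: "okq 0 j q \<Longrightarrow> fst (snd q) \<noteq> aid 0" for j q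
    unfolding okq_def using aid_fresh inj by auto
  have actS: "okq 0 j q \<Longrightarrow> fst (snd q) = aid (Suc k) \<Longrightarrow> fst q = enc_pair 1 (ac k) \<and>
      (\<forall>c\<in>set (us k) \<union> set (vs k). snd (snd q) (c + 3) = \<sigma> k c)" for j k q
    unfolding okq_def using aid_fresh[THEN not_sym] inj by (auto simp del: One_nat_def)
  have oS: "fst (L.occ (aid (Suc k))) = enc_pair 1 (ac k) \<and>
      (\<forall>c\<in>set (us k) \<union> set (vs k). snd (snd (L.occ (aid (Suc k)))) (c + 3) = \<sigma> k c) \<and> aid (Suc k) \<in> L.AA" for k
  proof -
    have "aid (Suc k) \<in> set (ids k)" by (simp add: ids_def)
    then obtain q where q: "q \<in> L.OC" "fst (snd q) = aid (Suc k)" using ex by blast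
    have "q \<noteq> (enc_pair 1 a0, aid 0, \<lambda>_. 0)" using q(2) inj by auto
    then obtain j where "okq 0 j q" using OC[OF q(1)] by blast
    from actS[OF this q(2)] have "fst q = enc_pair 1 (ac k) \<and>
      (\<forall>c\<in>set (us k) \<union> set (vs k). snd (snd q) (c + 3) = \<sigma> k c)" .
    moreover have "L.occ (aid (Suc k)) = q" using L.occ[OF q(1)] q(2) by simp
    moreover have "aid (Suc k) \<in> L.AA" unfolding L.AA_def using q calculation(1) by auto
    ultimately show ?thesis by simp
  qed
  have o0: "fst (L.occ (aid 0)) = enc_pair 1 a0" "aid 0 \<in> L.AA"
    using L.occ[OF ex0] ex0 unfolding L.AA_def by force+
  have AA: "L.AA = range aid"
  proof
    show "range aid \<subseteq> L.AA"
    proof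
      fix x assume "x \<in> range aid"
      then obtain k where "x = aid k" by blast
      then show "x \<in> L.AA" using oS o0(2) by (cases k) auto
    qed
    show "L.AA \<subseteq> range aid"
    proof
      fix x assume "x \<in> L.AA"
      then obtain q where q: "q \<in> L.OC" "fst (snd q) = x" "pfst (fst q) = 1" unfolding L.AA_def by blast
      from OC[OF q(1)] show "x \<in> range aid"
      proof
        assume "q = (enc_pair 1 a0, aid 0, \<lambda>_. 0)"
        then show ?thesis using q(2) by auto
      next
        assume "\<exists>j. okq 0 j q"
        then show ?thesis using q(2,3) unfolding okq_def by auto
      qed
    qed
  qed
  have NN: "\<sigma> k v \<in> L.NN" if "v \<in> set (vs k)" for k v
  proof -
    have "\<sigma> k v \<in> set (ids k)" using that by (simp add: ids_def)
    then obtain q where q: "q \<in> L.OC" "fst (snd q) = \<sigma> k v" using ex by blast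
    have ne: "fst (snd q) \<noteq> aid j" for j unfolding q(2) using aid_fresh[OF that] .
    then have "q \<noteq> (enc_pair 1 a0, aid 0, \<lambda>_. 0)" by fastforce
    then obtain j where "okq 0 j q" using OC[OF q(1)] by blast
    then have "pfst (fst q) = 0" unfolding okq_def using ne by blast
    then show ?thesis unfolding L.NN_def using q by blast
  qed
  have wf: "wfi K (map_item fst (W k))" for k
  proof (cases k)
    case 0 then show ?thesis using a0 by (simp add: W_def)
  next
    case (Suc m)
    then show ?thesis using s(4)[of m] K n0 unfolding runs_def by (auto simp: W_def)
  qed
  have "L.actf (aid 0) = a0" "\<And>k. L.actf (aid (Suc k)) = ac k" unfolding L.actf_def using o0(1) oS by simp_all
  moreover have "L.regf (aid (Suc k)) (c + 3) = \<sigma> k c" if "c \<in> set (us k) \<union> set (vs k)" for k c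
    unfolding L.regf_def using oS that by blast
  ultimately show ?thesis using lab wf AA NN by (intro exI[of _ W]) (simp add: image_subset_iff)
qed

end

subsection \<open>Invariance under renaming\<close>

lemma adom_rename: "adom (subst_inst \<nu> I) = \<nu> ` adom I"
  by (simp add: adom_def subst_inst_def image_UN case_prod_beta)

lemma subst_inst_compose: "subst_inst \<nu> (subst_inst \<sigma> I) = subst_inst (\<lambda>c. \<nu> (\<sigma> c)) I"
  by (simp add: subst_inst_def image_image case_prod_beta comp_def)

lemma subst_inst_cong: "(\<And>f c. f \<in> I \<Longrightarrow> c \<in> set (snd f) \<Longrightarrow> \<sigma> c = \<tau> c) \<Longrightarrow> subst_inst \<sigma> I = subst_inst \<tau> I"
  unfolding subst_inst_def by (rule image_cong) (auto simp: case_prod_beta)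

lemma subst_inst_Un: "subst_inst \<nu> (I \<union> I2) = subst_inst \<nu> I \<union> subst_inst \<nu> I2"
  by (simp add: subst_inst_def image_Un)

lemma inj_subst_inst:
  assumes "inj \<nu>"
  shows "inj (\<lambda>(r, args). (r :: nat, map \<nu> args))"
  using assms by (auto simp: inj_def dest: map_inj_on[OF _ inj_on_subset[OF assms subset_UNIV]])

lemma subst_inst_Diff: "inj \<nu> \<Longrightarrow> subst_inst \<nu> (I - I2) = subst_inst \<nu> I - subst_inst \<nu> I2"
  unfolding subst_inst_def by (rule image_set_diff[OF inj_subst_inst])

lemma subst_inst_mem:
  assumes "inj \<nu>"
  shows "(r, map \<nu> xs) \<in> subst_inst \<nu> I \<longleftrightarrow> (r, xs) \<in> I"
  using inj_image_mem_iff[OF inj_subst_inst[OF assms], of "(r, xs)" I] by (simp add: subst_inst_def)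

lemma fol_sat_cong: "(\<And>c. c \<in> fv_fol q \<Longrightarrow> \<sigma> c = \<tau> c) \<Longrightarrow> fol_sat I \<sigma> q \<longleftrightarrow> fol_sat I \<tau> q"
proof (induction q arbitrary: \<sigma> \<tau>)
  case (FAtom r xs)
  then have "map \<sigma> xs = map \<tau> xs" by simp
  then show ?case by (simp only: fol_sat.simps)
next
  case (FEx x q)
  have "fol_sat I (\<sigma>(x := e)) q \<longleftrightarrow> fol_sat I (\<tau>(x := e)) q" for e
    by (rule FEx.IH) (use FEx.prems in auto)
  then show ?case by simp
next
  case (FAnd q1 q2)
  show ?case using FAnd.IH(1)[of \<sigma> \<tau>] FAnd.IH(2)[of \<sigma> \<tau>] FAnd.prems by simp
next
  case (FNot q)
  show ?case using FNot.IH[of \<sigma> \<tau>] FNot.prems by simp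
qed simp

lemma fol_sat_rename:
  assumes "inj \<nu>"
  shows "fol_sat (subst_inst \<nu> I) (\<lambda>c. \<nu> (\<sigma> c)) q \<longleftrightarrow> fol_sat I \<sigma> q"
proof (induction q arbitrary: \<sigma>)
  case (FAtom r xs)
  show ?case using subst_inst_mem[OF assms, of r "map \<sigma> xs" I] by (simp add: comp_def)
next
  case (FEx x q)
  have "(\<lambda>c. \<nu> (\<sigma> c))(x := \<nu> e) = (\<lambda>c. \<nu> ((\<sigma>(x := e)) c))" for e by auto
  then show ?case using FEx by (simp add: adom_rename del: fun_upd_apply)
qed (simp_all add: inj_eq[OF assms])

lemma mso_sat_cong: "(\<And>u. u \<in> fvd \<phi> \<Longrightarrow> d u = d' u) \<Longrightarrow> mso_sat \<rho> p X d \<phi> \<longleftrightarrow> mso_sat \<rho> p X d' \<phi>"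
proof (induction \<phi> arbitrary: p X d d')
  case (MQAt q x)
  then show ?case using fol_sat_cong[of q d d'] by simp
next
  case (MExData u \<phi>)
  have "mso_sat \<rho> p X (d(u := e)) \<phi> \<longleftrightarrow> mso_sat \<rho> p X (d'(u := e)) \<phi>" for e
    by (rule MExData.IH) (use MExData.prems in auto)
  then show ?case by simp
next
  case (MNot \<phi>)
  show ?case using MNot.IH[of d d'] MNot.prems by simp
next
  case (MAnd \<phi> \<psi>)
  show ?case using MAnd.IH(1)[of d d'] MAnd.IH(2)[of d d'] MAnd.prems by simp
next
  case (MExPos x \<phi>)
  show ?case using MExPos.IH[of d d'] MExPos.prems by simp
next
  case (MExSet Y \<phi>)
  show ?case using MExSet.IH[of d d'] MExSet.prems by simp
qed simp_all

text \<open>Truth does not depend on the choice of names, so the elements of a run may be named by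
  their order of creation.\<close>

lemma mso_sat_rename:
  assumes "inj \<nu>"
  shows "mso_sat (\<lambda>i. subst_inst \<nu> (\<rho> i)) p X (\<lambda>u. \<nu> (d u)) \<phi> \<longleftrightarrow> mso_sat \<rho> p X d \<phi>"
proof (induction \<phi> arbitrary: p X d)
  case (MQAt q x)
  show ?case by (simp add: fol_sat_rename[OF assms] adom_rename inj_image_mem_iff[OF assms])
next
  case (MExData u \<phi>)
  have "(\<lambda>c. \<nu> (d c))(u := \<nu> e) = (\<lambda>c. \<nu> ((d(u := e)) c))" for e by auto
  moreover have "gadom (\<lambda>i. subst_inst \<nu> (\<rho> i)) = \<nu> ` gadom \<rho>" by (simp add: gadom_def adom_rename image_UN)
  ultimately show ?case using MExData by (simp del: fun_upd_apply)
qed simp_all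

subsection \<open>Canonical names for the elements of a run\<close>

locale run =
  fixes S :: dms and b lo n K :: nat and cs :: "nat \<Rightarrow> config" and \<alpha> :: "nat \<Rightarrow> action" and \<tau> :: "nat \<Rightarrow> nat \<Rightarrow> nat"
  assumes wf: "wf_dms S" and I0: "fst (cs 0) = set (dms_init S)" and H0: "fst (snd (cs 0)) = {}"
    and \<alpha>: "\<alpha> i \<in> set (dms_acts S)" and step: "dms_step b (cs i) (\<alpha> i) (\<tau> i) (cs (Suc i))"
    and bounds: "\<gamma> \<in> set (dms_acts S) \<Longrightarrow> c \<in> set (act_u \<gamma>) \<union> set (act_v \<gamma>) \<Longrightarrow> c + 3 < lo"
      "\<gamma> \<in> set (dms_acts S) \<Longrightarrow> c \<in> set (act_v \<gamma>) \<Longrightarrow> enc_pair 0 (c + 3) < K"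
      "\<gamma> \<in> set (dms_acts S) \<Longrightarrow> b + length (act_v \<gamma>) \<le> n"
      "\<gamma> \<in> set (dms_acts S) \<Longrightarrow> enc_pair 1 (enc_action \<gamma>) < K"
      "enc_pair 1 (enc_action (init_action (dms_init S))) < K" "3 \<le> lo" "lo + n \<le> K" "0 < n"
begin

abbreviation I where "I i \<equiv> fst (cs i)"
abbreviation H where "H i \<equiv> fst (snd (cs i))"
abbreviation s where "s i \<equiv> snd (snd (cs i))"
abbreviation us where "us i \<equiv> act_u (\<alpha> i)"
abbreviation vs where "vs i \<equiv> act_v (\<alpha> i)"

lemma acts:
  "distinct (vs i)" "set (us i) \<inter> set (vs i) = {}" "fv_fol (act_Q (\<alpha> i)) = set (us i)"
  "f \<in> set (act_Del (\<alpha> i)) \<Longrightarrow> c \<in> set (snd f) \<Longrightarrow> c \<in> set (us i)"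
  "f \<in> set (act_Add (\<alpha> i)) \<Longrightarrow> c \<in> set (snd f) \<Longrightarrow> c \<in> set (us i) \<union> set (vs i)"
  using wf \<alpha>[of i] unfolding wf_dms_def wf_action_def by blast+

lemma steps:
  "u \<in> set (us i) \<Longrightarrow> \<tau> i u \<in> adom (I i)" "v \<in> set (vs i) \<Longrightarrow> \<tau> i v \<notin> H i" "inj_on (\<tau> i) (set (vs i))"
  "fol_sat (I i) (\<tau> i) (act_Q (\<alpha> i))"
  "I (Suc i) = (I i - subst_inst (\<tau> i) (set (act_Del (\<alpha> i)))) \<union> subst_inst (\<tau> i) (set (act_Add (\<alpha> i)))"
  "H (Suc i) = H i \<union> \<tau> i ` set (vs i)" "u \<in> set (us i) \<Longrightarrow> \<tau> i u \<in> Recent b (I i) (s i)"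
  "e \<in> H i \<Longrightarrow> s (Suc i) e = s i e" "v \<in> set (vs i) \<Longrightarrow> e \<in> H i \<Longrightarrow> s i e < s (Suc i) (\<tau> i v)"
  "m < m' \<Longrightarrow> m' < length (vs i) \<Longrightarrow> s (Suc i) (\<tau> i (vs i ! m)) < s (Suc i) (\<tau> i (vs i ! m'))"
  using step[of i] unfolding dms_step_def by (simp_all add: case_prod_beta)

lemma H_mono: "i \<le> j \<Longrightarrow> H i \<subseteq> H j"
  by (induction rule: dec_induct) (auto simp: steps(6))

lemma s_mono: "i \<le> j \<Longrightarrow> e \<in> H i \<Longrightarrow> s j e = s i e"
proof (induction rule: dec_induct)
  case (step j)
  then have "e \<in> H j" using H_mono by blast
  then show ?case using step steps(8) by simp
qed simp

text \<open>All arguments of a deleted fact are parameters, so a fact that mentions a non-parameter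
  survives the step.\<close>

lemma adom_Suc: "adom (I (Suc i)) \<subseteq> adom (I i) \<union> \<tau> i ` set (vs i)" "adom (I i) - \<tau> i ` set (us i) \<subseteq> adom (I (Suc i))"
proof -
  show "adom (I (Suc i)) \<subseteq> adom (I i) \<union> \<tau> i ` set (vs i)"
  proof
    fix e assume "e \<in> adom (I (Suc i))"
    then consider "e \<in> adom (I i)" | f where "f \<in> set (act_Add (\<alpha> i))" "e \<in> \<tau> i ` set (snd f)"
      unfolding steps(5) by (fastforce simp: adom_def subst_inst_def)
    then show "e \<in> adom (I i) \<union> \<tau> i ` set (vs i)"
    proof cases
      case 2
      then obtain c where c: "c \<in> set (snd f)" "e = \<tau> i c" by blast
      then show ?thesis using acts(5)[OF 2(1) c(1)] steps(1) by blast
    qed simp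
  qed
  show "adom (I i) - \<tau> i ` set (us i) \<subseteq> adom (I (Suc i))"
  proof
    fix e assume e: "e \<in> adom (I i) - \<tau> i ` set (us i)"
    then obtain f where f: "f \<in> I i" "e \<in> set (snd f)" by (auto simp: adom_def)
    have "f \<notin> subst_inst (\<tau> i) (set (act_Del (\<alpha> i)))"
    proof
      assume "f \<in> subst_inst (\<tau> i) (set (act_Del (\<alpha> i)))"
      then obtain g where "g \<in> set (act_Del (\<alpha> i))" "e \<in> \<tau> i ` set (snd g)"
        using f(2) by (fastforce simp: subst_inst_def)
      then show False using acts(4) e by blast
    qed
    then show "e \<in> adom (I (Suc i))" using f unfolding steps(5) adom_def by blast
  qed
qed

lemma adom_0: "adom (I 0) = {}"
  using wf by (simp add: I0 wf_dms_def)

lemma adom_H: "adom (I i) \<subseteq> H i"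
proof (induction i)
  case (Suc i) then show ?case using adom_Suc(1)[of i] steps(6)[of i] by blast
qed (simp add: adom_0)

lemma finite_adom: "finite (adom (I i))"
proof (induction i)
  case (Suc i) show ?case by (rule finite_subset[OF adom_Suc(1)]) (use Suc in simp)
qed (simp add: adom_0)

definition born :: "nat \<Rightarrow> nat \<Rightarrow> nat \<Rightarrow> bool" where
  "born j m e \<longleftrightarrow> m < length (vs j) \<and> e = \<tau> j (vs j ! m)"

lemma born_H: "e \<in> H k \<longleftrightarrow> (\<exists>j<k. \<exists>m. born j m e)"
proof (induction k)
  case (Suc k)
  have "e \<in> \<tau> k ` set (vs k) \<longleftrightarrow> (\<exists>m. born k m e)" unfolding born_def set_conv_nth by auto
  then show ?case unfolding steps(6) using Suc by (auto simp: less_Suc_eq)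
qed (simp add: H0)

lemma born_new: "born j m e \<Longrightarrow> e \<notin> H j"
  unfolding born_def using steps(2) by force

lemma born_unique:
  assumes "born j m e" "born j' m' e"
  shows "j = j' \<and> m = m'"
proof -
  have "\<not> j < j'" if "born j m e" "born j' m' e" for j m j' m'
    using that born_H[of e j'] born_new by blast
  then have "j = j'" using assms by (meson linorder_neqE_nat)
  moreover have "m = m'"
    using assms steps(3)[of j] acts(1)[of j] calculation unfolding born_def
    by (metis inj_on_eq_iff nth_eq_iff_index_eq nth_mem)
  ultimately show ?thesis ..
qed

text \<open>The pair of birth step and index in the tuple, ordered lexicographically, reproduces the
  sequence numbering.\<close>

lemma born_s:
  assumes "born j m e" "born j' m' e'" "j < j' \<or> j = j' \<and> m < m'" "j' < k"
  shows "s k e < s k e'"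
proof -
  have "s (Suc j') e < s (Suc j') e'"
  proof (cases "j < j'")
    case True
    then have "e \<in> H j'" using assms(1) born_H by blast
    then show ?thesis using steps(8,9)[of _ j'] assms(2) unfolding born_def by auto
  next
    case False
    then show ?thesis using assms(1-3) steps(10)[of m m' j'] unfolding born_def by auto
  qed
  moreover have "e \<in> H (Suc j')" "e' \<in> H (Suc j')" using born_H assms(1-3) by (meson le_imp_less_Suc less_imp_le le_refl less_SucI)+
  ultimately show ?thesis using s_mono[of "Suc j'" k] assms(4) by simp
qed

text \<open>Elements are renamed to odd numbers in the order of their creation; the even numbers between the
  blocks of different steps name the positions of the actions.\<close>

definition B :: nat where "B = Suc (Suc (sum_list (map (\<lambda>\<gamma>. length (act_v \<gamma>)) (dms_acts S))))"
definition aid :: "nat \<Rightarrow> nat" where "aid k = 2 * (B * Suc k)"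
definition \<nu> :: "nat \<Rightarrow> nat" where
  "\<nu> e = (if \<exists>j m. born j m e then 2 * (THE x. \<exists>j m. born j m e \<and> x = B * Suc j + Suc m) + 1 else 2 * e)"

lemma B: "m < length (vs j) \<Longrightarrow> Suc m < B"
  using member_le_sum_list[of "length (vs j)" "map (\<lambda>\<gamma>. length (act_v \<gamma>)) (dms_acts S)"] \<alpha>[of j] unfolding B_def by force

lemma \<nu>_born: "born j m e \<Longrightarrow> \<nu> e = 2 * (B * Suc j + Suc m) + 1"
proof -
  assume b: "born j m e"
  then have "(THE x. \<exists>j m. born j m e \<and> x = B * Suc j + Suc m) = B * Suc j + Suc m"
    by (intro the_equality) (use born_unique in blast)+
  then show ?thesis using b unfolding \<nu>_def by auto
qed

lemma born_next: "born j m e \<Longrightarrow> j < j' \<Longrightarrow> B * Suc j + Suc m < B * Suc j'"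
proof -
  assume a: "born j m e" "j < j'"
  have "B * Suc j + Suc m < B * Suc (Suc j)" using B[of m j] a(1) unfolding born_def by simp
  also have "\<dots> \<le> B * Suc j'" using a(2) by (intro mult_le_mono2) simp
  finally show ?thesis .
qed

lemma born_\<nu>: "born j m e \<Longrightarrow> born j' m' e' \<Longrightarrow> j < j' \<or> j = j' \<and> m < m' \<Longrightarrow> \<nu> e < \<nu> e'"
  using born_next[of j m e j'] by (auto simp: \<nu>_born)

lemma \<nu>_s:
  assumes "e \<in> H k" "e' \<in> H k"
  shows "\<nu> e < \<nu> e' \<longleftrightarrow> s k e < s k e'"
proof -
  obtain j m j' m' where b: "born j m e" "born j' m' e'" "j < k" "j' < k" using assms born_H by metis
  consider "j < j' \<or> j = j' \<and> m < m'" | "j' < j \<or> j' = j \<and> m' < m" | "j = j'" "m = m'" by linarith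
  then show ?thesis
  proof cases
    case 1 show ?thesis using born_s[OF b(1,2) 1 b(4)] born_\<nu>[OF b(1,2) 1] by simp
  next
    case 2 show ?thesis using born_s[OF b(2,1) 2 b(3)] born_\<nu>[OF b(2,1) 2] by simp
  next
    case 3 then have "e = e'" using b unfolding born_def by simp
    then show ?thesis by simp
  qed
qed

lemma inj_\<nu>: "inj \<nu>"
proof (rule injI)
  fix e e' assume eq: "\<nu> e = \<nu> e'"
  \<comment> \<open>Parity tells whether an element is ever created; the others are doubled, which
    keeps them apart and makes \<open>\<nu>\<close> injective on the whole domain.\<close>
  have even: "odd (\<nu> e) \<longleftrightarrow> (\<exists>j m. born j m e)" for e unfolding \<nu>_def by simp
  show "e = e'"
  proof (cases "\<exists>j m. born j m e")
    case True
    then obtain j m j' m' where b: "born j m e" "born j' m' e'" using even eq by metis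
    then have "\<not> (j < j' \<or> j = j' \<and> m < m')" "\<not> (j' < j \<or> j' = j \<and> m' < m)"
      using born_\<nu>[OF b] born_\<nu>[OF b(2,1)] eq by auto
    then have "j = j'" "m = m'" by linarith+
    then show ?thesis using b unfolding born_def by simp
  next
    case False
    then have "\<not> (\<exists>j m. born j m e')" using even eq by metis
    then show ?thesis using False eq unfolding \<nu>_def by simp
  qed
qed

lemma born_nth: "m < length (vs t) \<Longrightarrow> born t m (\<tau> t (vs t ! m))"
  by (simp add: born_def)

sublocale sim K lo n b "\<lambda>i. \<nu> ` adom (I i)" "\<lambda>i c. \<nu> (\<tau> i c)" us vs aid "\<lambda>i. enc_action (\<alpha> i)"
proof
  fix i :: nat
  show "finite (\<nu> ` adom (I i))" using finite_adom by simp
  show "\<nu> ` adom (I 0) = {}" by (simp add: adom_0)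
  show "\<nu> ` adom (I (Suc i)) \<subseteq> \<nu> ` adom (I i) \<union> (\<lambda>c. \<nu> (\<tau> i c)) ` set (vs i)"
    using image_mono[OF adom_Suc(1)[of i], of \<nu>] by (simp add: image_Un image_image)
  show "\<nu> ` adom (I i) - (\<lambda>c. \<nu> (\<tau> i c)) ` set (us i) \<subseteq> \<nu> ` adom (I (Suc i))"
    using image_mono[OF adom_Suc(2)[of i], of \<nu>] by (simp add: image_set_diff[OF inj_\<nu>] image_image)
  show "distinct (vs i)" "set (us i) \<inter> set (vs i) = {}" by (rule acts)+
  show "3 \<le> lo" "lo + n \<le> K" "0 < n" by (rule bounds)+
  show "b + length (vs i) \<le> n" "enc_pair 1 (enc_action (\<alpha> i)) < K" using bounds \<alpha> by blast+
next
  fix u i assume u: "u \<in> set (us i)"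
  have r: "\<tau> i u \<in> adom (I i)" "card {e' \<in> adom (I i). s i (\<tau> i u) < s i e'} < b"
    using steps(7)[OF u] unfolding Recent_def by simp_all
  \<comment> \<open>On the elements introduced so far \<open>\<nu>\<close> is ordered like the
    sequence numbering, so both count the same newer elements.\<close>
  have "{e' \<in> \<nu> ` adom (I i). \<nu> (\<tau> i u) < e'} = \<nu> ` {e' \<in> adom (I i). s i (\<tau> i u) < s i e'}"
    using \<nu>_s[of "\<tau> i u" i] adom_H[of i] r(1) by blast
  then have "card {e' \<in> \<nu> ` adom (I i). \<nu> (\<tau> i u) < e'} = card {e' \<in> adom (I i). s i (\<tau> i u) < s i e'}"
    using card_image[OF inj_on_subset[OF inj_\<nu> subset_UNIV]] by simp
  then show "\<nu> (\<tau> i u) \<in> \<nu> ` adom (I i) \<and> card {e' \<in> \<nu> ` adom (I i). \<nu> (\<tau> i u) < e'} < b" using r by simp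
next
  fix v i e assume "v \<in> set (vs i)" "e \<in> \<nu> ` adom (I i)"
  then obtain m e' where "m < length (vs i)" "v = vs i ! m" "e' \<in> H i" "e = \<nu> e'" using adom_H[of i] by (auto simp: in_set_conv_nth)
  then show "e < \<nu> (\<tau> i v)" using born_H[of e' i] born_\<nu>[OF _ born_nth] by blast
next
  fix c i assume "c \<in> set (us i) \<union> set (vs i)"
  then show "c + 3 < lo" using bounds(1)[OF \<alpha>] by blast
next
  fix v i assume "v \<in> set (vs i)"
  then show "enc_pair 0 (v + 3) < K" using bounds(2)[OF \<alpha>] by blast
qed

lemma ids_increasing: "sorted_wrt (<) (aid t # ids t)"
proof -
  have v: "aid t < \<nu> (\<tau> t v)" "\<nu> (\<tau> t v) < aid (Suc t)" if "v \<in> set (vs t)" for v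
  proof -
    obtain m where m: "m < length (vs t)" "v = vs t ! m" using \<open>v \<in> set (vs t)\<close> by (auto simp: in_set_conv_nth)
    then have 1: "\<nu> (\<tau> t v) = 2 * (B * Suc t + Suc m) + 1" using \<nu>_born[OF born_nth] by simp
    have 2: "B * Suc t + Suc m < B * Suc (Suc t)" using born_next[OF born_nth[OF m(1)], of "Suc t"] by simp
    \<comment> \<open>The odd names fit strictly between the even names \<open>2 * p\<close> and
      \<open>2 * q\<close> of the two neighbouring actions.\<close>
    have "x = 2 * (p + Suc m) + 1 \<Longrightarrow> p + Suc m < q \<Longrightarrow> 2 * p < x \<and> x < 2 * q" for x p q :: nat by arith
    from this[OF 1 2] show "aid t < \<nu> (\<tau> t v)" "\<nu> (\<tau> t v) < aid (Suc t)" unfolding aid_def by blast+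
  qed
  have "aid t < aid (Suc t)" by (simp add: aid_def B_def)
  moreover have "sorted_wrt (<) (map (\<lambda>c. \<nu> (\<tau> t c)) (vs t))"
    unfolding sorted_wrt_iff_nth_less using born_\<nu>[OF born_nth born_nth] by simp
  ultimately show ?thesis using v unfolding ids_def by (simp add: sorted_wrt_append)
qed

sublocale simword K lo n b "\<lambda>i. \<nu> ` adom (I i)" "\<lambda>i c. \<nu> (\<tau> i c)" us vs aid "\<lambda>i. enc_action (\<alpha> i)"
  "enc_action (init_action (dms_init S))"
proof
  show "enc_pair 1 (enc_action (init_action (dms_init S))) < K" by (rule bounds)
  show "0 < aid 0" by (simp add: aid_def B_def)
  show "sorted_wrt (<) (aid t # ids t)" for t by (rule ids_increasing)
  fix v t k assume "v \<in> set (vs t)"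
  then obtain m where "m < length (vs t)" "v = vs t ! m" by (auto simp: in_set_conv_nth)
  then have "odd (\<nu> (\<tau> t v))" using \<nu>_born[OF born_nth] by simp
  then show "\<nu> (\<tau> t v) \<noteq> aid k" unfolding aid_def by fastforce
qed

text \<open>The instances described by the simulating word are the renamed instances of the run.
  Validity of the trace and violation of the sentence are then inherited from the run.\<close>

lemma word_of_run:
  assumes ok: "\<forall>\<gamma>\<in>set (dms_acts S). okact K \<gamma>" and \<phi>: "sentence \<phi>" and no: "\<not> models I \<phi>"
  shows "\<exists>W. labelled K W \<and> (\<forall>k. wfi K (map_item fst (W k))) \<and>
    labelled.evw K W (start (enc_instance S \<phi> b)) (\<lambda>_. {})"
proof -
  let ?L = "allacts S" and ?\<iota> = "init_action (dms_init S)"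
  obtain W where W: "labelled K W" "\<forall>k. wfi K (map_item fst (W k))" "labelled.AA K W = range aid"
      "labelled.actf K W (aid 0) = enc_action ?\<iota>"
      "\<forall>t. labelled.actf K W (aid (Suc t)) = enc_action (\<alpha> t) \<and>
      (\<forall>c\<in>set (us t) \<union> set (vs t). labelled.regf K W (aid (Suc t)) (c + 3) = \<nu> (\<tau> t c)) \<and>
      (\<lambda>c. \<nu> (\<tau> t c)) ` set (vs t) \<subseteq> labelled.NN K W"
    using word_exists by blast
  interpret L: labelled K W by (rule W(1))
  have act: "L.actf (aid (Suc t)) = enc_action (\<alpha> t)" for t using W(5) by blast
  have rg: "L.rg (aid (Suc t)) c = \<nu> (\<tau> t c)" if "c \<in> set (us t) \<union> set (vs t)" for t c
    using W(5) that unfolding L.rg_def by blast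
  have news: "\<nu> e \<in> L.NN" if e: "e \<in> H i" for e i
  proof -
    obtain j m where "born j m e" using e born_H by blast
    then have "e \<in> \<tau> j ` set (vs j)" unfolding born_def by simp
    then have "\<nu> e \<in> (\<lambda>c. \<nu> (\<tau> j c)) ` set (vs j)" by blast
    then show ?thesis using W(5) by blast
  qed
  have F: "L.Fat ?L (aid (Suc i)) = subst_inst \<nu> (I i)" for i
  proof (induction i)
    case 0
    have "L.Fat ?L (aid (Suc 0)) = (L.Fat ?L (aid 0) - subst_inst (L.rg (aid 0)) (set (act_Del ?\<iota>))) \<union> subst_inst (L.rg (aid 0)) (set (act_Add ?\<iota>))"
      by (rule L.Fat_Suc[OF W(3) aid_mono _ W(4)]) (simp add: allacts_def)
    moreover have "L.Fat ?L (aid 0) = {}"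
      by (rule L.Fat_first) (use W(3) aid_mono in \<open>auto simp: strict_mono_less\<close>)
    moreover have "adom (set (dms_init S)) = {}" using wf by (simp add: wf_dms_def)
    ultimately show ?case by (simp add: I0 subst_inst_no_args)
  next
    case (Suc i)
    have "\<alpha> i \<in> set ?L" using \<alpha> by (simp add: allacts_def)
    then have "L.Fat ?L (aid (Suc (Suc i))) = (L.Fat ?L (aid (Suc i)) - subst_inst (L.rg (aid (Suc i))) (set (act_Del (\<alpha> i))))
       \<union> subst_inst (L.rg (aid (Suc i))) (set (act_Add (\<alpha> i)))"
      by (rule L.Fat_Suc[OF W(3) aid_mono _ act])
    moreover have "subst_inst (L.rg (aid (Suc i))) (set (act_Del (\<alpha> i))) = subst_inst \<nu> (subst_inst (\<tau> i) (set (act_Del (\<alpha> i))))"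
      unfolding subst_inst_compose by (rule subst_inst_cong, rule rg) (use acts(4) in blast)
    moreover have "subst_inst (L.rg (aid (Suc i))) (set (act_Add (\<alpha> i))) = subst_inst \<nu> (subst_inst (\<tau> i) (set (act_Add (\<alpha> i))))"
      unfolding subst_inst_compose by (rule subst_inst_cong, rule rg) (use acts(5) in blast)
    ultimately show ?case unfolding steps(5) Suc by (simp add: subst_inst_Un subst_inst_Diff[OF inj_\<nu>])
  qed
  have low: "aid k \<le> aid i" if "aid k < aid (Suc i)" for i k
    using that aid_mono by (simp add: strict_mono_less strict_mono_less_eq)
  have "L.valid ?\<iota> (dms_acts S) b"
  proof -
    have en: "L.enabled ?L b (aid (Suc i)) (\<alpha> i)" for i
    proof -
      have "L.rg (aid (Suc i)) u \<in> L.NN \<and> L.rg (aid (Suc i)) u \<in> adom (L.Fat ?L (aid (Suc i))) \<and>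
          card {e' \<in> adom (L.Fat ?L (aid (Suc i))). L.rg (aid (Suc i)) u < e'} < b" if u: "u \<in> set (us i)" for u
      proof -
        have "L.rg (aid (Suc i)) u = \<nu> (\<tau> i u)" using rg u by blast
        moreover have "\<nu> (\<tau> i u) \<in> L.NN" using news steps(1)[OF u] adom_H by blast
        ultimately show ?thesis using U[OF u] unfolding F adom_rename by simp
      qed
      moreover have "fol_sat (L.Fat ?L (aid (Suc i))) (L.rg (aid (Suc i))) (act_Q (\<alpha> i))"
      proof -
        have "fol_sat (subst_inst \<nu> (I i)) (L.rg (aid (Suc i))) (act_Q (\<alpha> i)) \<longleftrightarrow>
            fol_sat (subst_inst \<nu> (I i)) (\<lambda>c. \<nu> (\<tau> i c)) (act_Q (\<alpha> i))"
          by (rule fol_sat_cong, rule rg) (use acts(3) in blast)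
        then show ?thesis unfolding F fol_sat_rename[OF inj_\<nu>] using steps(4) by simp
      qed
      ultimately show ?thesis unfolding L.enabled_def by blast
    qed
    have ch: "chainlt L.NN (L.rg (aid (Suc i))) (aid k) (vs i)" if "aid k < aid (Suc i)" for i k
    proof -
      have m: "map (L.rg (aid (Suc i))) (vs i) = map (\<lambda>c. \<nu> (\<tau> i c)) (vs i)" using rg by simp
      have "L.rg (aid (Suc i)) ` set (vs i) \<subseteq> L.NN" using W(5) rg by (auto simp: image_subset_iff)
      moreover have "sorted_wrt (<) (aid k # map (\<lambda>c. \<nu> (\<tau> i c)) (vs i))"
        using ids_increasing[of i] low[OF that] unfolding ids_def by (auto simp: sorted_wrt_append)
      ultimately show ?thesis unfolding chainlt_iff m by blast
    qed
    have *: "if \<exists>y\<in>range aid. y < aid k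
       then \<exists>\<gamma>\<in>set (dms_acts S). L.actf (aid k) = enc_action \<gamma> \<and> (\<forall>y\<in>range aid. y < aid k \<longrightarrow> chainlt L.NN (L.rg (aid k)) y (act_v \<gamma>)) \<and>
         L.enabled (?\<iota> # dms_acts S) b (aid k) \<gamma>
       else L.actf (aid k) = enc_action ?\<iota>" for k
    proof (cases k)
      case 0
      have "\<not> (\<exists>y\<in>range aid. y < aid k)" unfolding 0 using aid_mono by (auto simp: strict_mono_less)
      then show ?thesis unfolding 0 using W(4) by (simp only: if_False)
    next
      case (Suc i)
      have "aid i < aid k" unfolding Suc using aid_mono by (simp add: strict_mono_less)
      then have "\<exists>y\<in>range aid. y < aid k" by blast
      moreover have "\<exists>\<gamma>\<in>set (dms_acts S). L.actf (aid k) = enc_action \<gamma> \<and> (\<forall>y\<in>range aid. y < aid k \<longrightarrow> chainlt L.NN (L.rg (aid k)) y (act_v \<gamma>)) \<and>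
         L.enabled (?\<iota> # dms_acts S) b (aid k) \<gamma>"
        unfolding Suc using act[of i] ch[of _ i] en[of i] \<alpha>[of i] unfolding allacts_def by blast
      ultimately show ?thesis by (simp only: if_True)
    qed
    have "\<exists>y\<in>range aid. x < y" if "x \<in> range aid" for x
    proof -
      obtain k where "x = aid k" using \<open>x \<in> range aid\<close> by blast
      moreover have "aid k < aid (Suc k)" using aid_mono by (simp add: strict_mono_less)
      ultimately show ?thesis by blast
    qed
    moreover have "range aid \<noteq> {}" by blast
    ultimately show ?thesis 
      unfolding L.valid_def unfolding W(3) using *[unfolded W(3)] by (intro conjI ballI) (blast | elim imageE, simp only:)+
  qed
  moreover have "\<not> mso_sat (\<lambda>k. L.Fat ?L (aid (Suc k))) (\<lambda>_. 0) (\<lambda>_. {}) (\<lambda>_. 0) \<phi>"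
  proof -
    \<comment> \<open>Renaming turns the assignment constantly 0 into one constantly
      \<open>\<nu> 0\<close>; a sentence does not see the difference.\<close>
    have "mso_sat (\<lambda>k. subst_inst \<nu> (I k)) (\<lambda>_. 0) (\<lambda>_. {}) (\<lambda>_. 0) \<phi> \<longleftrightarrow>
        mso_sat (\<lambda>k. subst_inst \<nu> (I k)) (\<lambda>_. 0) (\<lambda>_. {}) (\<lambda>_. \<nu> 0) \<phi>"
      by (rule mso_sat_cong) (use \<phi> in \<open>simp add: sentence_def\<close>)
    also have "\<dots> \<longleftrightarrow> mso_sat I (\<lambda>_. 0) (\<lambda>_. {}) (\<lambda>_. 0) \<phi>" by (rule mso_sat_rename[OF inj_\<nu>])
    finally show ?thesis using no unfolding F models_def by simp
  qed
  moreover have "adom (set (dms_init S)) = {}" using wf by (simp add: wf_dms_def)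
  ultimately have "L.evw (start (enc_instance S \<phi> b)) (\<lambda>_. {})"
    using L.ev_start[OF ok _ \<phi>, of b] W(3) aid_mono by blast
  then show ?thesis using W(1,2) by blast
qed

end

subsection \<open>Decidability\<close>

text \<open>The initial action is not part of the coded instance; its code is bounded through that
  of its facts, which are.\<close>

lemma init_code_mono: "a \<le> c \<Longrightarrow> init_code a \<le> init_code c"
  unfolding init_code_def by (simp add: enc_pair_mono)

lemma list_encode_mem: "x \<in> set xs \<Longrightarrow> x < list_encode xs"
proof (induction xs)
  case (Cons a xs)
  then show ?case using le_enc_pair[where a=a and b="list_encode xs"] by (auto intro: le_less_trans simp: less_Suc_eq_le)
qed simp

lemma length_le_list_encode: "length xs \<le> list_encode xs"
proof (induction xs)
  case (Cons a xs)
  then show ?case using le_enc_pair(2)[where a=a and b="list_encode xs"] by simp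
qed simp

lemma action_bounds:
  "list_encode (act_u \<gamma>) < enc_action \<gamma>" "list_encode (act_v \<gamma>) < enc_action \<gamma>"
  by (cases \<gamma>; auto simp del: list_encode_Cons intro!: list_encode_mem)+

lemma instance_bounds:
  "b < enc_instance S \<phi> b" "\<gamma> \<in> set (dms_acts S) \<Longrightarrow> enc_action \<gamma> < enc_instance S \<phi> b"
  "enc_facts (dms_init S) < enc_instance S \<phi> b"
proof -
  have S: "enc_dms S < enc_instance S \<phi> b"
    unfolding enc_instance_def by (intro list_encode_mem) simp
  show "b < enc_instance S \<phi> b" unfolding enc_instance_def by (intro list_encode_mem) simp
  show "enc_facts (dms_init S) < enc_instance S \<phi> b"
    by (rule less_trans[OF _ S]) (cases S, auto simp del: list_encode_Cons intro!: list_encode_mem)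
  have "list_encode (map enc_action (dms_acts S)) < enc_dms S"
    by (cases S, auto simp del: list_encode_Cons intro!: list_encode_mem)
  moreover have "enc_action \<gamma> < list_encode (map enc_action (dms_acts S))" if "\<gamma> \<in> set (dms_acts S)"
    by (rule list_encode_mem) (use that in simp)
  ultimately show "\<gamma> \<in> set (dms_acts S) \<Longrightarrow> enc_action \<gamma> < enc_instance S \<phi> b" using S by (meson less_trans)
qed

text \<open>A run is simulated with \<open>x + 4\<close> registers for the reserved registers and the variables of the actions, followed by
  \<open>2 * x + 1\<close> registers for the elements that are alive.\<close>

definition size_bound :: "nat \<Rightarrow> nat" where
  "size_bound x = Suc (enc_pair (x + x + x + 10) (x + x + x + 10) + enc_pair 1 (init_code x))"

lemma cmp_size_bound: "cmp size_bound"
  unfolding size_bound_def init_code_def by (intro cmp_intros)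

lemma satisfiable_iff_counterexample:
  assumes v: "valid_input S \<phi>" and x: "x = enc_instance S \<phi> b" and \<psi>: "codes expand (start x) \<psi>"
  shows "satisfiable (size_bound x) \<psi> \<longleftrightarrow> \<not> recency_mc S \<phi> b"
proof -
  let ?K = "size_bound x"
  have wf: "wf_dms S" "sentence \<phi>" and ad: "adom (set (dms_init S)) = {}"
    using v by (auto simp: valid_input_def wf_dms_def)
  \<comment> \<open>The first summand of the bound covers \<open>nop\<close>, the creation letters
    and the letters of the actions of the system; the second one covers the initial action.\<close>
  have code: "enc_pair a c < ?K" if "a \<le> 3 * x + 10" "c \<le> 3 * x + 10" for a c
    using enc_pair_mono[of a "x + x + x + 10" c "x + x + x + 10"] that unfolding size_bound_def by simp
  have var: "c < x" if "\<gamma> \<in> set (dms_acts S)" "c \<in> set (act_u \<gamma>) \<union> set (act_v \<gamma>)" for c \<gamma>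
    using instance_bounds(2)[OF that(1), of \<phi> b] action_bounds[of \<gamma>] list_encode_mem[of c] that(2)
    unfolding x by (meson UnE less_trans)
  have K: "3 * x + 10 < ?K" using le_enc_pair(1)[where a="x + x + x + 10" and b="x + x + x + 10"] unfolding size_bound_def by simp
  have nop: "nop < ?K" by (rule code) simp_all
  have ok: "\<forall>\<gamma>\<in>set (dms_acts S). okact ?K \<gamma>"
  proof
    fix \<gamma> assume \<gamma>: "\<gamma> \<in> set (dms_acts S)"
    then have w: "wf_action (dms_schema S) \<gamma>" using wf(1) by (simp add: wf_dms_def)
    have "c + 3 < ?K" if "c \<in> set (act_u \<gamma>) \<union> set (act_v \<gamma>)" for c using var[OF \<gamma> that] K by linarith
    then show "okact ?K \<gamma>" using w unfolding okact_def wf_action_def by blast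
  qed
  show ?thesis
  proof
    assume "satisfiable ?K \<psi>"
    then obtain W0 where W0: "sat ?K \<psi> (\<lambda>n. bare (W0 n))" unfolding satisfiable_iff[OF nop] by blast
    have "3 < ?K" using K by simp
    from labelling_exists[OF this, of W0] obtain W where W: "labelled ?K W" "\<And>n. map_item fst (W n) = W0 n" by blast
    interpret L: labelled ?K W by (rule W(1))
    have "ann (\<lambda>_. {}) (W n) = bare (W0 n)" for n unfolding ann_def W(2)[symmetric] by (simp add: item.map_comp comp_def)
    then have "L.holds \<psi> (\<lambda>_. {})" using W0 unfolding L.holds_def by simp
    then have "L.evw (start x) (\<lambda>_. {})" using L.evw_codes[OF \<psi>] by simp
    then obtain a where a: "L.valid (init_action (dms_init S)) (dms_acts S) b" "L.AA = range a" "strict_mono a"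
      "\<not> mso_sat (\<lambda>k. L.Fat (allacts S) (a (Suc k))) (\<lambda>_. 0) (\<lambda>_. {}) (\<lambda>_. 0) \<phi>"
      using L.ev_start[OF ok ad wf(2), of b, folded x] by blast
    have "(\<lambda>k. L.Fat (allacts S) (a (Suc k))) \<in> Runs b S"
      by (rule L.valid_run[OF ok ad a(1-3)]) (rule L.regf_less)
    then show "\<not> recency_mc S \<phi> b" using a(4) unfolding recency_mc_def models_def by blast
  next
    assume "\<not> recency_mc S \<phi> b"
    then obtain cs where cs: "ext_run b S cs" "\<not> models (\<lambda>i. fst (cs i)) \<phi>"
      unfolding recency_mc_def Runs_def by blast
    then have "\<forall>i. \<exists>\<alpha> \<sigma>. \<alpha> \<in> set (dms_acts S) \<and> dms_step b (cs i) \<alpha> \<sigma> (cs (Suc i))" unfolding ext_run_def by blast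
    then obtain \<alpha> \<tau> where st: "\<And>i. \<alpha> i \<in> set (dms_acts S)" "\<And>i. dms_step b (cs i) (\<alpha> i) (\<tau> i) (cs (Suc i))" by metis
    \<comment> \<open>Variables, \<open>b\<close> and the lengths of the tuples of new elements are
      all smaller than the code \<open>x\<close>, which yields \<open>lo = x + 4\<close> and
      \<open>n = 2 * x + 1\<close>.\<close>
    interpret R: run S b "x + 4" "2 * x + 1" ?K cs \<alpha> \<tau>
    proof
      show "wf_dms S" by (rule wf)
      show "fst (cs 0) = set (dms_init S)" "fst (snd (cs 0)) = {}" using cs(1) unfolding ext_run_def by blast+
      show "\<alpha> i \<in> set (dms_acts S)" "dms_step b (cs i) (\<alpha> i) (\<tau> i) (cs (Suc i))" for i by (rule st)+
      show "c + 3 < x + 4" if "\<gamma> \<in> set (dms_acts S)" "c \<in> set (act_u \<gamma>) \<union> set (act_v \<gamma>)" for \<gamma> c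
        using var[OF that] by simp
      show "enc_pair 0 (c + 3) < ?K" if "\<gamma> \<in> set (dms_acts S)" "c \<in> set (act_v \<gamma>)" for \<gamma> c
        by (rule code) (use var[of \<gamma> c] that in auto)
      show "b + length (act_v \<gamma>) \<le> 2 * x + 1" if "\<gamma> \<in> set (dms_acts S)" for \<gamma>
        using instance_bounds(1)[of b S \<phi>] instance_bounds(2)[OF that, of \<phi> b] action_bounds(2)[of \<gamma>]
          length_le_list_encode[of "act_v \<gamma>"] unfolding x by linarith
      show "enc_pair 1 (enc_action \<gamma>) < ?K" if "\<gamma> \<in> set (dms_acts S)" for \<gamma>
        by (rule code) (use instance_bounds(2)[OF that, of \<phi> b] x in auto)
      have "enc_action (init_action (dms_init S)) \<le> init_code x"
        unfolding init_code[symmetric] by (rule init_code_mono) (use instance_bounds(3)[of S \<phi> b] x in simp)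
      from enc_pair_mono[OF order_refl this, of 1] show "enc_pair 1 (enc_action (init_action (dms_init S))) < ?K"
        unfolding size_bound_def by linarith
      show "3 \<le> x + 4" "x + 4 + (2 * x + 1) \<le> ?K" "0 < 2 * x + 1" using K by simp_all
    qed
    from R.word_of_run[OF ok wf(2) cs(2)] obtain W where
      W: "labelled ?K W" "\<And>k. wfi ?K (map_item fst (W k))" "labelled.evw ?K W (start (enc_instance S \<phi> b)) (\<lambda>_. {})" by blast
    interpret L: labelled ?K W by (rule W(1))
    have "L.holds \<psi> (\<lambda>_. {})" using W(3) L.evw_codes[OF \<psi>] unfolding x by simp
    moreover have "ann (\<lambda>_. {}) (W n) = bare (map_item fst (W n))" for n unfolding ann_def by (simp add: item.map_comp comp_def)
    ultimately have "sat ?K \<psi> (\<lambda>n. bare (map_item fst (W n)))" unfolding L.holds_def by simp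
    then show "satisfiable ?K \<psi>" unfolding satisfiable_iff[OF nop] using W(2)
      by (intro exI[of _ "\<lambda>n. map_item fst (W n)"]) simp
  qed
qed

theorem theorem5p1:
  shows "\<exists>f :: recf. \<forall>S \<phi> b. valid_input S \<phi> \<longrightarrow>
           rf_eval f [enc_instance S \<phi> b] (if recency_mc S \<phi> b then 1 else 0)"
proof -
  obtain f where f: "\<And>x \<psi>. codes expand (start x) \<psi> \<Longrightarrow> rf_eval f [x] (if satisfiable (size_bound x) \<psi> then 0 else 1)"
    using satisfiable_computable[OF cmp_expand cmp_start cmp_size_bound] by blast
  have "rf_eval f [enc_instance S \<phi> b] (if recency_mc S \<phi> b then 1 else 0)" if "valid_input S \<phi>" for S \<phi> b
  proof -
    obtain \<psi> where \<psi>: "codes expand (start (enc_instance S \<phi> b)) \<psi>" using dfd_start unfolding dfd_def by blast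
    show ?thesis using f[OF \<psi>] unfolding satisfiable_iff_counterexample[OF that refl \<psi>] by (simp split: if_splits)
  qed
  then show ?thesis by blast
qed

end
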